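(* Let $X_1,X_2,\dots$ be i.i.d. real random variables from a fixed distribution, let $s\ge2$ be a fixed integer, and let $h:\mathbb R^s\to\mathbb R$ be a fixed, symmetric, Borel-measurable function. Assume that $E h(X_1,\dots,X_s)=0$, that $|h(X_1,\dots,X_s)|\le C_1<\infty$ for a constant $C_1$, and that $E g^2(X_1)>0$, where $g(x):=E(h(X_1,\dots,X_s)\mid X_1=x)$. For an integer $m\ge s$ let $$W=\frac1\sigma\sum_{1\le i_1<\dots<i_s\le m}h(X_{i_1},\dots,X_{i_s}),\qquad \sigma^2=\mathrm{Var}\Big[\sum_{1\le i_1<\dots<i_s\le m}h(X_{i_1},\dots,X_{i_s})\Big],$$ and let $\gamma=EW^3$. Let $C_0$ be any fixed positive constant. Then there is a positive constant $C$, depending only on $C_0$ and $h$ (with $s$ and the distribution of $X_1$ being fixed), such that for all $0\le x\le C_0m^{1/4}$, $$\Big|\frac{P(W>x)}{(1-\Phi(x))e^{\gamma x^3/6}}-1\Big|\le\frac{C}{\sqrt m}(1+x^2).$$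
   Context: $\Phi$ is the standard normal distribution function. The constant $C$ does not depend on $m$ or $x$. *)

theory Defs
  imports "HOL-Probability.Probability" "HOL-Combinatorics.Permutations"
begin

definition iid_sequence :: "'a measure \<Rightarrow> (nat \<Rightarrow> 'a \<Rightarrow> real) \<Rightarrow> real measure \<Rightarrow> bool" where
  "iid_sequence M X D \<longleftrightarrow>
     prob_space M \<and>
     prob_space.indep_vars M (\<lambda>_. borel) X {1..} \<and>
     (\<forall>i\<ge>1. distr M borel (X i) = D)"

(* A point of R^s is an extensional function on {1..s}. The product sigma-algebra over the
   finite index set {1..s} is the Borel sigma-algebra of R^s, so Borel measurability of h
   is measurability with respect to PiM {1..s} (\<lambda>_. borel). *)
definition symmetric_kernel :: "nat \<Rightarrow> ((nat \<Rightarrow> real) \<Rightarrow> real) \<Rightarrow> bool" where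
  "symmetric_kernel s h \<longleftrightarrow>
     (\<forall>\<pi>. \<pi> permutes {1..s} \<longrightarrow> (\<forall>y \<in> {1..s} \<rightarrow>\<^sub>E UNIV. h (y \<circ> \<pi>) = h y))"

(* g(z) = E(Y | Z = z): a Borel function g for which g(Z) is a version of E(Y | sigma(Z)). *)
definition is_cond_exp_given ::
    "'a measure \<Rightarrow> ('a \<Rightarrow> real) \<Rightarrow> ('a \<Rightarrow> real) \<Rightarrow> (real \<Rightarrow> real) \<Rightarrow> bool" where
  "is_cond_exp_given M Y Z g \<longleftrightarrow>
     g \<in> borel_measurable borel \<and>
     (AE \<omega> in M. g (Z \<omega>) = real_cond_exp M (vimage_algebra (space M) Z borel) Y \<omega>)"

definition increasing_tuples :: "nat \<Rightarrow> nat \<Rightarrow> (nat \<Rightarrow> nat) set" where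
  "increasing_tuples s m = {i \<in> {1..s} \<rightarrow>\<^sub>E {1..m}. strict_mono_on {1..s} i}"

definition U_sum ::
    "nat \<Rightarrow> ((nat \<Rightarrow> real) \<Rightarrow> real) \<Rightarrow> (nat \<Rightarrow> 'a \<Rightarrow> real) \<Rightarrow> nat \<Rightarrow> 'a \<Rightarrow> real" where
  "U_sum s h X m \<omega> = (\<Sum>i\<in>increasing_tuples s m. h (\<lambda>j\<in>{1..s}. X (i j) \<omega>))"

definition U_sigma ::
    "'a measure \<Rightarrow> nat \<Rightarrow> ((nat \<Rightarrow> real) \<Rightarrow> real) \<Rightarrow> (nat \<Rightarrow> 'a \<Rightarrow> real) \<Rightarrow> nat \<Rightarrow> real" where
  "U_sigma M s h X m = sqrt (prob_space.variance M (U_sum s h X m))"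

definition U_stat ::
    "'a measure \<Rightarrow> nat \<Rightarrow> ((nat \<Rightarrow> real) \<Rightarrow> real) \<Rightarrow> (nat \<Rightarrow> 'a \<Rightarrow> real) \<Rightarrow> nat \<Rightarrow> 'a \<Rightarrow> real" where
  "U_stat M s h X m \<omega> = U_sum s h X m \<omega> / U_sigma M s h X m"

definition U_gamma ::
    "'a measure \<Rightarrow> nat \<Rightarrow> ((nat \<Rightarrow> real) \<Rightarrow> real) \<Rightarrow> (nat \<Rightarrow> 'a \<Rightarrow> real) \<Rightarrow> nat \<Rightarrow> real" where
  "U_gamma M s h X m = prob_space.expectation M (\<lambda>\<omega>. U_stat M s h X m \<omega> ^ 3)"

definition Phi :: "real \<Rightarrow> real" where
  "Phi = cdf std_normal_distribution"

end

theory Submission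
  imports Defs "HOL-Real_Asymp.Real_Asymp"
begin

text \<open>
With \<open>h\<^sub>1\<close> the projection of the centred kernel to one coordinate, \<open>W\<close> is a sum of iid terms
\<open>c\<^sub>1 h\<^sub>1(X\<^sub>i)\<close> plus a completely degenerate remainder of order \<open>m\<^sup>-\<^sup>1\<^sup>/\<^sup>2\<close>. Tilting by \<open>exp (x W)\<close> would destroy
independence, so the coordinates are tilted one by one, by a density proportional to \<open>exp \<phi>\<close> where
\<open>\<phi>\<close> is \<open>u = x c\<^sub>1\<close> times the projection of the kernel under the tilted law itself (up to \<open>O(u\<^sup>3)\<close>). Under
the resulting product measure \<open>Q\<close> the linear part of \<open>W\<close> cancels against the log density, whence
\<open>P(W > x) = exp(A) E\<^sub>Q[exp(- x (W - x) + Y); W > x]\<close> with a constant \<open>A\<close> and a random error \<open>Y\<close> consisting of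
\<open>x\<close> times the degenerate remainder under \<open>Q\<close> and a centred sum of \<open>m\<close> terms \<open>O(u\<^sup>3)\<close>. For \<open>x = O(m\<^sup>1\<^sup>/\<^sup>4)\<close> the exponential
moments of \<open>Y\<close> are bounded and \<open>E\<^sub>Q Y\<^sup>2 = O(x\<^sup>2 / m)\<close>. The Berry-Esseen theorem under \<open>Q\<close>, proved by Stein's
method with resampled coordinates, compares the remaining Laplace transform with
\<open>exp (x\<^sup>2 / 2) (1 - \<Phi>(x))\<close>, and an expansion of \<open>A\<close> in powers of \<open>u\<close> gives \<open>A = - x\<^sup>2 / 2 + \<gamma> x\<^sup>3 / 6 + O(x\<^sup>4 / m)\<close>.
Bounded \<open>x\<close> is covered by the Berry-Esseen theorem under the original law, and bounded \<open>m\<close> by a crude estimate.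
\<close>

section \<open>Bounded differences on product spaces\<close>

text \<open>Since \<open>mills x\<close> is of order \<open>1 / x\<close>, an absolute error
  \<open>O(x / sqrt m)\<close> in the tilted Laplace transform is what the claimed relative error
  \<open>O(x^2 / sqrt m)\<close> allows; the estimates under \<open>Q\<close> are calibrated to it.
  The range of \<open>x\<close> enters as \<open>x^2 \<le> c * sqrt m\<close>: this absorbs the
  exponent error \<open>x^4 / m\<close> and keeps \<open>m * u^6\<close> bounded, which controls the
  exponential moments of the sum of third-order residuals. The nonlinear remainder is governed by
  two numbers, the oscillation in one coordinate (order \<open>m powr (-1/2)\<close>) and the mixed
  second difference (order \<open>m powr (-3/2)\<close>). Both come from counting tuples and from
  the bound on the kernel, so they persist under every product law with the same
  \<open>\<sigma>\<close>; this is why \<open>ustat\<close> is stated for an arbitrary scale and can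
  be instantiated again under \<open>Q\<close>. The exponent is insensitive to errors of the tilt:
  first-order errors cancel between the relative entropy and the mean, so the density must be known
  only up to \<open>O(u^2)\<close> to get the exponent up to \<open>O(u^4)\<close>.\<close>

definition bm :: "'a measure \<Rightarrow> ('a \<Rightarrow> real) \<Rightarrow> bool" where
  "bm M f \<longleftrightarrow> f \<in> borel_measurable M \<and> (\<exists>K. \<forall>x. \<bar>f x\<bar> \<le> K)"

lemma bmI: "f \<in> borel_measurable M \<Longrightarrow> (\<And>x. \<bar>f x\<bar> \<le> K) \<Longrightarrow> bm M f"
  unfolding bm_def by blast

lemma bm_measurable [measurable_dest]: "bm M f \<Longrightarrow> f \<in> borel_measurable M"
  unfolding bm_def by blast

lemma bm_bound: "bm M f \<Longrightarrow> \<exists>K\<ge>0. \<forall>x. \<bar>f x\<bar> \<le> K"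
  unfolding bm_def by (metis abs_ge_zero order_trans)

lemma bm_const [intro!, simp]: "bm M (\<lambda>_. c)"
  by (rule bmI[where K = "\<bar>c\<bar>"]) auto

lemma bm_add [intro!]:
  assumes "bm M f" "bm M g" shows "bm M (\<lambda>x. f x + g x)"
proof -
  obtain K L where "\<And>x. \<bar>f x\<bar> \<le> K" "\<And>x. \<bar>g x\<bar> \<le> L" using assms bm_def by metis
  then have "\<bar>f x + g x\<bar> \<le> K + L" for x by (meson abs_triangle_ineq add_mono order_trans)
  then show ?thesis using assms by (intro bmI[where K="K+L"]) auto
qed

lemma bm_mult [intro!]:
  assumes "bm M f" "bm M g" shows "bm M (\<lambda>x. f x * g x)"
proof -
  obtain K L where "\<And>x. \<bar>f x\<bar> \<le> K" "\<And>x. \<bar>g x\<bar> \<le> L" using assms bm_def by metis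
  then have "\<bar>f x * g x\<bar> \<le> K * L" for x
    unfolding abs_mult by (intro mult_mono) (auto intro: order_trans[OF abs_ge_zero])
  then show ?thesis using assms by (intro bmI[where K="K*L"]) auto
qed

lemma bm_minus [intro!]: "bm M f \<Longrightarrow> bm M (\<lambda>x. - f x)"
  using bm_mult[OF bm_const[of M "-1"], of f] by simp

lemma bm_diff [intro!]: "bm M f \<Longrightarrow> bm M g \<Longrightarrow> bm M (\<lambda>x. f x - g x)"
  using bm_add[of M f "\<lambda>x. - g x"] by auto

lemma bm_divide [intro!]: "bm M f \<Longrightarrow> bm M (\<lambda>x. f x / c)"
  using bm_mult[OF _ bm_const[of M "1/c"], of f] by simp

lemma bm_power [intro!]: "bm M f \<Longrightarrow> bm M (\<lambda>x. f x ^ n)"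
  by (induction n) auto

lemma bm_abs [intro!]:
  assumes "bm M f" shows "bm M (\<lambda>x. \<bar>f x\<bar>)"
proof -
  obtain K where "\<And>x. \<bar>f x\<bar> \<le> K" using assms bm_def by metis
  then show ?thesis using assms by (intro bmI[where K=K]) auto
qed

lemma bm_exp [intro!]:
  assumes "bm M f" shows "bm M (\<lambda>x. exp (f x))"
proof -
  obtain K where "\<And>x. \<bar>f x\<bar> \<le> K" using assms bm_def by metis
  then have "\<bar>exp (f x)\<bar> \<le> exp K" for x by (simp add: abs_le_D1)
  then show ?thesis using assms by (intro bmI[where K="exp K"]) auto
qed

lemma bm_sum [intro!]: "(\<And>i. i \<in> A \<Longrightarrow> bm M (f i)) \<Longrightarrow> bm M (\<lambda>x. \<Sum>i\<in>A. f i x)"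
  by (induction A rule: infinite_finite_induct) auto

lemma bm_prod [intro!]: "(\<And>i. i \<in> A \<Longrightarrow> bm M (f i)) \<Longrightarrow> bm M (\<lambda>x. \<Prod>i\<in>A. f i x)"
  by (induction A rule: infinite_finite_induct) auto

lemma bm_indicator [intro]: "A \<in> sets M \<Longrightarrow> bm M (indicator A)"
  by (rule bmI[where K=1]) (auto simp: indicator_def)

lemma bm_compose: "f \<in> measurable M N \<Longrightarrow> bm N g \<Longrightarrow> bm M (\<lambda>x. g (f x))"
  unfolding bm_def by (metis measurable_compose)

text \<open>\<open>bm\<close> refers only to the sigma-algebra and a pointwise bound, so it gives
  integrability for every finite measure on that sigma-algebra; the tilted laws inherit their
  integrability facts in this way.\<close>

lemma (in finite_measure) bm_integrable [intro]: "bm M f \<Longrightarrow> integrable M f"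
  using bm_bound by (metis (no_types, lifting) AE_I2 bm_measurable integrable_const_bound real_norm_def)

lemma (in prob_space) abs_integral_le_const:
  assumes "\<And>x. x \<in> space M \<Longrightarrow> \<bar>f x\<bar> \<le> K" "0 \<le> K"
  shows "\<bar>\<integral>x. f x \<partial>M\<bar> \<le> (K::real)"
proof (cases "integrable M f")
  case True
  have "\<bar>\<integral>x. f x \<partial>M\<bar> \<le> (\<integral>x. \<bar>f x\<bar> \<partial>M)" by (rule integral_abs_bound)
  also have "\<dots> \<le> (\<integral>x. K \<partial>M)" using assms True by (intro integral_mono) auto
  also have "\<dots> = K" by (simp add: prob_space)
  finally show ?thesis .
next
  case False then show ?thesis using assms by (simp add: not_integrable_integral_eq)
qed

lemma (in prob_space) exp_jensen:
  assumes "bm M f"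
  shows "exp (\<integral>x. f x \<partial>M) \<le> (\<integral>x. exp (f x) \<partial>M)"
proof -
  let ?m = "\<integral>x. f x \<partial>M"
  have "(\<integral>x. exp ?m * (1 + (f x - ?m)) \<partial>M) \<le> (\<integral>x. exp (f x) \<partial>M)"
  proof (rule integral_mono)
    fix x
    have "exp ?m * (1 + (f x - ?m)) \<le> exp ?m * exp (f x - ?m)" by (intro mult_left_mono exp_ge_add_one_self) auto
    then show "exp ?m * (1 + (f x - ?m)) \<le> exp (f x)" by (simp add: exp_add[symmetric])
  qed (use assms in \<open>auto intro!: bm_integrable\<close>)
  moreover have "(\<integral>x. exp ?m * (1 + (f x - ?m)) \<partial>M) = exp ?m"
    using bm_integrable[OF assms] by (simp add: prob_space)
  ultimately show ?thesis by simp
qed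

lemma (in prob_space) bm_integral_snd:
  assumes "bm (N \<Otimes>\<^sub>M M) (\<lambda>(x,y). f x y)"
  shows "bm N (\<lambda>x. \<integral>y. f x y \<partial>M)"
proof -
  obtain K where K: "K \<ge> 0" "\<And>x y. \<bar>f x y\<bar> \<le> K" using bm_bound[OF assms] by auto
  have "(\<lambda>(x,y). f x y) \<in> borel_measurable (N \<Otimes>\<^sub>M M)" using assms by (rule bm_measurable)
  then have "(\<lambda>x. \<integral>y. f x y \<partial>M) \<in> borel_measurable N" by (rule borel_measurable_lebesgue_integral)
  then show ?thesis using K by (intro bmI[where K=K] abs_integral_le_const) auto
qed

text \<open>For negative \<open>u\<close> the second-order lower bound of \<open>exp (- u)\<close>
  is inverted; \<open>(1 + u + u^2) (1 - u + u^2/2)\<close> exceeds 1 by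
  \<open>u^2/2 (1 - u + u^2)\<close>.\<close>

lemma exp_le_quadratic:
  fixes u :: real assumes "\<bar>u\<bar> \<le> 1" shows "exp u \<le> 1 + u + u\<^sup>2"
proof (cases "u \<ge> 0")
  case True then show ?thesis using exp_bound[of u] assms by simp
next
  case False
  have "1 + (-u) + (-u)^2/2 \<le> exp (-u)" using False by (intro exp_lower_Taylor_quadratic) auto
  then have e: "1 - u + u\<^sup>2/2 \<le> exp (-u)" by simp
  have pos: "0 < 1 - u + u\<^sup>2/2" using False by (intro add_pos_nonneg) auto
  have "exp u = 1 / exp (-u)" by (simp add: exp_minus inverse_eq_divide)
  also have "\<dots> \<le> 1 / (1 - u + u\<^sup>2/2)" using e pos by (intro divide_left_mono) auto
  also have "\<dots> \<le> 1 + u + u\<^sup>2"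
  proof -
    have "1 \<le> (1 + u + u\<^sup>2) * (1 - u + u^2/2)"
    proof -
      have "(1 + u + u\<^sup>2) * (1 - u + u^2/2) = 1 + u\<^sup>2/2 * (1 - u + u\<^sup>2)" by (simp add: field_simps power2_eq_square)
      then show ?thesis using False by simp
    qed
    then show ?thesis using False by (subst divide_le_eq) (auto simp: add_pos_nonneg)
  qed
  finally show ?thesis .
qed

text \<open>The linear term vanishes against a centred variable, so a centred increment bounded by
  \<open>c\<close> has exponential moment at most \<open>exp (c^2)\<close>. This takes the place of
  Hoeffding's lemma, with a worse constant.\<close>

lemma exp_le_add_exp_square: "exp u \<le> u + exp (u\<^sup>2)" for u :: real
proof -
  consider "\<bar>u\<bar> \<le> 1" | "u > 1" | "u < -1" by linarith
  then show ?thesis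
  proof cases
    case 1 then show ?thesis using exp_le_quadratic[OF 1] exp_ge_add_one_self[of "u\<^sup>2"] by linarith
  next
    case 2 then have "u \<le> u\<^sup>2" by (simp add: power2_eq_square)
    then have "exp u \<le> exp (u\<^sup>2)" by simp
    then show ?thesis using 2 by linarith
  next
    case 3
    then have "-u \<le> u\<^sup>2" using mult_right_mono_neg[of u "-1" u] by (simp add: power2_eq_square)
    moreover have "exp u \<le> 1" using 3 by simp
    ultimately show ?thesis using exp_ge_add_one_self[of "u\<^sup>2"] by linarith
  qed
qed

lemma nn_integral_normal_exp:
  "(\<integral>\<^sup>+g. ennreal (std_normal_density g * exp (a * g)) \<partial>lborel) = ennreal (exp (a\<^sup>2 / 2))"
proof -
  have "std_normal_density g * exp (a * g) = exp (a\<^sup>2/2) * normal_density a 1 g" for g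
    by (simp add: normal_density_def exp_add[symmetric] power2_eq_square field_simps)
  then have "(\<integral>\<^sup>+g. ennreal (std_normal_density g * exp (a * g)) \<partial>lborel)
      = (\<integral>\<^sup>+g. ennreal (exp (a\<^sup>2/2) * normal_density a 1 g) \<partial>lborel)" by simp
  also have "\<dots> = ennreal (\<integral>g. exp (a\<^sup>2/2) * normal_density a 1 g \<partial>lborel)"
    by (rule nn_integral_eq_integral) auto
  finally show ?thesis by simp
qed

lemma nn_integral_normal_exp_square:
  "(\<integral>\<^sup>+g. ennreal (std_normal_density g * exp (g\<^sup>2 / 4)) \<partial>lborel) = ennreal (sqrt 2)"
proof -
  have "std_normal_density g * exp (g\<^sup>2/4) = sqrt 2 * normal_density 0 (sqrt 2) g" for g
    by (simp add: normal_density_def exp_add[symmetric] real_sqrt_mult field_simps)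
  then have "(\<integral>\<^sup>+g. ennreal (std_normal_density g * exp (g\<^sup>2 / 4)) \<partial>lborel)
      = (\<integral>\<^sup>+g. ennreal (sqrt 2 * normal_density 0 (sqrt 2) g) \<partial>lborel)" by simp
  also have "\<dots> = ennreal (\<integral>g. sqrt 2 * normal_density 0 (sqrt 2) g \<partial>lborel)"
    by (rule nn_integral_eq_integral) auto
  finally show ?thesis by simp
qed

text \<open>Linearise the square in the exponent by an independent Gaussian factor.\<close>

lemma (in prob_space) subgaussian_exp_square:
  assumes G: "bm M G" and sub: "\<And>r. (\<integral>x. exp (r * G x) \<partial>M) \<le> exp (r\<^sup>2 * c)"
    and t: "0 \<le> t" "8 * t * c \<le> 1"
  shows "(\<integral>x. exp (t * (G x)\<^sup>2) \<partial>M) \<le> 2"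
proof -
  interpret pair_sigma_finite M lborel ..
  \<comment> \<open>With \<open>k^2 = 2 t\<close> the Gaussian moment generating function at
    \<open>k * G x\<close> is \<open>exp (t * (G x)^2)\<close>.\<close>
  define k where "k = sqrt (2 * t)"
  have k: "k\<^sup>2 = 2 * t" using t by (simp add: k_def)
  have [measurable]: "G \<in> borel_measurable M" using G by (rule bm_measurable)
  have "ennreal (\<integral>x. exp (t * (G x)\<^sup>2) \<partial>M) = (\<integral>\<^sup>+x. ennreal (exp (t * (G x)\<^sup>2)) \<partial>M)"
    by (rule nn_integral_eq_integral[symmetric]) (use G in \<open>auto intro!: bm_integrable\<close>)
  also have "\<dots> = (\<integral>\<^sup>+x. (\<integral>\<^sup>+g. ennreal (std_normal_density g * exp (k * G x * g)) \<partial>lborel) \<partial>M)"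
    by (simp add: nn_integral_normal_exp power_mult_distrib k)
  also have "\<dots> = (\<integral>\<^sup>+g. (\<integral>\<^sup>+x. ennreal (std_normal_density g * exp (k * G x * g)) \<partial>M) \<partial>lborel)"
    by (rule Fubini'[symmetric]) simp
  also have "\<dots> \<le> (\<integral>\<^sup>+g. ennreal (std_normal_density g * exp (g\<^sup>2 / 4)) \<partial>lborel)"
  proof (rule nn_integral_mono)
    fix g :: real
    have "(\<integral>\<^sup>+x. ennreal (std_normal_density g * exp (k * G x * g)) \<partial>M)
      = ennreal (\<integral>x. std_normal_density g * exp (k * G x * g) \<partial>M)"
      by (rule nn_integral_eq_integral) (use G in \<open>auto intro!: bm_integrable\<close>)
    also have "\<dots> = ennreal (std_normal_density g * (\<integral>x. exp ((k * g) * G x) \<partial>M))"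
      by (simp add: mult_ac)
    also have "\<dots> \<le> ennreal (std_normal_density g * exp (g\<^sup>2/4))"
    proof (intro ennreal_leI mult_left_mono)
      \<comment> \<open>The condition \<open>8 t c \<le> 1\<close> bounds
        \<open>k^2 c = 2 t c\<close> by \<open>1/4\<close>, which is small enough for the Gaussian
        weight to integrate the result.\<close>
      have "(k * g)\<^sup>2 * c = g\<^sup>2 / 4 * (8 * t * c)" by (simp add: power_mult_distrib k)
      also have "\<dots> \<le> g\<^sup>2 / 4" using mult_left_mono[OF t(2), of "g\<^sup>2/4"] by simp
      finally show "(\<integral>x. exp ((k * g) * G x) \<partial>M) \<le> exp (g\<^sup>2/4)" using sub[of "k*g"] by (meson exp_le_cancel_iff order_trans)
    qed simp
    finally show "(\<integral>\<^sup>+x. ennreal (std_normal_density g * exp (k * G x * g)) \<partial>M) \<le> ennreal (std_normal_density g * exp (g\<^sup>2 / 4))" .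
  qed
  also have "\<dots> = ennreal (sqrt 2)" by (rule nn_integral_normal_exp_square)
  finally have "(\<integral>x. exp (t * (G x)\<^sup>2) \<partial>M) \<le> sqrt 2" by simp
  also have "sqrt 2 \<le> 2" using real_sqrt_le_mono[of 2 4] by simp
  finally show ?thesis .
qed

section \<open>Product spaces: averaging out and resampling one coordinate\<close>

locale iid_product = D: prob_space D for D :: "'b measure" +
  fixes I :: "'i set"
  assumes fin: "finite I"
begin

abbreviation P where "P \<equiv> PiM I (\<lambda>_. D)"

sublocale product_prob_space "\<lambda>_. D" I
  by unfold_locales

sublocale P: prob_space P
  by (rule prob_space_PiM) (rule D.prob_space_axioms)

sublocale PD: pair_prob_space P D ..

sublocale DD: pair_prob_space D D ..

text \<open>This is the conditional expectation of \<open>f\<close> given the coordinates other than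
  \<open>i\<close>, chosen as an honest function so that its properties hold pointwise.\<close>

definition avg :: "'i \<Rightarrow> (('i \<Rightarrow> 'b) \<Rightarrow> real) \<Rightarrow> ('i \<Rightarrow> 'b) \<Rightarrow> real" where
  "avg i f p = (\<integral>z. f (p(i := z)) \<partial>D)"

lemma upd_measurable:
  "i \<in> I \<Longrightarrow> (\<lambda>x. (fst x)(i := snd x)) \<in> measurable (P \<Otimes>\<^sub>M D) P"
  by (rule measurable_fun_upd[where J=I]) auto

lemma upd_measurable1: "i \<in> I \<Longrightarrow> z \<in> space D \<Longrightarrow> (\<lambda>p. p(i := z)) \<in> measurable P P"
  by (rule measurable_fun_upd[where J=I]) auto

lemma upd_measurable2: "i \<in> I \<Longrightarrow> p \<in> space P \<Longrightarrow> (\<lambda>z. p(i := z)) \<in> measurable D P"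
  by (rule measurable_fun_upd[where J=I]) auto

lemma upd_space [simp, intro]: "i \<in> I \<Longrightarrow> z \<in> space D \<Longrightarrow> p \<in> space P \<Longrightarrow> p(i := z) \<in> space P"
  by (auto simp: space_PiM PiE_def extensional_def)

lemma coord_space [simp, intro]: "i \<in> I \<Longrightarrow> p \<in> space P \<Longrightarrow> p i \<in> space D"
  by (auto simp: space_PiM)

lemma bm_upd: "bm P f \<Longrightarrow> i \<in> I \<Longrightarrow> bm (P \<Otimes>\<^sub>M D) (\<lambda>x. f ((fst x)(i := snd x)))"
  by (rule bm_compose[OF upd_measurable])

lemma bm_upd1 [intro]: "bm P f \<Longrightarrow> i \<in> I \<Longrightarrow> z \<in> space D \<Longrightarrow> bm P (\<lambda>p. f (p(i := z)))"
  by (rule bm_compose[OF upd_measurable1])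

lemma bm_upd2 [intro]: "bm P f \<Longrightarrow> i \<in> I \<Longrightarrow> p \<in> space P \<Longrightarrow> bm D (\<lambda>z. f (p(i := z)))"
  by (rule bm_compose[OF upd_measurable2])

lemma bm_coord [intro]: "bm D f \<Longrightarrow> i \<in> I \<Longrightarrow> bm P (\<lambda>p. f (p i))"
  by (rule bm_compose[where N=D]) auto

lemma bm_avg [intro]: "bm P f \<Longrightarrow> i \<in> I \<Longrightarrow> bm P (avg i f)"
  unfolding avg_def[abs_def] by (rule D.bm_integral_snd) (use bm_upd[of f i] in \<open>simp add: case_prod_beta'\<close>)

lemma integral_avg:
  assumes f: "bm P f" and i: "i \<in> I"
  shows "(\<integral>p. avg i f p \<partial>P) = (\<integral>p. f p \<partial>P)"
proof -
  define J where "J = I - {i}"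
  have J: "finite J" "i \<notin> J" "insert i J = I" using i fin by (auto simp: J_def)
  have *: "(\<integral>p. F p \<partial>P) = (\<integral>x. (\<integral>y. F (x(i:=y)) \<partial>D) \<partial>PiM J (\<lambda>_. D))" if "bm P F" for F :: "_ \<Rightarrow> real"
    using product_integral_insert[of J i F] that J by (simp add: P.bm_integrable)
  have "(\<integral>p. avg i f p \<partial>P) = (\<integral>x. (\<integral>y. avg i f (x(i:=y)) \<partial>D) \<partial>PiM J (\<lambda>_. D))"
    using f i by (intro *) auto
  also have "\<dots> = (\<integral>x. (\<integral>y. f (x(i:=y)) \<partial>D) \<partial>PiM J (\<lambda>_. D))"
    unfolding avg_def by (simp add: D.prob_space)
  also have "\<dots> = (\<integral>p. f p \<partial>P)" using f by (intro *[symmetric])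
  finally show ?thesis .
qed

lemma integral_upd:
  assumes f: "bm P f" and i: "i \<in> I"
  shows "(\<integral>z. (\<integral>p. f (p(i := z)) \<partial>P) \<partial>D) = (\<integral>p. f p \<partial>P)"
  using PD.Fubini_integral[of "\<lambda>p z. f (p(i := z))"] PD.bm_integrable[OF bm_upd[OF f i]] integral_avg[OF f i]
  by (simp add: case_prod_beta' avg_def)

text \<open>Both sides equal the integral over a resampled coordinate together with a second fresh copy of it.\<close>

lemma exchange:
  assumes F: "bm (P \<Otimes>\<^sub>M D) (\<lambda>(p, z). F p z)" and i: "i \<in> I"
  shows "(\<integral>p. (\<integral>z. F p z \<partial>D) \<partial>P) = (\<integral>p. (\<integral>z. F (p(i := z)) (p i) \<partial>D) \<partial>P)"
proof -
  have m2: "(\<lambda>x. ((fst x)(i := snd x), fst x i)) \<in> measurable (P \<Otimes>\<^sub>M D) (P \<Otimes>\<^sub>M D)"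
    using upd_measurable[OF i] i by measurable
  have b2: "bm (P \<Otimes>\<^sub>M D) (\<lambda>(p,z). F (p(i := z)) (p i))"
    using bm_compose[OF m2 F] by (simp add: case_prod_beta')
  have "(\<integral>p. (\<integral>z. F p z \<partial>D) \<partial>P) = (\<integral>p. (\<integral>w. (\<integral>z. F (p(i := w)) z \<partial>D) \<partial>D) \<partial>P)"
    using integral_avg[OF D.bm_integral_snd[OF F] i] by (simp add: avg_def)
  also have "\<dots> = (\<integral>p. (\<integral>w. (\<integral>z. F (p(i := z)) w \<partial>D) \<partial>D) \<partial>P)"
  proof (rule Bochner_Integration.integral_cong[OF refl])
    fix p assume w: "p \<in> space P"
    have m3: "(\<lambda>x. (p(i := fst x), snd x)) \<in> measurable (D \<Otimes>\<^sub>M D) (P \<Otimes>\<^sub>M D)"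
      using upd_measurable2[OF i w] by measurable
    have b3: "bm (D \<Otimes>\<^sub>M D) (\<lambda>(z,w). F (p(i := z)) w)"
      using bm_compose[OF m3 F] by (simp add: case_prod_beta')
    show "(\<integral>w. (\<integral>z. F (p(i := w)) z \<partial>D) \<partial>D) = (\<integral>w. (\<integral>z. F (p(i := z)) w \<partial>D) \<partial>D)"
      using DD.Fubini_integral[OF DD.bm_integrable[OF b3]] by simp
  qed
  also have "\<dots> = (\<integral>p. (\<integral>z. F (p(i := z)) (p i) \<partial>D) \<partial>P)"
    using integral_avg[OF D.bm_integral_snd[OF b2] i] by (simp add: avg_def)
  finally show ?thesis .
qed

section \<open>Functions insensitive to a coordinate, oscillations, and concentration\<close>

definition inv_at :: "'i \<Rightarrow> (('i \<Rightarrow> 'b) \<Rightarrow> real) \<Rightarrow> bool" where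
  "inv_at i f \<longleftrightarrow> (\<forall>p z. f (p(i := z)) = f p)"

lemma inv_at_avg_self: "inv_at i (avg i f)"
  by (simp add: inv_at_def avg_def)

lemma inv_at_avg: "inv_at j f \<Longrightarrow> inv_at j (avg i f)"
  by (cases "i = j") (simp_all add: inv_at_avg_self, simp add: inv_at_def avg_def fun_upd_twist)

lemma avg_mult_inv:
  "inv_at i F \<Longrightarrow> avg i (\<lambda>p. F p * f p) p = F p * avg i f p"
  by (simp add: inv_at_def avg_def)

lemma integral_mult_avg:
  assumes "bm P f" "bm P F" "i \<in> I" "inv_at i F"
  shows "(\<integral>p. F p * f p \<partial>P) = (\<integral>p. F p * avg i f p \<partial>P)"
proof -
  have "(\<integral>p. F p * f p \<partial>P) = (\<integral>p. avg i (\<lambda>p. F p * f p) p \<partial>P)"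
    using assms by (intro integral_avg[symmetric]) auto
  also have "\<dots> = (\<integral>p. F p * avg i f p \<partial>P)" using assms by (simp add: avg_mult_inv)
  finally show ?thesis .
qed

text \<open>The coordinates of \<open>p\<close> are replaced by those of \<open>p'\<close> one at a
  time. Outside \<open>I\<close> both points are \<open>undefined\<close>, which is where membership
  in \<open>space P\<close> enters.\<close>

lemma inv_all_const:
  assumes inv: "\<And>i. i \<in> I \<Longrightarrow> inv_at i f" and w: "p \<in> space P" "p' \<in> space P"
  shows "f p = f p'"
proof -
  have "f p = f (\<lambda>i. if i \<in> K then p' i else p i)" if "finite K" "K \<subseteq> I" for K
    using that
  proof (induction K rule: finite_induct)
    case (insert k K)
    have "(\<lambda>i. if i \<in> insert k K then p' i else p i) = (\<lambda>i. if i \<in> K then p' i else p i)(k := p' k)"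
      by auto
    then show ?case using insert inv[of k] by (simp add: inv_at_def)
  qed simp
  from this[OF fin subset_refl] have "f p = f (\<lambda>i. if i \<in> I then p' i else p i)" .
  also have "(\<lambda>i. if i \<in> I then p' i else p i) = p'"
    using w by (auto simp: space_PiM PiE_def extensional_def)
  finally show ?thesis .
qed

lemma inv_all_integral:
  assumes inv: "\<And>i. i \<in> I \<Longrightarrow> inv_at i f" and w: "p \<in> space P"
  shows "f p = (\<integral>p. f p \<partial>P)"
proof -
  have "(\<integral>p'. f p' \<partial>P) = (\<integral>p'. f p \<partial>P)"
    by (rule Bochner_Integration.integral_cong) (use inv_all_const[OF inv _ w] in auto)
  then show ?thesis by (simp add: P.prob_space)
qed

definition osc :: "'i set \<Rightarrow> real \<Rightarrow> (('i \<Rightarrow> 'b) \<Rightarrow> real) \<Rightarrow> bool" where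
  "osc J c f \<longleftrightarrow> (\<forall>i\<in>J. \<forall>p\<in>space P. \<forall>z\<in>space D. \<bar>f p - f (p(i := z))\<bar> \<le> c)"

text \<open>The mixed second difference in two distinct coordinates. It vanishes for sums of
  functions of single coordinates and so measures the departure from linearity.\<close>

definition osc2 :: "'i set \<Rightarrow> real \<Rightarrow> (('i \<Rightarrow> 'b) \<Rightarrow> real) \<Rightarrow> bool" where
  "osc2 J b f \<longleftrightarrow> (\<forall>i\<in>J. \<forall>j\<in>J. i \<noteq> j \<longrightarrow> (\<forall>p\<in>space P. \<forall>z\<in>space D. \<forall>w\<in>space D.
     \<bar>f p - f (p(i := z)) - (f (p(j := w)) - f (p(j := w, i := z)))\<bar> \<le> b))"

lemma oscD: "osc J c f \<Longrightarrow> i \<in> J \<Longrightarrow> p \<in> space P \<Longrightarrow> z \<in> space D \<Longrightarrow> \<bar>f p - f (p(i := z))\<bar> \<le> c"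
  by (simp add: osc_def)

lemma osc2D: "osc2 J b f \<Longrightarrow> i \<in> J \<Longrightarrow> j \<in> J \<Longrightarrow> i \<noteq> j \<Longrightarrow> p \<in> space P \<Longrightarrow> z \<in> space D \<Longrightarrow> w \<in> space D \<Longrightarrow>
     \<bar>f p - f (p(i := z)) - (f (p(j := w)) - f (p(j := w, i := z)))\<bar> \<le> b"
  by (simp add: osc2_def)

lemma ex_space: "\<exists>p. p \<in> space P" "\<exists>z. z \<in> space D"
  using P.not_empty D.not_empty by auto

lemma osc_nonneg: "osc J c f \<Longrightarrow> J \<noteq> {} \<Longrightarrow> 0 \<le> c"
  using ex_space unfolding osc_def by (metis abs_ge_zero all_not_in_conv order_trans)

lemma osc_mono: "osc J c f \<Longrightarrow> J' \<subseteq> J \<Longrightarrow> c \<le> c' \<Longrightarrow> osc J' c' f"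
  unfolding osc_def by (meson order_trans subsetD)

lemma osc2_mono: "osc2 J c f \<Longrightarrow> J' \<subseteq> J \<Longrightarrow> c \<le> c' \<Longrightarrow> osc2 J' c' f"
  unfolding osc2_def by (meson order_trans subsetD)

lemma osc_avg:
  assumes f: "bm P f" and k: "k \<in> I" "k \<notin> J" "J \<subseteq> I" and o: "osc J c f"
  shows "osc J c (avg k f)"
  unfolding osc_def
proof safe
  fix i p z assume a: "i \<in> J" "p \<in> space P" "z \<in> space D"
  then have ne: "i \<noteq> k" and iI: "i \<in> I" using k by auto
  have "avg k f p - avg k f (p(i := z)) = (\<integral>w. f (p(k := w)) - f (p(i := z, k := w)) \<partial>D)"
    unfolding avg_def using f k a iI
    by (subst Bochner_Integration.integral_diff) (auto intro!: D.bm_integrable)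
  moreover have "\<bar>\<dots>\<bar> \<le> c"
  proof (rule D.abs_integral_le_const)
    fix w assume "w \<in> space D"
    then show "\<bar>f (p(k := w)) - f (p(i := z, k := w))\<bar> \<le> c"
      using oscD[OF o, of i "p(k := w)" z] a ne k by (simp add: fun_upd_twist)
  qed (use osc_nonneg[OF o] a in auto)
  ultimately show "\<bar>avg k f p - avg k f (p(i := z))\<bar> \<le> c" by simp
qed

lemma osc2_nonneg: "osc2 J b f \<Longrightarrow> i \<in> J \<Longrightarrow> j \<in> J \<Longrightarrow> i \<noteq> j \<Longrightarrow> 0 \<le> b"
  using ex_space unfolding osc2_def by (meson abs_ge_zero order_trans)

lemma osc2_avg:
  assumes f: "bm P f" and k: "k \<in> I" "k \<notin> J" "J \<subseteq> I" and o: "osc2 J b f"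
  shows "osc2 J b (avg k f)"
  unfolding osc2_def
proof safe
  fix i j p z w assume a: "i \<in> J" "j \<in> J" "i \<noteq> j" "p \<in> space P" "z \<in> space D" "w \<in> space D"
  then have ne: "i \<noteq> k" "j \<noteq> k" and iI: "i \<in> I" "j \<in> I" using k by auto
  have i: "integrable D (\<lambda>y. f (p(k := y)))" "integrable D (\<lambda>y. f (p(i := z, k := y)))"
     "integrable D (\<lambda>y. f (p(j := w, k := y)))" "integrable D (\<lambda>y. f (p(j := w, i := z, k := y)))"
    using f k a iI by (auto intro!: D.bm_integrable)
  have "avg k f p - avg k f (p(i := z)) - (avg k f (p(j := w)) - avg k f (p(j := w, i := z)))
     = (\<integral>y. f (p(k := y)) - f (p(i := z, k := y)) - (f (p(j := w, k := y)) - f (p(j := w, i := z, k := y))) \<partial>D)"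
    unfolding avg_def using i by simp
  moreover have "\<bar>\<dots>\<bar> \<le> b"
  proof (rule D.abs_integral_le_const)
    fix y assume "y \<in> space D"
    then show "\<bar>f (p(k := y)) - f (p(i := z, k := y)) - (f (p(j := w, k := y)) - f (p(j := w, i := z, k := y)))\<bar> \<le> b"
      using osc2D[OF o a(1-3), of "p(k := y)" z w] a ne k by (simp add: fun_upd_twist)
  qed (use osc2_nonneg[OF o] a in auto)
  ultimately show "\<bar>avg k f p - avg k f (p(i := z)) - (avg k f (p(j := w)) - avg k f (p(j := w, i := z)))\<bar> \<le> b" by simp
qed

lemma abs_diff_avg_le:
  assumes f: "bm P f" and k: "k \<in> I" and o: "osc {k} c f" and w: "p \<in> space P"
  shows "\<bar>f p - avg k f p\<bar> \<le> c"
proof -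
  have "f p - avg k f p = (\<integral>z. f p - f (p(k := z)) \<partial>D)"
    unfolding avg_def using f k w
    by (subst Bochner_Integration.integral_diff) (auto intro!: D.bm_integrable simp: D.prob_space)
  moreover have "\<bar>\<dots>\<bar> \<le> c"
    by (rule D.abs_integral_le_const) (use oscD[OF o _ w] osc_nonneg[OF o] in auto)
  ultimately show ?thesis by simp
qed

text \<open>McDiarmid's argument: averaging out coordinate \<open>k\<close> keeps the mean and the
  oscillations, while the increment \<open>f - avg k f\<close> is conditionally centred and at most
  \<open>c\<close>, which costs a factor \<open>exp (c^2)\<close>.\<close>

lemma bounded_differences_mgf:
  fixes c :: real
  assumes "finite J" "J \<subseteq> I" "bm P f" "\<And>i. i \<in> I - J \<Longrightarrow> inv_at i f" "osc J c f"
  shows "(\<integral>p. exp (f p) \<partial>P) \<le> exp ((\<integral>p. f p \<partial>P) + card J * c\<^sup>2)"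
  using assms
proof (induction J arbitrary: f rule: finite_induct)
  case empty
  have "(\<integral>p. exp (f p) \<partial>P) = (\<integral>p. exp (\<integral>p. f p \<partial>P) \<partial>P)"
    by (rule Bochner_Integration.integral_cong) (use inv_all_integral[of f] empty in auto)
  then show ?case by (simp add: P.prob_space)
next
  case (insert k J)
  define F where "F = avg k f"
  have k: "k \<in> I" "J \<subseteq> I" using insert by auto
  have bF: "bm P F" and oJ: "osc J c f" and ok: "osc {k} c f"
    using insert k by (auto simp: F_def intro: osc_mono[OF insert(7)])
  have inv: "inv_at i F" if "i \<in> I - J" for i
    using that insert inv_at_avg[of i f k] inv_at_avg_self[of k f] by (cases "i = k") (auto simp: F_def)
  have c0: "0 \<le> c" using osc_nonneg[OF ok] by simp
  have le: "avg k (\<lambda>p. exp (f p - F p)) p \<le> exp (c\<^sup>2)" if w: "p \<in> space P" for p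
  proof -
    have F1: "F (p(k := z)) = F p" for z using inv[of k] insert k by (auto simp: inv_at_def)
    have ib: "bm D (\<lambda>z. f (p(k := z)))" using insert k w by auto
    have "avg k (\<lambda>p. exp (f p - F p)) p \<le> (\<integral>z. (f (p(k:=z)) - F p) + exp (c\<^sup>2) \<partial>D)"
      unfolding avg_def F1
    proof (rule integral_mono)
      show "integrable D (\<lambda>z. exp (f (p(k := z)) - F p))" using ib by (intro D.bm_integrable) auto
      show "integrable D (\<lambda>z. f (p(k := z)) - F p + exp (c\<^sup>2))" using ib by (intro D.bm_integrable) auto
      fix z assume "z \<in> space D"
      then have "\<bar>f (p(k:=z)) - F p\<bar> \<le> c"
        using abs_diff_avg_le[OF insert(5) k(1) ok, of "p(k := z)"] w k F1 by (simp add: F_def)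
      then have "(f (p(k:=z)) - F p)\<^sup>2 \<le> c\<^sup>2" by (metis abs_le_square_iff c0 abs_of_nonneg)
      then show "exp (f (p(k := z)) - F p) \<le> f (p(k := z)) - F p + exp (c\<^sup>2)"
        using exp_le_add_exp_square[of "f (p(k:=z)) - F p"] by (meson add_left_mono exp_le_cancel_iff order_trans)
    qed
    also have "\<dots> = (\<integral>z. f (p(k:=z)) \<partial>D) - F p + exp (c\<^sup>2)"
      using D.bm_integrable[OF ib] by (simp add: D.prob_space)
    also have "\<dots> = exp (c\<^sup>2)" by (simp add: F_def avg_def)
    finally show ?thesis .
  qed
  have "(\<integral>p. exp (f p) \<partial>P) = (\<integral>p. exp (F p) * exp (f p - F p) \<partial>P)"
    by (simp add: exp_add[symmetric])
  also have "\<dots> = (\<integral>p. exp (F p) * avg k (\<lambda>p. exp (f p - F p)) p \<partial>P)"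
    using insert bF k inv[of k] by (intro integral_mult_avg) (auto simp: inv_at_def)
  also have "\<dots> \<le> (\<integral>p. exp (F p) * exp (c\<^sup>2) \<partial>P)"
  proof (rule integral_mono)
    have "bm P (avg k (\<lambda>p. exp (f p - F p)))" using bF insert(5) k by (intro bm_avg bm_exp bm_diff)
    then show "integrable P (\<lambda>p. exp (F p) * avg k (\<lambda>p. exp (f p - F p)) p)"
      using bF by (intro P.bm_integrable) auto
    show "integrable P (\<lambda>p. exp (F p) * exp (c\<^sup>2))" using bF by (intro P.bm_integrable) auto
  qed (use le in auto)
  also have "\<dots> = (\<integral>p. exp (F p) \<partial>P) * exp (c\<^sup>2)" by simp
  also have "\<dots> \<le> exp ((\<integral>p. F p \<partial>P) + card J * c\<^sup>2) * exp (c\<^sup>2)"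
  proof (intro mult_right_mono insert.IH)
    show "osc J c F" unfolding F_def using insert k oJ by (intro osc_avg) auto
  qed (use k bF inv in auto)
  also have "\<dots> = exp ((\<integral>p. f p \<partial>P) + card (insert k J) * c\<^sup>2)"
    using integral_avg[OF insert(5) k(1)] insert(1,2) by (simp add: F_def exp_add[symmetric] algebra_simps)
  finally show ?case .
qed

text \<open>The same induction with orthogonality in place of the exponential:
  \<open>f - avg k f\<close> is orthogonal to every function insensitive to coordinate
  \<open>k\<close>, so second moments add up.\<close>

lemma bounded_differences_variance:
  fixes c :: real
  assumes "finite J" "J \<subseteq> I" "bm P f" "\<And>i. i \<in> I - J \<Longrightarrow> inv_at i f" "osc J c f"
  shows "(\<integral>p. (f p)\<^sup>2 \<partial>P) \<le> (\<integral>p. f p \<partial>P)\<^sup>2 + card J * c\<^sup>2"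
  using assms
proof (induction J arbitrary: f rule: finite_induct)
  case empty
  have "(\<integral>p. (f p)\<^sup>2 \<partial>P) = (\<integral>p. (\<integral>p. f p \<partial>P)\<^sup>2 \<partial>P)"
    by (rule Bochner_Integration.integral_cong) (use inv_all_integral[of f] empty in auto)
  then show ?case by (simp add: P.prob_space)
next
  case (insert k J)
  define F where "F = avg k f"
  have k: "k \<in> I" "J \<subseteq> I" using insert by auto
  have bF: "bm P F" and oJ: "osc J c f" and ok: "osc {k} c f"
    using insert k by (auto simp: F_def intro: osc_mono[OF insert(7)])
  have inv: "inv_at i F" if "i \<in> I - J" for i
    using that insert inv_at_avg[of i f k] inv_at_avg_self[of k f] by (cases "i = k") (auto simp: F_def)
  have c0: "0 \<le> c" using osc_nonneg[OF ok] by simp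
  have "(\<integral>p. F p * f p \<partial>P) = (\<integral>p. F p * F p \<partial>P)"
    using integral_mult_avg[OF insert(5) bF k(1)] inv[of k] insert(2) k(1) by (simp flip: F_def)
  moreover have "(\<integral>p. (f p)\<^sup>2 \<partial>P) = (\<integral>p. (f p - F p)\<^sup>2 + 2 * (F p * f p) - F p * F p \<partial>P)"
    by (rule Bochner_Integration.integral_cong) (auto simp: power2_eq_square algebra_simps)
  moreover have "\<dots> = (\<integral>p. (f p - F p)\<^sup>2 \<partial>P) + 2 * (\<integral>p. F p * f p \<partial>P) - (\<integral>p. F p * F p \<partial>P)"
  proof -
    have "integrable P (\<lambda>p. (f p - F p)\<^sup>2)" "integrable P (\<lambda>p. F p * f p)" "integrable P (\<lambda>p. F p * F p)"
      using insert(5) bF by (auto intro!: P.bm_integrable)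
    then show ?thesis by simp
  qed
  ultimately have "(\<integral>p. (f p)\<^sup>2 \<partial>P) = (\<integral>p. (f p - F p)\<^sup>2 \<partial>P) + (\<integral>p. (F p)\<^sup>2 \<partial>P)"
    by (simp add: power2_eq_square)
  moreover have "(\<integral>p. (f p - F p)\<^sup>2 \<partial>P) \<le> (\<integral>p. c\<^sup>2 \<partial>P)"
  proof (rule integral_mono)
    show "integrable P (\<lambda>p. (f p - F p)\<^sup>2)" using insert(5) bF by (auto intro!: P.bm_integrable)
    show "(f p - F p)\<^sup>2 \<le> c\<^sup>2" if "p \<in> space P" for p
      using abs_diff_avg_le[OF insert(5) k(1) ok that] c0 by (metis F_def abs_le_square_iff abs_of_nonneg)
  qed simp
  moreover have "(\<integral>p. (F p)\<^sup>2 \<partial>P) \<le> (\<integral>p. F p \<partial>P)\<^sup>2 + card J * c\<^sup>2"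
  proof (rule insert.IH)
    show "osc J c F" unfolding F_def using insert k oJ by (intro osc_avg) auto
  qed (use k bF inv in auto)
  moreover have "(\<integral>p. F p \<partial>P) = (\<integral>p. f p \<partial>P)" unfolding F_def by (rule integral_avg[OF insert(5) k(1)])
  ultimately show ?case using insert(1,2) by (simp add: P.prob_space distrib_right)
qed

text \<open>The predictable quadratic variation of the Doob martingale is compensated in the
  exponent; each increment is conditionally a centred function with bounded differences.\<close>

lemma second_order_supermartingale:
  fixes a b l :: real
  assumes "finite J" "J \<subseteq> I" "bm P f" "\<And>i. i \<in> I - J \<Longrightarrow> inv_at i f" "osc J a f" "osc2 J b f"
    "(\<integral>p. f p \<partial>P) = 0" "\<And>i z. i \<in> J \<Longrightarrow> z \<in> space D \<Longrightarrow> (\<integral>p. f (p(i := z)) \<partial>P) = 0"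
    and la: "\<bar>l\<bar> * a \<le> 1" and b0: "0 \<le> b"
  shows "\<exists>v. (\<forall>j\<in>J. bm P (v j) \<and> (\<forall>k\<in>I - J. inv_at k (v j)) \<and>
             (\<forall>t\<ge>0. 8 * t * (card I * b\<^sup>2) \<le> 1 \<longrightarrow> (\<integral>p. exp (t * v j p) \<partial>P) \<le> 2)) \<and>
           (\<integral>p. exp (l * f p - l\<^sup>2 * (\<Sum>j\<in>J. v j p)) \<partial>P) \<le> 1"
  using assms(1-8)
proof (induction J arbitrary: f rule: finite_induct)
  case empty
  have "f p = 0" if "p \<in> space P" for p using inv_all_integral[of f p] empty that by auto
  then have "(\<integral>p. exp (l * f p) \<partial>P) = (\<integral>p. 1 \<partial>P)" by (intro Bochner_Integration.integral_cong) auto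
  then show ?case by (simp add: P.prob_space)
next
  case (insert k J)
  note f = insert.prems(2)
  define F where "F = avg k f"
  have k: "k \<in> I" "J \<subseteq> I" "finite J" "k \<notin> J" using insert by auto
  have bF: "bm P F" using f k by (auto simp: F_def)
  have oJ: "osc J a f" and ok: "osc {k} a f" by (auto intro: osc_mono[OF insert.prems(4)])
  have o2J: "osc2 J b f" by (auto intro: osc2_mono[OF insert.prems(5)])
  have inv: "inv_at i F" if "i \<in> I - J" for i
    using that insert.prems(3)[of i] inv_at_avg[of i f k] inv_at_avg_self[of k f] by (cases "i = k") (auto simp: F_def)
  have F1: "F (p(k := z)) = F p" for p z using inv[of k] k by (auto simp: inv_at_def)
  have EF: "(\<integral>p. F p \<partial>P) = 0" unfolding F_def using integral_avg[OF f k(1)] insert.prems by simp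
  have "\<exists>v. (\<forall>j\<in>J. bm P (v j) \<and> (\<forall>k\<in>I - J. inv_at k (v j)) \<and>
             (\<forall>t\<ge>0. 8 * t * (card I * b\<^sup>2) \<le> 1 \<longrightarrow> (\<integral>p. exp (t * v j p) \<partial>P) \<le> 2)) \<and>
           (\<integral>p. exp (l * F p - l\<^sup>2 * (\<Sum>j\<in>J. v j p)) \<partial>P) \<le> 1"
  proof (rule insert.IH)
    show "osc J a F" unfolding F_def by (rule osc_avg[OF f k(1) k(4) k(2) oJ])
    show "osc2 J b F" unfolding F_def by (rule osc2_avg[OF f k(1) k(4) k(2) o2J])
    fix i z assume i: "i \<in> J" "z \<in> space D"
    then have ne: "i \<noteq> k" and iI: "i \<in> I" using k by auto
    have "(\<integral>p. F (p(i := z)) \<partial>P) = (\<integral>p. avg k (\<lambda>p. f (p(i := z))) p \<partial>P)"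
      using ne by (simp add: F_def avg_def fun_upd_twist)
    also have "\<dots> = (\<integral>p. f (p(i := z)) \<partial>P)" using f k i iI by (intro integral_avg) auto
    also have "\<dots> = 0" using i by (intro insert.prems(7)) auto
    finally show "(\<integral>p. F (p(i := z)) \<partial>P) = 0" .
  qed (use k bF inv EF in auto)
  then obtain v where v: "\<And>j. j \<in> J \<Longrightarrow> bm P (v j)" "\<And>j i. j \<in> J \<Longrightarrow> i \<in> I - J \<Longrightarrow> inv_at i (v j)"
      "\<And>j t. j \<in> J \<Longrightarrow> t \<ge> 0 \<Longrightarrow> 8 * t * (card I * b\<^sup>2) \<le> 1 \<Longrightarrow> (\<integral>p. exp (t * v j p) \<partial>P) \<le> 2"
      "(\<integral>p. exp (l * F p - l\<^sup>2 * (\<Sum>j\<in>J. v j p)) \<partial>P) \<le> 1" by blast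
  \<comment> \<open>The conditional variance of the martingale increment at \<open>k\<close>; it
    becomes the entry \<open>v' k\<close> of the compensator.\<close>
  define u where "u = avg k (\<lambda>p. (f p - F p)\<^sup>2)"
  have bu: "bm P u" unfolding u_def using f bF k by (intro bm_avg bm_power bm_diff)
  have inv_u: "inv_at i u" if "i \<in> I - J" for i
  proof (cases "i = k")
    case False
    then have "inv_at i f" using that insert.prems(3) by auto
    then have "inv_at i (\<lambda>p. (f p - F p)\<^sup>2)" using inv[OF that] by (auto simp: inv_at_def)
    then show ?thesis unfolding u_def by (rule inv_at_avg)
  qed (simp add: u_def inv_at_avg_self)
  have exp_u: "(\<integral>p. exp (t * u p) \<partial>P) \<le> 2" if t: "t \<ge> 0" "8 * t * (card I * b\<^sup>2) \<le> 1" for t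
  proof -
    define G where "G z p = f (p(k := z)) - F p" for z p
    have bG: "bm P (G z)" if "z \<in> space D" for z unfolding G_def using f k bF that by auto
    have bG2: "bm (P \<Otimes>\<^sub>M D) (\<lambda>(p,z). exp (t * (G z p)\<^sup>2))"
    proof -
      have "bm (P \<Otimes>\<^sub>M D) (\<lambda>x. F (fst x))" by (rule bm_compose[OF measurable_fst bF])
      then have "bm (P \<Otimes>\<^sub>M D) (\<lambda>x. exp (t * (f ((fst x)(k := snd x)) - F (fst x))\<^sup>2))"
        using bm_upd[OF f k(1)] by (intro bm_exp bm_mult bm_power bm_diff bm_const)
      then show ?thesis by (simp add: G_def case_prod_beta')
    qed
    \<comment> \<open>For a fixed value \<open>z\<close> the function \<open>G z\<close> is centred,
      because \<open>f (p(k := z))\<close> and \<open>F\<close> both have mean zero, and its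
      oscillation is an average of mixed second differences of \<open>f\<close>. Hence it is
      sub-Gaussian with parameter \<open>card I * b^2\<close>.\<close>
    have G2: "(\<integral>p. exp (t * (G z p)\<^sup>2) \<partial>P) \<le> 2" if z: "z \<in> space D" for z
    proof (rule P.subgaussian_exp_square[OF bG[OF z] _ t])
      fix r :: real
      have "(\<integral>p. exp (r * G z p) \<partial>P) \<le> exp ((\<integral>p. r * G z p \<partial>P) + card J * (\<bar>r\<bar> * b)\<^sup>2)"
      proof (rule bounded_differences_mgf)
        show "inv_at i (\<lambda>p. r * G z p)" if "i \<in> I - J" for i
        proof (cases "i = k")
          case False
          have "f (p(i := w, k := z)) = f (p(k := z))" for p w
            using that insert.prems(3)[of i] False fun_upd_twist[OF False, of p w z] by (auto simp: inv_at_def)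
          then show ?thesis using inv[OF that] by (auto simp: G_def inv_at_def)
        qed (use inv[OF that] in \<open>auto simp: G_def inv_at_def\<close>)
        show "osc J (\<bar>r\<bar> * b) (\<lambda>p. r * G z p)"
          unfolding osc_def
        proof safe
          fix i p w assume a: "i \<in> J" "p \<in> space P" "w \<in> space D"
          then have ne: "i \<noteq> k" and iI: "i \<in> I" using k by auto
          have i: "integrable D (\<lambda>y. f (p(k := y)))" "integrable D (\<lambda>y. f (p(i := w, k := y)))"
            using f k a iI by (auto intro!: D.bm_integrable)
          have "G z p - G z (p(i := w)) =
            (\<integral>y. (f (p(k := z)) - f (p(k := y))) - (f (p(i := w, k := z)) - f (p(i := w, k := y))) \<partial>D)"
            unfolding G_def F_def avg_def using i by (simp add: D.prob_space)
          moreover have "\<bar>\<dots>\<bar> \<le> b"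
          proof (rule D.abs_integral_le_const)
            fix y assume y: "y \<in> space D"
            show "\<bar>(f (p(k := z)) - f (p(k := y))) - (f (p(i := w, k := z)) - f (p(i := w, k := y)))\<bar> \<le> b"
            proof -
              have e: "p(k := z, i := w) = p(i := w, k := z)" using ne by (intro fun_upd_twist) auto
              have "\<bar>f (p(k := z)) - f (p(k := z, k := y)) - (f (p(k := z, i := w)) - f (p(k := z, i := w, k := y)))\<bar> \<le> b"
                by (rule osc2D[OF insert.prems(5) _ _ _ upd_space[OF k(1) z a(2)] y a(3)]) (use a ne in auto)
              then show ?thesis unfolding e fun_upd_upd .
            qed
          qed (use b0 in auto)
          ultimately have "\<bar>G z p - G z (p(i := w))\<bar> \<le> b" by simp
          then show "\<bar>r * G z p - r * G z (p(i := w))\<bar> \<le> \<bar>r\<bar> * b"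
            by (simp add: mult_left_mono abs_mult flip: right_diff_distrib)
        qed
      qed (use bG z k in auto)
      also have "(\<integral>p. r * G z p \<partial>P) = 0"
      proof -
        have "integrable P (\<lambda>p. f (p(k := z)))" "integrable P F" using f k z bF by (auto intro!: P.bm_integrable)
        moreover have "(\<integral>p. f (p(k := z)) \<partial>P) = 0" using z by (intro insert.prems(7)) auto
        ultimately show ?thesis using EF by (simp add: G_def)
      qed
      also have "exp (0 + card J * (\<bar>r\<bar> * b)\<^sup>2) \<le> exp (r\<^sup>2 * (card I * b\<^sup>2))"
        using card_mono[OF fin k(2)] by (simp add: power_mult_distrib mult_ac mult_left_mono mult_right_mono)
      finally show "(\<integral>p. exp (r * G z p) \<partial>P) \<le> exp (r\<^sup>2 * (card I * b\<^sup>2))" .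
    qed
    \<comment> \<open>Jensen's inequality over the resampled value \<open>z\<close>, followed by
      Fubini, reduces the claim to the bound for each fixed \<open>z\<close>.\<close>
    have "(\<integral>p. exp (t * u p) \<partial>P) \<le> (\<integral>p. (\<integral>z. exp (t * (G z p)\<^sup>2) \<partial>D) \<partial>P)"
    proof (rule integral_mono)
      show "integrable P (\<lambda>p. exp (t * u p))" using bu by (auto intro!: P.bm_integrable)
      show "integrable P (\<lambda>p. \<integral>z. exp (t * (G z p)\<^sup>2) \<partial>D)"
        by (rule P.bm_integrable[OF D.bm_integral_snd[OF bG2]])
      fix p assume p: "p \<in> space P"
      have "bm D (\<lambda>z. (t * (G z p)\<^sup>2))" using f k p by (auto simp: G_def)
      from D.exp_jensen[OF this] show "exp (t * u p) \<le> (\<integral>z. exp (t * (G z p)\<^sup>2) \<partial>D)"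
        by (simp add: u_def avg_def G_def F1)
    qed
    also have "\<dots> = (\<integral>z. (\<integral>p. exp (t * (G z p)\<^sup>2) \<partial>P) \<partial>D)"
      using PD.Fubini_integral[OF PD.bm_integrable[OF bG2]] by simp
    also have "\<dots> \<le> \<bar>\<integral>z. (\<integral>p. exp (t * (G z p)\<^sup>2) \<partial>P) \<partial>D\<bar>" by simp
    also have "\<dots> \<le> 2"
      by (rule D.abs_integral_le_const) (use G2 in \<open>auto simp: abs_of_nonneg integral_nonneg\<close>)
    finally show ?thesis .
  qed
  \<comment> \<open>The bound \<open>\<bar>l\<bar> * a \<le> 1\<close> admits the quadratic estimate
    of \<open>exp\<close>, whose linear term averages to zero.\<close>
  have step: "avg k (\<lambda>p. exp (l * (f p - F p))) p \<le> exp (l\<^sup>2 * u p)" if p: "p \<in> space P" for p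
  proof -
    have ib: "bm D (\<lambda>z. f (p(k := z)))" using f k p by auto
    have ii: "integrable D (\<lambda>z. f (p(k := z)))" "integrable D (\<lambda>z. (f (p(k := z)) - F p)\<^sup>2)"
      using ib by (auto intro!: D.bm_integrable)
    have "avg k (\<lambda>p. exp (l * (f p - F p))) p \<le>
       (\<integral>z. 1 + l * (f (p(k := z)) - F p) + l\<^sup>2 * (f (p(k := z)) - F p)\<^sup>2 \<partial>D)"
      unfolding avg_def F1
    proof (rule integral_mono)
      show "integrable D (\<lambda>z. exp (l * (f (p(k := z)) - F p)))" using ib by (auto intro!: D.bm_integrable)
      show "integrable D (\<lambda>z. 1 + l * (f (p(k := z)) - F p) + l\<^sup>2 * (f (p(k := z)) - F p)\<^sup>2)"
        using ib by (auto intro!: D.bm_integrable)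
      fix z assume "z \<in> space D"
      then have "\<bar>f (p(k:=z)) - F p\<bar> \<le> a"
        using abs_diff_avg_le[OF f k(1) ok, of "p(k := z)"] p k F1 by (simp add: F_def)
      then have "\<bar>l * (f (p(k:=z)) - F p)\<bar> \<le> 1"
        using la by (metis abs_ge_zero abs_mult mult_left_mono order_trans)
      from exp_le_quadratic[OF this]
      show "exp (l * (f (p(k := z)) - F p)) \<le> 1 + l * (f (p(k := z)) - F p) + l\<^sup>2 * (f (p(k := z)) - F p)\<^sup>2"
        by (simp add: power_mult_distrib)
    qed
    also have "\<dots> = 1 + l * ((\<integral>z. f (p(k:=z)) \<partial>D) - F p) + l\<^sup>2 * u p"
      using ii by (simp add: D.prob_space u_def avg_def F1)
    also have "\<dots> = 1 + l\<^sup>2 * u p" by (simp add: F_def avg_def)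
    also have "\<dots> \<le> exp (l\<^sup>2 * u p)" by (rule exp_ge_add_one_self)
    finally show ?thesis .
  qed
  define V where "V p = (\<Sum>j\<in>J. v j p)" for p
  have bV: "bm P V" using v by (auto simp: V_def[abs_def])
  have invV: "V (p(k := z)) = V p" for p z using v(2)[of _ k] k by (auto simp: V_def inv_at_def intro!: sum.cong)
  define v' where "v' = v(k := u)"
  have sum_v': "(\<Sum>j\<in>insert k J. v' j p) = V p + u p" for p
  proof -
    have "(\<Sum>j\<in>J. v' j p) = V p" using k by (auto simp: v'_def V_def intro!: sum.cong)
    then show ?thesis using k by (simp add: v'_def)
  qed
  define E where "E p = exp (l * F p - l\<^sup>2 * V p - l\<^sup>2 * u p)" for p
  have bE: "bm P E" using bF bV bu by (auto simp: E_def[abs_def])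
  have bq: "bm P (avg k (\<lambda>p. exp (l * (f p - F p))))"
    using f bF k by (intro bm_avg bm_exp bm_mult bm_const bm_diff)
  have "(\<integral>p. exp (l * f p - l\<^sup>2 * (\<Sum>j\<in>insert k J. v' j p)) \<partial>P) = (\<integral>p. E p * exp (l * (f p - F p)) \<partial>P)"
    unfolding sum_v' E_def exp_add[symmetric] by (simp add: algebra_simps)
  also have "\<dots> = (\<integral>p. E p * avg k (\<lambda>p. exp (l * (f p - F p))) p \<partial>P)"
  proof (rule integral_mult_avg)
    show "inv_at k E" using F1 invV inv_u[of k] k by (auto simp: inv_at_def E_def)
  qed (use f bF bE k in auto)
  also have "\<dots> \<le> (\<integral>p. exp (l * F p - l\<^sup>2 * V p) \<partial>P)"
  proof (rule integral_mono)
    show "integrable P (\<lambda>p. E p * avg k (\<lambda>p. exp (l * (f p - F p))) p)"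
      using bE bq by (intro P.bm_integrable bm_mult)
    show "integrable P (\<lambda>p. exp (l * F p - l\<^sup>2 * V p))" using bF bV by (auto intro!: P.bm_integrable)
    fix p assume "p \<in> space P"
    from step[OF this] have "E p * avg k (\<lambda>p. exp (l * (f p - F p))) p \<le> E p * exp (l\<^sup>2 * u p)"
      by (intro mult_left_mono) (auto simp: E_def)
    then show "E p * avg k (\<lambda>p. exp (l * (f p - F p))) p \<le> exp (l * F p - l\<^sup>2 * V p)"
      by (simp add: E_def exp_add[symmetric])
  qed
  also have "\<dots> \<le> 1" using v(4) by (simp add: V_def)
  finally have *: "(\<integral>p. exp (l * f p - l\<^sup>2 * (\<Sum>j\<in>insert k J. v' j p)) \<partial>P) \<le> 1" .
  show ?case
  proof (intro exI[of _ v'] conjI ballI allI impI)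
    show "(\<integral>p. exp (l * f p - l\<^sup>2 * (\<Sum>j\<in>insert k J. v' j p)) \<partial>P) \<le> 1" by (rule *)
  qed (use v bu inv_u exp_u k in \<open>auto simp: v'_def\<close>)
qed

text \<open>At \<open>2 * l\<close> the compensated exponential has mean at most 1. Writing
  \<open>exp (l * f)\<close> as a product of its square root and a power of the compensator, the
  inequality \<open>A * B \<le> (A^2 + B^2) / 2\<close> leaves only the exponential moment of the
  compensator \<open>V\<close>. The hypothesis that all one-coordinate conditional means vanish is
  what makes the gain over McDiarmid possible.\<close>

lemma second_order_mgf:
  fixes a b l :: real
  assumes f: "bm P f" and o: "osc I a f" "osc2 I b f" and b0: "0 \<le> b"
    and z: "\<And>i z. i \<in> I \<Longrightarrow> z \<in> space D \<Longrightarrow> (\<integral>p. f (p(i := z)) \<partial>P) = 0" and I: "I \<noteq> {}"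
    and la: "2 * \<bar>l\<bar> * a \<le> 1" and lb: "32 * l\<^sup>2 * (card I)\<^sup>2 * b\<^sup>2 \<le> 1"
  shows "(\<integral>p. exp (l * f p) \<partial>P) \<le> 2"
proof -
  define n where "n = real (card I)"
  have n: "n > 0" using I fin by (simp add: n_def card_gt_0_iff)
  obtain i where i: "i \<in> I" using I by auto
  have "(\<integral>p. f p \<partial>P) = (\<integral>z. (\<integral>p. f (p(i := z)) \<partial>P) \<partial>D)" using integral_upd[OF f i] by simp
  also have "\<dots> = (\<integral>z. 0 \<partial>D)" using z i by (intro Bochner_Integration.integral_cong) auto
  finally have Ef: "(\<integral>p. f p \<partial>P) = 0" by simp
  obtain v where v: "\<And>j. j \<in> I \<Longrightarrow> bm P (v j)"
      "\<And>j t. j \<in> I \<Longrightarrow> t \<ge> 0 \<Longrightarrow> 8 * t * (card I * b\<^sup>2) \<le> 1 \<Longrightarrow> (\<integral>p. exp (t * v j p) \<partial>P) \<le> 2"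
      "(\<integral>p. exp ((2*l) * f p - (2*l)\<^sup>2 * (\<Sum>j\<in>I. v j p)) \<partial>P) \<le> 1"
    using second_order_supermartingale[OF fin subset_refl f _ o Ef z, of "2*l"] la b0 by (auto simp: abs_mult)
  define V where "V p = (\<Sum>j\<in>I. v j p)" for p
  have bV: "bm P V" using v by (auto simp: V_def[abs_def])
  \<comment> \<open>The terms of \<open>V\<close> are dependent; convexity treats \<open>V\<close>
    as an average of \<open>n\<close> terms at the price of a factor \<open>n\<close> in each
    exponent. This is the origin of \<open>(card I)^2\<close> in the last hypothesis.\<close>
  have cJ: "exp (4 * l\<^sup>2 * V p) \<le> (\<Sum>j\<in>I. (1/n) * exp (4 * l\<^sup>2 * n * v j p))" for p
  proof -
    have "exp (\<Sum>j\<in>I. (1/n) *\<^sub>R (4 * l\<^sup>2 * n * v j p)) \<le> (\<Sum>j\<in>I. (1/n) * exp (4 * l\<^sup>2 * n * v j p))"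
      by (rule convex_on_sum[OF fin I exp_convex]) (use n in \<open>auto simp: n_def\<close>)
    moreover have "(\<Sum>j\<in>I. (1/n) *\<^sub>R (4 * l\<^sup>2 * n * v j p)) = 4 * l\<^sup>2 * V p"
      using n by (simp add: V_def sum_distrib_left mult_ac)
    ultimately show ?thesis by simp
  qed
  have E2: "(\<integral>p. exp (4 * l\<^sup>2 * V p) \<partial>P) \<le> 2"
  proof -
    have "(\<integral>p. exp (4 * l\<^sup>2 * V p) \<partial>P) \<le> (\<integral>p. (\<Sum>j\<in>I. (1/n) * exp (4 * l\<^sup>2 * n * v j p)) \<partial>P)"
    proof (rule integral_mono)
      show "integrable P (\<lambda>p. exp (4 * l\<^sup>2 * V p))" using bV by (auto intro!: P.bm_integrable)
      show "integrable P (\<lambda>p. \<Sum>j\<in>I. (1/n) * exp (4 * l\<^sup>2 * n * v j p))" using v(1) by (intro P.bm_integrable) auto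
    qed (rule cJ)
    also have "\<dots> = (\<Sum>j\<in>I. (1/n) * (\<integral>p. exp (4 * l\<^sup>2 * n * v j p) \<partial>P))"
      using v(1) by (subst Bochner_Integration.integral_sum) (auto intro!: P.bm_integrable)
    also have "\<dots> \<le> (\<Sum>j\<in>I. (1/n) * 2)"
    proof (intro sum_mono mult_left_mono v(2))
      show "8 * (4 * l\<^sup>2 * n) * (card I * b\<^sup>2) \<le> 1" using lb by (simp add: n_def power2_eq_square mult_ac)
    qed (use n in auto)
    also have "\<dots> = 2" using n by (simp add: n_def)
    finally show ?thesis .
  qed
  have "(\<integral>p. exp (l * f p) \<partial>P) \<le> (\<integral>p. 1/2 * exp ((2*l) * f p - (2*l)\<^sup>2 * V p) + 1/2 * exp (4 * l\<^sup>2 * V p) \<partial>P)"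
  proof (rule integral_mono)
    fix p
    define A where "A = exp (l * f p - 2 * l\<^sup>2 * V p)"
    define B where "B = exp (2 * l\<^sup>2 * V p)"
    have "A * B = exp (l * f p)" "A\<^sup>2 = exp ((2*l) * f p - (2*l)\<^sup>2 * V p)" "B\<^sup>2 = exp (4 * l\<^sup>2 * V p)"
      by (auto simp: A_def B_def exp_add[symmetric] power2_eq_square algebra_simps)
    moreover have "A * B \<le> 1/2 * A\<^sup>2 + 1/2 * B\<^sup>2" using sum_squares_bound[of A B] by simp
    ultimately show "exp (l * f p) \<le> 1/2 * exp ((2*l) * f p - (2*l)\<^sup>2 * V p) + 1/2 * exp (4 * l\<^sup>2 * V p)" by simp
  qed (use f bV in \<open>auto intro!: P.bm_integrable\<close>)
  also have "\<dots> = 1/2 * (\<integral>p. exp ((2*l) * f p - (2*l)\<^sup>2 * V p) \<partial>P) + 1/2 * (\<integral>p. exp (4 * l\<^sup>2 * V p) \<partial>P)"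
  proof -
    have "integrable P (\<lambda>p. exp ((2*l) * f p - (2*l)\<^sup>2 * V p))" "integrable P (\<lambda>p. exp (4 * l\<^sup>2 * V p))"
      using f bV by (auto intro!: P.bm_integrable)
    then show ?thesis by simp
  qed
  also have "\<dots> \<le> 2" using E2 v(3) by (simp add: V_def)
  finally show ?thesis .
qed

end

section \<open>The normal tail and Stein's equation\<close>

abbreviation phi :: "real \<Rightarrow> real" where "phi \<equiv> std_normal_density"

lemma phi_eq: "phi w = exp (- w\<^sup>2 / 2) / sqrt (2 * pi)"
  by (simp add: std_normal_density_def)

lemma phi_pos [simp]: "0 < phi w" by (simp add: phi_eq)

lemma phi_neq_0 [simp]: "phi w \<noteq> 0" using phi_pos[of w] by linarith

lemma DERIV_phi: "(phi has_real_derivative (- w * phi w)) (at w)"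
  unfolding phi_eq[abs_def] by (auto intro!: derivative_eq_intros simp: field_simps)

lemma real_distribution_std_normal: "real_distribution std_normal_distribution"
  by (rule real_dist_normal_dist)

interpretation N: real_distribution std_normal_distribution
  by (rule real_distribution_std_normal)

lemma Phi_bounds [simp]: "0 \<le> Phi w" "Phi w \<le> 1"
  by (simp_all add: Phi_def N.cdf_nonneg N.cdf_bounded_prob)

lemma Phi_mono: "v \<le> w \<Longrightarrow> Phi v \<le> Phi w"
  by (simp add: Phi_def N.cdf_nondecreasing)

lemma Phi_at_top: "(Phi \<longlongrightarrow> 1) at_top"
  by (simp add: Phi_def N.cdf_lim_at_top_prob)

lemma isCont_phi: "isCont phi w" using DERIV_phi DERIV_isCont by blast

lemma continuous_on_phi: "continuous_on A phi"
  by (simp add: continuous_at_imp_continuous_on isCont_phi)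

lemma Phi_diff:
  assumes "a \<le> b" shows "Phi b - Phi a = integral {a..b} phi"
proof -
  have "Phi b - Phi a = measure std_normal_distribution {a<..b}"
    using assms by (cases "a = b") (auto simp: Phi_def N.cdf_diff_eq)
  also have "\<dots> = (\<integral>x. indicator {a<..b} x * phi x \<partial>lborel)"
  proof -
    have "measure std_normal_distribution {a<..b} = (\<integral>x. indicator {a<..b} x \<partial>std_normal_distribution)"
      by simp
    also have "\<dots> = (\<integral>x. phi x * indicator {a<..b} x \<partial>lborel)"
      by (subst integral_density) auto
    finally show ?thesis by (simp add: mult.commute)
  qed
  also have "\<dots> = (\<integral>x. indicator {a..b} x * phi x \<partial>lborel)"
  proof (rule integral_cong_AE)
    show "AE x in lborel. indicator {a<..b} x * phi x = indicator {a..b} x * phi x"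
      using AE_lborel_singleton[of a] by eventually_elim (auto simp: indicator_def)
  qed auto
  also have "\<dots> = (LINT x:{a..b}|lborel. phi x)" by (simp add: set_lebesgue_integral_def)
  also have "\<dots> = integral {a..b} phi"
    by (rule set_borel_integral_eq_integral(2))
       (auto intro!: borel_integrable_atLeastAtMost' continuous_on_phi)
  finally show ?thesis .
qed

lemma DERIV_Phi: "(Phi has_real_derivative phi w) (at w)"
proof -
  have "((\<lambda>x. integral {w-1..x} phi) has_real_derivative phi w) (at w within {w-1..w+1})"
    by (rule integral_has_real_derivative) (auto intro: continuous_on_phi)
  then have "((\<lambda>x. integral {w-1..x} phi) has_real_derivative phi w) (at w)"
    by (subst (asm) at_within_interior) auto
  then have "((\<lambda>x. Phi (w-1) + integral {w-1..x} phi) has_real_derivative phi w) (at w)"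
    by (auto intro!: derivative_eq_intros)
  moreover have "Phi (w-1) + integral {w-1..x} phi = Phi x" if "x \<in> {w-1<..<w+1}" for x
    using Phi_diff[of "w-1" x] that by auto
  ultimately show ?thesis
    using has_field_derivative_transform_within_open[of _ "phi w" w "{w-1<..<w+1}" Phi] by auto
qed

lemma phi_at_top: "(phi \<longlongrightarrow> 0) at_top"
  unfolding phi_eq[abs_def] by real_asymp

text \<open>The difference \<open>phi w / w - (1 - Phi w)\<close> tends to 0 at infinity and has
  derivative \<open>- phi w / w^2\<close>, hence is positive.\<close>

lemma mills_upper:
  assumes "w > 0" shows "w * (1 - Phi w) \<le> phi w"
proof -
  define g where "g w = phi w / w - (1 - Phi w)" for w
  have "0 < g w"
  proof (rule DERIV_neg_imp_decreasing_at_top[where f=g and b=w])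
    fix x assume x: "w \<le> x"
    have "(g has_real_derivative (- phi x / x\<^sup>2)) (at x)"
      unfolding g_def using x assms
      by (auto intro!: derivative_eq_intros DERIV_phi DERIV_Phi simp: field_simps power2_eq_square)
    then show "\<exists>y. (g has_real_derivative y) (at x) \<and> y < 0"
      using x assms by (intro exI[of _ "- phi x / x\<^sup>2"]) (auto intro!: divide_neg_pos)
  next
    have "((\<lambda>x. phi x * (1 / x) - (1 - Phi x)) \<longlongrightarrow> 0 * 0 - (1 - 1)) at_top"
      by (intro tendsto_intros phi_at_top Phi_at_top) real_asymp
    then show "(g \<longlongrightarrow> 0) at_top" by (simp add: g_def[abs_def])
  qed
  then show ?thesis using assms by (simp add: g_def field_simps)
qed

text \<open>Again a difference that vanishes at infinity, now with derivative
  \<open>- 2 * phi w / (1 + w^2)^2\<close>. There is no sign condition on \<open>w\<close>, so the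
  reflected argument also yields the bound for the left tail.\<close>

lemma mills_lower: "w * phi w \<le> (1 + w\<^sup>2) * (1 - Phi w)"
proof -
  define g where "g w = (1 - Phi w) - w * phi w / (1 + w\<^sup>2)" for w
  have nz: "0 < 1 + x\<^sup>2" "1 + x\<^sup>2 \<noteq> 0" for x :: real
    using add_pos_nonneg[of 1 "x\<^sup>2"] by auto
  have "0 < g w"
  proof (rule DERIV_neg_imp_decreasing_at_top[where f=g and b=w])
    fix x assume x: "w \<le> x"
    have "(g has_real_derivative (0 - phi x) - (((1 * phi x + (- x * phi x) * x) * (1 + x\<^sup>2) - x * phi x * (0 + 2 * x)) / ((1 + x\<^sup>2) * (1 + x\<^sup>2)))) (at x)"
      unfolding g_def using nz
      by (auto intro!: derivative_eq_intros DERIV_phi DERIV_Phi)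
    also have "(0 - phi x) - (((1 * phi x + (- x * phi x) * x) * (1 + x\<^sup>2) - x * phi x * (0 + 2 * x)) / ((1 + x\<^sup>2) * (1 + x\<^sup>2))) = - 2 * phi x / (1 + x\<^sup>2)\<^sup>2"
      using nz[of x] by (simp add: divide_simps) (simp add: algebra_simps power2_eq_square)
    finally show "\<exists>y. (g has_real_derivative y) (at x) \<and> y < 0"
      using nz[of x] by (intro exI[of _ "- 2 * phi x / (1 + x\<^sup>2)\<^sup>2"]) (auto intro!: divide_neg_pos)
  next
    have "((\<lambda>x. (1 - Phi x) - phi x * (x / (1 + x\<^sup>2))) \<longlongrightarrow> (1 - 1) - 0 * 0) at_top"
      by (intro tendsto_intros phi_at_top Phi_at_top) real_asymp
    then show "(g \<longlongrightarrow> 0) at_top" by (simp add: g_def[abs_def] mult.commute)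
  qed
  then show ?thesis using nz[of w] by (simp add: g_def field_simps)
qed

lemma Phi_minus: "Phi (- w) = 1 - Phi w"
proof -
  define g where "g w = Phi (- w) + Phi w" for w
  have "((\<lambda>w. Phi (- w)) has_real_derivative (phi (- x) * (- 1))) (at x)" for x
    by (rule DERIV_chain2[OF DERIV_Phi]) (auto intro!: derivative_eq_intros)
  then have "(g has_real_derivative 0) (at x)" for x
    unfolding g_def by (auto intro!: derivative_eq_intros DERIV_Phi simp: phi_eq)
  then have c: "g x = g 0" for x using DERIV_isconst_all[of g] by blast
  have bot: "(Phi \<longlongrightarrow> 0) at_bot" by (simp add: Phi_def N.cdf_lim_at_bot)
  have "((\<lambda>w. Phi (- w)) \<longlongrightarrow> 0) at_top"
    using bot by (simp add: filterlim_at_bot_mirror)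
  then have "(g \<longlongrightarrow> 0 + 1) at_top" unfolding g_def by (intro tendsto_intros Phi_at_top)
  moreover have "(g \<longlongrightarrow> g 0) at_top" using c by (metis (no_types, lifting) ext tendsto_const)
  ultimately have "g 0 = 1" using tendsto_unique trivial_limit_at_top_linorder by fastforce
  then show ?thesis using c[of w] by (simp add: g_def)
qed

text \<open>The two Mills ratios solve \<open>f' = 1 + w * f\<close> and
  \<open>f' = - 1 + w * f\<close>. Scaled by \<open>1 - Phi z\<close> and \<open>Phi z\<close> they
  form the two branches of the bounded solution of Stein's equation.\<close>

definition mills_left :: "real \<Rightarrow> real" where "mills_left w = Phi w / phi w"
definition mills_right :: "real \<Rightarrow> real" where "mills_right w = (1 - Phi w) / phi w"

lemma DERIV_mills_left: "(mills_left has_real_derivative (1 + w * mills_left w)) (at w)"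
proof -
  have "(mills_left has_real_derivative (phi w * phi w - Phi w * (- w * phi w)) / (phi w * phi w)) (at w)"
    unfolding mills_left_def[abs_def] by (rule DERIV_divide[OF DERIV_Phi DERIV_phi phi_neq_0])
  moreover have "(phi w * phi w - Phi w * (- w * phi w)) / (phi w * phi w) = 1 + w * mills_left w"
    by (simp add: mills_left_def divide_simps) (simp add: algebra_simps)
  ultimately show ?thesis by simp
qed

lemma DERIV_mills_right: "(mills_right has_real_derivative (- 1 + w * mills_right w)) (at w)"
proof -
  have "((\<lambda>w. 1 - Phi w) has_real_derivative (- phi w)) (at w)"
    by (auto intro!: derivative_eq_intros DERIV_Phi)
  then have "(mills_right has_real_derivative (- phi w * phi w - (1 - Phi w) * (- w * phi w)) / (phi w * phi w)) (at w)"
    unfolding mills_right_def[abs_def] by (rule DERIV_divide[OF _ DERIV_phi phi_neq_0])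
  moreover have "(- phi w * phi w - (1 - Phi w) * (- w * phi w)) / (phi w * phi w) = - 1 + w * mills_right w"
    by (simp add: mills_right_def divide_simps) (simp add: algebra_simps)
  ultimately show ?thesis by simp
qed

text \<open>The derivative is \<open>w + (1 + w^2) * mills_left w\<close>, and its sign is
  \<open>mills_lower\<close> at \<open>- w\<close>.\<close>

lemma mono_w_mills_left: "v \<le> w \<Longrightarrow> v * mills_left v \<le> w * mills_left w"
proof (rule DERIV_nonneg_imp_nondecreasing[where f="\<lambda>w. w * mills_left w"])
  fix x :: real
  have "- x * phi x \<le> (1 + x\<^sup>2) * Phi x" using mills_lower[of "-x"] by (simp add: Phi_minus phi_eq)
  then have "- x \<le> (1 + x\<^sup>2) * Phi x / phi x" by (simp add: pos_le_divide_eq)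
  then have "0 \<le> x + (1 + x\<^sup>2) * mills_left x" by (simp add: mills_left_def)
  moreover have "((\<lambda>w. w * mills_left w) has_real_derivative (x + (1 + x\<^sup>2) * mills_left x)) (at x)"
    by (auto intro!: derivative_eq_intros DERIV_mills_left simp: algebra_simps power2_eq_square)
  ultimately show "\<exists>y. ((\<lambda>w. w * mills_left w) has_real_derivative y) (at x) \<and> 0 \<le> y" by blast
qed

lemma mono_w_mills_right: "v \<le> w \<Longrightarrow> v * mills_right v \<le> w * mills_right w"
proof (rule DERIV_nonneg_imp_nondecreasing[where f="\<lambda>w. w * mills_right w"])
  fix x :: real
  have "x \<le> (1 + x\<^sup>2) * (1 - Phi x) / phi x" using mills_lower[of x] by (simp add: pos_le_divide_eq)
  then have "0 \<le> (1 + x\<^sup>2) * mills_right x - x" by (simp add: mills_right_def)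
  moreover have "((\<lambda>w. w * mills_right w) has_real_derivative ((1 + x\<^sup>2) * mills_right x - x)) (at x)"
    by (auto intro!: derivative_eq_intros DERIV_mills_right simp: algebra_simps power2_eq_square)
  ultimately show "\<exists>y. ((\<lambda>w. w * mills_right w) has_real_derivative y) (at x) \<and> 0 \<le> y" by blast
qed

lemma mills_nonneg: "0 \<le> mills_left w" "0 \<le> mills_right w"
  by (simp_all add: mills_left_def mills_right_def)

lemma mills_comm: "mills_left w * (1 - Phi w) = mills_right w * Phi w"
  by (simp add: mills_left_def mills_right_def)

lemma w_mills_right_le: "0 \<le> w \<Longrightarrow> w * mills_right w \<le> 1"
  using mills_upper[of w] by (cases "w = 0") (auto simp: mills_right_def field_simps)

lemma w_mills_left_ge: "w \<le> 0 \<Longrightarrow> - 1 \<le> w * mills_left w"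
  using mills_upper[of "-w"] by (cases "w = 0") (auto simp: mills_left_def field_simps Phi_minus phi_eq)

text \<open>The bounded solution of \<open>f' w - w * f w = indicator {..z} w - Phi z\<close>. It
  has a corner at \<open>z\<close>, so increments rather than derivatives are estimated
  below.\<close>

definition stein_sol :: "real \<Rightarrow> real \<Rightarrow> real" where
  "stein_sol z w = (if w \<le> z then mills_left w * (1 - Phi z) else mills_right w * Phi z)"

lemma stein_sol_nonneg: "0 \<le> stein_sol z w"
  by (simp add: stein_sol_def mills_nonneg)

text \<open>The bound is the value for \<open>z = w\<close>, where the branches meet; monotonicity
  of \<open>Phi\<close> shows that it is the worst threshold.\<close>

lemma stein_sol_le: "stein_sol z w \<le> mills_left w * (1 - Phi w)"
  using mills_nonneg[of w] Phi_mono[of w z] Phi_mono[of z w]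
  by (auto simp: stein_sol_def mills_comm intro!: mult_left_mono) (simp flip: mills_comm add: mult_left_mono)

lemma w_stein_abs_le: "\<bar>w * stein_sol z w\<bar> \<le> 1"
proof (cases "0 \<le> w")
  case True
  have "w * stein_sol z w \<le> w * (mills_right w * Phi w)"
    using stein_sol_le[of z w] True by (intro mult_left_mono) (auto simp: mills_comm)
  also have "\<dots> = (w * mills_right w) * Phi w" by simp
  also have "\<dots> \<le> 1 * 1" using w_mills_right_le[OF True] by (intro mult_mono) auto
  finally show ?thesis using True stein_sol_nonneg by simp
next
  case False
  have "- w * stein_sol z w \<le> - w * (mills_left w * (1 - Phi w))"
    using stein_sol_le[of z w] False by (intro mult_left_mono) auto
  also have "\<dots> = (- (w * mills_left w)) * (1 - Phi w)" by simp
  also have "\<dots> \<le> 1 * 1" using w_mills_left_ge[of w] False by (intro mult_mono) auto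
  finally show ?thesis using False stein_sol_nonneg[of z w] by (simp add: abs_mult)
qed

text \<open>For \<open>\<bar>w\<bar> \<ge> 1\<close> the bound on \<open>w * stein_sol z w\<close>
  suffices; otherwise \<open>1 / phi w = sqrt (2 * pi) * exp (w^2 / 2)\<close> is at most
  \<open>3 * 2\<close>.\<close>

lemma stein_sol_abs_le: "\<bar>stein_sol z w\<bar> \<le> 6"
proof (cases "1 \<le> \<bar>w\<bar>")
  case True
  have "\<bar>stein_sol z w\<bar> \<le> \<bar>w\<bar> * \<bar>stein_sol z w\<bar>" using True by (simp add: mult_le_cancel_right1)
  then show ?thesis using w_stein_abs_le[of w z] by (simp add: abs_mult)
next
  case False
  have s: "sqrt (2 * pi) \<le> 3" using pi_less_4 by (intro real_le_lsqrt) auto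
  have e: "exp (1/2) \<le> (2::real)" using exp_bound_half[of "1/2::real"] by simp
  have "w\<^sup>2 \<le> 1" using False by (simp add: abs_square_le_1)
  then have "exp (w\<^sup>2/2) \<le> exp (1/2)" by simp
  then have "exp (w\<^sup>2 / 2) \<le> 2" using e by linarith
  then have "sqrt (2*pi) * exp (w\<^sup>2 / 2) \<le> 3 * 2" using s by (intro mult_mono) auto
  moreover have "1 / phi w = sqrt (2*pi) * exp (w\<^sup>2 / 2)" by (simp add: phi_eq exp_minus field_simps)
  ultimately have "1 / phi w \<le> 6" by simp
  moreover have "mills_left w * (1 - Phi w) \<le> 1 / phi w"
  proof -
    have "mills_left w * (1 - Phi w) = (Phi w * (1 - Phi w)) / phi w" by (simp add: mills_left_def)
    also have "\<dots> \<le> (1 * 1) / phi w" by (intro divide_right_mono mult_mono) (auto simp: less_imp_le)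
    finally show ?thesis by simp
  qed
  ultimately show ?thesis using stein_sol_le[of z w] stein_sol_nonneg[of z w] by simp
qed

lemma w_stein_mono:
  assumes "v \<le> w" shows "v * stein_sol z v \<le> w * stein_sol z w"
proof -
  have L: "v * (mills_left v * (1 - Phi z)) \<le> w * (mills_left w * (1 - Phi z))" if "v \<le> w" for v w
    using mult_right_mono[OF mono_w_mills_left[OF that], of "1 - Phi z"] by (simp add: mult_ac)
  have R: "v * (mills_right v * Phi z) \<le> w * (mills_right w * Phi z)" if "v \<le> w" for v w
    using mult_right_mono[OF mono_w_mills_right[OF that], of "Phi z"] by (simp add: mult_ac)
  consider "w \<le> z" | "v \<le> z" "z < w" | "z < v" using assms by linarith
  then show ?thesis
  proof cases
    case 2
    have "v * (mills_left v * (1 - Phi z)) \<le> z * (mills_left z * (1 - Phi z))" using 2 by (intro L)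
    also have "\<dots> = z * (mills_right z * Phi z)" by (simp add: mills_comm)
    also have "\<dots> \<le> w * (mills_right w * Phi z)" using 2 by (intro R) auto
    finally show ?thesis using 2 by (simp add: stein_sol_def)
  qed (use assms L[of v w] R[of v w] in \<open>auto simp: stein_sol_def\<close>)
qed

text \<open>On each side of \<open>z\<close> the mean value theorem applies, with derivative
  \<open>w * stein_sol z w\<close> plus a constant. Monotonicity of \<open>w * stein_sol z w\<close>
  moves the intermediate point to an end, and an interval that contains \<open>z\<close> is cut
  there.\<close>

lemma stein_sol_increment:
  assumes "S < T"
  shows "(T - S) * (S * stein_sol z S + indicator {..z} T - Phi z) \<le> stein_sol z T - stein_sol z S"
    and "stein_sol z T - stein_sol z S \<le> (T - S) * (T * stein_sol z T + indicator {..z} S - Phi z)"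
proof -
  define k where "k w = w * stein_sol z w" for w
  have km: "v \<le> w \<Longrightarrow> k v \<le> k w" for v w by (simp add: k_def w_stein_mono)
  have left: "(T - S) * (k S + 1 - Phi z) \<le> stein_sol z T - stein_sol z S \<and> stein_sol z T - stein_sol z S \<le> (T - S) * (k T + 1 - Phi z)"
    if ST: "S < T" "T \<le> z" for S T
  proof -
    have "\<exists>y. S < y \<and> y < T \<and> mills_left T * (1 - Phi z) - mills_left S * (1 - Phi z) = (T - S) * ((1 + y * mills_left y) * (1 - Phi z))"
      by (rule MVT2[OF ST(1)]) (rule DERIV_cmult_right[OF DERIV_mills_left])
    then obtain y where y: "S < y" "y < T"
      "mills_left T * (1 - Phi z) - mills_left S * (1 - Phi z) = (T - S) * ((1 + y * mills_left y) * (1 - Phi z))" by blast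
    then have "stein_sol z T - stein_sol z S = (T - S) * (k y + 1 - Phi z)"
      using ST by (simp add: stein_sol_def k_def algebra_simps)
    then show ?thesis using km[of S y] km[of y T] y ST by simp
  qed
  have zz: "stein_sol z z = mills_right z * Phi z" by (simp add: stein_sol_def mills_comm)
  have sr: "stein_sol z w = mills_right w * Phi z" if "z \<le> w" for w
    using that zz by (cases "w = z") (auto simp: stein_sol_def)
  have right: "(T - S) * (k S - Phi z) \<le> stein_sol z T - stein_sol z S \<and> stein_sol z T - stein_sol z S \<le> (T - S) * (k T - Phi z)"
    if ST: "S < T" "z \<le> S" for S T
  proof -
    have "\<exists>y. S < y \<and> y < T \<and> mills_right T * Phi z - mills_right S * Phi z = (T - S) * ((- 1 + y * mills_right y) * Phi z)"
      by (rule MVT2[OF ST(1)]) (rule DERIV_cmult_right[OF DERIV_mills_right])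
    then obtain y where y: "S < y" "y < T"
      "mills_right T * Phi z - mills_right S * Phi z = (T - S) * ((- 1 + y * mills_right y) * Phi z)" by blast
    then have "stein_sol z T - stein_sol z S = (T - S) * (k y - Phi z)"
      using ST by (simp add: sr k_def algebra_simps)
    then show ?thesis using km[of S y] km[of y T] y ST by simp
  qed
  have "(T - S) * (k S + indicator {..z} T - Phi z) \<le> stein_sol z T - stein_sol z S \<and>
        stein_sol z T - stein_sol z S \<le> (T - S) * (k T + indicator {..z} S - Phi z)"
  proof -
    consider "T \<le> z" | "z \<le> S" | "S < z" "z < T" by linarith
    then show ?thesis
    proof cases
      case 1 then show ?thesis using left[of S T] assms by (simp add: indicator_def)
    next
      case 2
      have "(T - S) * (k T - Phi z) \<le> (T - S) * (k T + indicator {..z} S - Phi z)" (is "?l \<le> ?r")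
        using assms by (intro mult_left_mono) (auto simp: indicator_def)
      moreover have "indicator {..z} T = (0::real)" using assms 2 by (auto simp: indicator_def)
      ultimately show ?thesis using right[OF assms 2] order_trans[of _ ?l ?r] by (simp only:) simp
    next
      case 3
      note l = left[OF 3(1) order_refl] and r = right[OF 3(2) order_refl]
      have "(T - z) * (k S - Phi z) \<le> (T - z) * (k z - Phi z)" "(z - S) * (k S - Phi z) \<le> (z - S) * (k S + 1 - Phi z)"
        "(T - z) * (k T - Phi z) \<le> (T - z) * (k T + 1 - Phi z)" "(z - S) * (k z + 1 - Phi z) \<le> (z - S) * (k T + 1 - Phi z)"
        using km[of S z] km[of z T] 3 by (auto intro!: mult_left_mono)
      moreover have "(T - S) * (k S - Phi z) = (T - z) * (k S - Phi z) + (z - S) * (k S - Phi z)"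
        "(T - S) * (k T + 1 - Phi z) = (T - z) * (k T + 1 - Phi z) + (z - S) * (k T + 1 - Phi z)"
        by (simp_all add: algebra_simps)
      moreover have ind: "indicator {..z} T = (0::real)" "indicator {..z} S = (1::real)" using 3 by (auto simp: indicator_def)
      ultimately have "(T - S) * (k S - Phi z) \<le> stein_sol z T - stein_sol z S \<and>
        stein_sol z T - stein_sol z S \<le> (T - S) * (k T + 1 - Phi z)"
        using l[THEN conjunct1] l[THEN conjunct2] r[THEN conjunct1] r[THEN conjunct2]
        by (intro conjI) linarith+
      then show ?thesis by (simp add: ind)
    qed
  qed
  then show "(T - S) * (S * stein_sol z S + indicator {..z} T - Phi z) \<le> stein_sol z T - stein_sol z S"
    "stein_sol z T - stein_sol z S \<le> (T - S) * (T * stein_sol z T + indicator {..z} S - Phi z)" by (simp_all add: k_def)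
qed

text \<open>The function \<open>r w = w * stein_sol z w - indicator {..z} w\<close> is
  nondecreasing, so the remainder is bounded by \<open>(T - S) * (r T - r S)\<close>. Under an
  exchangeable pair the expectation of such a product can be rewritten with \<open>r\<close> at one
  end only, and no concentration inequality is required for the jump of the indicator.\<close>

lemma stein_sol_taylor:
  "\<bar>stein_sol z T - stein_sol z S - (T - S) * (T * stein_sol z T + indicator {..z} T - Phi z)\<bar>
    \<le> (T - S) * ((T * stein_sol z T - indicator {..z} T) - (S * stein_sol z S - indicator {..z} S))"
proof -
  consider "S < T" | "S = T" | "T < S" by linarith
  then show ?thesis
  proof cases
    case 1
    have "(T - S) * (S * stein_sol z S) \<le> (T - S) * (T * stein_sol z T)" using 1 w_stein_mono[of S T z] by (intro mult_left_mono) auto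
    moreover have "(T - S) * indicator {..z} T \<le> (T - S) * indicator {..z} S" using 1 by (intro mult_left_mono) (auto simp: indicator_def)
    ultimately show ?thesis using stein_sol_increment[OF 1, of z] by (simp add: ring_distribs, linarith?)
  next
    case 3
    have "(S - T) * (T * stein_sol z T) \<le> (S - T) * (S * stein_sol z S)" using 3 w_stein_mono[of T S z] by (intro mult_left_mono) auto
    moreover have "(S - T) * indicator {..z} S \<le> (S - T) * indicator {..z} T" using 3 by (intro mult_left_mono) (auto simp: indicator_def)
    ultimately show ?thesis using stein_sol_increment[OF 3, of z] by (simp add: ring_distribs)
  qed simp
qed

lemma stein_sol_measurable [measurable]: "stein_sol z \<in> borel_measurable borel"
proof -
  have "continuous_on UNIV mills_left" "continuous_on UNIV mills_right"
    using DERIV_mills_left DERIV_mills_right DERIV_isCont by (blast intro: continuous_at_imp_continuous_on)+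
  then have [measurable]: "mills_left \<in> borel_measurable borel" "mills_right \<in> borel_measurable borel"
    by (auto intro: borel_measurable_continuous_onI)
  show ?thesis unfolding stein_sol_def[abs_def] by measurable
qed

section \<open>Berry-Esseen bound by resampling\<close>

context iid_product
begin

lemma bm_pair_fst [intro]: "bm P f \<Longrightarrow> bm (P \<Otimes>\<^sub>M D) (\<lambda>x. f (fst x))"
  by (rule bm_compose[OF measurable_fst])

lemma bm_pair_snd [intro]: "bm D f \<Longrightarrow> bm (P \<Otimes>\<^sub>M D) (\<lambda>x. f (snd x))"
  by (rule bm_compose[OF measurable_snd])

lemma bm_pair_coord [intro]: "bm D f \<Longrightarrow> i \<in> I \<Longrightarrow> bm (P \<Otimes>\<^sub>M D) (\<lambda>x. f (fst x i))"
  using bm_pair_fst[OF bm_coord[of f i]] .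

lemma integrable_pair_snd:
  assumes "bm (P \<Otimes>\<^sub>M D) (\<lambda>(p,z). F p z)"
  shows "integrable P (\<lambda>p. \<integral>z. F p z \<partial>D)" "p \<in> space P \<Longrightarrow> integrable D (F p)"
proof -
  show "integrable P (\<lambda>p. \<integral>z. F p z \<partial>D)" by (rule P.bm_integrable[OF D.bm_integral_snd[OF assms]])
  assume "p \<in> space P"
  then have "(\<lambda>z. (p, z)) \<in> measurable D (P \<Otimes>\<^sub>M D)" by measurable
  from D.bm_integrable[OF bm_compose[OF this assms]] show "integrable D (F p)" by simp
qed

lemma bm_pair_upd2:
  assumes "bm (P \<Otimes>\<^sub>M D) (\<lambda>(p,z). F p z)" "i \<in> I"
  shows "bm (P \<Otimes>\<^sub>M D) (\<lambda>(p,z). F (p(i := z)) (p i))"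
proof -
  have "(\<lambda>x. ((fst x)(i := snd x), fst x i)) \<in> measurable (P \<Otimes>\<^sub>M D) (P \<Otimes>\<^sub>M D)"
    using upd_measurable[OF assms(2)] assms(2) by measurable
  from bm_compose[OF this assms(1)] show ?thesis by (simp add: case_prod_beta')
qed

lemma integral_antisym:
  assumes "bm (P \<Otimes>\<^sub>M D) (\<lambda>(p,z). F p z)" "i \<in> I"
    and "\<And>p z. F (p(i := z)) (p i) = - F p z"
  shows "(\<integral>p. (\<integral>z. F p z \<partial>D) \<partial>P) = 0"
  using exchange[OF assms(1,2)] assms(3) by simp

lemma integral_coord: "bm D f \<Longrightarrow> i \<in> I \<Longrightarrow> (\<integral>p. f (p i) \<partial>P) = (\<integral>z. f z \<partial>D)"
  using integral_avg[of "\<lambda>p. f (p i)" i] bm_coord[of f i] by (simp add: avg_def P.prob_space)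

lemma integral_coord_mult:
  assumes "bm D f" "bm P F" "i \<in> I"
  shows "(\<integral>p. f (p i) * F p \<partial>P) = (\<integral>z. f z * (\<integral>p. F (p(i := z)) \<partial>P) \<partial>D)"
  using integral_upd[OF bm_mult[OF bm_coord[OF assms(1,3)] assms(2)] assms(3)] by simp

lemma integral_coord_mult_inv:
  assumes "bm D f" "bm P F" "i \<in> I" "inv_at i F"
  shows "(\<integral>p. f (p i) * F p \<partial>P) = (\<integral>z. f z \<partial>D) * (\<integral>p. F p \<partial>P)"
  using integral_coord_mult[OF assms(1-3)] assms(4) by (simp add: inv_at_def)

text \<open>The product on the right expands into four terms. Swapping the coordinate with its fresh
  copy identifies them in pairs, and the pair in which \<open>xi\<close> and \<open>F\<close> see
  different copies vanishes since \<open>xi\<close> is centred.\<close>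

lemma coord_symmetrize:
  assumes xi: "bm D xi" "(\<integral>z. xi z \<partial>D) = 0" and F: "bm P F" and i: "i \<in> I"
  shows "(\<integral>p. xi (p i) * F p \<partial>P) = (\<integral>p. (\<integral>z. (xi (p i) - xi z) / 2 * (F p - F (p(i := z))) \<partial>D) \<partial>P)"
proof -
  have b1: "bm (P \<Otimes>\<^sub>M D) (\<lambda>(p,z). xi (p i) * F p)"
    using bm_pair_coord[OF xi(1) i] bm_pair_fst[OF F] by (auto simp: case_prod_beta')
  have b2: "bm (P \<Otimes>\<^sub>M D) (\<lambda>(p,z). xi z * F p)"
    using bm_pair_snd[OF xi(1)] bm_pair_fst[OF F] by (auto simp: case_prod_beta')
  note c1 = bm_pair_upd2[OF b1 i] and c2 = bm_pair_upd2[OF b2 i]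
  have I1: "(\<integral>p. (\<integral>z. xi (p i) * F p \<partial>D) \<partial>P) = (\<integral>p. xi (p i) * F p \<partial>P)" by (simp add: D.prob_space)
  have I2: "(\<integral>p. (\<integral>z. xi z * F p \<partial>D) \<partial>P) = 0" by (simp add: xi)
  note i1 = exchange[OF b1 i] and i2 = exchange[OF b2 i]
  note s = integrable_pair_snd[OF b1] integrable_pair_snd[OF b2] integrable_pair_snd[OF c1] integrable_pair_snd[OF c2]
  have "(\<integral>p. (\<integral>z. (xi (p i) - xi z) / 2 * (F p - F (p(i := z))) \<partial>D) \<partial>P)
     = (\<integral>p. ((\<integral>z. xi (p i) * F p \<partial>D) - (\<integral>z. xi z * F p \<partial>D) + (\<integral>z. xi ((p(i := z)) i) * F (p(i := z)) \<partial>D)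
           - (\<integral>z. xi (p i) * F (p(i := z)) \<partial>D)) / 2 \<partial>P)"
  proof (rule Bochner_Integration.integral_cong[OF refl])
    fix p assume p: "p \<in> space P"
    have "(\<integral>z. (xi (p i) - xi z) / 2 * (F p - F (p(i := z))) \<partial>D) =
      (\<integral>z. (xi (p i) * F p - xi z * F p + xi ((p(i := z)) i) * F (p(i := z)) - xi (p i) * F (p(i := z))) / 2 \<partial>D)"
      by (rule Bochner_Integration.integral_cong) (auto simp: field_simps)
    also have "\<dots> = ((\<integral>z. xi (p i) * F p \<partial>D) - (\<integral>z. xi z * F p \<partial>D) + (\<integral>z. xi ((p(i := z)) i) * F (p(i := z)) \<partial>D)
           - (\<integral>z. xi (p i) * F (p(i := z)) \<partial>D)) / 2"
      using s(2)[OF p] s(4)[OF p] s(6)[OF p] s(8)[OF p] by simp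
    finally show "(\<integral>z. (xi (p i) - xi z) / 2 * (F p - F (p(i := z))) \<partial>D) = \<dots>" .
  qed
  also have "\<dots> = ((\<integral>p. (\<integral>z. xi (p i) * F p \<partial>D) \<partial>P) - (\<integral>p. (\<integral>z. xi z * F p \<partial>D) \<partial>P)
      + (\<integral>p. (\<integral>z. xi ((p(i := z)) i) * F (p(i := z)) \<partial>D) \<partial>P) - (\<integral>p. (\<integral>z. xi (p i) * F (p(i := z)) \<partial>D) \<partial>P)) / 2"
    using s(1) s(3) s(5) s(7) by simp
  also have "\<dots> = (\<integral>p. xi (p i) * F p \<partial>P)" using i1 i2 I1 I2 by (simp add: D.prob_space xi)
  finally show ?thesis by simp
qed

text \<open>Changing coordinate \<open>j\<close> alters each summand \<open>i \<noteq> j\<close> by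
  a weighted mixed second difference, at most \<open>a * b\<close>. The summand \<open>j\<close>
  itself is only bounded by \<open>a^2\<close> before and after, which gives
  \<open>2 * a^2\<close>.\<close>

lemma osc_weighted_differences:
  fixes a b :: real
  assumes T: "bm P T" and H: "\<And>x y. x \<in> space D \<Longrightarrow> y \<in> space D \<Longrightarrow> \<bar>H x y\<bar> \<le> a"
    and bH: "\<And>i. i \<in> I \<Longrightarrow> bm (P \<Otimes>\<^sub>M D) (\<lambda>(p,z). H (p i) z)"
    and o: "osc I a T" "osc2 I b T" and ab: "0 \<le> a" "0 \<le> b"
  shows "osc I (2 * a\<^sup>2 + card I * (a * b)) (\<lambda>p. \<Sum>i\<in>I. \<integral>z. H (p i) z * (T p - T (p(i := z))) \<partial>D)"
  unfolding osc_def
proof safe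
  fix j p w assume j: "j \<in> I" and p: "p \<in> space P" and w: "w \<in> space D"
  let ?K = "\<lambda>i p. \<integral>z. H (p i) z * (T p - T (p(i := z))) \<partial>D"
  have int: "integrable D (\<lambda>z. H (p i) z * (T p - T (p(i := z))))" if "i \<in> I" "p \<in> space P" for i p
  proof -
    have "bm (P \<Otimes>\<^sub>M D) (\<lambda>(p,z). H (p i) z * (T p - T (p(i := z))))"
      using bH[OF that(1)] bm_upd[OF T that(1)] bm_pair_fst[OF T]
      unfolding case_prod_beta' by (intro bm_mult bm_diff)
    from integrable_pair_snd(2)[OF this that(2)] show ?thesis .
  qed
  have 1: "\<bar>?K i p - ?K i (p(j := w))\<bar> \<le> a * b" if i: "i \<in> I - {j}" for i
  proof -
    have ij: "i \<in> I" "i \<noteq> j" using i by auto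
    have "?K i p - ?K i (p(j := w)) = (\<integral>z. H (p i) z * (T p - T (p(i := z))) - H ((p(j := w)) i) z * (T (p(j := w)) - T (p(j := w, i := z))) \<partial>D)"
      by (rule Bochner_Integration.integral_diff[symmetric, OF int[OF ij(1) p] int[OF ij(1) upd_space[OF j w p]]])
    also have "\<dots> = (\<integral>z. H (p i) z * (T p - T (p(i := z)) - (T (p(j := w)) - T (p(j := w, i := z)))) \<partial>D)"
      using ij by (simp add: right_diff_distrib)
    also have "\<bar>\<dots>\<bar> \<le> a * b"
    proof (rule D.abs_integral_le_const)
      fix z assume z: "z \<in> space D"
      show "\<bar>H (p i) z * (T p - T (p(i := z)) - (T (p(j := w)) - T (p(j := w, i := z))))\<bar> \<le> a * b"
        unfolding abs_mult using H[of "p i" z] z p ij osc2D[OF o(2) ij(1) j ij(2) p z w] ab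
        by (intro mult_mono) auto
    qed (use ab in auto)
    finally show ?thesis .
  qed
  have K: "\<bar>?K j p\<bar> \<le> a * a" if "p \<in> space P" for p
  proof (rule D.abs_integral_le_const)
    fix z assume z: "z \<in> space D"
    show "\<bar>H (p j) z * (T p - T (p(j := z)))\<bar> \<le> a * a"
      unfolding abs_mult using H[of "p j" z] z that j oscD[OF o(1) j that z] ab by (intro mult_mono) auto
  qed (use ab in auto)
  have 2: "\<bar>?K j p - ?K j (p(j := w))\<bar> \<le> 2 * a\<^sup>2"
    using K[OF p] K[of "p(j := w)"] j p w by (simp add: power2_eq_square)
  have "(\<Sum>i\<in>I. ?K i p) - (\<Sum>i\<in>I. ?K i (p(j := w))) = (\<Sum>i\<in>I. ?K i p - ?K i (p(j := w)))"
    by (simp add: sum_subtractf)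
  also have "\<dots> = (?K j p - ?K j (p(j := w))) + (\<Sum>i\<in>I - {j}. ?K i p - ?K i (p(j := w)))"
    by (rule sum.remove[OF fin j])
  also have "\<bar>\<dots>\<bar> \<le> 2 * a\<^sup>2 + (\<Sum>i\<in>I - {j}. a * b)"
    by (rule order_trans[OF abs_triangle_ineq], rule add_mono[OF 2], rule order_trans[OF sum_abs], rule sum_mono, rule 1)
  also have "\<dots> \<le> 2 * a\<^sup>2 + card I * (a * b)"
  proof -
    have "(\<Sum>i\<in>I - {j}. a * b) \<le> (\<Sum>i\<in>I. a * b)" by (rule sum_mono2) (use fin ab in auto)
    then show ?thesis by simp
  qed
  finally show "\<bar>(\<Sum>i\<in>I. ?K i p) - (\<Sum>i\<in>I. ?K i (p(j := w)))\<bar> \<le> 2 * a\<^sup>2 + card I * (a * b)" .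
qed

lemma expectation_abs_deviation_le:
  fixes c :: real
  assumes f: "bm P f" and o: "osc I c f" and c: "0 \<le> c"
  shows "(\<integral>p. \<bar>f p - (\<integral>p. f p \<partial>P)\<bar> \<partial>P) \<le> sqrt (card I) * c"
proof -
  let ?m = "\<integral>p. f p \<partial>P"
  let ?g = "\<lambda>p. f p - ?m"
  have bg: "bm P ?g" using f by auto
  have og: "osc I c ?g" using o by (simp add: osc_def)
  have "(\<integral>p. ?g p \<partial>P) = 0" using P.bm_integrable[OF f] by (simp add: P.prob_space)
  then have v: "(\<integral>p. (?g p)\<^sup>2 \<partial>P) \<le> card I * c\<^sup>2"
    using bounded_differences_variance[OF fin subset_refl bg _ og] by simp
  have "(\<integral>p. \<bar>?g p\<bar> \<partial>P)\<^sup>2 \<le> (\<integral>p. (\<bar>?g p\<bar>)\<^sup>2 \<partial>P)"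
  proof -
    have "0 \<le> (\<integral>p. (\<bar>?g p\<bar> - (\<integral>p. \<bar>?g p\<bar> \<partial>P))\<^sup>2 \<partial>P)" by simp
    also have "\<dots> = (\<integral>p. (\<bar>?g p\<bar>)\<^sup>2 \<partial>P) - (\<integral>p. \<bar>?g p\<bar> \<partial>P)\<^sup>2"
      by (rule P.variance_eq) (use bg in \<open>auto intro!: P.bm_integrable\<close>)
    finally show ?thesis by simp
  qed
  with v have "(\<integral>p. \<bar>?g p\<bar> \<partial>P)\<^sup>2 \<le> card I * c\<^sup>2" by simp
  then have "(\<integral>p. \<bar>?g p\<bar> \<partial>P) \<le> sqrt (card I * c\<^sup>2)" by (rule real_le_rsqrt)
  then show ?thesis using c by (simp add: real_sqrt_mult)
qed

text \<open>Stein's method for the exchangeable pair \<open>T p\<close>,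
  \<open>T (p(i := z))\<close>, weighted by the differences of the projection \<open>xi\<close>. The
  constants reflect the bounds 2, 2 and 6 on \<open>f'\<close>, \<open>r\<close> and
  \<open>f\<close>; the last term is the part of \<open>T\<close> that \<open>xi\<close> does not
  see.\<close>

theorem berry_esseen:
  fixes a b :: real
  assumes T: "bm P T" and ET: "(\<integral>p. T p \<partial>P) = 0" and xi: "bm D xi"
    and proj: "\<And>i z. i \<in> I \<Longrightarrow> z \<in> space D \<Longrightarrow> (\<integral>p. T (p(i := z)) \<partial>P) = xi z"
    and o: "osc I a T" "osc2 I b T" and b0: "0 \<le> b" and I: "I \<noteq> {}"
  defines "n \<equiv> real (card I)"
  shows "\<bar>measure P {p \<in> space P. T p \<le> t} - Phi t\<bar> \<le>
     2 * \<bar>1 - n * (\<integral>z. (xi z)\<^sup>2 \<partial>D)\<bar> + 4 * (sqrt n * (2 * a\<^sup>2 + n * (a * b)))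
     + 6 * (\<integral>p. \<bar>T p - (\<Sum>i\<in>I. xi (p i))\<bar> \<partial>P)"
proof -
  have a0: "0 \<le> a" using osc_nonneg[OF o(1) I] .
  obtain i0 where i0: "i0 \<in> I" using I by auto
  have Exi: "(\<integral>z. xi z \<partial>D) = 0"
  proof -
    have "(\<integral>z. xi z \<partial>D) = (\<integral>z. (\<integral>p. T (p(i0 := z)) \<partial>P) \<partial>D)"
      using proj[OF i0] by (intro Bochner_Integration.integral_cong) auto
    then show ?thesis using integral_upd[OF T i0] ET by simp
  qed
  have xid: "\<bar>xi x - xi y\<bar> \<le> a" if "x \<in> space D" "y \<in> space D" for x y
  proof -
    have "xi x - xi y = (\<integral>p. T (p(i0 := x)) - T (p(i0 := y)) \<partial>P)"
      using proj[OF i0] that T i0 by (subst Bochner_Integration.integral_diff) (auto intro!: P.bm_integrable)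
    also have "\<bar>\<dots>\<bar> \<le> a"
    proof (rule P.abs_integral_le_const)
      fix p assume "p \<in> space P"
      then show "\<bar>T (p(i0 := x)) - T (p(i0 := y))\<bar> \<le> a"
        using oscD[OF o(1) i0, of "p(i0 := x)" y] that i0 by simp
    qed (rule a0)
    finally show ?thesis .
  qed
  define f where "f = stein_sol t"
  define k where "k w = w * f w" for w
  define r where "r w = k w - indicator {..t} w" for w
  define f' where "f' w = k w + indicator {..t} w - Phi t" for w
  have [measurable]: "f \<in> borel_measurable borel" by (simp add: f_def)
  have [measurable]: "T \<in> borel_measurable P" using T by (rule bm_measurable)
  have kb: "\<bar>k w\<bar> \<le> 1" for w by (simp add: k_def f_def w_stein_abs_le)
  have rb: "\<bar>r w\<bar> \<le> 2" for w using kb[of w] by (auto simp: r_def indicator_def abs_le_iff)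
  have f'b: "\<bar>f' w\<bar> \<le> 2" for w
  proof -
    have "0 \<le> (indicator {..t} w :: real)" "(indicator {..t} w :: real) \<le> 1" by (auto simp: indicator_def)
    then show ?thesis using kb[of w] Phi_bounds[of t] unfolding f'_def by linarith
  qed
  have bf: "bm P (\<lambda>p. f (T p))" by (rule bmI[where K=6]) (auto simp: f_def stein_sol_abs_le)
  have br: "bm P (\<lambda>p. r (T p))" by (rule bmI[where K=2]) (auto simp: r_def k_def rb[unfolded r_def k_def])
  have bf': "bm P (\<lambda>p. f' (T p))" by (rule bmI[where K=2]) (auto simp: f'_def k_def f'b[unfolded f'_def k_def])
  have bk: "bm P (\<lambda>p. k (T p))" by (rule bmI[where K=1]) (auto simp: k_def kb[unfolded k_def])
  define d where "d i p z = T p - T (p(i := z))" for i p z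
  \<comment> \<open>\<open>V1\<close> acts as the random variance in Stein's expansion and has mean
    \<open>n\<close> times the second moment of \<open>xi\<close>. \<open>V2\<close> carries
    absolute weights and bounds the remainder; antisymmetry makes its mean zero, so its small
    oscillation bounds its first absolute moment.\<close>
  define V1 where "V1 p = (\<Sum>i\<in>I. \<integral>z. (xi (p i) - xi z) / 2 * (T p - T (p(i := z))) \<partial>D)" for p
  define V2 where "V2 p = (\<Sum>i\<in>I. \<integral>z. \<bar>xi (p i) - xi z\<bar> * (T p - T (p(i := z))) \<partial>D)" for p
  have bh1: "bm (P \<Otimes>\<^sub>M D) (\<lambda>(p,z). (xi (p i) - xi z) / 2)" if "i \<in> I" for i
    using bm_pair_coord[OF xi that] bm_pair_snd[OF xi] by (auto simp: case_prod_beta')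
  have bh2: "bm (P \<Otimes>\<^sub>M D) (\<lambda>(p,z). \<bar>xi (p i) - xi z\<bar>)" if "i \<in> I" for i
    using bm_pair_coord[OF xi that] bm_pair_snd[OF xi] by (auto simp: case_prod_beta')
  have bd: "bm (P \<Otimes>\<^sub>M D) (\<lambda>(p,z). d i p z)" if "i \<in> I" for i
    using bm_upd[OF T that] bm_pair_fst[OF T] unfolding case_prod_beta' d_def by (intro bm_diff)
  have b1: "bm (P \<Otimes>\<^sub>M D) (\<lambda>(p,z). (xi (p i) - xi z) / 2 * (T p - T (p(i := z))))" if "i \<in> I" for i
    using bm_mult[OF bh1[OF that] bd[OF that]] by (simp add: case_prod_beta' d_def)
  have b2: "bm (P \<Otimes>\<^sub>M D) (\<lambda>(p,z). \<bar>xi (p i) - xi z\<bar> * (T p - T (p(i := z))))" if "i \<in> I" for i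
    using bm_mult[OF bh2[OF that] bd[OF that]] by (simp add: case_prod_beta' d_def)
  have bV1: "bm P V1" unfolding V1_def[abs_def] by (intro bm_sum D.bm_integral_snd b1)
  have bV2: "bm P V2" unfolding V2_def[abs_def] by (intro bm_sum D.bm_integral_snd b2)
  define c where "c = 2 * a\<^sup>2 + n * (a * b)"
  have c0: "0 \<le> c" using a0 b0 by (simp add: c_def n_def)
  have oV1: "osc I c V1" unfolding V1_def[abs_def] c_def n_def
  proof (rule osc_weighted_differences[OF T _ bh1 o a0 b0])
    show "\<bar>(xi x - xi y) / 2\<bar> \<le> a" if "x \<in> space D" "y \<in> space D" for x y unfolding abs_divide using xid[OF that] a0 by simp
  qed
  have oV2: "osc I c V2" unfolding V2_def[abs_def] c_def n_def
    by (rule osc_weighted_differences[OF T _ bh2 o a0 b0]) (use xid in auto)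
  have EV1: "(\<integral>p. V1 p \<partial>P) = n * (\<integral>z. (xi z)\<^sup>2 \<partial>D)"
  proof -
    have "(\<integral>p. V1 p \<partial>P) = (\<Sum>i\<in>I. \<integral>p. (\<integral>z. (xi (p i) - xi z) / 2 * (T p - T (p(i := z))) \<partial>D) \<partial>P)"
      unfolding V1_def by (rule Bochner_Integration.integral_sum) (rule integrable_pair_snd(1)[OF b1])
    also have "\<dots> = (\<Sum>i\<in>I. \<integral>p. xi (p i) * T p \<partial>P)"
      by (intro sum.cong refl coord_symmetrize[OF xi Exi T, symmetric])
    also have "\<dots> = (\<Sum>i\<in>I. \<integral>z. (xi z)\<^sup>2 \<partial>D)"
    proof (rule sum.cong[OF refl])
      fix i assume i: "i \<in> I"
      show "(\<integral>p. xi (p i) * T p \<partial>P) = (\<integral>z. (xi z)\<^sup>2 \<partial>D)"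
        unfolding integral_coord_mult[OF xi T i] using proj[OF i]
        by (intro Bochner_Integration.integral_cong) (auto simp: power2_eq_square)
    qed
    finally show ?thesis by (simp add: n_def)
  qed
  have EV2: "(\<integral>p. V2 p \<partial>P) = 0"
  proof -
    have "(\<integral>p. V2 p \<partial>P) = (\<Sum>i\<in>I. \<integral>p. (\<integral>z. \<bar>xi (p i) - xi z\<bar> * (T p - T (p(i := z))) \<partial>D) \<partial>P)"
      unfolding V2_def by (rule Bochner_Integration.integral_sum) (rule integrable_pair_snd(1)[OF b2])
    also have "\<dots> = (\<Sum>i\<in>I. 0)"
    proof (rule sum.cong[OF refl])
      fix i assume i: "i \<in> I"
      show "(\<integral>p. (\<integral>z. \<bar>xi (p i) - xi z\<bar> * (T p - T (p(i := z))) \<partial>D) \<partial>P) = 0"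
        by (rule integral_antisym[OF b2[OF i] i]) (simp add: abs_minus_commute algebra_simps)
    qed
    finally show ?thesis by simp
  qed
  have E1: "(\<integral>p. \<bar>1 - V1 p\<bar> \<partial>P) \<le> \<bar>1 - n * (\<integral>z. (xi z)\<^sup>2 \<partial>D)\<bar> + sqrt n * c"
  proof -
    have "(\<integral>p. \<bar>1 - V1 p\<bar> \<partial>P) \<le> (\<integral>p. \<bar>1 - n * (\<integral>z. (xi z)\<^sup>2 \<partial>D)\<bar> + \<bar>V1 p - n * (\<integral>z. (xi z)\<^sup>2 \<partial>D)\<bar> \<partial>P)"
      by (rule integral_mono) (use bV1 in \<open>auto intro!: P.bm_integrable\<close>)
    also have "\<dots> = \<bar>1 - n * (\<integral>z. (xi z)\<^sup>2 \<partial>D)\<bar> + (\<integral>p. \<bar>V1 p - n * (\<integral>z. (xi z)\<^sup>2 \<partial>D)\<bar> \<partial>P)"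
      by (subst Bochner_Integration.integral_add) (use bV1 in \<open>auto intro!: P.bm_integrable simp: P.prob_space\<close>)
    also have "(\<integral>p. \<bar>V1 p - n * (\<integral>z. (xi z)\<^sup>2 \<partial>D)\<bar> \<partial>P) \<le> sqrt n * c"
      using expectation_abs_deviation_le[OF bV1 oV1 c0] EV1 by (simp add: n_def)
    finally show ?thesis by simp
  qed
  have E2: "(\<integral>p. \<bar>V2 p\<bar> \<partial>P) \<le> sqrt n * c"
    using expectation_abs_deviation_le[OF bV2 oV2 c0] EV2 by (simp add: n_def)
  define R where "R p = T p - (\<Sum>i\<in>I. xi (p i))" for p
  have bR: "bm P R" unfolding R_def[abs_def] using T xi by (intro bm_diff bm_sum bm_coord)
  \<comment> \<open>Symmetrisation replaces \<open>f (T p)\<close> by its increment, and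
    \<open>stein_sol_taylor\<close> linearises this increment at \<open>T p\<close>.\<close>
  have Ti: "\<bar>(\<integral>p. xi (p i) * f (T p) \<partial>P) - (\<integral>p. (\<integral>z. (xi (p i) - xi z) / 2 * d i p z * f' (T p) \<partial>D) \<partial>P)\<bar>
     \<le> (\<integral>p. (\<integral>z. \<bar>xi (p i) - xi z\<bar> * d i p z * r (T p) \<partial>D) \<partial>P)" if i: "i \<in> I" for i
  proof -
    define e where "e p z = f (T p) - f (T (p(i := z))) - d i p z * f' (T p)" for p z
    have bp: "bm (P \<Otimes>\<^sub>M D) (\<lambda>(p,z). f (T p) - f (T (p(i := z))))"
      using bm_upd[OF bf i] bm_pair_fst[OF bf] unfolding case_prod_beta' by (intro bm_diff)
    have bfr: "bm (P \<Otimes>\<^sub>M D) (\<lambda>(p,z). f' (T p))" "bm (P \<Otimes>\<^sub>M D) (\<lambda>(p,z). r (T p))"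
      using bm_pair_fst[OF bf'] bm_pair_fst[OF br] by (auto simp: case_prod_beta')
    have bru: "bm (P \<Otimes>\<^sub>M D) (\<lambda>(p,z). r (T (p(i := z))))"
      using bm_upd[OF br i] by (simp add: case_prod_beta')
    have g1: "bm (P \<Otimes>\<^sub>M D) (\<lambda>(p,z). (xi (p i) - xi z) / 2 * (f (T p) - f (T (p(i := z)))))"
      using bm_mult[OF bh1[OF i] bp] by (simp add: case_prod_beta')
    have g2: "bm (P \<Otimes>\<^sub>M D) (\<lambda>(p,z). (xi (p i) - xi z) / 2 * d i p z * f' (T p))"
      using bm_mult[OF bm_mult[OF bh1[OF i] bd[OF i]] bfr(1)] by (simp add: case_prod_beta')
    have g3: "bm (P \<Otimes>\<^sub>M D) (\<lambda>(p,z). \<bar>xi (p i) - xi z\<bar> * d i p z * r (T p))"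
      using bm_mult[OF bm_mult[OF bh2[OF i] bd[OF i]] bfr(2)] by (simp add: case_prod_beta')
    have g4: "bm (P \<Otimes>\<^sub>M D) (\<lambda>(p,z). \<bar>xi (p i) - xi z\<bar> * d i p z * r (T (p(i := z))))"
      using bm_mult[OF bm_mult[OF bh2[OF i] bd[OF i]] bru] by (simp add: case_prod_beta')
    note s = integrable_pair_snd[OF g1] integrable_pair_snd[OF g2] integrable_pair_snd[OF g3] integrable_pair_snd[OF g4]
    have ptw: "\<bar>(xi (p i) - xi z) / 2 * (f (T p) - f (T (p(i := z)))) - (xi (p i) - xi z) / 2 * d i p z * f' (T p)\<bar>
      \<le> (\<bar>xi (p i) - xi z\<bar> * d i p z * r (T p) - \<bar>xi (p i) - xi z\<bar> * d i p z * r (T (p(i := z)))) / 2" for p z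
    proof -
      have "\<bar>e p z\<bar> \<le> d i p z * (r (T p) - r (T (p(i := z))))"
        using stein_sol_taylor[of t] by (simp add: e_def d_def f'_def r_def k_def f_def)
      then have A: "\<bar>xi (p i) - xi z\<bar> / 2 * \<bar>e p z\<bar> \<le> \<bar>xi (p i) - xi z\<bar> / 2 * (d i p z * (r (T p) - r (T (p(i := z)))))"
        by (intro mult_left_mono) auto
      have E: "(xi (p i) - xi z) / 2 * (f (T p) - f (T (p(i := z)))) - (xi (p i) - xi z) / 2 * d i p z * f' (T p) = (xi (p i) - xi z) / 2 * e p z"
        unfolding e_def by (simp only: right_diff_distrib mult.assoc)
      have S: "\<bar>xi (p i) - xi z\<bar> / 2 * (d i p z * (r (T p) - r (T (p(i := z))))) =
         (\<bar>xi (p i) - xi z\<bar> * d i p z * r (T p) - \<bar>xi (p i) - xi z\<bar> * d i p z * r (T (p(i := z)))) / 2"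
        by (simp add: right_diff_distrib mult.assoc)
      have "\<bar>(xi (p i) - xi z) / 2 * e p z\<bar> = \<bar>xi (p i) - xi z\<bar> / 2 * \<bar>e p z\<bar>" by (simp add: abs_mult)
      then show ?thesis unfolding E S[symmetric] using A by (rule ord_eq_le_trans)
    qed
    \<comment> \<open>Swapping the coordinate with its copy reverses the sign of \<open>d\<close>
      and moves \<open>r\<close> back to \<open>T p\<close>; hence both halves of the remainder
      bound contribute equally.\<close>
    have x4: "(\<integral>p. (\<integral>z. \<bar>xi (p i) - xi z\<bar> * d i p z * r (T (p(i := z))) \<partial>D) \<partial>P) = - (\<integral>p. (\<integral>z. \<bar>xi (p i) - xi z\<bar> * d i p z * r (T p) \<partial>D) \<partial>P)"
    proof -
      have "\<bar>xi ((p(i := z)) i) - xi (p i)\<bar> * d i (p(i := z)) (p i) * r (T (p(i := z, i := p i))) = - (\<bar>xi (p i) - xi z\<bar> * d i p z * r (T p))" for p z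
        by (simp add: d_def abs_minus_commute algebra_simps)
      then show ?thesis using exchange[OF g4 i] by simp
    qed
    have "(\<integral>p. xi (p i) * f (T p) \<partial>P) - (\<integral>p. (\<integral>z. (xi (p i) - xi z) / 2 * d i p z * f' (T p) \<partial>D) \<partial>P)
      = (\<integral>p. (\<integral>z. (xi (p i) - xi z) / 2 * (f (T p) - f (T (p(i := z)))) \<partial>D) - (\<integral>z. (xi (p i) - xi z) / 2 * d i p z * f' (T p) \<partial>D) \<partial>P)"
      unfolding coord_symmetrize[OF xi Exi bf i] by (rule Bochner_Integration.integral_diff[symmetric, OF s(1) s(3)])
    also have "\<dots> = (\<integral>p. (\<integral>z. (xi (p i) - xi z) / 2 * (f (T p) - f (T (p(i := z)))) - (xi (p i) - xi z) / 2 * d i p z * f' (T p) \<partial>D) \<partial>P)"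
      by (rule Bochner_Integration.integral_cong[OF refl]) (rule Bochner_Integration.integral_diff[symmetric, OF s(2) s(4)])
    finally have eq: "(\<integral>p. xi (p i) * f (T p) \<partial>P) - (\<integral>p. (\<integral>z. (xi (p i) - xi z) / 2 * d i p z * f' (T p) \<partial>D) \<partial>P) = (\<integral>p. (\<integral>z. (xi (p i) - xi z) / 2 * (f (T p) - f (T (p(i := z)))) - (xi (p i) - xi z) / 2 * d i p z * f' (T p) \<partial>D) \<partial>P)" .
    have "\<bar>(\<integral>p. (\<integral>z. (xi (p i) - xi z) / 2 * (f (T p) - f (T (p(i := z)))) - (xi (p i) - xi z) / 2 * d i p z * f' (T p) \<partial>D) \<partial>P)\<bar> \<le> (\<integral>p. ((\<integral>z. \<bar>xi (p i) - xi z\<bar> * d i p z * r (T p) \<partial>D) - (\<integral>z. \<bar>xi (p i) - xi z\<bar> * d i p z * r (T (p(i := z))) \<partial>D)) / 2 \<partial>P)"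
    proof (rule order_trans[OF integral_abs_bound integral_mono])
      have "bm (P \<Otimes>\<^sub>M D) (\<lambda>(p,z). (xi (p i) - xi z) / 2 * (f (T p) - f (T (p(i := z)))) - (xi (p i) - xi z) / 2 * d i p z * f' (T p))"
        using bm_diff[OF g1 g2] by (simp add: case_prod_beta')
      then show "integrable P (\<lambda>p. \<bar>\<integral>z. (xi (p i) - xi z) / 2 * (f (T p) - f (T (p(i := z)))) - (xi (p i) - xi z) / 2 * d i p z * f' (T p) \<partial>D\<bar>)"
        by (intro integrable_abs integrable_pair_snd(1))
      show "integrable P (\<lambda>p. ((\<integral>z. \<bar>xi (p i) - xi z\<bar> * d i p z * r (T p) \<partial>D) - (\<integral>z. \<bar>xi (p i) - xi z\<bar> * d i p z * r (T (p(i := z))) \<partial>D)) / 2)"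
        using s(5) s(7) by (intro integrable_divide Bochner_Integration.integrable_diff)
      fix p assume p: "p \<in> space P"
      have "\<bar>\<integral>z. (xi (p i) - xi z) / 2 * (f (T p) - f (T (p(i := z)))) - (xi (p i) - xi z) / 2 * d i p z * f' (T p) \<partial>D\<bar>
         \<le> (\<integral>z. (\<bar>xi (p i) - xi z\<bar> * d i p z * r (T p) - \<bar>xi (p i) - xi z\<bar> * d i p z * r (T (p(i := z)))) / 2 \<partial>D)"
        by (rule order_trans[OF integral_abs_bound integral_mono])
           (use s(2,4,6,8)[OF p] ptw in \<open>auto intro!: integrable_abs Bochner_Integration.integrable_diff integrable_divide\<close>)
      also have "\<dots> = ((\<integral>z. \<bar>xi (p i) - xi z\<bar> * d i p z * r (T p) \<partial>D) - (\<integral>z. \<bar>xi (p i) - xi z\<bar> * d i p z * r (T (p(i := z))) \<partial>D)) / 2"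
        using s(6,8)[OF p] by simp
      finally show "\<bar>\<integral>z. (xi (p i) - xi z) / 2 * (f (T p) - f (T (p(i := z)))) - (xi (p i) - xi z) / 2 * d i p z * f' (T p) \<partial>D\<bar> \<le> \<dots>" .
    qed
    also have "\<dots> = ((\<integral>p. (\<integral>z. \<bar>xi (p i) - xi z\<bar> * d i p z * r (T p) \<partial>D) \<partial>P)
        - (\<integral>p. (\<integral>z. \<bar>xi (p i) - xi z\<bar> * d i p z * r (T (p(i := z))) \<partial>D) \<partial>P)) / 2"
      by (simp only: integral_divide_zero Bochner_Integration.integral_diff[OF s(5) s(7)])
    also have "\<dots> = (\<integral>p. (\<integral>z. \<bar>xi (p i) - xi z\<bar> * d i p z * r (T p) \<partial>D) \<partial>P)"
      unfolding x4 by simp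
    finally show ?thesis unfolding eq .
  qed
  have S1: "(\<Sum>i\<in>I. \<integral>p. (\<integral>z. (xi (p i) - xi z) / 2 * d i p z * f' (T p) \<partial>D) \<partial>P) = (\<integral>p. V1 p * f' (T p) \<partial>P)"
  proof -
    have "(\<integral>p. V1 p * f' (T p) \<partial>P) = (\<integral>p. (\<Sum>i\<in>I. (\<integral>z. (xi (p i) - xi z) / 2 * d i p z \<partial>D) * f' (T p)) \<partial>P)"
      by (simp add: V1_def d_def sum_distrib_right)
    also have "\<dots> = (\<Sum>i\<in>I. \<integral>p. (\<integral>z. (xi (p i) - xi z) / 2 * d i p z \<partial>D) * f' (T p) \<partial>P)"
    proof (rule Bochner_Integration.integral_sum)
      fix i assume i: "i \<in> I"
      show "integrable P (\<lambda>p. (\<integral>z. (xi (p i) - xi z) / 2 * d i p z \<partial>D) * f' (T p))"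
        using D.bm_integral_snd[OF b1[OF i]] bf' unfolding d_def by (intro P.bm_integrable bm_mult)
    qed
    finally show ?thesis by simp
  qed
  have S2: "(\<Sum>i\<in>I. \<integral>p. (\<integral>z. \<bar>xi (p i) - xi z\<bar> * d i p z * r (T p) \<partial>D) \<partial>P) = (\<integral>p. V2 p * r (T p) \<partial>P)"
  proof -
    have "(\<integral>p. V2 p * r (T p) \<partial>P) = (\<integral>p. (\<Sum>i\<in>I. (\<integral>z. \<bar>xi (p i) - xi z\<bar> * d i p z \<partial>D) * r (T p)) \<partial>P)"
      by (simp add: V2_def d_def sum_distrib_right)
    also have "\<dots> = (\<Sum>i\<in>I. \<integral>p. (\<integral>z. \<bar>xi (p i) - xi z\<bar> * d i p z \<partial>D) * r (T p) \<partial>P)"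
    proof (rule Bochner_Integration.integral_sum)
      fix i assume i: "i \<in> I"
      show "integrable P (\<lambda>p. (\<integral>z. \<bar>xi (p i) - xi z\<bar> * d i p z \<partial>D) * r (T p))"
        using D.bm_integral_snd[OF b2[OF i]] br unfolding d_def by (intro P.bm_integrable bm_mult)
    qed
    finally show ?thesis by simp
  qed
  have Ek: "(\<integral>p. k (T p) \<partial>P) = (\<Sum>i\<in>I. \<integral>p. xi (p i) * f (T p) \<partial>P) + (\<integral>p. R p * f (T p) \<partial>P)"
  proof -
    have "(\<integral>p. k (T p) \<partial>P) = (\<integral>p. (\<Sum>i\<in>I. xi (p i) * f (T p)) + R p * f (T p) \<partial>P)"
      by (simp add: k_def R_def algebra_simps sum_distrib_left)
    also have "\<dots> = (\<integral>p. (\<Sum>i\<in>I. xi (p i) * f (T p)) \<partial>P) + (\<integral>p. R p * f (T p) \<partial>P)"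
      using bf bR xi by (intro Bochner_Integration.integral_add P.bm_integrable bm_sum bm_mult bm_coord)
    also have "(\<integral>p. (\<Sum>i\<in>I. xi (p i) * f (T p)) \<partial>P) = (\<Sum>i\<in>I. \<integral>p. xi (p i) * f (T p) \<partial>P)"
      using bf xi by (intro Bochner_Integration.integral_sum P.bm_integrable bm_mult bm_coord)
    finally show ?thesis .
  qed
  have main: "\<bar>(\<Sum>i\<in>I. \<integral>p. xi (p i) * f (T p) \<partial>P) - (\<integral>p. V1 p * f' (T p) \<partial>P)\<bar> \<le> (\<integral>p. V2 p * r (T p) \<partial>P)"
    unfolding S1[symmetric] S2[symmetric] sum_subtractf[symmetric]
    by (rule order_trans[OF sum_abs sum_mono]) (rule Ti)
  have V2r: "(\<integral>p. V2 p * r (T p) \<partial>P) \<le> 2 * (sqrt n * c)"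
  proof -
    have "(\<integral>p. V2 p * r (T p) \<partial>P) \<le> (\<integral>p. 2 * \<bar>V2 p\<bar> \<partial>P)"
    proof (rule integral_mono)
      fix p
      have "V2 p * r (T p) \<le> \<bar>V2 p\<bar> * \<bar>r (T p)\<bar>" by (metis abs_ge_self abs_mult)
      also have "\<dots> \<le> \<bar>V2 p\<bar> * 2" by (intro mult_left_mono rb) auto
      finally show "V2 p * r (T p) \<le> 2 * \<bar>V2 p\<bar>" by simp
    qed (use bV2 br in \<open>auto intro!: P.bm_integrable\<close>)
    also have "\<dots> = 2 * (\<integral>p. \<bar>V2 p\<bar> \<partial>P)" by simp
    finally show ?thesis using E2 by linarith
  qed
  have V1f: "\<bar>\<integral>p. (1 - V1 p) * f' (T p) \<partial>P\<bar> \<le> 2 * (\<bar>1 - n * (\<integral>z. (xi z)\<^sup>2 \<partial>D)\<bar> + sqrt n * c)"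
  proof -
    have "\<bar>\<integral>p. (1 - V1 p) * f' (T p) \<partial>P\<bar> \<le> (\<integral>p. 2 * \<bar>1 - V1 p\<bar> \<partial>P)"
    proof (rule order_trans[OF integral_abs_bound integral_mono])
      fix p
      have "\<bar>1 - V1 p\<bar> * \<bar>f' (T p)\<bar> \<le> \<bar>1 - V1 p\<bar> * 2" by (intro mult_left_mono f'b) auto
      then show "\<bar>(1 - V1 p) * f' (T p)\<bar> \<le> 2 * \<bar>1 - V1 p\<bar>" by (simp add: abs_mult)
    qed (use bV1 bf' in \<open>auto intro!: P.bm_integrable\<close>)
    also have "\<dots> = 2 * (\<integral>p. \<bar>1 - V1 p\<bar> \<partial>P)" by simp
    also have "\<dots> \<le> 2 * (\<bar>1 - n * (\<integral>z. (xi z)\<^sup>2 \<partial>D)\<bar> + sqrt n * c)" using E1 by (rule mult_left_mono) simp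
    finally show ?thesis .
  qed
  have Rf: "\<bar>\<integral>p. R p * f (T p) \<partial>P\<bar> \<le> 6 * (\<integral>p. \<bar>R p\<bar> \<partial>P)"
  proof -
    have "\<bar>\<integral>p. R p * f (T p) \<partial>P\<bar> \<le> (\<integral>p. 6 * \<bar>R p\<bar> \<partial>P)"
    proof (rule order_trans[OF integral_abs_bound integral_mono])
      fix p
      have "\<bar>R p\<bar> * \<bar>f (T p)\<bar> \<le> \<bar>R p\<bar> * 6" by (intro mult_left_mono) (auto simp: f_def stein_sol_abs_le)
      then show "\<bar>R p * f (T p)\<bar> \<le> 6 * \<bar>R p\<bar>" by (simp add: abs_mult)
    qed (use bR bf in \<open>auto intro!: P.bm_integrable\<close>)
    then show ?thesis by simp
  qed
  \<comment> \<open>Stein's equation integrated against the law of \<open>T\<close>: the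
    distribution function error appears as the mean of \<open>f' - k\<close>.\<close>
  have Ef': "(\<integral>p. f' (T p) \<partial>P) = (\<integral>p. k (T p) \<partial>P) + measure P {p \<in> space P. T p \<le> t} - Phi t"
  proof -
    have "(\<integral>p. f' (T p) \<partial>P) = (\<integral>p. k (T p) + indicator {p \<in> space P. T p \<le> t} p - Phi t \<partial>P)"
      by (rule Bochner_Integration.integral_cong) (auto simp: f'_def indicator_def)
    also have "\<dots> = (\<integral>p. k (T p) \<partial>P) + (\<integral>p. indicator {p \<in> space P. T p \<le> t} p \<partial>P) - Phi t"
    proof -
      have "integrable P (\<lambda>p. k (T p))" "integrable P (indicator {p \<in> space P. T p \<le> t} :: _ \<Rightarrow> real)"
        using bk by (auto intro!: P.bm_integrable bm_indicator)
      then show ?thesis by (simp add: P.prob_space)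
    qed
    also have "(\<integral>p. indicator {p \<in> space P. T p \<le> t} p \<partial>P) = measure P {p \<in> space P. T p \<le> t}"
      by simp
    finally show ?thesis .
  qed
  have "(\<integral>p. (1 - V1 p) * f' (T p) \<partial>P) = (\<integral>p. f' (T p) \<partial>P) - (\<integral>p. V1 p * f' (T p) \<partial>P)"
  proof -
    have "integrable P (\<lambda>p. f' (T p))" "integrable P (\<lambda>p. V1 p * f' (T p))" using bf' bV1 by (auto intro!: P.bm_integrable)
    then show ?thesis by (simp add: left_diff_distrib)
  qed
  with Ef' Ek have "measure P {p \<in> space P. T p \<le> t} - Phi t = (\<integral>p. (1 - V1 p) * f' (T p) \<partial>P)
     - ((\<Sum>i\<in>I. \<integral>p. xi (p i) * f (T p) \<partial>P) - (\<integral>p. V1 p * f' (T p) \<partial>P)) - (\<integral>p. R p * f (T p) \<partial>P)" by linarith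
  then have "\<bar>measure P {p \<in> space P. T p \<le> t} - Phi t\<bar> \<le> 2 * (\<bar>1 - n * (\<integral>z. (xi z)\<^sup>2 \<partial>D)\<bar> + sqrt n * c) + 2 * (sqrt n * c) + 6 * (\<integral>p. \<bar>R p\<bar> \<partial>P)"
    using main V2r V1f Rf by linarith
  then show ?thesis by (simp add: c_def R_def)
qed

end

section \<open>Laplace transforms on the positive half-line\<close>

text \<open>The integrand left by the tilt once \<open>W - x\<close> is inserted for
  \<open>t\<close>. The value 0 at \<open>t = 0\<close> matches the strict inequality in the event
  \<open>x < W\<close>.\<close>

definition lap :: "real \<Rightarrow> real \<Rightarrow> real" where
  "lap x t = (if 0 < t then exp (- x * t) else 0)"

lemma lap_bounds: "0 \<le> x \<Longrightarrow> 0 \<le> lap x t" "0 \<le> x \<Longrightarrow> lap x t \<le> 1"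
  by (auto simp: lap_def)

lemma lap_measurable [measurable]: "lap x \<in> borel_measurable borel"
  unfolding lap_def[abs_def] by measurable

lemma lap_eq_exponential:
  assumes x: "0 < x"
  shows "lap x t = (\<integral>r. indicator {r. 0 < t \<and> t \<le> r} r \<partial>density lborel (exponential_density x))"
proof (cases "0 < t")
  case True
  let ?E = "density lborel (exponential_density x)"
  interpret E: prob_space ?E by (rule prob_space_exponential_density[OF x])
  have ae: "AE r in ?E. r \<noteq> t"
    using AE_lborel_singleton[of t] by (subst AE_density) auto
  have "(\<integral>r. indicator {r. 0 < t \<and> t \<le> r} r \<partial>?E) = (\<integral>r. indicator {t<..} r \<partial>?E)"
    by (rule integral_cong_AE) (use ae True in \<open>auto simp: indicator_def elim!: eventually_mono\<close>)
  also have "\<dots> = measure ?E {t<..}" by simp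
  also have "\<dots> = 1 - measure ?E {..t}"
  proof -
    have "{t<..} = space ?E - {..t}" by auto
    then show ?thesis using E.prob_compl[of "{..t}"] by simp
  qed
  also have "measure ?E {..t} = 1 - exp (- x * t)"
    using emeasure_erlang_density[where l=x and a=t and k=0] x True by (simp add: measure_def erlang_CDF_0 mult.commute)
  finally show ?thesis using True by (simp add: lap_def)
qed (simp add: lap_def)

text \<open>The Laplace kernel is a mixture of indicators of half-open intervals.\<close>

lemma expectation_lap:
  assumes "prob_space M" and T: "T \<in> borel_measurable M" and x: "0 < x"
  shows "(\<integral>p. lap x (T p) \<partial>M) = (\<integral>r. measure M {p \<in> space M. 0 < T p \<and> T p \<le> r} \<partial>density lborel (exponential_density x))"
proof -
  interpret M: prob_space M by fact
  let ?E = "density lborel (exponential_density x)"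
  interpret E: prob_space ?E by (rule prob_space_exponential_density[OF x])
  interpret ME: pair_prob_space M ?E ..
  note T [measurable]
  have meas: "(\<lambda>(p, r). indicator {r. 0 < T p \<and> T p \<le> r} r :: real) \<in> borel_measurable (M \<Otimes>\<^sub>M ?E)"
  proof -
    have "(\<lambda>z. if 0 < T (fst z) \<and> T (fst z) \<le> snd z then 1 else 0 :: real) \<in> borel_measurable (M \<Otimes>\<^sub>M lborel)"
      by measurable
    then show ?thesis by (simp add: case_prod_beta' indicator_def measurable_cong_sets[OF sets_pair_measure_cong[OF refl sets_density] refl])
  qed
  have b: "bm (M \<Otimes>\<^sub>M ?E) (\<lambda>(p, r). indicator {r. 0 < T p \<and> T p \<le> r} r)"
    by (rule bmI[OF meas, where K=1]) (auto simp: indicator_def)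
  have "(\<integral>p. lap x (T p) \<partial>M) = (\<integral>p. (\<integral>r. indicator {r. 0 < T p \<and> T p \<le> r} r \<partial>?E) \<partial>M)"
    by (simp add: lap_eq_exponential[OF x])
  also have "\<dots> = (\<integral>r. (\<integral>p. indicator {r. 0 < T p \<and> T p \<le> r} r \<partial>M) \<partial>?E)"
    by (rule ME.Fubini_integral[OF ME.bm_integrable[OF b], symmetric])
  also have "\<dots> = (\<integral>r. measure M {p \<in> space M. 0 < T p \<and> T p \<le> r} \<partial>?E)"
  proof (rule Bochner_Integration.integral_cong[OF refl])
    fix r
    have "(\<integral>p. indicator {r. 0 < T p \<and> T p \<le> r} r \<partial>M) = (\<integral>p. indicator {p \<in> space M. 0 < T p \<and> T p \<le> r} p \<partial>M :: real)"
      by (rule Bochner_Integration.integral_cong) (auto simp: indicator_def)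
    then show "(\<integral>p. indicator {r. 0 < T p \<and> T p \<le> r} r \<partial>M) = measure M {p \<in> space M. 0 < T p \<and> T p \<le> r}"
      by simp
  qed
  finally show ?thesis .
qed

text \<open>The event \<open>0 < T \<le> r\<close> is a difference of two distribution function
  values, whence the factor 2. The mixing law has mass 1, so the bound does not deteriorate with
  \<open>x\<close>.\<close>

lemma lap_compare:
  assumes "prob_space M" "T \<in> borel_measurable M" "prob_space M'" "T' \<in> borel_measurable M'" and x: "0 < x"
    and le: "\<And>t. \<bar>measure M {p \<in> space M. T p \<le> t} - measure M' {p \<in> space M'. T' p \<le> t}\<bar> \<le> e"
  shows "\<bar>(\<integral>p. lap x (T p) \<partial>M) - (\<integral>p. lap x (T' p) \<partial>M')\<bar> \<le> 2 * e"
proof -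
  let ?E = "density lborel (exponential_density x)"
  interpret E: prob_space ?E by (rule prob_space_exponential_density[OF x])
  have e0: "0 \<le> e" using le[of 0] by linarith
  have F: "measure N {p \<in> space N. 0 < S p \<and> S p \<le> r} =
      (if 0 < r then measure N {p \<in> space N. S p \<le> r} - measure N {p \<in> space N. S p \<le> 0} else 0)"
    if "prob_space N" "S \<in> borel_measurable N" for N and S :: "'z \<Rightarrow> real" and r
  proof (cases "0 < r")
    case True
    interpret N: prob_space N by fact
    note that(2) [measurable]
    have eq: "{p \<in> space N. 0 < S p \<and> S p \<le> r} = {p \<in> space N. S p \<le> r} - {p \<in> space N. S p \<le> 0}"
      using True by auto
    have "measure N {p \<in> space N. 0 < S p \<and> S p \<le> r} = measure N {p \<in> space N. S p \<le> r} - measure N {p \<in> space N. S p \<le> 0}"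
      unfolding eq
    proof (rule N.finite_measure_Diff)
      show "{p \<in> space N. S p \<le> r} \<in> sets N" "{p \<in> space N. S p \<le> 0} \<in> sets N" by measurable
      show "{p \<in> space N. S p \<le> 0} \<subseteq> {p \<in> space N. S p \<le> r}" using True by auto
    qed
    then show ?thesis using True by simp
  next
    case False
    then have "{p \<in> space N. 0 < S p \<and> S p \<le> r} = {}" by auto
    then show ?thesis using False by (simp only:) simp
  qed
  define G where "G r = measure M {p \<in> space M. 0 < T p \<and> T p \<le> r}" for r
  define G' where "G' r = measure M' {p \<in> space M'. 0 < T' p \<and> T' p \<le> r}" for r
  have d: "\<bar>G r - G' r\<bar> \<le> 2 * e" for r
    using le[of r] le[of 0] e0 unfolding G_def G'_def F[OF assms(1,2)] F[OF assms(3,4)] by (auto simp: abs_le_iff)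
  have bG: "bm ?E G" if "prob_space N" "S \<in> borel_measurable N" "\<And>r. G r = measure N {p \<in> space N. 0 < S p \<and> S p \<le> r}"
    for N and S :: "'z \<Rightarrow> real" and G
  proof -
    interpret N: prob_space N by fact
    note that(2) [measurable]
    have "mono (\<lambda>r. measure N {p \<in> space N. 0 < S p \<and> S p \<le> r})"
      by (rule monoI) (auto intro!: N.finite_measure_mono)
    moreover have "G = (\<lambda>r. measure N {p \<in> space N. 0 < S p \<and> S p \<le> r})" using that(3) by (rule ext)
    ultimately have "G \<in> borel_measurable borel" by (simp only: borel_measurable_mono)
    then show ?thesis by (intro bmI[where K=1]) (auto simp: that(3) measurable_cong_sets[OF sets_density refl])
  qed
  have b: "bm ?E G" "bm ?E G'"
    using bG[OF assms(1,2), of G] bG[OF assms(3,4), of G'] by (auto simp: G_def G'_def)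
  have "(\<integral>p. lap x (T p) \<partial>M) - (\<integral>p. lap x (T' p) \<partial>M') = (\<integral>r. G r - G' r \<partial>?E)"
    unfolding expectation_lap[OF assms(1,2) x] expectation_lap[OF assms(3,4) x] G_def[symmetric] G'_def[symmetric]
    using b by (intro Bochner_Integration.integral_diff[symmetric] E.bm_integrable)
  moreover have "\<bar>\<dots>\<bar> \<le> 2 * e" by (rule E.abs_integral_le_const) (use d e0 in auto)
  ultimately show ?thesis by simp
qed

lemma integral_lap: "0 < x \<Longrightarrow> integrable lborel (lap x)" "0 < x \<Longrightarrow> (\<integral>t. lap x t \<partial>lborel) = 1 / x"
proof -
  assume x: "0 < x"
  interpret E: prob_space "density lborel (exponential_density x)" by (rule prob_space_exponential_density[OF x])
  have nn: "AE t in lborel. 0 \<le> exponential_density x t" by (simp add: exponential_density_nonneg x)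
  have "integrable (density lborel (exponential_density x)) (\<lambda>_. 1 :: real)" by simp
  then have i: "integrable lborel (exponential_density x)"
    using integrable_density[of "\<lambda>_. 1 :: real" lborel "exponential_density x"] nn by simp
  have one: "(\<integral>t. exponential_density x t \<partial>lborel) = 1"
    using integral_density[of "\<lambda>_. 1 :: real" lborel "exponential_density x"] nn E.prob_space by simp
  have ae: "AE t in lborel. lap x t = exponential_density x t / x"
    using AE_lborel_singleton[of "0::real"] by eventually_elim (use x in \<open>auto simp: lap_def exponential_density_def mult.commute\<close>)
  have "integrable lborel (\<lambda>t. exponential_density x t / x)" using i by simp
  then show "integrable lborel (lap x)"
    using integrable_cong_AE[OF _ _ ae] by simp
  have "(\<integral>t. lap x t \<partial>lborel) = (\<integral>t. exponential_density x t / x \<partial>lborel)"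
    by (rule integral_cong_AE) (use ae in auto)
  then show "(\<integral>t. lap x t \<partial>lborel) = 1 / x" using one by simp
qed

lemma phi_lipschitz: "\<bar>phi a - phi b\<bar> \<le> \<bar>a - b\<bar>"
proof -
  have d: "\<bar>- w * phi w\<bar> \<le> 1" for w
  proof -
    have "\<bar>w\<bar> \<le> exp (w\<^sup>2/2)"
    proof -
      have "\<bar>w\<bar> \<le> 1 + w\<^sup>2 / 2" using sum_squares_bound[of 1 "\<bar>w\<bar>"] by simp
      then show ?thesis using exp_ge_add_one_self[of "w\<^sup>2/2"] by linarith
    qed
    moreover have "1 \<le> sqrt (2 * pi)" using pi_gt3 by (intro real_le_rsqrt) auto
    ultimately have "\<bar>w\<bar> * 1 \<le> exp (w\<^sup>2/2) * sqrt (2*pi)" by (intro mult_mono) auto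
    then show ?thesis by (simp add: phi_eq abs_mult exp_minus field_simps)
  qed
  have "\<bar>phi b - phi a\<bar> \<le> \<bar>b - a\<bar>" if ab: "a < b" for a b
  proof -
    obtain z where z: "phi b - phi a = (b - a) * (- z * phi z)"
      using MVT2[OF ab, of phi "\<lambda>z. - z * phi z"] DERIV_phi by blast
    have "\<bar>b - a\<bar> * \<bar>- z * phi z\<bar> \<le> \<bar>b - a\<bar> * 1" by (intro mult_left_mono d) auto
    then show ?thesis unfolding z abs_mult by simp
  qed
  from this[of a b] this[of b a] show ?thesis by (cases a b rule: linorder_cases) auto
qed

text \<open>The Laplace transform at \<open>x\<close> of the normal density on the positive
  half-line, hence the Gaussian counterpart of the tilted tail integral. It is
  \<open>mills_right x / sqrt (2 * pi)\<close>.\<close>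

definition mills :: "real \<Rightarrow> real" where "mills x = exp (x\<^sup>2/2) * (1 - Phi x)"

text \<open>For \<open>x \<ge> 1\<close> the factor \<open>1 + x^2\<close> in
  \<open>mills_lower\<close> is at most \<open>2 * x^2\<close>, and
  \<open>sqrt (2 * pi) \<le> 3\<close>. The lemma converts absolute errors into relative
  ones.\<close>

lemma mills_ge:
  assumes "1 \<le> x" shows "1 / (6 * x) \<le> mills x"
proof -
  have s: "sqrt (2 * pi) \<le> 3" using pi_less_4 by (intro real_le_lsqrt) auto
  have e: "exp (x\<^sup>2/2) * phi x = 1 / sqrt (2*pi)" by (simp add: phi_eq exp_minus field_simps)
  have "x * x \<ge> 1" using assms mult_mono[of 1 x 1 x] by simp
  have "x / sqrt (2*pi) = exp (x\<^sup>2/2) * (x * phi x)" using e by (simp add: mult_ac)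
  also have "\<dots> \<le> exp (x\<^sup>2/2) * ((1 + x\<^sup>2) * (1 - Phi x))" by (intro mult_left_mono mills_lower) auto
  also have "\<dots> = (1 + x\<^sup>2) * mills x" by (simp add: mills_def)
  also have "\<dots> \<le> (2 * x\<^sup>2) * mills x"
    using \<open>x * x \<ge> 1\<close> by (intro mult_right_mono) (auto simp: mills_def power2_eq_square)
  finally have "x / sqrt (2*pi) \<le> 2 * x\<^sup>2 * mills x" .
  moreover have "x / 3 \<le> x / sqrt (2*pi)" using s assms by (intro divide_left_mono) auto
  ultimately have "x / 3 \<le> 2 * x\<^sup>2 * mills x" by linarith
  then have "x * 1 \<le> x * (6 * x * mills x)" by (simp add: power2_eq_square)
  then have "1 \<le> 6 * x * mills x" using assms by (subst (asm) mult_le_cancel_left_pos) auto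
  then show ?thesis using assms by (simp add: field_simps)
qed

lemma integral_lap_phi: "(\<integral>t. lap x t * phi t \<partial>lborel) = mills x"
proof -
  have e: "lap x t * phi t = exp (x\<^sup>2/2) * (indicator {x<..} (x + 1 * t) * phi (x + 1 * t))" for t
  proof -
    have "exp (- x * t) * phi t = exp (x\<^sup>2/2) * phi (x + t)"
      by (simp add: phi_eq exp_add[symmetric] field_simps power2_eq_square)
    then show ?thesis by (simp add: lap_def indicator_def)
  qed
  have "(\<integral>t. lap x t * phi t \<partial>lborel) = exp (x\<^sup>2/2) * (\<integral>t. indicator {x<..} (x + 1 * t) * phi (x + 1 * t) \<partial>lborel)"
    unfolding e by simp
  also have "(\<integral>t. indicator {x<..} (x + 1 * t) * phi (x + 1 * t) \<partial>lborel) = (\<integral>t. indicator {x<..} t * phi t \<partial>lborel)"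
    using lborel_integral_real_affine[of 1 "\<lambda>t. indicator {x<..} t * phi t" x] by simp
  also have "\<dots> = (\<integral>t. indicator {x<..} t \<partial>std_normal_distribution)"
    by (subst integral_density) (auto simp: mult.commute)
  also have "\<dots> = measure std_normal_distribution {x<..}" by simp
  also have "\<dots> = 1 - Phi x"
  proof -
    have "{x<..} = space std_normal_distribution - {..x}" by auto
    then show ?thesis using N.prob_compl[of "{..x}"] by (simp add: Phi_def cdf_def)
  qed
  finally show ?thesis by (simp add: mills_def)
qed

text \<open>The kernel \<open>lap x\<close> jumps at 0, so the shift is moved onto the Lipschitz
  density \<open>phi\<close>; the remaining kernel integrates to \<open>1 / x\<close>.\<close>

lemma integral_lap_shift:
  assumes x: "0 < x"
  shows "\<bar>(\<integral>t. lap x (t + \<delta>) \<partial>std_normal_distribution) - mills x\<bar> \<le> \<bar>\<delta>\<bar> / x"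
proof -
  have i: "integrable lborel (\<lambda>t. lap x t * phi (t - d))" for d
  proof (rule Bochner_Integration.integrable_bound[OF integral_lap(1)[OF x]])
    show "AE t in lborel. norm (lap x t * phi (t - d)) \<le> norm (lap x t)"
    proof (rule AE_I2)
      fix t
      have "phi (t - d) \<le> 1"
      proof -
        have "1 \<le> sqrt (2 * pi)" using pi_gt3 by (intro real_le_rsqrt) auto
        then have "exp (- (t - d)\<^sup>2 / 2) / sqrt (2 * pi) \<le> 1 / 1" by (intro frac_le) auto
        then show ?thesis by (simp add: phi_eq)
      qed
      then show "norm (lap x t * phi (t - d)) \<le> norm (lap x t)"
        by (simp add: abs_mult mult_left_le)
    qed
  qed auto
  have "(\<integral>t. lap x (t + \<delta>) \<partial>std_normal_distribution) = (\<integral>t. phi t * lap x (t + \<delta>) \<partial>lborel)"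
    by (subst integral_density) auto
  also have "\<dots> = (\<integral>t. lap x t * phi (t - \<delta>) \<partial>lborel)"
    using lborel_integral_real_affine[of 1 "\<lambda>t. lap x t * phi (t - \<delta>)" \<delta>] by (simp add: mult.commute add.commute)
  finally have "(\<integral>t. lap x (t + \<delta>) \<partial>std_normal_distribution) - mills x = (\<integral>t. lap x t * phi (t - \<delta>) - lap x t * phi t \<partial>lborel)"
    using i[of \<delta>] i[of 0] by (simp add: integral_lap_phi)
  also have "\<bar>\<dots>\<bar> \<le> (\<integral>t. lap x t * \<bar>\<delta>\<bar> \<partial>lborel)"
  proof (rule order_trans[OF integral_abs_bound integral_mono])
    show "integrable lborel (\<lambda>t. \<bar>lap x t * phi (t - \<delta>) - lap x t * phi t\<bar>)"
      using i[of \<delta>] i[of 0] by simp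
    show "integrable lborel (\<lambda>t. lap x t * \<bar>\<delta>\<bar>)" using integral_lap(1)[OF x] by simp
    fix t
    have "lap x t * \<bar>phi (t - \<delta>) - phi t\<bar> \<le> lap x t * \<bar>\<delta>\<bar>"
      using phi_lipschitz[of "t - \<delta>" t] lap_bounds(1)[of x t] x by (intro mult_left_mono) auto
    then show "\<bar>lap x t * phi (t - \<delta>) - lap x t * phi t\<bar> \<le> lap x t * \<bar>\<delta>\<bar>"
      using lap_bounds(1)[of x t] x by (simp add: abs_mult right_diff_distrib[symmetric])
  qed
  also have "\<dots> = \<bar>\<delta>\<bar> / x" using integral_lap(2)[OF x] by simp
  finally show ?thesis .
qed

lemma laplace_normal_approx:
  assumes M: "prob_space M" "T \<in> borel_measurable M" and x: "0 < x"
    and le: "\<And>t. \<bar>measure M {p \<in> space M. T p - \<delta> \<le> t} - Phi t\<bar> \<le> e"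
  shows "\<bar>(\<integral>p. lap x (T p) \<partial>M) - mills x\<bar> \<le> 2 * e + \<bar>\<delta>\<bar> / x"
proof -
  have "\<bar>(\<integral>p. lap x (T p) \<partial>M) - (\<integral>t. lap x (t + \<delta>) \<partial>std_normal_distribution)\<bar> \<le> 2 * e"
  proof (rule lap_compare[OF M _ _ x])
    show "prob_space std_normal_distribution" by (rule N.prob_space_axioms)
    fix t
    have "{p \<in> space std_normal_distribution. p + \<delta> \<le> t} = {..t - \<delta>}" by auto
    then show "\<bar>measure M {p \<in> space M. T p \<le> t} - measure std_normal_distribution {p \<in> space std_normal_distribution. p + \<delta> \<le> t}\<bar> \<le> e"
      using le[of "t - \<delta>"] by (simp add: Phi_def cdf_def)
  qed auto
  then show ?thesis using integral_lap_shift[OF x, of \<delta>] by linarith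
qed

section \<open>U-statistics and their linear part\<close>

declare One_nat_def [simp del]

lemma card_subsets_superset:
  assumes "finite X" "R \<subseteq> X" "card R \<le> s"
  shows "card {A. A \<subseteq> X \<and> card A = s \<and> R \<subseteq> A} = (card X - card R) choose (s - card R)"
proof -
  have fR: "finite R" using assms finite_subset by blast
  have "{A. A \<subseteq> X \<and> card A = s \<and> R \<subseteq> A} = (\<lambda>B. R \<union> B) ` {B. B \<subseteq> X - R \<and> card B = s - card R}"
  proof safe
    fix A assume A: "A \<subseteq> X" "s = card A" "R \<subseteq> A"
    then show "A \<in> (\<lambda>B. R \<union> B) ` {B. B \<subseteq> X - R \<and> card B = card A - card R}"
      using fR by (intro image_eqI[of _ _ "A - R"]) (auto simp: card_Diff_subset)
  next
    fix B assume B: "B \<subseteq> X - R" "card B = s - card R"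
    then have "finite B" using assms finite_subset by blast
    then show "card (R \<union> B) = s" using B assms(3) fR by (subst card_Un_disjoint) auto
  qed (use assms in auto)
  moreover have "inj_on (\<lambda>B. R \<union> B) {B. B \<subseteq> X - R \<and> card B = s - card R}"
    by (rule inj_onI) auto
  ultimately have "card {A. A \<subseteq> X \<and> card A = s \<and> R \<subseteq> A} = card {B. B \<subseteq> X - R \<and> card B = s - card R}"
    by (simp add: card_image)
  also have "\<dots> = card (X - R) choose (s - card R)" using assms by (intro n_subsets) auto
  finally show ?thesis using assms fR by (simp add: card_Diff_subset)
qed

lemma increasing_tuples_strict_mono:
  "i \<in> increasing_tuples s m \<Longrightarrow> strict_mono_on {1..s} i"
  "i \<in> increasing_tuples s m \<Longrightarrow> inj_on i {1..s}"
  "i \<in> increasing_tuples s m \<Longrightarrow> i \<in> {1..s} \<rightarrow>\<^sub>E {1..m}"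
  by (auto simp: increasing_tuples_def strict_mono_on_imp_inj_on)

text \<open>If \<open>f j\<close> exceeded \<open>g j\<close>, the value \<open>g j\<close> would be
  attained by \<open>f\<close> at an earlier index, where both functions already agree,
  contradicting injectivity of \<open>g\<close>.\<close>

lemma strict_mono_on_image_eq:
  fixes f g :: "nat \<Rightarrow> nat"
  assumes "strict_mono_on {1..s} f" "strict_mono_on {1..s} g" "f ` {1..s} = g ` {1..s}" "j \<in> {1..s}"
  shows "f j = g j"
  using assms(4)
proof (induction j rule: less_induct)
  case (less j)
  have le: "f' j \<le> g' j" if "strict_mono_on {1..s} f'" "strict_mono_on {1..s} g'" "f' ` {1..s} = g' ` {1..s}"
     "\<And>y. y < j \<Longrightarrow> y \<in> {1..s} \<Longrightarrow> f' y = g' y" for f' g' :: "nat \<Rightarrow> nat"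
  proof (rule ccontr)
    assume n: "\<not> f' j \<le> g' j"
    have "g' j \<in> f' ` {1..s}" using that(3) less.prems by simp
    then obtain y where y: "y \<in> {1..s}" "g' j = f' y" by auto
    with n have "f' y < f' j" by simp
    then have "y < j" using that(1) y(1) less.prems by (metis linorder_not_less nat_less_le order_less_le strict_mono_onD)
    then have "g' y = g' j" using that(4) y by simp
    then show False using \<open>y < j\<close> y(1) less.prems that(2) by (metis less_irrefl strict_mono_onD)
  qed
  show ?case using le[of f g] le[of g f] assms less.IH by (metis order_antisym)
qed

lemma bij_betw_increasing_tuples:
  "bij_betw (\<lambda>i. i ` {1..s}) (increasing_tuples s m) {A. A \<subseteq> {1..m} \<and> card A = s}"
  unfolding bij_betw_def
proof
  show "inj_on (\<lambda>i. i ` {1..s}) (increasing_tuples s m)"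
  proof (rule inj_onI)
    fix i i' assume a: "i \<in> increasing_tuples s m" "i' \<in> increasing_tuples s m" "i ` {1..s} = i' ` {1..s}"
    show "i = i'"
      by (rule PiE_ext[OF increasing_tuples_strict_mono(3)[OF a(1)] increasing_tuples_strict_mono(3)[OF a(2)]])
         (rule strict_mono_on_image_eq[OF increasing_tuples_strict_mono(1)[OF a(1)] increasing_tuples_strict_mono(1)[OF a(2)] a(3)])
  qed
  show "(\<lambda>i. i ` {1..s}) ` increasing_tuples s m = {A. A \<subseteq> {1..m} \<and> card A = s}"
  proof safe
    fix i x assume "i \<in> increasing_tuples s m" "x \<in> {1..s}"
    then show "i x \<in> {1..m}" using increasing_tuples_strict_mono(3)[of i s m] by (blast dest: PiE_mem)
  next
    fix i assume "i \<in> increasing_tuples s m"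
    then show "card (i ` {1..s}) = s" using increasing_tuples_strict_mono(2) by (simp add: card_image)
  next
    fix A assume A: "A \<subseteq> {1..m}" "s = card A"
    then have "finite A" using finite_subset by blast
    then obtain f where f: "bij_betw f {..<card A} A" "strict_mono_on {..<card A} f"
      by (rule ex_bij_betw_strict_mono_card)
    \<comment> \<open>The enumeration \<open>f\<close> starts at 0 while tuples are indexed from
      1.\<close>
    define i where "i = (\<lambda>j\<in>{1..s}. f (j - 1))"
    have im: "i ` {1..s} = A"
    proof -
      have "i ` {1..s} = f ` ((\<lambda>j. j - 1) ` {1..s})" by (auto simp: i_def image_image)
      also have "(\<lambda>j. j - 1) ` {1..s} = {..<s}"
      proof safe
        fix x assume "x < s" then show "x \<in> (\<lambda>j. j - 1) ` {1..s}" by (intro image_eqI[of _ _ "Suc x"]) auto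
      qed auto
      finally show ?thesis using f(1) A(2) by (simp add: bij_betw_def)
    qed
    have "strict_mono_on {1..s} i"
    proof (rule strict_mono_onI)
      fix x y assume "x \<in> {1..s}" "y \<in> {1..s}" "x < y"
      then show "i x < i y" using strict_mono_onD[OF f(2), of "x - 1" "y - 1"] A(2) by (auto simp: i_def)
    qed
    then have "i \<in> increasing_tuples s m"
      using im A by (auto simp: increasing_tuples_def i_def)
    then show "A \<in> (\<lambda>i. i ` {1..card A}) ` increasing_tuples (card A) m" using im A by auto
  qed
qed

lemma finite_increasing_tuples [simp]: "finite (increasing_tuples s m)"
proof -
  have "finite {A. A \<subseteq> {1..m} \<and> card A = s}" by (rule finite_subset[of _ "Pow {1..m}"]) auto
  then show ?thesis using bij_betw_finite[OF bij_betw_increasing_tuples] by blast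
qed

lemma card_increasing_tuples_containing:
  assumes "R \<subseteq> {1..m}" "card R \<le> s"
  shows "card {i \<in> increasing_tuples s m. R \<subseteq> i ` {1..s}} = (m - card R) choose (s - card R)"
proof -
  have b: "inj_on (\<lambda>i. i ` {1..s}) (increasing_tuples s m)"
    "(\<lambda>i. i ` {1..s}) ` increasing_tuples s m = {A. A \<subseteq> {1..m} \<and> card A = s}"
    using bij_betw_increasing_tuples[of s m] by (simp_all only: bij_betw_def)
  have "(\<lambda>i. i ` {1..s}) ` {i \<in> increasing_tuples s m. R \<subseteq> i ` {1..s}}
      = {A \<in> (\<lambda>i. i ` {1..s}) ` increasing_tuples s m. R \<subseteq> A}" by blast
  also have "\<dots> = {A. A \<subseteq> {1..m} \<and> card A = s \<and> R \<subseteq> A}" unfolding b(2) by blast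
  finally have "bij_betw (\<lambda>i. i ` {1..s}) {i \<in> increasing_tuples s m. R \<subseteq> i ` {1..s}} {A. A \<subseteq> {1..m} \<and> card A = s \<and> R \<subseteq> A}"
    using inj_on_subset[OF b(1)] by (intro bij_betw_imageI) auto
  then have "card {i \<in> increasing_tuples s m. R \<subseteq> i ` {1..s}} = card {A. A \<subseteq> {1..m} \<and> card A = s \<and> R \<subseteq> A}"
    by (rule bij_betw_same_card)
  then show ?thesis using card_subsets_superset[of "{1..m}" R s] assms by simp
qed

text \<open>The bound on \<open>h\<close> is required at every point, not almost surely, so that it
  survives any change of the law \<open>D\<close>; an almost surely bounded kernel is clipped before
  it enters here.\<close>

locale ustat_kernel = D: prob_space D for D :: "real measure" +
  fixes s :: nat and h :: "(nat \<Rightarrow> real) \<Rightarrow> real" and B :: real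
  assumes setsD: "sets D = sets borel" and s2: "2 \<le> s"
    and h_meas: "h \<in> borel_measurable (PiM {1..s} (\<lambda>_. borel))"
    and sym: "symmetric_kernel s h" and h_bound: "\<And>y. \<bar>h y\<bar> \<le> B" and B_pos: "0 < B"
begin

lemma spaceD [simp]: "space D = UNIV" using sets_eq_imp_space_eq[OF setsD] by simp

lemma prob_UNIV [simp]: "D.prob UNIV = 1" using D.prob_space by simp

sublocale K: iid_product D "{1..s}" by unfold_locales simp

lemma sets_PiM_D: "sets (PiM J (\<lambda>_. D)) = sets (PiM J (\<lambda>_. borel))"
  by (rule sets_PiM_cong) (auto simp: setsD)

lemma bm_h: "bm K.P h"
  by (rule bmI[OF _ h_bound]) (use h_meas in \<open>simp add: measurable_cong_sets[OF sets_PiM_D refl]\<close>)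

definition theta :: real where "theta = (\<integral>y. h y \<partial>K.P)"

text \<open>A version of the conditional expectation of \<open>h\<close> given the first coordinate,
  defined at every \<open>z\<close>: coordinate 1 is overwritten, so integrating over all
  \<open>s\<close> coordinates averages only the others.\<close>

definition h1 :: "real \<Rightarrow> real" where "h1 z = (\<integral>y. h (y(1 := z)) \<partial>K.P)"

lemma one_s: "1 \<in> {1..s}" "2 \<in> {1..s}" "{1..s} \<noteq> {}" using s2 by auto

lemma h1_bound: "\<bar>h1 z\<bar> \<le> B"
  unfolding h1_def by (rule K.P.abs_integral_le_const) (use h_bound B_pos in auto)

lemma bm_h1: "bm D h1"
proof -
  have "bm (D \<Otimes>\<^sub>M K.P) (\<lambda>(z,y). h (y(1 := z)))"
  proof -
    have "(\<lambda>x. (snd x)(1 := fst x)) \<in> measurable (D \<Otimes>\<^sub>M K.P) K.P"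
      using one_s by (intro measurable_fun_upd[where J="{1..s}"]) auto
    from bm_compose[OF this bm_h] show ?thesis by (simp add: case_prod_beta')
  qed
  from K.P.bm_integral_snd[OF this] show ?thesis by (simp add: h1_def[abs_def])
qed

lemma integral_h1: "(\<integral>z. h1 z \<partial>D) = theta"
  unfolding h1_def theta_def by (rule K.integral_upd[OF bm_h one_s(1)])

lemma distr_reindex:
  assumes "inj_on i {1..s}" "i \<in> {1..s} \<rightarrow> J"
  shows "distr (PiM J (\<lambda>_. D)) K.P (\<lambda>p. \<lambda>j\<in>{1..s}. p (i j)) = K.P"
  using distr_PiM_reindex[of J "\<lambda>_. D" i "{1..s}"] assms D.prob_space_axioms by simp

lemma measurable_reindex:
  assumes "i \<in> {1..s} \<rightarrow> J"
  shows "(\<lambda>p. \<lambda>j\<in>{1..s}. p (i j)) \<in> measurable (PiM J (\<lambda>_. D)) K.P"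
  using assms by (intro measurable_restrict measurable_component_singleton) auto

lemma integral_reindex:
  assumes "inj_on i {1..s}" "i \<in> {1..s} \<rightarrow> J" and F: "F \<in> borel_measurable K.P"
  shows "(\<integral>p. F (\<lambda>j\<in>{1..s}. p (i j)) \<partial>PiM J (\<lambda>_. D)) = (\<integral>y. F y \<partial>K.P :: real)"
  using integral_distr[OF measurable_reindex[OF assms(2)] F] distr_reindex[OF assms(1,2)] by simp

lemma h_permute:
  assumes "\<pi> permutes {1..s}" "y \<in> space K.P"
  shows "h (\<lambda>j\<in>{1..s}. y (\<pi> j)) = h y"
proof -
  have y: "y \<in> {1..s} \<rightarrow>\<^sub>E UNIV" using assms(2) by (auto simp: space_PiM)
  have "(\<lambda>j\<in>{1..s}. y (\<pi> j)) = y \<circ> \<pi>"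
    using y permutes_not_in[OF assms(1)] by (auto simp: fun_eq_iff PiE_def extensional_def)
  then show ?thesis using sym y assms(1) by (auto simp: symmetric_kernel_def)
qed

lemma integral_permute:
  assumes "\<pi> permutes {1..s}" and F: "F \<in> borel_measurable K.P"
  shows "(\<integral>y. F (\<lambda>j\<in>{1..s}. y (\<pi> j)) \<partial>K.P) = (\<integral>y. F y \<partial>K.P :: real)"
proof (rule integral_reindex[OF permutes_inj_on[OF assms(1)] _ F])
  show "\<pi> \<in> {1..s} \<rightarrow> {1..s}" by (rule Pi_I) (simp only: permutes_in_image[OF assms(1)])
qed

lemma integral_h_upd:
  assumes q: "q \<in> {1..s}"
  shows "(\<integral>y. h (y(q := z)) \<partial>K.P) = h1 z"
proof -
  let ?\<pi> = "Transposition.transpose 1 q"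
  have p: "?\<pi> permutes {1..s}" using permutes_swap_id[of 1 "{1..s}" q] one_s q by auto
  have "h1 z = (\<integral>y. h ((\<lambda>j\<in>{1..s}. y (?\<pi> j))(1 := z)) \<partial>K.P)"
    unfolding h1_def by (rule integral_permute[OF p, symmetric]) (rule bm_measurable[OF K.bm_upd1[OF bm_h one_s(1)]], simp)
  also have "\<dots> = (\<integral>y. h (y(q := z)) \<partial>K.P)"
  proof (rule Bochner_Integration.integral_cong[OF refl])
    fix y assume y: "y \<in> space K.P"
    have "(\<lambda>j\<in>{1..s}. y (?\<pi> j))(1 := z) = (\<lambda>j\<in>{1..s}. (y(q := z)) (?\<pi> j))"
      using one_s q by (auto simp: fun_eq_iff Transposition.transpose_def)
    moreover have "h \<dots> = h (y(q := z))" by (rule h_permute[OF p K.upd_space[OF q _ y]]) simp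
    ultimately show "h ((\<lambda>j\<in>{1..s}. y (?\<pi> j))(1 := z)) = h (y(q := z))" by simp
  qed
  finally show ?thesis ..
qed

lemma integral_h_pair:
  assumes "bm D f" "bm D g" and q: "q \<in> {1..s}" "r \<in> {1..s}" "q \<noteq> r"
  shows "(\<integral>y. h y * (f (y q) * g (y r)) \<partial>K.P) = (\<integral>y. h y * (f (y 1) * g (y 2)) \<partial>K.P)"
proof -
  \<comment> \<open>The permutation must send 1 to \<open>q\<close> and 2 to \<open>r\<close>.
    Taking \<open>r'\<close> as the preimage of \<open>r\<close> under the first transposition makes
    the composition do both.\<close>
  define r' where "r' = Transposition.transpose 1 q r"
  define \<pi> where "\<pi> = Transposition.transpose 1 q \<circ> Transposition.transpose 2 r'"
  have r': "r' \<in> {1..s}" "r' \<noteq> 1" using one_s q by (auto simp: r'_def Transposition.transpose_def)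
  have p: "\<pi> permutes {1..s}" unfolding \<pi>_def using one_s q r'
    by (intro permutes_compose permutes_swap_id) auto
  have p1: "\<pi> 1 = q" using r' by (simp add: \<pi>_def Transposition.transpose_def)
  have p2: "\<pi> 2 = r" by (simp add: \<pi>_def r'_def)
  have bmF: "bm K.P (\<lambda>y. h y * (f (y 1) * g (y 2)))"
    using bm_h K.bm_coord[OF assms(1) one_s(1)] K.bm_coord[OF assms(2) one_s(2)] by auto
  have "(\<integral>y. h y * (f (y 1) * g (y 2)) \<partial>K.P) = (\<integral>y. h (\<lambda>j\<in>{1..s}. y (\<pi> j)) * (f ((\<lambda>j\<in>{1..s}. y (\<pi> j)) 1) * g ((\<lambda>j\<in>{1..s}. y (\<pi> j)) 2)) \<partial>K.P)"
    by (rule integral_permute[OF p bm_measurable[OF bmF], symmetric])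
  also have "\<dots> = (\<integral>y. h y * (f (y q) * g (y r)) \<partial>K.P)"
  proof (rule Bochner_Integration.integral_cong[OF refl])
    fix y assume y: "y \<in> space K.P"
    show "h (\<lambda>j\<in>{1..s}. y (\<pi> j)) * (f ((\<lambda>j\<in>{1..s}. y (\<pi> j)) 1) * g ((\<lambda>j\<in>{1..s}. y (\<pi> j)) 2)) = h y * (f (y q) * g (y r))"
      unfolding h_permute[OF p y] restrict_apply' [OF one_s(1)] restrict_apply'[OF one_s(2)] p1 p2 ..
  qed
  finally show ?thesis by simp
qed

lemma integral_h_coord:
  assumes "bm D f" "q \<in> {1..s}"
  shows "(\<integral>y. h y * f (y q) \<partial>K.P) = (\<integral>z. f z * h1 z \<partial>D)"
  using K.integral_coord_mult[OF assms(1) bm_h assms(2)] integral_h_upd[OF assms(2)] by (simp add: mult.commute)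

end

text \<open>\<open>\<sigma>\<close> is any positive scale, not necessarily the standard deviation
  under \<open>D\<close>; the last assumption only fixes its order. Thus the tilted law may be used
  with the scale computed under the original law.\<close>

locale ustat = ustat_kernel +
  fixes m :: nat and \<sigma> \<kappa> :: real
  assumes sm: "s \<le> m" and sigma_pos: "0 < \<sigma>" and kappa_pos: "0 < \<kappa>"
    and sigma_ge: "real ((m - 1) choose (s - 1)) / \<sigma> \<le> \<kappa> / sqrt (real m)"
begin

sublocale M: iid_product D "{1..m}" by unfold_locales simp

abbreviation "P \<equiv> M.P"

definition W :: "(nat \<Rightarrow> real) \<Rightarrow> real" where "W p = U_sum s h (\<lambda>i p. p i) m p / \<sigma>"

text \<open>\<open>c0\<close>, \<open>c1\<close>, \<open>c2\<close> count the tuples, those through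
  one given index and those through two given indices, all divided by \<open>\<sigma>\<close>. By
  \<open>sigma_ge\<close> their orders are at most \<open>sqrt m\<close>,
  \<open>m powr (-1/2)\<close> and \<open>m powr (-3/2)\<close>.\<close>

definition c0 :: real where "c0 = real (m choose s) / \<sigma>"
definition c1 :: real where "c1 = real ((m - 1) choose (s - 1)) / \<sigma>"
definition c2 :: real where "c2 = real ((m - 2) choose (s - 2)) / \<sigma>"

definition mu :: real where "mu = c0 * theta"
definition xi :: "real \<Rightarrow> real" where "xi z = c1 * (h1 z - theta)"
definition R :: "(nat \<Rightarrow> real) \<Rightarrow> real" where "R p = W p - mu - (\<Sum>i\<in>{1..m}. xi (p i))"

lemma m_pos: "0 < m" "1 < m" "0 < real m" using sm s2 by auto

lemma c1_pos: "0 < c1" using sm s2 sigma_pos by (simp add: c1_def)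
lemma c2_nonneg: "0 \<le> c2" using sigma_pos by (simp add: c2_def)
lemma c1_le: "c1 \<le> \<kappa> / sqrt m" using sigma_ge by (simp add: c1_def)

lemma c0_eq: "c0 * s = m * c1"
proof -
  have "(m choose s) * s = m * ((m - 1) choose (s - 1))"
    using binomial_absorption[of "s - 1" "m"] times_binomial_minus1_eq[of s m] s2 by (simp add: mult.commute)
  then have "real (m choose s) * real s = real m * real ((m - 1) choose (s - 1))" by (metis of_nat_mult)
  then show ?thesis by (simp add: c0_def c1_def)
qed

lemma c2_eq: "c2 * (real m - 1) = c1 * (real s - 1)"
proof -
  have "(s - 1) * ((m - 1) choose (s - 1)) = (m - 1) * ((m - 2) choose (s - 2))"
    using times_binomial_minus1_eq[of "s - 1" "m - 1"] s2 by (simp add: numeral_2_eq_2)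
  then have "real (s - 1) * real ((m - 1) choose (s - 1)) = real (m - 1) * real ((m - 2) choose (s - 2))"
    by (metis of_nat_mult)
  then show ?thesis using s2 m_pos by (simp add: c1_def c2_def of_nat_diff mult_ac)
qed

lemma c2_le: "c2 \<le> 2 * \<kappa> * s / (m * sqrt m)"
proof -
  have "c2 * (m / 2) \<le> c2 * (real m - 1)" using m_pos c2_nonneg by (intro mult_left_mono) auto
  also have "\<dots> \<le> c1 * s" unfolding c2_eq using c1_pos by (intro mult_left_mono) auto
  also have "\<dots> \<le> \<kappa> / sqrt m * s" by (intro mult_right_mono c1_le) auto
  finally show ?thesis using m_pos by (simp add: field_simps)
qed

definition tup :: "(nat \<Rightarrow> nat) \<Rightarrow> (nat \<Rightarrow> real) \<Rightarrow> real" where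
  "tup i p = h (\<lambda>j\<in>{1..s}. p (i j))"

lemma W_eq: "W p = (\<Sum>i\<in>increasing_tuples s m. tup i p) / \<sigma>"
  by (simp add: W_def U_sum_def tup_def)

lemma bm_tup [intro]: "i \<in> increasing_tuples s m \<Longrightarrow> bm P (tup i)"
  unfolding tup_def[abs_def]
  by (rule bm_compose[OF measurable_reindex bm_h]) (use increasing_tuples_strict_mono(3) in auto)

lemma bm_W [intro]: "bm P W"
  unfolding W_eq[abs_def] by (intro bm_divide bm_sum bm_tup)

lemma tup_integral:
  "i \<in> increasing_tuples s m \<Longrightarrow> F \<in> borel_measurable K.P \<Longrightarrow>
    (\<integral>p. F (\<lambda>j\<in>{1..s}. p (i j)) \<partial>P) = (\<integral>y. F y \<partial>K.P :: real)"
  using increasing_tuples_strict_mono[of i s m] by (intro integral_reindex) auto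

lemma tup_inv: "k \<notin> i ` {1..s} \<Longrightarrow> tup i (p(k := z)) = tup i p"
  unfolding tup_def by (rule arg_cong[where f=h]) (auto simp: fun_eq_iff)

lemma tup_upd_integral:
  assumes i: "i \<in> increasing_tuples s m"
  shows "(\<integral>p. tup i (p(k := z)) \<partial>P) = (if k \<in> i ` {1..s} then h1 z else theta)"
proof (cases "k \<in> i ` {1..s}")
  case True
  then obtain q where q: "q \<in> {1..s}" "k = i q" by auto
  have "(\<lambda>j\<in>{1..s}. (p(k := z)) (i j)) = (\<lambda>j\<in>{1..s}. p (i j))(q := z)" for p
  proof
    fix j
    have "i j = i q \<longleftrightarrow> j = q" if "j \<in> {1..s}"
      using inj_onD[OF increasing_tuples_strict_mono(2)[OF i] _ that q(1)] by auto
    then show "(\<lambda>j\<in>{1..s}. (p(k := z)) (i j)) j = ((\<lambda>j\<in>{1..s}. p (i j))(q := z)) j"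
      using q by (cases "j \<in> {1..s}") auto
  qed
  then have "(\<integral>p. tup i (p(k := z)) \<partial>P) = (\<integral>p. h ((\<lambda>j\<in>{1..s}. p (i j))(q := z)) \<partial>P)" by (simp add: tup_def)
  also have "\<dots> = (\<integral>y. h (y(q := z)) \<partial>K.P)"
    using bm_h q by (intro tup_integral[OF i]) (auto intro!: bm_measurable)
  finally show ?thesis using True integral_h_upd[OF q(1)] by simp
next
  case False
  then show ?thesis using tup_integral[OF i bm_measurable[OF bm_h]] tup_inv[OF False]
    by (simp add: tup_def theta_def)
qed

lemma card_tuples: "card (increasing_tuples s m) = m choose s"
  using card_increasing_tuples_containing[of "{}" m s] by simp

lemma card_tuples1: "k \<in> {1..m} \<Longrightarrow> card {i \<in> increasing_tuples s m. k \<in> i ` {1..s}} = (m - 1) choose (s - 1)"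
  using card_increasing_tuples_containing[of "{k}" m s] s2 by (simp add: One_nat_def)

lemma card_tuples2: "k \<in> {1..m} \<Longrightarrow> l \<in> {1..m} \<Longrightarrow> k \<noteq> l \<Longrightarrow>
    card {i \<in> increasing_tuples s m. k \<in> i ` {1..s} \<and> l \<in> i ` {1..s}} = (m - 2) choose (s - 2)"
  using card_increasing_tuples_containing[of "{k,l}" m s] s2 by (simp add: numeral_2_eq_2)

lemma integrable_upd: "bm P f \<Longrightarrow> k \<in> {1..m} \<Longrightarrow> integrable P (\<lambda>p. f (p(k := z)))"
  by (rule M.P.bm_integrable[OF M.bm_upd1]) auto

lemma W_upd_integral:
  assumes k: "k \<in> {1..m}"
  shows "(\<integral>p. W (p(k := z)) \<partial>P) = mu + xi z"
proof -
  let ?T = "increasing_tuples s m" let ?C = "{i \<in> ?T. k \<in> i ` {1..s}}"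
  have "(\<integral>p. W (p(k := z)) \<partial>P) = (\<Sum>i\<in>?T. \<integral>p. tup i (p(k := z)) \<partial>P) / \<sigma>"
    unfolding W_eq using k using Bochner_Integration.integral_sum[of "increasing_tuples s m" P "\<lambda>i p. tup i (p(k := z))", OF integrable_upd[OF bm_tup k]] by simp
  also have "(\<Sum>i\<in>?T. \<integral>p. tup i (p(k := z)) \<partial>P) = (\<Sum>i\<in>?T. theta + (if k \<in> i ` {1..s} then h1 z - theta else 0))"
    by (rule sum.cong[OF refl]) (auto simp: tup_upd_integral)
  also have "\<dots> = real (m choose s) * theta + real ((m-1) choose (s-1)) * (h1 z - theta)"
    by (simp add: sum.distrib card_tuples sum.If_cases card_tuples1[OF k, symmetric] Int_def)
  also have "(real (m choose s) * theta + real ((m-1) choose (s-1)) * (h1 z - theta)) / \<sigma> = mu + xi z"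
    by (simp add: mu_def c0_def c1_def xi_def add_divide_distrib)
  finally show ?thesis .
qed

lemma bm_xi [intro]: "bm D xi"
  unfolding xi_def[abs_def] using bm_h1 by (intro bm_mult bm_diff bm_const)

lemma integral_xi: "(\<integral>z. xi z \<partial>D) = 0"
  unfolding xi_def using D.bm_integrable[OF bm_h1] by (simp add: integral_h1 D.prob_space)

lemma integral_W: "(\<integral>p. W p \<partial>P) = mu"
proof -
  have one: "1 \<in> {1..m}" using m_pos by auto
  have "(\<integral>p. W p \<partial>P) = (\<integral>z. mu + xi z \<partial>D)"
    using M.integral_upd[OF bm_W one] W_upd_integral[OF one] by simp
  then show ?thesis using D.bm_integrable[OF bm_xi] by (simp add: integral_xi D.prob_space)
qed

lemma W_diff:
  "W p - W (p(k := z)) = (\<Sum>i\<in>{i \<in> increasing_tuples s m. k \<in> i ` {1..s}}. tup i p - tup i (p(k := z))) / \<sigma>"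
proof -
  have "(\<Sum>i\<in>increasing_tuples s m. tup i p - tup i (p(k := z)))
     = (\<Sum>i\<in>{i \<in> increasing_tuples s m. k \<in> i ` {1..s}}. tup i p - tup i (p(k := z)))"
    by (rule sum.mono_neutral_right) (auto simp: tup_inv)
  then show ?thesis unfolding W_eq diff_divide_distrib[symmetric] sum_subtractf[symmetric] by simp
qed

lemma tup_bound: "\<bar>tup i p\<bar> \<le> B" by (simp add: tup_def h_bound)

lemma osc_W: "M.osc {1..m} (2 * B * c1) W"
  unfolding M.osc_def
proof safe
  fix k p z assume k: "k \<in> {1..m}"
  have "\<bar>\<Sum>i\<in>{i \<in> increasing_tuples s m. k \<in> i ` {1..s}}. tup i p - tup i (p(k := z))\<bar> \<le> (\<Sum>i\<in>{i \<in> increasing_tuples s m. k \<in> i ` {1..s}}. 2 * B)"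
  proof (rule order_trans[OF sum_abs sum_mono])
    fix i show "\<bar>tup i p - tup i (p(k := z))\<bar> \<le> 2 * B" using tup_bound[of i p] tup_bound[of i "p(k:=z)"] by linarith
  qed
  also have "\<dots> = real ((m-1) choose (s-1)) * (2 * B)" by (simp only: sum_constant card_tuples1[OF k])
  finally show "\<bar>W p - W (p(k := z))\<bar> \<le> 2 * B * c1"
    using sigma_pos by (simp add: W_diff c1_def divide_right_mono mult_ac)
qed

text \<open>A tuple that misses one of the two indices has vanishing mixed difference; only the
  tuples through both survive, and each contributes at most \<open>4 * B\<close>.\<close>

lemma osc2_W: "M.osc2 {1..m} (4 * B * c2) W"
  unfolding M.osc2_def
proof (intro ballI impI)
  fix k l p z w assume k: "k \<in> {1..m}" "l \<in> {1..m}" "k \<noteq> l"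
  let ?g = "\<lambda>i. tup i p - tup i (p(k := z)) - (tup i (p(l := w)) - tup i (p(l := w, k := z)))"
  let ?A = "{i \<in> increasing_tuples s m. k \<in> i ` {1..s}}"
  let ?B = "{i \<in> increasing_tuples s m. k \<in> i ` {1..s} \<and> l \<in> i ` {1..s}}"
  have "W p - W (p(k := z)) - (W (p(l := w)) - W (p(l := w, k := z))) = (\<Sum>i\<in>?A. ?g i) / \<sigma>"
    by (simp add: W_diff sum_subtractf diff_divide_distrib)
  moreover have "(\<Sum>i\<in>?A. ?g i) = (\<Sum>i\<in>?B. ?g i)"
  proof (rule sum.mono_neutral_right)
    show "\<forall>i\<in>?A - ?B. ?g i = 0"
    proof
      fix i assume "i \<in> ?A - ?B"
      then have l: "l \<notin> i ` {1..s}" by auto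
      have "tup i (p(l := w, k := z)) = tup i (p(k := z))"
        using tup_inv[OF l, of "p(k := z)" w] k(3) by (simp add: fun_upd_twist)
      then show "?g i = 0" using tup_inv[OF l] by simp
    qed
  qed auto
  ultimately have eq: "W p - W (p(k := z)) - (W (p(l := w)) - W (p(l := w, k := z))) = (\<Sum>i\<in>?B. ?g i) / \<sigma>" by (simp only:)
  have "\<bar>(\<Sum>i\<in>?B. ?g i) / \<sigma>\<bar> \<le> real ((m - 2) choose (s - 2)) * (4 * B) / \<sigma>"
  proof -
    have "\<bar>\<Sum>i\<in>?B. ?g i\<bar> \<le> (\<Sum>i\<in>?B. 4 * B)"
    proof (rule order_trans[OF sum_abs sum_mono])
      fix i show "\<bar>?g i\<bar> \<le> 4 * B"
        using tup_bound[of i p] tup_bound[of i "p(k:=z)"] tup_bound[of i "p(l:=w)"] tup_bound[of i "p(l:=w,k:=z)"] by linarith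
    qed
    also have "\<dots> = real ((m - 2) choose (s - 2)) * (4 * B)" by (simp only: sum_constant card_tuples2[OF k])
    finally show ?thesis using sigma_pos by (simp add: divide_right_mono)
  qed
  also have "\<dots> = 4 * B * c2" by (simp add: c2_def)
  finally show "\<bar>W p - W (p(k := z)) - (W (p(l := w)) - W (p(l := w, k := z)))\<bar> \<le> 4 * B * c2"
    unfolding eq .
qed

lemma bm_R [intro]: "bm P R"
  unfolding R_def[abs_def] by (intro bm_diff bm_sum bm_W bm_const M.bm_coord bm_xi)

text \<open>Degeneracy in Hoeffding's sense: subtracting the projections removes every
  one-coordinate conditional mean. This is the hypothesis that \<open>second_order_mgf\<close> asks
  for.\<close>

lemma R_upd_integral:
  assumes k: "k \<in> {1..m}" shows "(\<integral>p. R (p(k := z)) \<partial>P) = 0"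
proof -
  have "(\<integral>p. R (p(k := z)) \<partial>P) = (\<integral>p. W (p(k := z)) - mu - (\<Sum>i\<in>{1..m}. xi ((p(k := z)) i)) \<partial>P)"
    by (simp add: R_def)
  also have "\<dots> = (\<integral>p. W (p(k := z)) \<partial>P) - mu - (\<Sum>i\<in>{1..m}. \<integral>p. xi ((p(k := z)) i) \<partial>P)"
  proof -
    have "integrable P (\<lambda>p. W (p(k := z)))" using k by (intro integrable_upd bm_W)
    moreover have i: "integrable P (\<lambda>p. xi ((p(k := z)) i))" if "i \<in> {1..m}" for i
    proof -
      show ?thesis by (rule integrable_upd[OF M.bm_coord[OF bm_xi that] k])
    qed
    moreover note Bochner_Integration.integral_sum[of "{1..m}" P "\<lambda>i p. xi ((p(k := z)) i)", OF i]
    ultimately show ?thesis using i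
      by (simp only: Bochner_Integration.integral_diff Bochner_Integration.integrable_diff Bochner_Integration.integrable_sum
        M.P.integrable_const M.P.prob_space lebesgue_integral_const scaleR_one real_scaleR_def mult_1)
  qed
  also have "(\<Sum>i\<in>{1..m}. \<integral>p. xi ((p(k := z)) i) \<partial>P) = (\<Sum>i\<in>{1..m}. if i = k then xi z else 0)"
  proof (rule sum.cong[OF refl])
    fix i assume "i \<in> {1..m}"
    then show "(\<integral>p. xi ((p(k := z)) i) \<partial>P) = (if i = k then xi z else 0)"
      using M.integral_coord[OF bm_xi] integral_xi by (auto simp: M.P.prob_space)
  qed
  also have "\<dots> = xi z" using k by simp
  finally have "(\<integral>p. R (p(k := z)) \<partial>P) = (\<integral>p. W (p(k := z)) \<partial>P) - mu - xi z" .
  then show ?thesis unfolding W_upd_integral[OF k] by simp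
qed

lemma xi_diff_bound: "\<bar>xi z - xi w\<bar> \<le> 2 * B * c1"
proof -
  have "\<bar>h1 z - h1 w\<bar> \<le> 2 * B" using h1_bound[of z] h1_bound[of w] by linarith
  then have "c1 * \<bar>h1 z - h1 w\<bar> \<le> c1 * (2 * B)" using c1_pos by (intro mult_left_mono) auto
  moreover have "xi z - xi w = c1 * (h1 z - h1 w)" by (simp add: xi_def algebra_simps)
  ultimately show ?thesis using c1_pos by (simp add: abs_mult mult_ac)
qed

lemma sum_xi_upd:
  assumes "k \<in> {1..m}"
  shows "(\<Sum>i\<in>{1..m}. xi ((p(k := z)) i)) = (\<Sum>i\<in>{1..m}. xi (p i)) - xi (p k) + xi z"
proof -
  have "(\<Sum>i\<in>{1..m} - {k}. xi ((p(k := z)) i)) = (\<Sum>i\<in>{1..m} - {k}. xi (p i))" by (rule sum.cong) auto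
  then show ?thesis using sum.remove[OF _ assms, of "\<lambda>i. xi ((p(k := z)) i)"] sum.remove[OF _ assms, of "\<lambda>i. xi (p i)"] by simp
qed

lemma R_diff:
  assumes "k \<in> {1..m}"
  shows "R p - R (p(k := z)) = W p - W (p(k := z)) - (xi (p k) - xi z)"
  using sum_xi_upd[OF assms, of p z] by (simp add: R_def)

lemma osc_R: "M.osc {1..m} (4 * B * c1) R"
  unfolding M.osc_def
proof (intro ballI)
  fix k p z assume k: "k \<in> {1..m}" "p \<in> space P" "z \<in> space D"
  show "\<bar>R p - R (p(k := z))\<bar> \<le> 4 * B * c1"
    using R_diff[OF k(1), of p z] M.oscD[OF osc_W k] xi_diff_bound[of "p k" z] by linarith
qed

lemma osc2_R: "M.osc2 {1..m} (4 * B * c2) R"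
  unfolding M.osc2_def
proof (intro ballI impI)
  fix k l p z w assume k: "k \<in> {1..m}" "l \<in> {1..m}" "k \<noteq> l" "p \<in> space P" "z \<in> space D" "w \<in> space D"
  show "\<bar>R p - R (p(k := z)) - (R (p(l := w)) - R (p(l := w, k := z)))\<bar> \<le> 4 * B * c2"
    using R_diff[OF k(1), of p z] R_diff[OF k(1), of "p(l := w)" z] M.osc2D[OF osc2_W k(1-3) k(4,5,6)] k(3) by simp
qed

text \<open>The range of exponents for which \<open>R\<close> satisfies both smallness conditions of
  \<open>second_order_mgf\<close>. The factor 64 makes \<open>L0 * m * 4 * B * c2\<close> at most
  \<open>1/8\<close>, and \<open>32 / 8^2 \<le> 1\<close>.\<close>

definition L0 :: real where "L0 = sqrt m / (64 * B * \<kappa> * s)"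

lemma L0_pos: "0 < L0" using m_pos B_pos kappa_pos s2 by (simp add: L0_def)

lemma R_mgf:
  assumes "\<bar>l\<bar> \<le> L0"
  shows "(\<integral>p. exp (l * R p) \<partial>P) \<le> 2"
proof (rule M.second_order_mgf[OF bm_R osc_R osc2_R])
  show "0 \<le> 4 * B * c2" using B_pos c2_nonneg by simp
  show "{1..m} \<noteq> {}" using m_pos by auto
  have sp: "1 \<le> real s" using s2 by simp
  have "2 * \<bar>l\<bar> * (4 * B * c1) \<le> 2 * L0 * (4 * B * (\<kappa> / sqrt m))"
    using assms c1_le c1_pos B_pos L0_pos by (intro mult_mono) auto
  also have "\<dots> = 8 / (64 * s)" using B_pos kappa_pos m_pos s2 by (simp add: L0_def field_simps)
  also have "\<dots> \<le> 1" using sp by (simp add: field_simps)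
  finally show "2 * \<bar>l\<bar> * (4 * B * c1) \<le> 1" .
  have "\<bar>l\<bar> * m * (4 * B * c2) \<le> L0 * m * (4 * B * (2 * \<kappa> * s / (m * sqrt m)))"
    using assms c2_le c2_nonneg B_pos L0_pos by (intro mult_mono) auto
  also have "\<dots> = 1 / 8" using B_pos kappa_pos m_pos s2 by (simp add: L0_def field_simps)
  finally have "(\<bar>l\<bar> * m * (4 * B * c2))\<^sup>2 \<le> (1/8)\<^sup>2"
    using B_pos c2_nonneg by (intro power_mono) auto
  then show "32 * l\<^sup>2 * (card {1..m})\<^sup>2 * (4 * B * c2)\<^sup>2 \<le> 1"
    by (simp add: power_mult_distrib power2_eq_square mult_ac)
qed (rule R_upd_integral)

text \<open>All terms of the series of \<open>cosh\<close> are nonnegative, so it dominates its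
  truncation at degree 4. Second and fourth moments can then be read off the exponential moments at
  \<open>l\<close> and \<open>- l\<close>.\<close>

lemma cosh_lower: "l\<^sup>2 * r\<^sup>2 \<le> exp (l * r) + exp (- l * r)" "l^4 * r^4 / 12 \<le> exp (l * r) + exp (- l * r)" for l r :: real
proof -
  have *: "1 + x\<^sup>2/2 + x^4/24 \<le> (exp x + exp (-x)) / 2" for x :: real
  proof -
    have "(\<Sum>n<5. if even n then x^n / fact n else 0) \<le> cosh x"
    proof -
      have "(\<lambda>n. if even n then x^n /\<^sub>R fact n else 0) sums cosh x" by (rule cosh_converges)
      then have s: "(\<lambda>n. if even n then x^n / fact n else 0) sums cosh x" by (simp add: divide_inverse mult.commute cong: if_cong)
      have "(\<Sum>n<5. if even n then x^n / fact n else 0) \<le> (\<Sum>n. if even n then x^n / fact n else 0)"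
        by (rule sum_le_suminf[OF sums_summable[OF s]]) (auto simp: zero_le_even_power)
      then show ?thesis using sums_unique[OF s] by simp
    qed
    moreover have "(\<Sum>n<5. if even n then x^n / fact n else 0) = 1 + x\<^sup>2/2 + x^4/24"
    proof -
      have "{..<5::nat} = {0,1,2,3,4}" by auto
      then show ?thesis by (simp add: fact_numeral)
    qed
    ultimately show ?thesis by (simp add: cosh_def)
  qed
  from *[of "l * r"] have a: "2 + (l*r)\<^sup>2 + (l*r)^4/12 \<le> exp (l * r) + exp (- l * r)" by simp
  have "0 \<le> (l*r)\<^sup>2" "0 \<le> (l*r)^4" by auto
  with a show "l\<^sup>2 * r\<^sup>2 \<le> exp (l * r) + exp (- l * r)" "l^4 * r^4 / 12 \<le> exp (l * r) + exp (- l * r)"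
    unfolding power_mult_distrib[symmetric] by linarith+
qed

lemma R_moments: "(\<integral>p. (R p)\<^sup>2 \<partial>P) \<le> 4 / L0\<^sup>2" "(\<integral>p. (R p)^4 \<partial>P) \<le> 48 / L0^4"
proof -
  have i: "integrable P (\<lambda>p. exp (L0 * R p))" "integrable P (\<lambda>p. exp (- L0 * R p))" 
    by (intro M.P.bm_integrable bm_exp bm_mult bm_R bm_const)+
  have e: "(\<integral>p. exp (L0 * R p) + exp (- L0 * R p) \<partial>P) \<le> 4"
    using R_mgf[of L0] R_mgf[of "- L0"] L0_pos i by simp
  have i2: "integrable P (\<lambda>p. (R p)\<^sup>2)" "integrable P (\<lambda>p. (R p)^4)" by (intro M.P.bm_integrable bm_power bm_R)+
  have "(\<integral>p. L0\<^sup>2 * (R p)\<^sup>2 \<partial>P) \<le> (\<integral>p. exp (L0 * R p) + exp (- L0 * R p) \<partial>P)"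
    by (rule integral_mono) (use i i2 cosh_lower in auto)
  with e have "L0\<^sup>2 * (\<integral>p. (R p)\<^sup>2 \<partial>P) \<le> 4" by simp
  then show "(\<integral>p. (R p)\<^sup>2 \<partial>P) \<le> 4 / L0\<^sup>2" using L0_pos by (simp add: field_simps)
  have "(\<integral>p. L0^4 * (R p)^4 / 12 \<partial>P) \<le> (\<integral>p. exp (L0 * R p) + exp (- L0 * R p) \<partial>P)"
    by (rule integral_mono) (use i i2 cosh_lower in auto)
  with e have "L0^4 * (\<integral>p. (R p)^4 \<partial>P) \<le> 48" by simp
  then show "(\<integral>p. (R p)^4 \<partial>P) \<le> 48 / L0^4" using L0_pos by (simp add: field_simps)
qed

lemma R_abs_moment: "(\<integral>p. \<bar>R p\<bar> \<partial>P) \<le> 2 / L0"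
proof -
  have "(\<integral>p. \<bar>R p\<bar> \<partial>P)\<^sup>2 \<le> (\<integral>p. (\<bar>R p\<bar>)\<^sup>2 \<partial>P)"
  proof -
    have "0 \<le> (\<integral>p. (\<bar>R p\<bar> - (\<integral>p. \<bar>R p\<bar> \<partial>P))\<^sup>2 \<partial>P)" by simp
    also have "\<dots> = (\<integral>p. (\<bar>R p\<bar>)\<^sup>2 \<partial>P) - (\<integral>p. \<bar>R p\<bar> \<partial>P)\<^sup>2"
      by (rule M.P.variance_eq) (auto intro!: M.P.bm_integrable)
    finally show ?thesis by simp
  qed
  also have "\<dots> \<le> (2 / L0)\<^sup>2" using R_moments(1) by (simp add: power_divide)
  finally show ?thesis by (rule power2_le_imp_le) (use L0_pos in simp)
qed

text \<open>With oscillations of orders \<open>m powr (-1/2)\<close> and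
  \<open>m powr (-3/2)\<close> the middle term of \<open>berry_esseen\<close> is
  \<open>O(1 / sqrt m)\<close>. The variance defect is kept separate because \<open>\<sigma>\<close>
  is only a scale here. The constants 2000 are crude.\<close>

lemma clt_bound:
  "\<bar>measure P {p \<in> space P. W p - mu \<le> t} - Phi t\<bar> \<le>
     2 * \<bar>1 - m * (\<integral>z. (xi z)\<^sup>2 \<partial>D)\<bar> + (2000 * B\<^sup>2 * \<kappa>\<^sup>2 * s + 2000 * B * \<kappa> * s) / sqrt m"
proof -
  have sp: "1 \<le> real s" using s2 by simp
  let ?T = "\<lambda>p. W p - mu"
  have i: "integrable P W" by (auto intro!: M.P.bm_integrable)
  have ET: "(\<integral>p. ?T p \<partial>P) = 0" using i integral_W by (simp add: M.P.prob_space)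
  have pr: "(\<integral>p. ?T (p(k := z)) \<partial>P) = xi z" if k: "k \<in> {1..m}" for k z
  proof -
    have "integrable P (\<lambda>p. W (p(k := z)))" using k by (intro integrable_upd bm_W)
    then show ?thesis using W_upd_integral[OF k] by (simp add: M.P.prob_space)
  qed
  have o: "M.osc {1..m} (2 * B * c1) ?T" "M.osc2 {1..m} (4 * B * c2) ?T"
    using osc_W osc2_W by (simp_all add: M.osc_def M.osc2_def)
  have bT: "bm P ?T" by auto
  have "\<bar>measure P {p \<in> space P. ?T p \<le> t} - Phi t\<bar> \<le>
     2 * \<bar>1 - real (card {1..m}) * (\<integral>z. (xi z)\<^sup>2 \<partial>D)\<bar> + 4 * (sqrt (real (card {1..m})) * (2 * (2 * B * c1)\<^sup>2 + real (card {1..m}) * (2 * B * c1 * (4 * B * c2))))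
     + 6 * (\<integral>p. \<bar>?T p - (\<Sum>i\<in>{1..m}. xi (p i))\<bar> \<partial>P)"
    by (rule M.berry_esseen[OF bT ET bm_xi _ o]) (use pr B_pos c2_nonneg m_pos in auto)
  then have 1: "\<bar>measure P {p \<in> space P. ?T p \<le> t} - Phi t\<bar> \<le>
     2 * \<bar>1 - m * (\<integral>z. (xi z)\<^sup>2 \<partial>D)\<bar> + 4 * (sqrt m * (2 * (2 * B * c1)\<^sup>2 + m * (2 * B * c1 * (4 * B * c2))))
     + 6 * (\<integral>p. \<bar>R p\<bar> \<partial>P)" by (simp add: R_def)
  have "6 * (\<integral>p. \<bar>R p\<bar> \<partial>P) \<le> 6 * (2 / L0)" using R_abs_moment by simp
  also have "\<dots> = 768 * B * \<kappa> * s / sqrt m" by (simp add: L0_def)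
  also have "\<dots> \<le> 2000 * B * \<kappa> * s / sqrt m" using B_pos kappa_pos by (intro divide_right_mono) auto
  finally have 2: "6 * (\<integral>p. \<bar>R p\<bar> \<partial>P) \<le> 2000 * B * \<kappa> * s / sqrt m" .
  have "4 * (sqrt m * (2 * (2 * B * c1)\<^sup>2 + m * (2 * B * c1 * (4 * B * c2)))) \<le>
      4 * (sqrt m * (2 * (2 * B * (\<kappa> / sqrt m))\<^sup>2 + m * (2 * B * (\<kappa> / sqrt m) * (4 * B * (2 * \<kappa> * s / (m * sqrt m))))))"
    using c1_le c2_le c1_pos c2_nonneg B_pos kappa_pos by (intro mult_left_mono add_mono power_mono mult_mono) auto
  also have "\<dots> = (32 * B\<^sup>2 * \<kappa>\<^sup>2 + 64 * B\<^sup>2 * \<kappa>\<^sup>2 * s) / sqrt m"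
  proof -
    define q where "q = sqrt m"
    have q: "q > 0" "real m = q * q" using m_pos by (auto simp: q_def)
    show ?thesis unfolding q_def[symmetric] q(2) using q(1) by (simp add: field_simps power2_eq_square)
  qed
  also have "\<dots> \<le> 2000 * B\<^sup>2 * \<kappa>\<^sup>2 * s / sqrt m"
  proof (rule divide_right_mono)
    have "B\<^sup>2 * \<kappa>\<^sup>2 * 1 \<le> B\<^sup>2 * \<kappa>\<^sup>2 * s" using sp by (intro mult_left_mono) auto
    moreover have "0 \<le> B\<^sup>2 * \<kappa>\<^sup>2 * s" by simp
    ultimately show "32 * B\<^sup>2 * \<kappa>\<^sup>2 + 64 * B\<^sup>2 * \<kappa>\<^sup>2 * s \<le> 2000 * B\<^sup>2 * \<kappa>\<^sup>2 * s" by linarith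
  qed simp
  finally show ?thesis using 1 2 by (simp add: add_divide_distrib)
qed

end

section \<open>Densities on product spaces and uniform orders of magnitude as the tilt
  vanishes\<close>

lemma (in iid_product) PiM_density:
  assumes q: "bm D q" "\<And>z. 0 \<le> q z" "(\<integral>z. q z \<partial>D) = 1"
  shows "prob_space (density D q)" "PiM I (\<lambda>_. density D q) = density P (\<lambda>p. \<Prod>i\<in>I. q (p i))"
proof -
  have [measurable]: "q \<in> borel_measurable D" using q(1) by (rule bm_measurable)
  show pr: "prob_space (density D q)"
  proof
    have "emeasure (density D q) (space (density D q)) = (\<integral>\<^sup>+z. ennreal (q z) * indicator (space D) z \<partial>D)"
      by (subst emeasure_density) auto
    also have "\<dots> = (\<integral>\<^sup>+z. ennreal (q z) \<partial>D)" by (rule nn_integral_cong) (simp add: indicator_def)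
    also have "\<dots> = ennreal (\<integral>z. q z \<partial>D)"
      by (rule nn_integral_eq_integral) (use q in \<open>auto intro!: D.bm_integrable\<close>)
    finally show "emeasure (density D q) (space (density D q)) = 1" using q(3) by simp
  qed
  interpret Q: prob_space "density D q" by (rule pr)
  interpret PQ: product_prob_space "\<lambda>_. density D q" I by unfold_locales
  show "PiM I (\<lambda>_. density D q) = density P (\<lambda>p. \<Prod>i\<in>I. q (p i))"
  proof (rule PQ.PiM_eqI[OF fin, symmetric])
    show "sets (density P (\<lambda>p. \<Prod>i\<in>I. q (p i))) = sets (PiM I (\<lambda>_. density D q))"
      by (simp cong: sets_PiM_cong)
    fix A assume A: "\<And>i. i \<in> I \<Longrightarrow> A i \<in> sets (density D q)"
    then have A' [measurable]: "\<And>i. i \<in> I \<Longrightarrow> A i \<in> sets D" by simp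
    have "emeasure (density P (\<lambda>p. \<Prod>i\<in>I. q (p i))) (Pi\<^sub>E I A)
       = (\<integral>\<^sup>+p. ennreal (\<Prod>i\<in>I. q (p i)) * indicator (Pi\<^sub>E I A) p \<partial>P)"
      by (rule emeasure_density) (use A' fin in \<open>auto intro!: sets_PiM_I_finite\<close>)
    also have "\<dots> = (\<integral>\<^sup>+p. (\<Prod>i\<in>I. ennreal (q (p i)) * indicator (A i) (p i)) \<partial>P)"
    proof (rule nn_integral_cong)
      fix p assume p: "p \<in> space P"
      have "indicator (Pi\<^sub>E I A) p = (\<Prod>i\<in>I. indicator (A i) (p i) :: ennreal)"
      proof (cases "p \<in> Pi\<^sub>E I A")
        case True then show ?thesis by (auto simp: PiE_iff intro!: prod.neutral[symmetric])
      next
        case False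
        then obtain i where "i \<in> I" "p i \<notin> A i" using p by (auto simp: space_PiM PiE_iff)
        then have "(\<Prod>i\<in>I. indicator (A i) (p i) :: ennreal) = 0"
          by (intro prod_zero[OF fin] bexI[of _ i]) (auto simp: indicator_def)
        then show ?thesis using False by simp
      qed
      then show "ennreal (\<Prod>i\<in>I. q (p i)) * indicator (Pi\<^sub>E I A) p = (\<Prod>i\<in>I. ennreal (q (p i)) * indicator (A i) (p i))"
        using q(2) by (simp add: prod.distrib prod_ennreal)
    qed
    also have "\<dots> = (\<Prod>i\<in>I. \<integral>\<^sup>+z. ennreal (q z) * indicator (A i) z \<partial>D)"
      by (rule product_nn_integral_prod[OF fin]) (use A' in measurable)
    also have "\<dots> = (\<Prod>i\<in>I. emeasure (density D q) (A i))"
      by (rule prod.cong) (auto simp: emeasure_density)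
    finally show "emeasure (density P (\<lambda>p. \<Prod>i\<in>I. q (p i))) (Pi\<^sub>E I A) = (\<Prod>i\<in>I. emeasure (density D q) (A i))" .
  qed
qed

lemma (in iid_product) integral_PiM_density:
  assumes q: "bm D q" "\<And>z. 0 \<le> q z" "(\<integral>z. q z \<partial>D) = 1" and F: "bm P F"
  shows "(\<integral>p. F p \<partial>PiM I (\<lambda>_. density D q)) = (\<integral>p. F p * (\<Prod>i\<in>I. q (p i)) \<partial>P)"
proof -
  have "bm P (\<lambda>p. \<Prod>i\<in>I. q (p i))" using q(1) by (intro bm_prod bm_coord)
  then have [measurable]: "(\<lambda>p. \<Prod>i\<in>I. q (p i)) \<in> borel_measurable P" by (rule bm_measurable)
  have [measurable]: "F \<in> borel_measurable P" using F by (rule bm_measurable)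
  show ?thesis unfolding PiM_density(2)[OF q]
    by (subst integral_density) (auto simp: q(2) prod_nonneg mult.commute)
qed

text \<open>A big-O at \<open>0+\<close>, uniform in a second argument of arbitrary type. This one
  notion serves functions of a coordinate, functions of the whole sample and, with a dummy argument,
  functions of \<open>u\<close> alone.\<close>

definition uO :: "nat \<Rightarrow> (real \<Rightarrow> 'z \<Rightarrow> real) \<Rightarrow> bool" where
  "uO n f \<longleftrightarrow> (\<exists>C. \<forall>\<^sub>F u in at_right 0. \<forall>z. \<bar>f u z\<bar> \<le> C * u ^ n)"

lemma eventually_at_right_01: "\<forall>\<^sub>F u in at_right (0::real). 0 < u \<and> u < 1"
  using eventually_at_right_field[of _ "0::real"] by (auto intro!: exI[of _ 1])

lemma uO_I: "\<forall>\<^sub>F u in at_right 0. \<forall>z. \<bar>f u z\<bar> \<le> C * u ^ n \<Longrightarrow> uO n f"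
  unfolding uO_def by blast

lemma uO_dest:
  assumes "uO n f"
  obtains C where "0 \<le> C" "\<forall>\<^sub>F u in at_right 0. 0 < u \<and> u < 1 \<and> (\<forall>z. \<bar>f u z\<bar> \<le> C * u ^ n)"
proof -
  obtain C where C: "\<forall>\<^sub>F u in at_right 0. \<forall>z. \<bar>f u z\<bar> \<le> C * u ^ n" using assms uO_def by blast
  have "\<forall>\<^sub>F u in at_right 0. 0 < u \<and> u < 1 \<and> (\<forall>z. \<bar>f u z\<bar> \<le> \<bar>C\<bar> * u ^ n)"
    using C eventually_at_right_01
  proof eventually_elim
    case (elim u)
    have "C * u ^ n \<le> \<bar>C\<bar> * u ^ n" using elim by (intro mult_right_mono) auto
    then show ?case using elim by (meson order_trans)
  qed
  then show ?thesis using that[of "\<bar>C\<bar>"] by auto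
qed

text \<open>The dominating value may be taken at another argument \<open>w\<close>, even of another
  type; this is what makes composition and changes of the argument type instances of the
  rule.\<close>

lemma uO_mono:
  assumes "uO n g" "\<forall>\<^sub>F u in at_right 0. \<forall>z. \<exists>w. \<bar>f u z\<bar> \<le> K * \<bar>g u w\<bar>"
  shows "uO n f"
proof -
  obtain C where C: "0 \<le> C" "\<forall>\<^sub>F u in at_right 0. 0 < u \<and> u < 1 \<and> (\<forall>z. \<bar>g u z\<bar> \<le> C * u ^ n)"
    using uO_dest[OF assms(1)] .
  have "\<forall>\<^sub>F u in at_right 0. \<forall>z. \<bar>f u z\<bar> \<le> (\<bar>K\<bar> * C) * u ^ n"
    using C(2) assms(2)
  proof eventually_elim
    case (elim u)
    show ?case
    proof
      fix z
      obtain w where "\<bar>f u z\<bar> \<le> K * \<bar>g u w\<bar>" using elim by blast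
      also have "\<dots> \<le> \<bar>K\<bar> * (C * u ^ n)" using elim C(1) by (intro mult_mono) auto
      finally show "\<bar>f u z\<bar> \<le> (\<bar>K\<bar> * C) * u ^ n" by simp
    qed
  qed
  then show ?thesis by (rule uO_I)
qed

lemma uO_compose: "uO n f \<Longrightarrow> uO n (\<lambda>u y. f u (g u y))"
  by (rule uO_mono[where K=1]) (auto intro: always_eventually)

lemma uO_cmult: "uO n f \<Longrightarrow> uO n (\<lambda>u z. c * f u z)"
  by (rule uO_mono[where K="\<bar>c\<bar>" and g=f]) (auto intro!: always_eventually simp: abs_mult)

lemma uO_minus: "uO n f \<Longrightarrow> uO n (\<lambda>u z. - f u z)"
  using uO_cmult[of n f "-1"] by simp

lemma uO_add:
  assumes "uO n f" "uO n g" shows "uO n (\<lambda>u z. f u z + g u z)"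
proof -
  obtain C where C: "0 \<le> C" "\<forall>\<^sub>F u in at_right 0. 0 < u \<and> u < 1 \<and> (\<forall>z. \<bar>f u z\<bar> \<le> C * u ^ n)" using uO_dest[OF assms(1)] .
  obtain C' where C': "0 \<le> C'" "\<forall>\<^sub>F u in at_right 0. 0 < u \<and> u < 1 \<and> (\<forall>z. \<bar>g u z\<bar> \<le> C' * u ^ n)" using uO_dest[OF assms(2)] .
  have "\<forall>\<^sub>F u in at_right 0. \<forall>z. \<bar>f u z + g u z\<bar> \<le> (C + C') * u ^ n"
    using C(2) C'(2)
  proof eventually_elim
    case (elim u)
    show ?case
    proof
      fix z
      have "\<bar>f u z\<bar> \<le> C * u ^ n" "\<bar>g u z\<bar> \<le> C' * u ^ n" using elim by auto
      then show "\<bar>f u z + g u z\<bar> \<le> (C + C') * u ^ n" by (simp add: distrib_right)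
    qed
  qed
  then show ?thesis by (rule uO_I)
qed

lemma uO_diff: "uO n f \<Longrightarrow> uO n g \<Longrightarrow> uO n (\<lambda>u z. f u z - g u z)"
  using uO_add[OF _ uO_minus, of n f g] by simp

lemma uO_mult:
  assumes "uO n f" "uO k g" shows "uO (n + k) (\<lambda>u z. f u z * g u z)"
proof -
  obtain C where C: "0 \<le> C" "\<forall>\<^sub>F u in at_right 0. 0 < u \<and> u < 1 \<and> (\<forall>z. \<bar>f u z\<bar> \<le> C * u ^ n)" using uO_dest[OF assms(1)] .
  obtain C' where C': "0 \<le> C'" "\<forall>\<^sub>F u in at_right 0. 0 < u \<and> u < 1 \<and> (\<forall>z. \<bar>g u z\<bar> \<le> C' * u ^ k)" using uO_dest[OF assms(2)] .
  have "\<forall>\<^sub>F u in at_right 0. \<forall>z. \<bar>f u z * g u z\<bar> \<le> (C * C') * u ^ (n + k)"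
    using C(2) C'(2)
  proof eventually_elim
    case (elim u)
    show ?case
    proof
      fix z
      have "\<bar>f u z\<bar> * \<bar>g u z\<bar> \<le> (C * u ^ n) * (C' * u ^ k)" using elim C(1) by (intro mult_mono) auto
      then show "\<bar>f u z * g u z\<bar> \<le> (C * C') * u ^ (n + k)" by (simp add: abs_mult power_add mult_ac)
    qed
  qed
  then show ?thesis by (rule uO_I)
qed

lemma uO_weaken:
  assumes "uO n f" "k \<le> n" shows "uO k f"
proof -
  obtain C where C: "0 \<le> C" "\<forall>\<^sub>F u in at_right 0. 0 < u \<and> u < 1 \<and> (\<forall>z. \<bar>f u z\<bar> \<le> C * u ^ n)" using uO_dest[OF assms(1)] .
  have "\<forall>\<^sub>F u in at_right 0. \<forall>z. \<bar>f u z\<bar> \<le> C * u ^ k"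
    using C(2)
  proof eventually_elim
    case (elim u)
    have "C * u ^ n \<le> C * u ^ k" using elim C(1) assms(2) by (intro mult_left_mono power_decreasing) auto
    then show ?case using elim by (meson order_trans)
  qed
  then show ?thesis by (rule uO_I)
qed

lemma uO_bounded: "(\<And>z. \<bar>g z\<bar> \<le> K) \<Longrightarrow> uO 0 (\<lambda>u z. g z)"
  by (rule uO_I[where C=K]) auto

lemma uO_const: "uO 0 (\<lambda>u z. c)"
  by (rule uO_bounded[where K="\<bar>c\<bar>"]) auto

lemma uO_id: "uO 1 (\<lambda>u z. u)"
  by (rule uO_I[where C=1], rule eventually_mono[OF eventually_at_right_01]) auto

lemma uO_u_mult: "uO n f \<Longrightarrow> uO (Suc n) (\<lambda>u z. u * f u z)"
  using uO_mult[OF uO_id, of n f] by (simp add: One_nat_def)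

lemma uO_power: "uO n f \<Longrightarrow> uO (k * n) (\<lambda>u z. f u z ^ k)"
  by (induction k) (auto intro: uO_const dest: uO_mult)

lemma uO_sum: "(\<And>i. i \<in> A \<Longrightarrow> uO n (f i)) \<Longrightarrow> uO n (\<lambda>u z. \<Sum>i\<in>A. f i u z)"
proof (induction A rule: infinite_finite_induct)
  case (insert i A) then show ?case using uO_add[of n "f i"] by simp
qed (use uO_cmult[of n _ 0] in \<open>auto intro!: uO_I[where C=0] always_eventually\<close>)

lemma uO_integral:
  assumes M: "prob_space M" and f: "uO n (\<lambda>u w. f u (fst w) (snd w))"
  shows "uO n (\<lambda>u y. \<integral>z. f u y z \<partial>M)"
proof -
  interpret prob_space M by fact
  obtain C where C: "0 \<le> C" "\<forall>\<^sub>F u in at_right 0. 0 < u \<and> u < 1 \<and> (\<forall>w. \<bar>f u (fst w) (snd w)\<bar> \<le> C * u ^ n)" using uO_dest[OF f] .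
  have "\<forall>\<^sub>F u in at_right 0. \<forall>y. \<bar>\<integral>z. f u y z \<partial>M\<bar> \<le> C * u ^ n"
    using C(2)
  proof eventually_elim
    case (elim u)
    show ?case
    proof
      fix y
      have "\<bar>f u y z\<bar> \<le> C * u ^ n" for z using elim by (metis fst_conv snd_conv)
      then show "\<bar>\<integral>z. f u y z \<partial>M\<bar> \<le> C * u ^ n" using C(1) elim by (intro abs_integral_le_const) auto
    qed
  qed
  then show ?thesis by (rule uO_I)
qed

lemma uO_integral': "prob_space M \<Longrightarrow> uO n f \<Longrightarrow> uO n (\<lambda>u y. \<integral>z. f u z \<partial>M)"
  using uO_integral[of M n "\<lambda>u y z. f u z"] uO_compose[of n f "\<lambda>u. snd"] by simp

lemma uO_small:
  assumes "uO n f" "1 \<le> n" "0 < e"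
  shows "\<forall>\<^sub>F u in at_right 0. \<forall>z. \<bar>f u z\<bar> \<le> e"
proof -
  have "uO 1 f" using uO_weaken assms by blast
  then obtain C where C: "0 \<le> C" "\<forall>\<^sub>F u in at_right 0. 0 < u \<and> u < 1 \<and> (\<forall>z. \<bar>f u z\<bar> \<le> C * u ^ 1)" by (rule uO_dest)
  have "\<forall>\<^sub>F u in at_right 0. u < e / (C + 1)"
    unfolding eventually_at_right_field using C(1) assms(3) by (intro exI[of _ "e / (C + 1)"]) auto
  then show ?thesis using C(2)
  proof eventually_elim
    case (elim u)
    have "C * u \<le> e" using elim C(1) mult_left_mono[of u "e / (C+1)" "C + 1"] by (simp add: field_simps)
    then show ?case using elim by (auto intro: order_trans)
  qed
qed

lemma abs_exp_remainder: "\<bar>w\<bar> \<le> 1 \<Longrightarrow> \<bar>exp w - 1 - w\<bar> \<le> w\<^sup>2" for w :: real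
  using exp_le_quadratic[of w] exp_ge_add_one_self[of w] zero_le_power2[of w] unfolding abs_le_iff by linarith

lemma uO_exp2: assumes "uO 1 f" shows "uO 2 (\<lambda>u z. exp (f u z) - 1 - f u z)"
proof (rule uO_mono[where K=1])
  show "uO 2 (\<lambda>u z. f u z ^ 2)" using uO_power[OF assms, of 2] by simp
  show "\<forall>\<^sub>F u in at_right 0. \<forall>z. \<exists>w. \<bar>exp (f u z) - 1 - f u z\<bar> \<le> 1 * \<bar>(f u w)\<^sup>2\<bar>"
    using uO_small[OF assms order_refl zero_less_one] by eventually_elim (auto dest: abs_exp_remainder)
qed

lemma uO_inverse: assumes "uO n f" "1 \<le> n" shows "uO n (\<lambda>u z. 1 / (1 + f u z) - 1)"
proof (rule uO_mono[where K=2, OF assms(1)])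
  have "\<bar>1 / (1 + w) - 1\<bar> \<le> 2 * \<bar>w\<bar>" if "\<bar>w\<bar> \<le> 1/2" for w :: real
  proof -
    have "1 / (1 + w) - 1 = - w / (1 + w)" using that by (simp add: field_simps)
    moreover have "\<bar>w\<bar> / (1 + w) \<le> \<bar>w\<bar> / (1/2)" using that by (intro divide_left_mono) auto
    ultimately show ?thesis using that by (simp add: abs_divide)
  qed
  then show "\<forall>\<^sub>F u in at_right 0. \<forall>z. \<exists>w. \<bar>1 / (1 + f u z) - 1\<bar> \<le> 2 * \<bar>f u w\<bar>"
    using uO_small[OF assms, of "1/2"] by (auto elim!: eventually_mono)
qed

text \<open>The mean value bound is used twice: the derivative is
  \<open>ln (1 + w) - w + w^2/2\<close>, whose own derivative \<open>w^2 / (1 + w)\<close> is at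
  most \<open>2 * w^2\<close> for \<open>\<bar>w\<bar> \<le> 1/2\<close>.\<close>

lemma entropy_remainder:
  fixes w :: real assumes "\<bar>w\<bar> \<le> 1/2"
  shows "\<bar>(1 + w) * ln (1 + w) - w - w\<^sup>2/2 + w^3/6\<bar> \<le> 2 * w^4"
proof -
  have mv: "\<bar>f w\<bar> \<le> K * \<bar>w\<bar>" if "f 0 = 0" "\<bar>w\<bar> \<le> 1/2" "\<And>t. \<bar>t\<bar> \<le> \<bar>w\<bar> \<Longrightarrow> (f has_real_derivative f' t) (at t) \<and> \<bar>f' t\<bar> \<le> K"
    for f f' :: "real \<Rightarrow> real" and K w
  proof -
    have "norm (f w - f 0) \<le> K * norm (w - 0)"
    proof (rule field_differentiable_bound[where S="{-\<bar>w\<bar>..\<bar>w\<bar>}" and f'=f'])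
      fix z assume "z \<in> {-\<bar>w\<bar>..\<bar>w\<bar>}"
      then have z: "\<bar>z\<bar> \<le> \<bar>w\<bar>" by (simp only: atLeastAtMost_iff) linarith
      show "(f has_real_derivative f' z) (at z within {-\<bar>w\<bar>..\<bar>w\<bar>})"
        using that(3)[OF z] by (blast intro: has_field_derivative_at_within)
      show "norm (f' z) \<le> K" using that(3)[OF z] by simp
    next
      show "0 \<in> {-\<bar>w\<bar>..\<bar>w\<bar>}" by simp
      show "w \<in> {-\<bar>w\<bar>..\<bar>w\<bar>}" by (simp only: atLeastAtMost_iff) linarith
    qed simp
    then show ?thesis using that(1) by simp
  qed
  have L: "\<bar>ln (1 + t) - t + t\<^sup>2/2\<bar> \<le> 2 * \<bar>t\<bar>^3" if t: "\<bar>t\<bar> \<le> 1/2" for t :: real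
  proof -
    have "\<bar>ln (1 + t) - t + t\<^sup>2/2\<bar> \<le> (2 * t\<^sup>2) * \<bar>t\<bar>"
    proof (rule mv[where f="\<lambda>t. ln (1 + t) - t + t\<^sup>2/2" and f'="\<lambda>t. t\<^sup>2 / (1 + t)", OF _ t], simp, intro conjI)
      fix r assume r: "\<bar>r\<bar> \<le> \<bar>t\<bar>"
      then have pos: "1/2 \<le> 1 + r" using t by linarith
      show "((\<lambda>t. ln (1 + t) - t + t\<^sup>2/2) has_real_derivative r\<^sup>2 / (1 + r)) (at r)"
        using pos by (auto intro!: derivative_eq_intros simp: field_simps power2_eq_square)
      have "r\<^sup>2 / (1 + r) \<le> r\<^sup>2 / (1/2)" using pos by (intro divide_left_mono) auto
      also have "\<dots> \<le> 2 * t\<^sup>2" using r by (simp add: abs_le_square_iff)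
      finally show "\<bar>r\<^sup>2 / (1 + r)\<bar> \<le> 2 * t\<^sup>2" using pos by simp
    qed
    then show ?thesis by (simp add: power3_eq_cube power2_eq_square abs_mult mult.assoc)
  qed
  have "\<bar>(1 + w) * ln (1 + w) - w - w\<^sup>2/2 + w^3/6\<bar> \<le> (2 * \<bar>w\<bar>^3) * \<bar>w\<bar>"
  proof (rule mv[where f="\<lambda>w. (1 + w) * ln (1 + w) - w - w\<^sup>2/2 + w^3/6" and f'="\<lambda>t. ln (1 + t) - t + t\<^sup>2/2", OF _ assms], simp, intro conjI)
    fix r assume r: "\<bar>r\<bar> \<le> \<bar>w\<bar>"
    then have p0: "0 < 1 + r" using assms by linarith
    have d1: "((\<lambda>w. 1 + w) has_real_derivative 1) (at r)" by (auto intro!: derivative_eq_intros)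
    have "((\<lambda>w. ln (1 + w)) has_real_derivative 1 / (1 + r) * 1) (at r)"
      by (rule DERIV_chain2[OF DERIV_ln_divide[OF p0] d1])
    from DERIV_mult[OF d1 this] have D: "((\<lambda>w. (1 + w) * ln (1 + w)) has_real_derivative ln (1 + r) + 1) (at r)"
      using p0 by simp
    show "((\<lambda>w. (1 + w) * ln (1 + w) - w - w\<^sup>2/2 + w^3/6) has_real_derivative ln (1 + r) - r + r\<^sup>2/2) (at r)"
    proof -
      have "((\<lambda>w. w\<^sup>2/2) has_real_derivative r) (at r)" "((\<lambda>w. w^3/6) has_real_derivative r\<^sup>2/2) (at r)"
        by (auto intro!: derivative_eq_intros)
      from DERIV_add[OF DERIV_diff[OF DERIV_diff[OF D DERIV_ident] this(1)] this(2)] show ?thesis by simp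
    qed
    have "\<bar>ln (1 + r) - r + r\<^sup>2/2\<bar> \<le> 2 * \<bar>r\<bar>^3" using r assms by (intro L) auto
    also have "\<dots> \<le> 2 * \<bar>w\<bar>^3" using r by (intro mult_left_mono power_mono) auto
    finally show "\<bar>ln (1 + r) - r + r\<^sup>2/2\<bar> \<le> 2 * \<bar>w\<bar>^3" .
  qed
  then show ?thesis by (simp add: power3_eq_cube power4_eq_xxxx mult.assoc)
qed

lemma uO_entropy:
  assumes "uO 1 f"
  shows "uO 4 (\<lambda>u z. (1 + f u z) * ln (1 + f u z) - f u z - (f u z)\<^sup>2/2 + (f u z)^3/6)"
proof (rule uO_mono[where K=2])
  show "uO 4 (\<lambda>u z. f u z ^ 4)" using uO_power[OF assms, of 4] by simp
  show "\<forall>\<^sub>F u in at_right 0. \<forall>z. \<exists>w. \<bar>(1 + f u z) * ln (1 + f u z) - f u z - (f u z)\<^sup>2/2 + (f u z)^3/6\<bar> \<le> 2 * \<bar>f u w ^ 4\<bar>"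
    using uO_small[OF assms order_refl, of "1/2"] by (auto elim!: eventually_mono intro!: exI order_trans[OF entropy_remainder])
qed

lemma uO_prod_bounded: "uO 0 a \<Longrightarrow> uO 0 (\<lambda>u y. \<Prod>j\<in>J. a u (y j))"
proof (induction J rule: infinite_finite_induct)
  case (insert i A)
  have "uO 0 (\<lambda>u y. a u (y i))" using uO_compose[OF insert.prems, of "\<lambda>u y. y i"] .
  then show ?case using uO_mult[OF _ insert.IH[OF insert.prems], of 0] insert.hyps by simp
qed (auto intro: uO_const)

lemma uO_prod_diff:
  assumes "uO n (\<lambda>u z. a u z - b u z)" "uO 0 a" "uO 0 b" "finite J"
  shows "uO n (\<lambda>u y. (\<Prod>j\<in>J. a u (y j)) - (\<Prod>j\<in>J. b u (y j)))"
  using assms(4)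
proof (induction J rule: finite_induct)
  case empty then show ?case by (auto intro!: uO_I[where C=0] always_eventually)
next
  case (insert i A)
  have 1: "uO n (\<lambda>u y. (a u (y i) - b u (y i)) * (\<Prod>j\<in>A. a u (y j)))"
    using uO_mult[OF uO_compose[OF assms(1), of "\<lambda>u y. y i"] uO_prod_bounded[OF assms(2)]] by simp
  have 2: "uO n (\<lambda>u y. b u (y i) * ((\<Prod>j\<in>A. a u (y j)) - (\<Prod>j\<in>A. b u (y j))))"
    using uO_mult[OF uO_compose[OF assms(3), of "\<lambda>u y. y i"] insert.IH] by simp
  show ?case using uO_add[OF 1 2] insert.hyps by (simp add: algebra_simps)
qed

text \<open>The double sum is the second elementary symmetric polynomial. Its ordered form
  \<open>j < k\<close> turns the induction step into a multiplication by one more factor, with the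
  new third-order terms collected in the error.\<close>

lemma uO_prod_expand:
  fixes n :: nat
  assumes f: "uO 1 f"
  shows "uO 3 (\<lambda>u y. (\<Prod>j=1..n. 1 + f u (y j)) - 1 - (\<Sum>j=1..n. f u (y j))
      - (\<Sum>k=1..n. f u (y k) * (\<Sum>j\<in>{1..<k}. f u (y j))))"
proof (induction n)
  case 0 then show ?case by (auto intro!: uO_I[where C=0] always_eventually)
next
  case (Suc n)
  have fi: "uO 1 (\<lambda>u y. f u (y j))" for j :: nat using uO_compose[OF f, of "\<lambda>u y. y j"] .
  have 1: "uO 3 (\<lambda>u y. ((\<Prod>j=1..n. 1 + f u (y j)) - 1 - (\<Sum>j=1..n. f u (y j))
      - (\<Sum>k=1..n. f u (y k) * (\<Sum>j\<in>{1..<k}. f u (y j)))) * (1 + f u (y (Suc n))))"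
    using uO_mult[OF Suc uO_add[OF uO_const uO_weaken[OF fi]], of 1 "Suc n"] by simp
  have "uO 1 (\<lambda>u y. (\<Sum>j\<in>{1..<k}. f u (y j)))" for k :: nat by (rule uO_sum) (rule fi)
  then have "uO (1 + 1) (\<lambda>u y. f u (y k) * (\<Sum>j\<in>{1..<k}. f u (y j)))" for k :: nat by (intro uO_mult fi)
  then have "uO 2 (\<lambda>u y. f u (y k) * (\<Sum>j\<in>{1..<k}. f u (y j)))" for k :: nat by (simp add: numeral_2_eq_2 One_nat_def)
  then have "uO 2 (\<lambda>u y. \<Sum>k=1..n. f u (y k) * (\<Sum>j\<in>{1..<k}. f u (y j)))" by (intro uO_sum)
  from uO_mult[OF this fi, of "Suc n"]
  have 2: "uO 3 (\<lambda>u y. (\<Sum>k=1..n. f u (y k) * (\<Sum>j\<in>{1..<k}. f u (y j))) * f u (y (Suc n)))"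
    by (simp add: numeral_3_eq_3 numeral_2_eq_2 One_nat_def)
  have s: "{1..<Suc n} = {1..n}" by auto
  show ?case using uO_add[OF 1 2] by (simp add: s algebra_simps)
qed

section \<open>Expansion in the tilting parameter\<close>

lemma uO_mult': "uO n f \<Longrightarrow> uO k g \<Longrightarrow> l = n + k \<Longrightarrow> uO l (\<lambda>u z. f u z * g u z)"
  using uO_mult by blast

lemma uO_cong: "(\<And>u z. f u z = g u z) \<Longrightarrow> uO n g \<Longrightarrow> uO n f"
  by presburger

locale tilt = ustat_kernel +
  assumes theta0: "theta = 0"
begin

abbreviation "KP \<equiv> K.P"

definition dens :: "(real \<Rightarrow> real) \<Rightarrow> real \<Rightarrow> real" where
  "dens f z = exp (f z) / (\<integral>z. exp (f z) \<partial>D)"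

text \<open>The functionals \<open>hq q\<close> and \<open>tq q\<close> play the roles of \<open>h1\<close> and \<open>theta\<close> under the law with density \<open>q\<close>
  with respect to \<open>D\<close>. The ideal tilt \<open>q\<close> is proportional to \<open>exp \<phi>\<close> with \<open>\<phi> = u * (hq q - tq q)\<close>: then the
  logarithm of the density cancels the linear part of the tilted U-statistic. Two steps \<open>q1\<close>, \<open>qd\<close> of
  the fixed-point iteration from \<open>q = 1\<close> are enough, since they leave a residual \<open>psi\<close> of order \<open>u^3\<close>.\<close>

definition hq :: "(real \<Rightarrow> real) \<Rightarrow> real \<Rightarrow> real" where
  "hq q z = (\<integral>y. h (y(1 := z)) * (\<Prod>j\<in>{1..s}. q (y j)) \<partial>KP)"

definition tq :: "(real \<Rightarrow> real) \<Rightarrow> real" where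
  "tq q = (\<integral>y. h y * (\<Prod>j\<in>{1..s}. q (y j)) \<partial>KP)"

definition q1 :: "real \<Rightarrow> real \<Rightarrow> real" where "q1 u = dens (\<lambda>z. u * h1 z)"
definition ph :: "real \<Rightarrow> real \<Rightarrow> real" where "ph u z = u * (hq (q1 u) z - tq (q1 u))"
definition qd :: "real \<Rightarrow> real \<Rightarrow> real" where "qd u = dens (ph u)"
definition kap :: "real \<Rightarrow> real" where "kap u = ln (\<integral>z. exp (ph u z) \<partial>D)"
definition psi :: "real \<Rightarrow> real \<Rightarrow> real" where
  "psi u z = ph u z - (\<integral>w. ph u w * qd u w \<partial>D) - u * (hq (qd u) z - tq (qd u))"

definition v2 :: real where "v2 = (\<integral>z. (h1 z)\<^sup>2 \<partial>D)"
definition v3 :: real where "v3 = (\<integral>z. (h1 z)^3 \<partial>D)"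
text \<open>The interaction of the kernel with two of its projections. With \<open>v3\<close> it
  gives the leading term \<open>m * c1^3 * (v3 + 3 * (s - 1) * hh)\<close> of the third
  moment.\<close>

definition hh :: real where "hh = (\<integral>y. h y * (h1 (y 1) * h1 (y 2)) \<partial>KP)"

lemma Z_pos: "bm D f \<Longrightarrow> 0 < (\<integral>z. exp (f z) \<partial>D)"
  using D.exp_jensen[of f] exp_gt_zero[of "\<integral>z. f z \<partial>D"] by linarith

lemma bm_dens [intro]: "bm D f \<Longrightarrow> bm D (dens f)"
  unfolding dens_def[abs_def] by (intro bm_divide bm_exp)

lemma dens_pos: "bm D f \<Longrightarrow> 0 < dens f z"
  unfolding dens_def using Z_pos by simp

lemma integral_dens: "bm D f \<Longrightarrow> (\<integral>z. dens f z \<partial>D) = 1"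
  unfolding dens_def using Z_pos[of f] by simp

lemma bm_hq [intro]:
  assumes q: "bm D q" shows "bm D (hq q)"
proof -
  have m: "(\<lambda>x. (snd x)(1 := fst x)) \<in> measurable (D \<Otimes>\<^sub>M KP) KP"
    using one_s by (intro measurable_fun_upd[where J="{1..s}"]) auto
  have "bm KP (\<lambda>y. \<Prod>j\<in>{1..s}. q (y j))" using q by (intro bm_prod K.bm_coord)
  then have "bm (D \<Otimes>\<^sub>M KP) (\<lambda>x. h ((snd x)(1 := fst x)) * (\<Prod>j\<in>{1..s}. q (snd x j)))"
    by (intro bm_mult bm_compose[OF m bm_h] bm_compose[OF measurable_snd])
  then have "bm (D \<Otimes>\<^sub>M KP) (\<lambda>(z, y). h (y(1 := z)) * (\<Prod>j\<in>{1..s}. q (y j)))"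
    by (simp add: case_prod_beta')
  from K.P.bm_integral_snd[OF this] show ?thesis by (simp add: hq_def[abs_def])
qed

text \<open>The kernel in \<open>hq\<close> no longer sees coordinate 1, so the factor
  \<open>q (y 1)\<close> integrates to one; reinstating it as the weight of \<open>z\<close>
  recovers the full product density.\<close>

lemma integral_hq:
  assumes q: "bm D q" "(\<integral>z. q z \<partial>D) = 1"
  shows "(\<integral>z. hq q z * q z \<partial>D) = tq q"
proof -
  have bP: "bm KP (\<lambda>y. \<Prod>j\<in>{1..s}. q (y j))" using q by (intro bm_prod K.bm_coord)
  have bP': "bm KP (\<lambda>y. \<Prod>j\<in>{1..s} - {1}. q (y j))" using q by (intro bm_prod K.bm_coord) auto
  have split: "(\<Prod>j\<in>{1..s}. q (y j)) = q (y 1) * (\<Prod>j\<in>{1..s} - {1}. q (y j))" for y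
    by (rule prod.remove) (use one_s in auto)
  have upd: "(\<Prod>j\<in>{1..s} - {1}. q ((y(1 := z)) j)) = (\<Prod>j\<in>{1..s} - {1}. q (y j))" for y z
    by (rule prod.cong) auto
  have "tq q = (\<integral>z. (\<integral>y. h (y(1 := z)) * (\<Prod>j\<in>{1..s}. q ((y(1 := z)) j)) \<partial>KP) \<partial>D)"
    unfolding tq_def by (rule K.integral_upd[OF bm_mult[OF bm_h bP] one_s(1), symmetric])
  also have "\<dots> = (\<integral>z. hq q z * q z \<partial>D)"
  proof (rule Bochner_Integration.integral_cong[OF refl])
    fix z
    have b: "bm KP (\<lambda>y. h (y(1 := z)) * (\<Prod>j\<in>{1..s} - {1}. q (y j)))"
      by (intro bm_mult bP' K.bm_upd1[OF bm_h one_s(1)]) simp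
    have inv: "K.inv_at 1 (\<lambda>y. h (y(1 := z)) * (\<Prod>j\<in>{1..s} - {1}. q (y j)))"
      unfolding K.inv_at_def upd by simp
    have "hq q z = (\<integral>y. q (y 1) * (h (y(1 := z)) * (\<Prod>j\<in>{1..s} - {1}. q (y j))) \<partial>KP)"
      unfolding hq_def split by (simp add: mult_ac)
    also have "\<dots> = (\<integral>y. h (y(1 := z)) * (\<Prod>j\<in>{1..s} - {1}. q (y j)) \<partial>KP)"
      using K.integral_coord_mult_inv[OF q(1) b one_s(1) inv] q(2) by simp
    finally have hz: "hq q z = \<dots>" .
    show "(\<integral>y. h (y(1 := z)) * (\<Prod>j\<in>{1..s}. q ((y(1 := z)) j)) \<partial>KP) = hq q z * q z"
      unfolding split upd hz by (simp add: mult_ac)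
  qed
  finally show ?thesis by simp
qed

lemma kernel_density:
  assumes q: "bm D q" "\<And>z. 0 \<le> q z" "(\<integral>z. q z \<partial>D) = 1"
  shows "ustat_kernel (density D q) s h B" "ustat_kernel.theta (density D q) s h = tq q"
    "ustat_kernel.h1 (density D q) s h = hq q"
proof -
  interpret Q: prob_space "density D q" by (rule K.PiM_density(1)[OF q])
  show Qk: "ustat_kernel (density D q) s h B"
    by unfold_locales (use setsD s2 h_meas sym h_bound B_pos in auto)
  show "ustat_kernel.theta (density D q) s h = tq q"
    unfolding ustat_kernel.theta_def[OF Qk] tq_def by (rule K.integral_PiM_density[OF q bm_h])
  show "ustat_kernel.h1 (density D q) s h = hq q"
    unfolding ustat_kernel.h1_def[OF Qk] hq_def fun_eq_iff
    by (intro allI K.integral_PiM_density[OF q] K.bm_upd1[OF bm_h one_s(1)]) simp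
qed

lemma hq_one: "hq (\<lambda>_. 1) z = h1 z" by (simp add: hq_def h1_def)
lemma tq_one: "tq (\<lambda>_. 1) = 0" using theta0 by (simp add: tq_def theta_def)

lemma uO_h1: "uO 0 (\<lambda>u. h1)" by (rule uO_bounded) (rule h1_bound)

lemma uO_uh1: "uO 1 (\<lambda>u z. u * h1 z)" using uO_u_mult[OF uO_h1] by (simp add: One_nat_def)

text \<open>The normalising integral differs from 1 only by \<open>O(u^2)\<close>, because the
  first-order term \<open>u * h1\<close> is centred when \<open>theta\<close> is 0.\<close>

lemma dens_expand:
  assumes b: "\<And>u. bm D (f u)" and f: "uO 2 (\<lambda>u z. f u z - u * h1 z)"
  shows "uO 2 (\<lambda>u z. dens (f u) z - 1 - u * h1 z)"
proof -
  have f1: "uO 1 f"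
    by (rule uO_cong[OF _ uO_add[OF uO_weaken[OF f] uO_uh1]]) auto
  have e: "uO 2 (\<lambda>u z. exp (f u z) - 1 - u * h1 z)"
    by (rule uO_cong[OF _ uO_add[OF uO_exp2[OF f1] f]]) simp
  define Z where "Z u = (\<integral>z. exp (f u z) \<partial>D)" for u
  have Zp: "Z u > 0" for u using Z_pos[OF b] by (simp add: Z_def)
  have Z: "uO 2 (\<lambda>u (z::real). Z u - 1)"
  proof (rule uO_cong[OF _ uO_integral'[OF D.prob_space_axioms e]])
    fix u
    have i: "integrable D (\<lambda>z. exp (f u z))" "integrable D h1"
      using b bm_h1 by (auto intro!: D.bm_integrable)
    show "Z u - 1 = (\<integral>z. exp (f u z) - 1 - u * h1 z \<partial>D)"
      using i by (simp add: Z_def integral_h1 theta0)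
  qed
  have i: "uO 2 (\<lambda>u (z::real). 1 / Z u - 1)"
    by (rule uO_cong[OF _ uO_inverse[OF Z]]) auto
  have 1: "uO 2 (\<lambda>u z. (exp (f u z) - 1 - u * h1 z) * (1 + (1 / Z u - 1)))"
    by (rule uO_mult'[OF e uO_add[OF uO_const uO_weaken[OF i, of 0]]]) auto
  have 2: "uO 2 (\<lambda>u z. (1 + u * h1 z) * (1 / Z u - 1))"
    by (rule uO_mult'[OF uO_add[OF uO_const uO_weaken[OF uO_uh1, of 0]] i]) auto
  show ?thesis
  proof (rule uO_cong[OF _ uO_add[OF 1 2]])
    fix u z
    have "dens (f u) z = exp (f u z) * (1 / Z u)" by (simp add: dens_def Z_def)
    then show "dens (f u) z - 1 - u * h1 z = (exp (f u z) - 1 - u * h1 z) * (1 + (1 / Z u - 1)) + (1 + u * h1 z) * (1 / Z u - 1)"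
      by (simp add: algebra_simps)
  qed
qed

text \<open>The functionals depend on the density in a Lipschitz way, since \<open>h\<close> is
  bounded and the product has finitely many bounded factors. Together with the prefactor
  \<open>u\<close> of the fixed-point map, each iteration gains one order.\<close>

lemma hq_tq_diff:
  assumes d: "uO n (\<lambda>u z. a u z - b u z)" and ab: "uO 0 a" "uO 0 b" "\<And>u. bm D (a u)" "\<And>u. bm D (b u)"
  shows "uO n (\<lambda>u z. hq (a u) z - hq (b u) z)" "uO n (\<lambda>u (z::real). tq (a u) - tq (b u))"
proof -
  let ?E = "\<lambda>u y. (\<Prod>j\<in>{1..s}. a u (y j)) - (\<Prod>j\<in>{1..s}. b u (y j))"
  have E: "uO n ?E" by (rule uO_prod_diff[OF d ab(1,2)]) simp
  have bP: "bm KP (\<lambda>y. \<Prod>j\<in>{1..s}. a u (y j))" "bm KP (\<lambda>y. \<Prod>j\<in>{1..s}. b u (y j))" for u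
    by (intro bm_prod K.bm_coord ab(3,4), assumption)+
  have "uO 0 (\<lambda>u w. h ((snd w)(1 := fst w)))" by (rule uO_bounded) (rule h_bound)
  from uO_mult[OF this uO_compose[OF E, of "\<lambda>u. snd"]]
  have 1: "uO n (\<lambda>u w. h ((snd w)(1 := fst w)) * ?E u (snd w))" by simp
  show "uO n (\<lambda>u z. hq (a u) z - hq (b u) z)"
  proof (rule uO_cong[OF _ uO_integral[OF K.P.prob_space_axioms 1]])
    fix u z
    have hb: "bm KP (\<lambda>y. h (y(1 := z)))" by (rule K.bm_upd1[OF bm_h one_s(1)]) simp
    have "integrable KP (\<lambda>y. h (y(1 := z)) * (\<Prod>j\<in>{1..s}. a u (y j)))" "integrable KP (\<lambda>y. h (y(1 := z)) * (\<Prod>j\<in>{1..s}. b u (y j)))"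
      by (intro K.P.bm_integrable bm_mult hb bP)+
    then show "hq (a u) z - hq (b u) z = (\<integral>y. h (y(1 := z)) * ?E u y \<partial>KP)"
      unfolding hq_def right_diff_distrib by (rule Bochner_Integration.integral_diff[symmetric])
  qed
  have "uO 0 (\<lambda>u. h)" by (rule uO_bounded) (rule h_bound)
  from uO_mult[OF this E] have 2: "uO n (\<lambda>u y. h y * ?E u y)" by simp
  show "uO n (\<lambda>u (z::real). tq (a u) - tq (b u))"
  proof (rule uO_cong[OF _ uO_integral'[OF K.P.prob_space_axioms 2]])
    fix u
    have "integrable KP (\<lambda>y. h y * (\<Prod>j\<in>{1..s}. a u (y j)))" "integrable KP (\<lambda>y. h y * (\<Prod>j\<in>{1..s}. b u (y j)))"
      by (intro K.P.bm_integrable bm_mult bm_h bP)+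
    then show "tq (a u) - tq (b u) = (\<integral>y. h y * ?E u y \<partial>KP)"
      unfolding tq_def right_diff_distrib by (rule Bochner_Integration.integral_diff[symmetric])
  qed
qed

lemma bm_q1 [intro]: "bm D (q1 u)" unfolding q1_def by (intro bm_dens bm_mult bm_h1 bm_const)
lemma bm_ph [intro]: "bm D (ph u)" unfolding ph_def[abs_def] by (intro bm_mult bm_diff bm_hq bm_q1 bm_const)
lemma bm_qd [intro]: "bm D (qd u)" unfolding qd_def by (intro bm_dens bm_ph)
lemma qd_pos: "0 < qd u z" unfolding qd_def by (rule dens_pos[OF bm_ph])
lemma integral_qd: "(\<integral>z. qd u z \<partial>D) = 1" unfolding qd_def by (rule integral_dens[OF bm_ph])

lemma q1_expand: "uO 2 (\<lambda>u z. q1 u z - 1 - u * h1 z)"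
  unfolding q1_def
proof (rule dens_expand)
  show "uO 2 (\<lambda>u z. u * h1 z - u * h1 z)" by (auto intro!: uO_I[where C=0] always_eventually)
qed (intro bm_mult bm_h1 bm_const)

lemma uO_minus_one:
  assumes "uO 2 (\<lambda>u z. q u z - 1 - u * h1 z)"
  shows "uO 1 (\<lambda>u z. q u z - 1)" "uO 0 q"
proof -
  show 1: "uO 1 (\<lambda>u z. q u z - 1)"
    by (rule uO_cong[OF _ uO_add[OF uO_weaken[OF assms] uO_uh1]]) auto
  show "uO 0 q" by (rule uO_cong[OF _ uO_add[OF uO_weaken[OF 1] uO_const[of 1]]]) auto
qed

lemma hq_q1: "uO 1 (\<lambda>u z. hq (q1 u) z - h1 z)" "uO 1 (\<lambda>u (z::real). tq (q1 u))"
  using hq_tq_diff[of 1 q1 "\<lambda>u z. 1"] uO_minus_one[OF q1_expand] uO_const[of 1] bm_q1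
  by (auto simp: hq_one tq_one)

lemma ph_expand: "uO 2 (\<lambda>u z. ph u z - u * h1 z)"
proof (rule uO_cong)
  show "uO 2 (\<lambda>u z. u * ((hq (q1 u) z - h1 z) - tq (q1 u)))"
    using uO_u_mult[OF uO_diff[OF hq_q1]] by (simp add: numeral_2_eq_2 One_nat_def)
qed (simp add: ph_def algebra_simps)

lemma qd_expand: "uO 2 (\<lambda>u z. qd u z - 1 - u * h1 z)"
  unfolding qd_def by (rule dens_expand[OF bm_ph ph_expand])

lemmas qd_one = uO_minus_one[OF qd_expand]

lemma qd_q1: "uO 2 (\<lambda>u z. qd u z - q1 u z)"
  by (rule uO_cong[OF _ uO_diff[OF qd_expand q1_expand]]) simp

lemma hq_qd: "uO 1 (\<lambda>u z. hq (qd u) z - h1 z)" "uO 1 (\<lambda>u (z::real). tq (qd u))"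
  using hq_tq_diff[of 1 qd "\<lambda>u z. 1"] qd_one uO_const[of 1] bm_qd
  by (auto simp: hq_one tq_one)

text \<open>All constants cancel by centring under \<open>qd u\<close>, which leaves
  \<open>u\<close> times the centred difference of \<open>hq (q1 u)\<close> and
  \<open>hq (qd u)\<close>. The densities agree up to \<open>O(u^2)\<close>, and the prefactor
  supplies the third order.\<close>

lemma psi_uO: "uO 3 psi"
proof -
  have d: "uO 2 (\<lambda>u z. hq (q1 u) z - hq (qd u) z)"
    by (rule uO_cong[OF _ uO_minus[OF hq_tq_diff(1)[OF qd_q1 qd_one(2) uO_minus_one(2)[OF q1_expand] bm_qd bm_q1]]]) simp
  have "uO 2 (\<lambda>u z. (hq (q1 u) z - hq (qd u) z) * qd u z)" using uO_mult[OF d qd_one(2)] by simp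
  from uO_integral'[OF D.prob_space_axioms this]
  have i: "uO 2 (\<lambda>u (z::real). \<integral>z. (hq (q1 u) z - hq (qd u) z) * qd u z \<partial>D)" .
  have "uO 3 (\<lambda>u z. u * ((hq (q1 u) z - hq (qd u) z) - (\<integral>z. (hq (q1 u) z - hq (qd u) z) * qd u z \<partial>D)))"
    using uO_u_mult[OF uO_diff[OF d i]] by (simp add: numeral_3_eq_3 numeral_2_eq_2)
  then show ?thesis
  proof (rule uO_cong[rotated])
    fix u z
    have ii: "integrable D (\<lambda>z. hq (q1 u) z * qd u z)" "integrable D (\<lambda>z. hq (qd u) z * qd u z)" "integrable D (qd u)"
      by (intro D.bm_integrable bm_mult bm_hq bm_q1 bm_qd)+
    have "(\<integral>w. ph u w * qd u w \<partial>D) = (\<integral>w. u * (hq (q1 u) w * qd u w) - (u * tq (q1 u)) * qd u w \<partial>D)"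
      by (rule Bochner_Integration.integral_cong) (auto simp: ph_def algebra_simps)
    also have "\<dots> = u * (\<integral>w. hq (q1 u) w * qd u w \<partial>D) - u * tq (q1 u)"
      using ii by (simp add: integral_qd)
    finally have 1: "(\<integral>w. ph u w * qd u w \<partial>D) = \<dots>" .
    have 2: "(\<integral>z. (hq (q1 u) z - hq (qd u) z) * qd u z \<partial>D) = (\<integral>w. hq (q1 u) w * qd u w \<partial>D) - tq (qd u)"
      using ii integral_hq[OF bm_qd integral_qd] by (simp add: left_diff_distrib)
    show "psi u z = u * ((hq (q1 u) z - hq (qd u) z) - (\<integral>z. (hq (q1 u) z - hq (qd u) z) * qd u z \<partial>D))"
      unfolding psi_def 1 2 by (simp add: ph_def algebra_simps)
  qed
qed

lemma integral_psi: "(\<integral>z. psi u z * qd u z \<partial>D) = 0"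
proof -
  have ii: "integrable D (\<lambda>z. ph u z * qd u z)" "integrable D (\<lambda>z. hq (qd u) z * qd u z)" "integrable D (qd u)"
    by (intro D.bm_integrable bm_mult bm_hq bm_ph bm_qd)+
  have "(\<integral>z. psi u z * qd u z \<partial>D) = (\<integral>z. ph u z * qd u z - (\<integral>w. ph u w * qd u w \<partial>D) * qd u z - u * (hq (qd u) z * qd u z) + (u * tq (qd u)) * qd u z \<partial>D)"
    by (rule Bochner_Integration.integral_cong) (auto simp: psi_def algebra_simps)
  also have "\<dots> = 0" using ii by (simp add: integral_qd integral_hq[OF bm_qd integral_qd])
  finally show ?thesis .
qed

definition zeta :: "real \<Rightarrow> real \<Rightarrow> real" where "zeta u z = qd u z - 1"

lemma bm_zeta [intro]: "bm D (zeta u)" unfolding zeta_def[abs_def] by (intro bm_diff bm_qd bm_const)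
lemma zeta_uO: "uO 1 zeta" "uO 2 (\<lambda>u z. zeta u z - u * h1 z)"
  unfolding zeta_def[abs_def] by (rule qd_one(1), rule qd_expand)

text \<open>\<open>tq\<close> is multilinear in the factors \<open>1 + zeta\<close>. The constant
  term is \<open>theta = 0\<close>, and symmetry of the kernel makes the \<open>s\<close> linear
  terms equal and likewise the \<open>s * (s - 1) / 2\<close> quadratic ones.\<close>

lemma tq_expand: "uO 3 (\<lambda>u (z::real). tq (qd u) - s * (\<integral>z. zeta u z * h1 z \<partial>D)
    - (s * (real s - 1) / 2) * (\<integral>y. h y * (zeta u (y 1) * zeta u (y 2)) \<partial>KP))"
proof -
  let ?S = "\<lambda>u y. \<Sum>j=1..s. zeta u (y j)"
  let ?E = "\<lambda>u y. \<Sum>k=1..s. zeta u (y k) * (\<Sum>j\<in>{1..<k}. zeta u (y j))"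
  have R: "uO 3 (\<lambda>u y. (\<Prod>j=1..s. 1 + zeta u (y j)) - 1 - ?S u y - ?E u y)"
    by (rule uO_prod_expand[OF zeta_uO(1)])
  have "uO 0 (\<lambda>u. h)" by (rule uO_bounded) (rule h_bound)
  from uO_mult[OF this R] have "uO 3 (\<lambda>u y. h y * ((\<Prod>j=1..s. 1 + zeta u (y j)) - 1 - ?S u y - ?E u y))" by simp
  from uO_integral'[OF K.P.prob_space_axioms this]
  have 1: "uO 3 (\<lambda>u (z::real). \<integral>y. h y * ((\<Prod>j=1..s. 1 + zeta u (y j)) - 1 - ?S u y - ?E u y) \<partial>KP)" .
  show ?thesis
  proof (rule uO_cong[OF _ 1])
    fix u
    define H where "H = (\<integral>y. h y * (zeta u (y 1) * zeta u (y 2)) \<partial>KP)"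
    have bj: "bm KP (\<lambda>y. zeta u (y j))" if "j \<in> {1..s}" for j using that by (intro K.bm_coord bm_zeta)
    have b: "bm KP (\<lambda>y. \<Prod>j=1..s. 1 + zeta u (y j))" by (intro bm_prod bm_add bm_const bj)
    have be: "bm KP (\<lambda>y. zeta u (y k) * (\<Sum>j\<in>{1..<k}. zeta u (y j)))" if "k \<in> {1..s}" for k
      using that by (intro bm_mult bm_sum bj) auto
    have "integrable KP (\<lambda>y. h y * (\<Prod>j=1..s. 1 + zeta u (y j)))" "integrable KP h"
      "integrable KP (\<lambda>y. h y * ?S u y)" "integrable KP (\<lambda>y. h y * ?E u y)"
      by (intro K.P.bm_integrable bm_mult bm_h b bm_sum bj be, assumption?)+
    then have "(\<integral>y. h y * ((\<Prod>j=1..s. 1 + zeta u (y j)) - 1 - ?S u y - ?E u y) \<partial>KP)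
      = (\<integral>y. h y * (\<Prod>j=1..s. 1 + zeta u (y j)) \<partial>KP) - (\<integral>y. h y \<partial>KP) - (\<integral>y. h y * ?S u y \<partial>KP) - (\<integral>y. h y * ?E u y \<partial>KP)"
      by (simp add: right_diff_distrib)
    also have "(\<integral>y. h y * (\<Prod>j=1..s. 1 + zeta u (y j)) \<partial>KP) = tq (qd u)" by (simp add: tq_def zeta_def)
    also have "(\<integral>y. h y \<partial>KP) = 0" using theta0 by (simp add: theta_def)
    also have "(\<integral>y. h y * ?S u y \<partial>KP) = s * (\<integral>z. zeta u z * h1 z \<partial>D)"
    proof -
      have "(\<integral>y. h y * ?S u y \<partial>KP) = (\<Sum>j=1..s. \<integral>y. h y * zeta u (y j) \<partial>KP)"
        unfolding sum_distrib_left by (intro Bochner_Integration.integral_sum K.P.bm_integrable bm_mult bm_h bj)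
      also have "\<dots> = (\<Sum>j=1..s. \<integral>z. zeta u z * h1 z \<partial>D)"
        by (intro sum.cong refl integral_h_coord bm_zeta)
      finally show ?thesis by simp
    qed
    also have "(\<integral>y. h y * ?E u y \<partial>KP) = (s * (real s - 1) / 2) * H"
    proof -
      have "(\<integral>y. h y * ?E u y \<partial>KP) = (\<Sum>k=1..s. \<integral>y. h y * (zeta u (y k) * (\<Sum>j\<in>{1..<k}. zeta u (y j))) \<partial>KP)"
        unfolding sum_distrib_left[of "h _" _ "{1..s}"]
        by (intro Bochner_Integration.integral_sum K.P.bm_integrable bm_mult[OF bm_h] be)
      also have "\<dots> = (\<Sum>k=1..s. (real k - 1) * H)"
      proof (rule sum.cong[OF refl])
        fix k assume k: "k \<in> {1..s}"
        have "(\<integral>y. h y * (zeta u (y k) * (\<Sum>j\<in>{1..<k}. zeta u (y j))) \<partial>KP) = (\<integral>y. (\<Sum>j\<in>{1..<k}. h y * (zeta u (y k) * zeta u (y j))) \<partial>KP)"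
          by (simp add: sum_distrib_left)
        also have "\<dots> = (\<Sum>j\<in>{1..<k}. \<integral>y. h y * (zeta u (y k) * zeta u (y j)) \<partial>KP)"
        proof (intro Bochner_Integration.integral_sum K.P.bm_integrable bm_mult bm_h bj)
        qed (use k in auto)
        also have "\<dots> = (\<Sum>j\<in>{1..<k}. H)"
        proof (rule sum.cong[OF refl])
          fix j assume "j \<in> {1..<k}"
          then show "(\<integral>y. h y * (zeta u (y k) * zeta u (y j)) \<partial>KP) = H"
            unfolding H_def using k by (intro integral_h_pair bm_zeta) auto
        qed
        finally show "(\<integral>y. h y * (zeta u (y k) * (\<Sum>j\<in>{1..<k}. zeta u (y j))) \<partial>KP) = (real k - 1) * H"
          using k by (simp add: of_nat_diff)
      qed
      also have "\<dots> = (\<Sum>k=1..s. real k - 1) * H" by (simp add: sum_distrib_right)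
      also have "(\<Sum>k=1..n. real k - 1) = n * (real n - 1) / 2" for n :: nat
        by (induction n) (auto simp: field_simps One_nat_def)
      finally show ?thesis .
    qed
    finally show "tq (qd u) - s * (\<integral>z. zeta u z * h1 z \<partial>D) - (s * (real s - 1) / 2) * (\<integral>y. h y * (zeta u (y 1) * zeta u (y 2)) \<partial>KP)
      = (\<integral>y. h y * ((\<Prod>j=1..s. 1 + zeta u (y j)) - 1 - ?S u y - ?E u y) \<partial>KP)" by (simp add: H_def)
  qed
qed

lemma zeta_pair: "uO 3 (\<lambda>u (z::real). (\<integral>y. h y * (zeta u (y 1) * zeta u (y 2)) \<partial>KP) - u\<^sup>2 * hh)"
proof -
  let ?r = "\<lambda>u z. zeta u z - u * h1 z"
  have c: "uO n (\<lambda>u y. f u (y j))" if "uO n f" for n f and j :: nat using uO_compose[OF that, of "\<lambda>u y. y j"] .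
  have h0: "uO 0 (\<lambda>u. h)" by (rule uO_bounded) (rule h_bound)
  have 1: "uO 3 (\<lambda>u (y :: nat \<Rightarrow> real). ?r u (y 1) * zeta u (y 2))"
    by (rule uO_mult'[OF c[OF zeta_uO(2)] c[OF zeta_uO(1)]]) simp
  have 2: "uO 3 (\<lambda>u (y :: nat \<Rightarrow> real). (u * h1 (y 1)) * ?r u (y 2))"
    by (rule uO_mult'[OF c[OF uO_uh1] c[OF zeta_uO(2)]]) simp
  have "uO 3 (\<lambda>u y. h y * (?r u (y 1) * zeta u (y 2) + (u * h1 (y 1)) * ?r u (y 2)))"
    using uO_mult[OF h0 uO_add[OF 1 2]] by simp
  from uO_integral'[OF K.P.prob_space_axioms this]
  show ?thesis
  proof (rule uO_cong[rotated])
    fix u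
    have b: "bm KP (\<lambda>y. zeta u (y j))" "bm KP (\<lambda>y. h1 (y j))" if "j \<in> {1..s}" for j
      using that by (auto intro!: K.bm_coord bm_zeta bm_h1)
    have "(\<integral>y. h y * (zeta u (y 1) * zeta u (y 2)) \<partial>KP) - u\<^sup>2 * hh
      = (\<integral>y. h y * (zeta u (y 1) * zeta u (y 2)) - u\<^sup>2 * (h y * (h1 (y 1) * h1 (y 2))) \<partial>KP)"
    proof -
      have "integrable KP (\<lambda>y. h y * (zeta u (y 1) * zeta u (y 2)))" "integrable KP (\<lambda>y. h y * (h1 (y 1) * h1 (y 2)))"
        by (intro K.P.bm_integrable bm_mult bm_h b one_s)+
      then show ?thesis by (simp add: hh_def)
    qed
    also have "\<dots> = (\<integral>y. h y * (?r u (y 1) * zeta u (y 2) + (u * h1 (y 1)) * ?r u (y 2)) \<partial>KP)"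
      by (rule Bochner_Integration.integral_cong) (auto simp: algebra_simps power2_eq_square)
    finally show "(\<integral>y. h y * (zeta u (y 1) * zeta u (y 2)) \<partial>KP) - u\<^sup>2 * hh = \<dots>" .
  qed
qed

lemma zeta_h1: "uO 2 (\<lambda>u (z::real). (\<integral>z. zeta u z * h1 z \<partial>D) - u * v2)"
proof -
  have "uO 2 (\<lambda>u z. (zeta u z - u * h1 z) * h1 z)" using uO_mult[OF zeta_uO(2) uO_h1] by simp
  from uO_integral'[OF D.prob_space_axioms this] show ?thesis
  proof (rule uO_cong[rotated])
    fix u
    have "integrable D (\<lambda>z. zeta u z * h1 z)" "integrable D (\<lambda>z. (h1 z)\<^sup>2)"
      by (intro D.bm_integrable bm_mult bm_power bm_zeta bm_h1)+
    then show "(\<integral>z. zeta u z * h1 z \<partial>D) - u * v2 = (\<integral>z. (zeta u z - u * h1 z) * h1 z \<partial>D)"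
      by (simp add: v2_def left_diff_distrib power2_eq_square mult.assoc)
  qed
qed

lemma tq_linear: "uO 2 (\<lambda>u (z::real). tq (qd u) / s - u * v2)"
proof -
  have hh2: "uO 2 (\<lambda>u (z::real). u\<^sup>2 * hh)" using uO_mult[OF uO_power[OF uO_id, of 2] uO_const, of hh] by simp
  have 1: "uO 2 (\<lambda>u (z::real). (\<integral>y. h y * (zeta u (y 1) * zeta u (y 2)) \<partial>KP))"
    by (rule uO_cong[OF _ uO_add[OF uO_weaken[OF zeta_pair] hh2]]) auto
  note 2 = uO_add[OF uO_add[OF uO_cmult[OF uO_weaken[OF tq_expand, of 2], of "1 / s"] uO_cmult[OF 1, of "(real s - 1) / 2"]] zeta_h1]
  show ?thesis
    by (rule uO_cong[OF _ 2]) (use s2 in \<open>auto simp: field_simps\<close>)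
qed

text \<open>The first two terms are minus the relative entropy of the tilted law, expanded by
  \<open>uO_entropy\<close>. Its part linear in \<open>zeta - u * h1\<close> cancels against
  \<open>u / s * tq (qd u)\<close>, the stationarity of Gibbs' variational principle, so the
  \<open>O(u^2)\<close> error of the density enters only through its square.\<close>

lemma exponent_expand:
  "uO 4 (\<lambda>u (z::real). kap u - (\<integral>z. ph u z * qd u z \<partial>D) + u / s * tq (qd u)
      - u\<^sup>2 / 2 * v2 - u^3 * (v3 / 6 + (real s - 1) / 2 * hh))"
proof -
  define ent where "ent u z = (1 + zeta u z) * ln (1 + zeta u z) - zeta u z - (zeta u z)\<^sup>2/2 + (zeta u z)^3/6" for u z
  define r where "r u z = zeta u z - u * h1 z" for u z
  have bln: "ln (1 + zeta u z) = ph u z - kap u" for u z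
    using Z_pos[OF bm_ph, of u] by (simp add: zeta_def qd_def dens_def kap_def ln_div)
  have bent: "bm D (ent u)" for u
    unfolding ent_def[abs_def] bln by (intro bm_add bm_diff bm_mult bm_divide bm_power bm_zeta bm_ph bm_const)
  have br: "bm D (r u)" for u unfolding r_def[abs_def] by (intro bm_diff bm_mult bm_zeta bm_h1 bm_const)
  have e: "uO 4 (\<lambda>u (z::real). \<integral>z. ent u z \<partial>D)"
    using uO_integral'[OF D.prob_space_axioms uO_entropy[OF zeta_uO(1)]] by (simp add: ent_def[abs_def])
  have rr: "uO 2 r" unfolding r_def[abs_def] by (rule zeta_uO(2))
  have "uO 4 (\<lambda>u z. (r u z)\<^sup>2)" using uO_power[OF rr, of 2] by simp
  from uO_integral'[OF D.prob_space_axioms this] have r2: "uO 4 (\<lambda>u (z::real). \<integral>z. (r u z)\<^sup>2 \<partial>D)" .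
  have z2: "uO 2 (\<lambda>u z. (zeta u z)\<^sup>2)" "uO 2 (\<lambda>u z. (u * h1 z)\<^sup>2)"
    using uO_power[OF zeta_uO(1), of 2] uO_power[OF uO_uh1, of 2] by simp_all
  have "uO 2 (\<lambda>u z. zeta u z * (u * h1 z))" by (rule uO_mult'[OF zeta_uO(1) uO_uh1]) simp
  with z2 have "uO 2 (\<lambda>u z. (zeta u z)\<^sup>2 + zeta u z * (u * h1 z) + (u * h1 z)\<^sup>2)"
    by (intro uO_add)
  from uO_mult[OF rr this]
  have "uO 4 (\<lambda>u z. r u z * ((zeta u z)\<^sup>2 + zeta u z * (u * h1 z) + (u * h1 z)\<^sup>2))" by simp
  from uO_integral'[OF D.prob_space_axioms this]
  have r3: "uO 4 (\<lambda>u (z::real). \<integral>z. r u z * ((zeta u z)\<^sup>2 + zeta u z * (u * h1 z) + (u * h1 z)\<^sup>2) \<partial>D)" .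
  have p: "uO 4 (\<lambda>u (z::real). u * ((\<integral>y. h y * (zeta u (y 1) * zeta u (y 2)) \<partial>KP) - u\<^sup>2 * hh))"
    using uO_u_mult[OF zeta_pair] by simp
  have t: "uO 4 (\<lambda>u (z::real). u * (tq (qd u) - s * (\<integral>z. zeta u z * h1 z \<partial>D)
    - (s * (real s - 1) / 2) * (\<integral>y. h y * (zeta u (y 1) * zeta u (y 2)) \<partial>KP)))"
    using uO_u_mult[OF tq_expand] by simp
  note all = uO_add[OF uO_add[OF uO_add[OF uO_add[OF uO_minus[OF e] uO_cmult[OF r2, of "-1/2"]] uO_cmult[OF r3, of "1/6"]] uO_cmult[OF p, of "(real s - 1)/2"]] uO_cmult[OF t, of "1/s"]]
  show ?thesis
  proof (rule uO_cong[OF _ all])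
    fix u
    have i: "integrable D (\<lambda>z. ph u z * qd u z)" "integrable D (qd u)" "integrable D (\<lambda>z. (zeta u z)\<^sup>2)" "integrable D (\<lambda>z. (zeta u z)^3)"
      "integrable D (\<lambda>z. zeta u z * h1 z)" "integrable D (\<lambda>z. (h1 z)\<^sup>2)" "integrable D (\<lambda>z. (h1 z)^3)" "integrable D (ent u)" "integrable D (zeta u)"
      by (intro D.bm_integrable bm_mult bm_power bm_ph bm_qd bm_zeta bm_h1 bent)+
    have z0: "(\<integral>z. zeta u z \<partial>D) = 0" using i(2) by (simp add: zeta_def integral_qd)
    have "kap u - (\<integral>z. ph u z * qd u z \<partial>D) = - (\<integral>z. (1 + zeta u z) * ln (1 + zeta u z) \<partial>D)"
    proof -
      have "(\<integral>z. (1 + zeta u z) * ln (1 + zeta u z) \<partial>D) = (\<integral>z. ph u z * qd u z - kap u * qd u z \<partial>D)"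
        unfolding bln by (rule Bochner_Integration.integral_cong) (auto simp: zeta_def algebra_simps)
      then show ?thesis using i by (simp add: integral_qd)
    qed
    also have "(\<integral>z. (1 + zeta u z) * ln (1 + zeta u z) \<partial>D) = (\<integral>z. ent u z + zeta u z + (zeta u z)\<^sup>2/2 - (zeta u z)^3/6 \<partial>D)"
      by (rule Bochner_Integration.integral_cong) (auto simp: ent_def)
    also have "\<dots> = (\<integral>z. ent u z \<partial>D) + (\<integral>z. (zeta u z)\<^sup>2 \<partial>D) / 2 - (\<integral>z. (zeta u z)^3 \<partial>D) / 6"
      using i by (simp add: z0)
    finally have K: "kap u - (\<integral>z. ph u z * qd u z \<partial>D) = - ((\<integral>z. ent u z \<partial>D) + (\<integral>z. (zeta u z)\<^sup>2 \<partial>D) / 2 - (\<integral>z. (zeta u z)^3 \<partial>D) / 6)" .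
    \<comment> \<open>Completing the square around \<open>u * h1\<close> isolates the cross term
      \<open>2 * u * \<integral> zeta h1\<close>; after the factor \<open>- 1/2\<close> it cancels
      the linear term of \<open>tq_expand\<close>.\<close>
    have "(\<integral>z. (r u z)\<^sup>2 \<partial>D) = (\<integral>z. (zeta u z)\<^sup>2 - 2 * u * (zeta u z * h1 z) + u\<^sup>2 * (h1 z)\<^sup>2 \<partial>D)"
      by (rule Bochner_Integration.integral_cong) (auto simp: r_def algebra_simps power2_eq_square)
    also have "\<dots> = (\<integral>z. (zeta u z)\<^sup>2 \<partial>D) - 2 * u * (\<integral>z. zeta u z * h1 z \<partial>D) + u\<^sup>2 * v2"
      using i by (simp add: v2_def)
    finally have R2: "(\<integral>z. (zeta u z)\<^sup>2 \<partial>D) = (\<integral>z. (r u z)\<^sup>2 \<partial>D) + 2 * u * (\<integral>z. zeta u z * h1 z \<partial>D) - u\<^sup>2 * v2" by linarith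
    have "(\<integral>z. r u z * ((zeta u z)\<^sup>2 + zeta u z * (u * h1 z) + (u * h1 z)\<^sup>2) \<partial>D) = (\<integral>z. (zeta u z)^3 - u^3 * (h1 z)^3 \<partial>D)"
      by (rule Bochner_Integration.integral_cong) (auto simp: r_def algebra_simps power2_eq_square power3_eq_cube)
    also have "\<dots> = (\<integral>z. (zeta u z)^3 \<partial>D) - u^3 * v3" using i by (simp add: v3_def)
    finally have R3: "(\<integral>z. (zeta u z)^3 \<partial>D) = (\<integral>z. r u z * ((zeta u z)\<^sup>2 + zeta u z * (u * h1 z) + (u * h1 z)\<^sup>2) \<partial>D) + u^3 * v3" by linarith
    have sp: "real s \<noteq> 0" using s2 by simp
    show "kap u - (\<integral>z. ph u z * qd u z \<partial>D) + u / s * tq (qd u) - u\<^sup>2 / 2 * v2 - u^3 * (v3 / 6 + (real s - 1) / 2 * hh) =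
       - (\<integral>z. ent u z \<partial>D) + - 1 / 2 * (\<integral>z. (r u z)\<^sup>2 \<partial>D) + 1 / 6 * (\<integral>z. r u z * ((zeta u z)\<^sup>2 + zeta u z * (u * h1 z) + (u * h1 z)\<^sup>2) \<partial>D)
       + (real s - 1) / 2 * (u * ((\<integral>y. h y * (zeta u (y 1) * zeta u (y 2)) \<partial>KP) - u\<^sup>2 * hh))
       + 1 / s * (u * (tq (qd u) - s * (\<integral>z. zeta u z * h1 z \<partial>D) - (s * (real s - 1) / 2) * (\<integral>y. h y * (zeta u (y 1) * zeta u (y 2)) \<partial>KP)))"
      unfolding K R2 R3 using sp by (simp add: field_simps power2_eq_square power3_eq_cube)
  qed
qed

lemma variance_expand: "uO 1 (\<lambda>u (z::real). (\<integral>z. (hq (qd u) z)\<^sup>2 * qd u z \<partial>D) - (tq (qd u))\<^sup>2 - v2)"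
proof -
  have h0: "uO 0 (\<lambda>u z. hq (qd u) z)"
    by (rule uO_cong[OF _ uO_add[OF uO_weaken[OF hq_qd(1)] uO_h1]]) auto
  have 1: "uO 1 (\<lambda>u z. (hq (qd u) z - h1 z) * ((hq (qd u) z + h1 z) * qd u z))"
    using uO_mult[OF hq_qd(1) uO_mult[OF uO_add[OF h0 uO_h1] qd_one(2)]] by simp
  have 2: "uO 1 (\<lambda>u z. (qd u z - 1) * (h1 z)\<^sup>2)"
    using uO_mult[OF qd_one(1) uO_power[OF uO_h1, of 2]] by simp
  note i = uO_integral'[OF D.prob_space_axioms uO_add[OF 1 2]]
  have t: "uO 1 (\<lambda>u (z::real). (tq (qd u))\<^sup>2)" using uO_weaken[OF uO_power[OF hq_qd(2), of 2], of 1] by simp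
  show ?thesis
  proof (rule uO_cong[OF _ uO_diff[OF i t]])
    fix u
    have "integrable D (\<lambda>z. (hq (qd u) z)\<^sup>2 * qd u z)" "integrable D (\<lambda>z. (h1 z)\<^sup>2)"
      by (intro D.bm_integrable bm_mult bm_power bm_hq bm_qd bm_h1)+
    then have "(\<integral>z. (hq (qd u) z)\<^sup>2 * qd u z \<partial>D) - v2 = (\<integral>z. (hq (qd u) z)\<^sup>2 * qd u z - (h1 z)\<^sup>2 \<partial>D)"
      by (simp add: v2_def)
    also have "\<dots> = (\<integral>z. (hq (qd u) z - h1 z) * ((hq (qd u) z + h1 z) * qd u z) + (qd u z - 1) * (h1 z)\<^sup>2 \<partial>D)"
      by (rule Bochner_Integration.integral_cong) (auto simp: algebra_simps power2_eq_square)
    finally show "(\<integral>z. (hq (qd u) z)\<^sup>2 * qd u z \<partial>D) - (tq (qd u))\<^sup>2 - v2 =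
       (\<integral>z. (hq (qd u) z - h1 z) * ((hq (qd u) z + h1 z) * qd u z) + (qd u z - 1) * (h1 z)\<^sup>2 \<partial>D) - (tq (qd u))\<^sup>2" by simp
  qed
qed

end

section \<open>Second and third moments\<close>

context ustat
begin

definition L :: "(nat \<Rightarrow> real) \<Rightarrow> real" where "L p = (\<Sum>i\<in>{1..m}. xi (p i))"

lemma bm_L [intro]: "bm P L"
  unfolding L_def[abs_def] by (intro bm_sum M.bm_coord bm_xi)

lemma W_decomp: "W p = mu + L p + R p" by (simp add: R_def L_def)

lemma bm_xi_coord: "i \<in> {1..m} \<Longrightarrow> bm P (\<lambda>p. xi (p i))" by (intro M.bm_coord bm_xi)

lemma integral_xi_inv:
  assumes "bm P F" "i \<in> {1..m}" "M.inv_at i F"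
  shows "(\<integral>p. xi (p i) * F p \<partial>P) = 0"
  using M.integral_coord_mult_inv[OF bm_xi assms] integral_xi by simp

text \<open>Each \<open>xi (p i)\<close> tests \<open>R\<close> only through its conditional mean
  given coordinate \<open>i\<close>, which is zero; hence the two parts of the variance add.\<close>

lemma integral_LR: "(\<integral>p. L p * R p \<partial>P) = 0"
proof -
  have "(\<integral>p. L p * R p \<partial>P) = (\<Sum>i\<in>{1..m}. \<integral>p. xi (p i) * R p \<partial>P)"
    unfolding L_def sum_distrib_right
    by (intro Bochner_Integration.integral_sum M.P.bm_integrable bm_mult bm_xi_coord bm_R)
  also have "\<dots> = (\<Sum>i\<in>{1..m}. 0)"
  proof (rule sum.cong[OF refl])
    fix i assume i: "i \<in> {1..m}"
    show "(\<integral>p. xi (p i) * R p \<partial>P) = 0"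
      unfolding M.integral_coord_mult[OF bm_xi bm_R i] R_upd_integral[OF i] by simp
  qed
  finally show ?thesis by simp
qed

lemma integral_pair_xi:
  assumes "i \<in> {1..m}" "j \<in> {1..m}" "i \<noteq> j" "bm P F" "M.inv_at i F"
  shows "(\<integral>p. xi (p i) * (xi (p j) * F p) \<partial>P) = 0"
  using assms by (intro integral_xi_inv bm_mult bm_xi_coord) (auto simp: M.inv_at_def)

lemma integral_square_L:
  assumes F: "bm P F"
  shows "(\<integral>p. F p * (L p)\<^sup>2 \<partial>P) = (\<Sum>i\<in>{1..m}. \<Sum>j\<in>{1..m}. \<integral>p. F p * (xi (p i) * xi (p j)) \<partial>P)"
proof -
  have "(\<integral>p. F p * (L p)\<^sup>2 \<partial>P) = (\<integral>p. (\<Sum>i\<in>{1..m}. \<Sum>j\<in>{1..m}. F p * (xi (p i) * xi (p j))) \<partial>P)"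
    unfolding L_def power2_eq_square sum_product by (simp only: sum_distrib_left)
  also have "\<dots> = (\<Sum>i\<in>{1..m}. \<integral>p. (\<Sum>j\<in>{1..m}. F p * (xi (p i) * xi (p j))) \<partial>P)"
    by (intro Bochner_Integration.integral_sum M.P.bm_integrable bm_sum bm_mult bm_xi_coord F)
  also have "\<dots> = (\<Sum>i\<in>{1..m}. \<Sum>j\<in>{1..m}. \<integral>p. F p * (xi (p i) * xi (p j)) \<partial>P)"
    by (intro sum.cong refl Bochner_Integration.integral_sum M.P.bm_integrable bm_mult bm_xi_coord F)
  finally show ?thesis .
qed

lemma double_sum_diagonal:
  assumes "\<And>i. i \<in> {1..m} \<Longrightarrow> f i i = a" "\<And>i j. i \<in> {1..m} \<Longrightarrow> j \<in> {1..m} \<Longrightarrow> i \<noteq> j \<Longrightarrow> f i j = b"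
  shows "(\<Sum>i\<in>{1..m}. \<Sum>j\<in>{1..m}. f i j) = real m * a + real m * (real m - 1) * b"
proof -
  have "(\<Sum>j\<in>{1..m}. f i j) = a + (real m - 1) * b" if i: "i \<in> {1..m}" for i
  proof -
    have "(\<Sum>j\<in>{1..m}. f i j) = f i i + (\<Sum>j\<in>{1..m} - {i}. f i j)" by (rule sum.remove) (use i in auto)
    also have "(\<Sum>j\<in>{1..m} - {i}. f i j) = (\<Sum>j\<in>{1..m} - {i}. b)" using assms(2) i by (intro sum.cong) auto
    also have "\<dots> = (real m - 1) * b" using i m_pos by (simp add: of_nat_diff)
    finally show ?thesis using assms(1) i by simp
  qed
  then have "(\<Sum>i\<in>{1..m}. \<Sum>j\<in>{1..m}. f i j) = (\<Sum>i\<in>{1..m}. a + (real m - 1) * b)" by (intro sum.cong) auto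
  then show ?thesis by (simp add: algebra_simps)
qed

lemma integral_L2: "(\<integral>p. (L p)\<^sup>2 \<partial>P) = m * (\<integral>z. (xi z)\<^sup>2 \<partial>D)"
proof -
  have "(\<integral>p. (L p)\<^sup>2 \<partial>P) = (\<Sum>i\<in>{1..m}. \<Sum>j\<in>{1..m}. \<integral>p. 1 * (xi (p i) * xi (p j)) \<partial>P)"
    using integral_square_L[of "\<lambda>_. 1"] by simp
  also have "\<dots> = real m * (\<integral>z. (xi z)\<^sup>2 \<partial>D) + real m * (real m - 1) * 0"
  proof (rule double_sum_diagonal)
    fix i assume i: "i \<in> {1..m}"
    show "(\<integral>p. 1 * (xi (p i) * xi (p i)) \<partial>P) = (\<integral>z. (xi z)\<^sup>2 \<partial>D)"
      using M.integral_coord[OF bm_power[OF bm_xi] i, of 2] by (simp add: power2_eq_square)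
  next
    fix i j assume "i \<in> {1..m}" "j \<in> {1..m}" "i \<noteq> j"
    then show "(\<integral>p. 1 * (xi (p i) * xi (p j)) \<partial>P) = 0"
      using integral_pair_xi[of i j "\<lambda>_. 1"] by (simp add: M.inv_at_def)
  qed
  finally show ?thesis by simp
qed

lemma variance_decomp: "(\<integral>p. (W p - mu)\<^sup>2 \<partial>P) = m * (\<integral>z. (xi z)\<^sup>2 \<partial>D) + (\<integral>p. (R p)\<^sup>2 \<partial>P)"
proof -
  have "(\<integral>p. (W p - mu)\<^sup>2 \<partial>P) = (\<integral>p. (L p)\<^sup>2 + 2 * (L p * R p) + (R p)\<^sup>2 \<partial>P)"
    by (rule Bochner_Integration.integral_cong) (auto simp: W_decomp power2_eq_square algebra_simps)
  also have "\<dots> = (\<integral>p. (L p)\<^sup>2 \<partial>P) + 2 * (\<integral>p. L p * R p \<partial>P) + (\<integral>p. (R p)\<^sup>2 \<partial>P)"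
  proof -
    have "integrable P (\<lambda>p. (L p)\<^sup>2)" "integrable P (\<lambda>p. L p * R p)" "integrable P (\<lambda>p. (R p)\<^sup>2)"
      by (intro M.P.bm_integrable bm_power bm_mult bm_L bm_R)+
    then show ?thesis by simp
  qed
  finally show ?thesis by (simp add: integral_LR integral_L2)
qed

text \<open>\<open>sqrt m / L0\<close>, which does not depend on \<open>m\<close>; the moment bounds
  for \<open>R\<close> are restated in terms of it.\<close>

definition HH :: real where "HH = 64 * B * \<kappa> * s"

lemma HH_pos: "0 < HH" using B_pos kappa_pos s2 by (simp add: HH_def)

lemma L0_inv: "1 / L0\<^sup>2 = HH\<^sup>2 / m" "1 / L0^4 = HH^4 / (real m)\<^sup>2"
proof -
  have L: "L0 = sqrt m / HH" by (simp add: L0_def HH_def)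
  have "(sqrt m)^4 = (real m)\<^sup>2" using m_pos by (simp add: power4_eq_xxxx power2_eq_square)
  then show "1 / L0\<^sup>2 = HH\<^sup>2 / m" "1 / L0^4 = HH^4 / (real m)\<^sup>2"
    unfolding L by (simp_all add: power_divide)
qed

lemma R_second: "(\<integral>p. (R p)\<^sup>2 \<partial>P) \<le> 4 * HH\<^sup>2 / m"
  using R_moments(1) L0_inv(1) by (simp add: divide_inverse)

lemma R_fourth: "(\<integral>p. (R p)^4 \<partial>P) \<le> 48 * HH^4 / (real m)\<^sup>2"
  using R_moments(2) L0_inv(2) by (simp add: divide_inverse)

end

text \<open>Here \<open>\<sigma>\<close> is tied to the law: since \<open>theta = 0\<close> makes
  \<open>W\<close> centred, the second moment 1 says that \<open>\<sigma>\<close> is the standard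
  deviation of the sum.\<close>

locale normed = tilt D s h B + ustat D s h B m \<sigma> \<kappa> for D s h B m \<sigma> \<kappa> +
  assumes var_W: "(\<integral>p. (W p)\<^sup>2 \<partial>M.P) = 1"
begin

lemma mu0: "mu = 0" by (simp add: mu_def theta0)

lemma xi_eq: "xi z = c1 * h1 z" by (simp add: xi_def theta0)

lemma integral_xi_power: "(\<integral>z. (xi z)\<^sup>2 \<partial>D) = c1\<^sup>2 * v2" "(\<integral>z. (xi z)^3 \<partial>D) = c1^3 * v3"
  by (simp_all add: xi_eq power_mult_distrib v2_def v3_def)

lemma var_one: "m * c1\<^sup>2 * v2 + (\<integral>p. (R p)\<^sup>2 \<partial>P) = 1"
  using variance_decomp var_W by (simp add: mu0 integral_xi_power)

lemma var_defect: "\<bar>1 - m * c1\<^sup>2 * v2\<bar> \<le> 4 * HH\<^sup>2 / m"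
proof -
  have "0 \<le> (\<integral>p. (R p)\<^sup>2 \<partial>P)" by simp
  then show ?thesis using var_one R_second by linarith
qed

text \<open>If one of the indices is missing from the tuple, its centred factor is independent of
  the rest and the integral vanishes. Otherwise symmetry reduces to the first two kernel
  positions.\<close>

lemma integral_tup_pair:
  assumes t: "t \<in> increasing_tuples s m" and ij: "i \<in> {1..m}" "j \<in> {1..m}" "i \<noteq> j"
  shows "(\<integral>p. tup t p * (xi (p i) * xi (p j)) \<partial>P) = (if i \<in> t ` {1..s} \<and> j \<in> t ` {1..s} then c1\<^sup>2 * hh else 0)"
proof (cases "i \<in> t ` {1..s}")
  case False
  have "(\<integral>p. xi (p i) * (xi (p j) * tup t p) \<partial>P) = 0"
    by (rule integral_pair_xi[OF ij bm_tup[OF t]]) (auto simp: M.inv_at_def tup_inv[OF False])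
  then show ?thesis using False by (simp add: mult_ac)
next
  case True
  show ?thesis
  proof (cases "j \<in> t ` {1..s}")
    case False
    have "(\<integral>p. xi (p j) * (xi (p i) * tup t p) \<partial>P) = 0"
      by (rule integral_pair_xi[OF ij(2,1) _ bm_tup[OF t]]) (use ij in \<open>auto simp: M.inv_at_def tup_inv[OF False]\<close>)
    then show ?thesis using False by (simp add: mult_ac)
  next
    case j: True
    obtain q r where qr: "q \<in> {1..s}" "i = t q" "r \<in> {1..s}" "j = t r" using True j by auto
    then have ne: "q \<noteq> r" using ij by auto
    have b: "bm K.P (\<lambda>y. h y * (xi (y q) * xi (y r)))"
      by (intro bm_mult bm_h K.bm_coord bm_xi qr)
    have "(\<integral>p. tup t p * (xi (p i) * xi (p j)) \<partial>P) = (\<integral>p. (\<lambda>y. h y * (xi (y q) * xi (y r))) (\<lambda>j\<in>{1..s}. p (t j)) \<partial>P)"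
      using qr by (simp add: tup_def)
    also have "\<dots> = (\<integral>y. h y * (xi (y q) * xi (y r)) \<partial>K.P)"
      by (rule tup_integral[OF t bm_measurable[OF b]])
    also have "\<dots> = (\<integral>y. h y * (xi (y 1) * xi (y 2)) \<partial>K.P)"
      by (rule integral_h_pair[OF bm_xi bm_xi qr(1,3) ne])
    also have "\<dots> = (\<integral>y. c1\<^sup>2 * (h y * (h1 (y 1) * h1 (y 2))) \<partial>K.P)"
      by (simp add: xi_eq power2_eq_square mult_ac)
    also have "\<dots> = c1\<^sup>2 * hh" by (simp add: hh_def)
    finally show ?thesis using True j by simp
  qed
qed

lemma integral_W_pair:
  assumes ij: "i \<in> {1..m}" "j \<in> {1..m}" "i \<noteq> j"
  shows "(\<integral>p. W p * (xi (p i) * xi (p j)) \<partial>P) = c2 * c1\<^sup>2 * hh"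
proof -
  have "(\<integral>p. W p * (xi (p i) * xi (p j)) \<partial>P) = (\<integral>p. (\<Sum>t\<in>increasing_tuples s m. tup t p * (xi (p i) * xi (p j))) / \<sigma> \<partial>P)"
    by (simp add: W_eq sum_distrib_right)
  also have "\<dots> = (\<integral>p. (\<Sum>t\<in>increasing_tuples s m. tup t p * (xi (p i) * xi (p j))) \<partial>P) / \<sigma>" by simp
  also have "(\<integral>p. (\<Sum>t\<in>increasing_tuples s m. tup t p * (xi (p i) * xi (p j))) \<partial>P)
     = (\<Sum>t\<in>increasing_tuples s m. \<integral>p. tup t p * (xi (p i) * xi (p j)) \<partial>P)"
    by (intro Bochner_Integration.integral_sum M.P.bm_integrable bm_mult bm_tup bm_xi_coord ij)
  also have "\<dots> = (\<Sum>t\<in>increasing_tuples s m. if i \<in> t ` {1..s} \<and> j \<in> t ` {1..s} then c1\<^sup>2 * hh else 0)"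
    by (intro sum.cong refl integral_tup_pair ij)
  also have "\<dots> = real ((m - 2) choose (s - 2)) * (c1\<^sup>2 * hh)"
    by (simp add: sum.If_cases Int_def card_tuples2[OF ij])
  finally show ?thesis by (simp add: c2_def)
qed

lemma bm_xi2: "bm D (\<lambda>z. (xi z)\<^sup>2)" by (intro bm_power bm_xi)

lemma integral_W_diag:
  assumes i: "i \<in> {1..m}"
  shows "(\<integral>p. W p * (xi (p i) * xi (p i)) \<partial>P) = c1^3 * v3"
proof -
  have "(\<integral>p. (xi (p i))\<^sup>2 * W p \<partial>P) = (\<integral>z. (xi z)^3 \<partial>D)"
    unfolding M.integral_coord_mult[OF bm_xi2 bm_W i] W_upd_integral[OF i] mu0
    by (simp add: power2_eq_square power3_eq_cube mult_ac)
  then show ?thesis by (simp add: power2_eq_square mult_ac integral_xi_power(2))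
qed

lemma integral_WL2: "(\<integral>p. W p * (L p)\<^sup>2 \<partial>P) = m * (c1^3 * v3) + m * (c1^3 * (real s - 1) * hh)"
proof -
  have "(\<integral>p. W p * (L p)\<^sup>2 \<partial>P) = real m * (c1^3 * v3) + real m * (real m - 1) * (c2 * c1\<^sup>2 * hh)"
    unfolding integral_square_L[OF bm_W]
    by (rule double_sum_diagonal[OF integral_W_diag integral_W_pair])
  \<comment> \<open>\<open>c2_eq\<close> trades the number of pairs times \<open>c2\<close> for
    \<open>m * c1 * (s - 1)\<close>, so diagonal and off-diagonal terms have the same order.\<close>
  also have "real m * (real m - 1) * (c2 * c1\<^sup>2 * hh) = real m * ((c2 * (real m - 1)) * c1\<^sup>2 * hh)" by simp
  also have "\<dots> = m * (c1^3 * (real s - 1) * hh)" unfolding c2_eq by (simp add: power2_eq_square power3_eq_cube)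
  finally show ?thesis .
qed

lemma integral_L3: "(\<integral>p. L p * (L p)\<^sup>2 \<partial>P) = m * (c1^3 * v3)"
proof -
  have Lsum: "(\<integral>p. L p * F p \<partial>P) = (\<Sum>k\<in>{1..m}. \<integral>p. xi (p k) * F p \<partial>P)" if "bm P F" for F
    unfolding L_def sum_distrib_right
    by (intro Bochner_Integration.integral_sum M.P.bm_integrable bm_mult bm_xi_coord that)
  have "(\<integral>p. L p * (L p)\<^sup>2 \<partial>P) = real m * (c1^3 * v3) + real m * (real m - 1) * 0"
    unfolding integral_square_L[OF bm_L]
  proof (rule double_sum_diagonal)
    fix i assume i: "i \<in> {1..m}"
    have "(\<integral>p. L p * (xi (p i) * xi (p i)) \<partial>P) = (\<Sum>k\<in>{1..m}. \<integral>p. xi (p k) * (xi (p i) * xi (p i)) \<partial>P)"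
      by (intro Lsum bm_mult bm_xi_coord i)
    also have "\<dots> = (\<Sum>k\<in>{1..m}. if k = i then c1^3 * v3 else 0)"
    proof (rule sum.cong[OF refl])
      fix k assume k: "k \<in> {1..m}"
      show "(\<integral>p. xi (p k) * (xi (p i) * xi (p i)) \<partial>P) = (if k = i then c1^3 * v3 else 0)"
      proof (cases "k = i")
        case True
        then show ?thesis using M.integral_coord[OF bm_power[OF bm_xi] i, of 3] integral_xi_power(2)
          by (simp add: power3_eq_cube mult_ac)
      next
        case False
        then show ?thesis using i k by (auto intro!: integral_pair_xi bm_xi_coord simp: M.inv_at_def)
      qed
    qed
    also have "\<dots> = c1^3 * v3" using i by simp
    finally show "(\<integral>p. L p * (xi (p i) * xi (p i)) \<partial>P) = c1^3 * v3" .
  next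
    fix i j assume ij: "i \<in> {1..m}" "j \<in> {1..m}" "i \<noteq> j"
    have "(\<integral>p. L p * (xi (p i) * xi (p j)) \<partial>P) = (\<Sum>k\<in>{1..m}. \<integral>p. xi (p k) * (xi (p i) * xi (p j)) \<partial>P)"
      by (intro Lsum bm_mult bm_xi_coord ij)
    also have "\<dots> = (\<Sum>k\<in>{1..m}. 0)"
    proof (rule sum.cong[OF refl])
      fix k assume k: "k \<in> {1..m}"
      show "(\<integral>p. xi (p k) * (xi (p i) * xi (p j)) \<partial>P) = 0"
      proof (cases "k = i")
        case True
        have "(\<integral>p. xi (p j) * (xi (p i) * xi (p i)) \<partial>P) = 0"
          using ij by (intro integral_pair_xi bm_xi_coord) (auto simp: M.inv_at_def)
        then show ?thesis using True by (simp add: mult_ac)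
      next
        case False
        show ?thesis
        proof (cases "k = j")
          case True
          have "(\<integral>p. xi (p i) * (xi (p j) * xi (p j)) \<partial>P) = 0"
            using ij by (intro integral_pair_xi bm_xi_coord) (auto simp: M.inv_at_def)
          then show ?thesis using True by (simp add: mult_ac)
        next
          case False
          then show ?thesis
            using ij k \<open>k \<noteq> i\<close> by (intro integral_pair_xi bm_xi_coord) (auto simp: M.inv_at_def)
        qed
      qed
    qed
    finally show "(\<integral>p. L p * (xi (p i) * xi (p j)) \<partial>P) = 0" by simp
  qed
  then show ?thesis by simp
qed

definition CG :: real where "CG = 3 * (1 + 48 * HH^4) + (4 * HH\<^sup>2 + 48 * HH^4)"

text \<open>Since \<open>W = L + R\<close>, the cube equals
  \<open>3 W L^2 - 2 L^3 + 3 L R^2 + R^3\<close>. The first two terms are computed exactly; in the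
  mixed term \<open>L^2 / m + m * R^4\<close> balances the factors, so the rest is
  \<open>O(1 / m)\<close>.\<close>

lemma gamma_bound:
  "\<bar>(\<integral>p. (W p)^3 \<partial>P) - m * c1^3 * (v3 + 3 * (real s - 1) * hh)\<bar> \<le> CG / m"
proof -
  have i: "integrable P (\<lambda>p. W p * (L p)\<^sup>2)" "integrable P (\<lambda>p. L p * (L p)\<^sup>2)" "integrable P (\<lambda>p. 3 * L p * (R p)\<^sup>2 + (R p)^3)"
    "integrable P (\<lambda>p. (L p)\<^sup>2)" "integrable P (\<lambda>p. (R p)\<^sup>2)" "integrable P (\<lambda>p. (R p)^4)"
    by (intro M.P.bm_integrable bm_mult bm_add bm_power bm_W bm_L bm_R bm_const)+
  have "(\<integral>p. (W p)^3 \<partial>P) = (\<integral>p. 3 * (W p * (L p)\<^sup>2) - 2 * (L p * (L p)\<^sup>2) + (3 * L p * (R p)\<^sup>2 + (R p)^3) \<partial>P)"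
    by (rule Bochner_Integration.integral_cong) (auto simp: W_decomp mu0 algebra_simps power2_eq_square power3_eq_cube)
  also have "\<dots> = 3 * (\<integral>p. W p * (L p)\<^sup>2 \<partial>P) - 2 * (\<integral>p. L p * (L p)\<^sup>2 \<partial>P) + (\<integral>p. 3 * L p * (R p)\<^sup>2 + (R p)^3 \<partial>P)"
    using i(1-3) by simp
  also have "\<dots> = m * c1^3 * (v3 + 3 * (real s - 1) * hh) + (\<integral>p. 3 * L p * (R p)\<^sup>2 + (R p)^3 \<partial>P)"
    unfolding integral_WL2 integral_L3 by (simp add: algebra_simps)
  finally have eq: "(\<integral>p. (W p)^3 \<partial>P) - m * c1^3 * (v3 + 3 * (real s - 1) * hh) = (\<integral>p. 3 * L p * (R p)\<^sup>2 + (R p)^3 \<partial>P)" by simp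
  have "\<bar>\<integral>p. 3 * L p * (R p)\<^sup>2 + (R p)^3 \<partial>P\<bar> \<le> (\<integral>p. 3 * ((L p)\<^sup>2 / m + m * (R p)^4) + ((R p)\<^sup>2 + (R p)^4) \<partial>P)"
  proof (rule order_trans[OF integral_abs_bound integral_mono])
    show "integrable P (\<lambda>p. \<bar>3 * L p * (R p)\<^sup>2 + (R p)^3\<bar>)" using i by simp
    show "integrable P (\<lambda>p. 3 * ((L p)\<^sup>2 / m + m * (R p)^4) + ((R p)\<^sup>2 + (R p)^4))" using i by simp
    fix p
    define l where "l = L p" define r where "r = R p"
    have a: "\<bar>l\<bar> * r\<^sup>2 \<le> l\<^sup>2 / m + m * r^4"
    proof -
      define q where "q = sqrt m"
      have q: "q > 0" "real m = q * q" using m_pos by (auto simp: q_def)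
      have "2 * (\<bar>l\<bar> / q) * (q * r\<^sup>2) \<le> (\<bar>l\<bar> / q)\<^sup>2 + (q * r\<^sup>2)\<^sup>2" by (rule sum_squares_bound)
      then have "2 * (\<bar>l\<bar> * r\<^sup>2) \<le> l\<^sup>2 / m + m * r^4"
        using q by (simp add: power_divide power_mult_distrib power2_eq_square power4_eq_xxxx mult_ac)
      moreover have "0 \<le> \<bar>l\<bar> * r\<^sup>2" by simp
      ultimately show ?thesis by linarith
    qed
    have b: "\<bar>r^3\<bar> \<le> r\<^sup>2 + r^4"
    proof -
      have "2 * \<bar>r\<bar> * (r\<^sup>2) \<le> (\<bar>r\<bar>)\<^sup>2 + (r\<^sup>2)\<^sup>2" by (rule sum_squares_bound)
      then have "2 * \<bar>r^3\<bar> \<le> r\<^sup>2 + r^4" by (simp add: power_abs power2_eq_square power3_eq_cube power4_eq_xxxx abs_mult)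
      then show ?thesis by linarith
    qed
    have "\<bar>3 * l * r\<^sup>2 + r^3\<bar> \<le> 3 * (\<bar>l\<bar> * r\<^sup>2) + \<bar>r^3\<bar>" by (rule order_trans[OF abs_triangle_ineq]) (simp add: abs_mult)
    then show "\<bar>3 * L p * (R p)\<^sup>2 + (R p)^3\<bar> \<le> 3 * ((L p)\<^sup>2 / m + m * (R p)^4) + ((R p)\<^sup>2 + (R p)^4)"
      using a b by (simp add: l_def r_def)
  qed
  also have "\<dots> = 3 * ((\<integral>p. (L p)\<^sup>2 \<partial>P) / m + m * (\<integral>p. (R p)^4 \<partial>P)) + ((\<integral>p. (R p)\<^sup>2 \<partial>P) + (\<integral>p. (R p)^4 \<partial>P))"
    using i by simp
  also have "\<dots> \<le> 3 * (1 / m + m * (48 * HH^4 / (real m)\<^sup>2)) + (4 * HH\<^sup>2 / m + 48 * HH^4 / m)"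
  proof (intro add_mono mult_left_mono divide_right_mono)
    have "0 \<le> (\<integral>p. (R p)\<^sup>2 \<partial>P)" by simp
    then show "(\<integral>p. (L p)\<^sup>2 \<partial>P) \<le> 1" using var_one unfolding integral_L2 integral_xi_power mult.assoc by linarith
    have "48 * HH^4 / (real m)\<^sup>2 \<le> 48 * HH^4 / m"
      using m_pos by (intro divide_left_mono) (auto simp: power2_eq_square)
    then show "(\<integral>p. (R p)^4 \<partial>P) \<le> 48 * HH^4 / m" using R_fourth by linarith
  qed (use R_fourth R_second in auto)
  also have "\<dots> = CG / m" using m_pos by (simp add: CG_def field_simps power2_eq_square)
  finally show ?thesis unfolding eq .
qed

end

section \<open>Change of measure\<close>

lemma abs_exp_minus_one_le: "\<bar>exp w - 1\<bar> \<le> \<bar>w\<bar> * exp \<bar>w\<bar>" for w :: real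
proof (cases "0 \<le> w")
  case True
  have "1 - w \<le> exp (- w)" using exp_ge_add_one_self[of "-w"] by simp
  then have "(1 - w) * exp w \<le> exp (- w) * exp w" by (intro mult_right_mono) auto
  then show ?thesis using True by (simp add: exp_minus algebra_simps)
next
  case False
  have "1 + w \<le> exp w" by (rule exp_ge_add_one_self)
  moreover have "\<bar>w\<bar> * 1 \<le> \<bar>w\<bar> * exp \<bar>w\<bar>" by (intro mult_left_mono) auto
  moreover have "exp w \<le> 1" using False by simp
  ultimately show ?thesis using False by linarith
qed

text \<open>The common last step: the ratio is \<open>exp w * (1 + b)\<close> with both errors of
  size \<open>d\<close>. The bound \<open>E\<close> on the exponent keeps the constant finite when
  the exponential is linearised.\<close>

lemma exp_ratio_bound:
  fixes w b a c d :: real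
  assumes w: "\<bar>w\<bar> \<le> a * d" and b: "\<bar>b\<bar> \<le> c * d" and d: "0 \<le> d" "a * d \<le> E" and ac: "0 \<le> a" "0 \<le> c"
  shows "\<bar>exp w * (1 + b) - 1\<bar> \<le> exp E * (a + c) * d"
proof -
  have ew: "exp \<bar>w\<bar> \<le> exp E" using w d by simp
  have ew': "exp w \<le> exp E" using w d by (simp add: abs_le_iff)
  have "\<bar>exp w * (1 + b) - 1\<bar> \<le> \<bar>exp w - 1\<bar> + exp w * \<bar>b\<bar>"
  proof -
    have "exp w * (1 + b) - 1 = (exp w - 1) + exp w * b" by (simp add: algebra_simps)
    then show ?thesis using abs_triangle_ineq[of "exp w - 1" "exp w * b"] by (simp add: abs_mult)
  qed
  also have "\<bar>exp w - 1\<bar> \<le> (a * d) * exp E"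
    by (rule order_trans[OF abs_exp_minus_one_le]) (use w ew ac d in \<open>auto intro!: mult_mono\<close>)
  also have "exp w * \<bar>b\<bar> \<le> exp E * (c * d)" using ew' b by (intro mult_mono) auto
  finally show ?thesis by (simp add: algebra_simps)
qed

context tilt
begin

text \<open>With \<open>u = x * c1\<close>, the logarithm of the density of \<open>P\<close> with respect to the tilted law is
  \<open>m * G u - x * W + Y x u\<close>.\<close>

definition G :: "real \<Rightarrow> real" where
  "G u = kap u - (\<integral>z. ph u z * qd u z \<partial>D) + u / s * tq (qd u)"

text \<open>The four expansions frozen at a single \<open>u\<close> with one constant, so that
  estimates for given \<open>m\<close> and \<open>x\<close> no longer involve a limit.\<close>

definition asym :: "real \<Rightarrow> real \<Rightarrow> bool" where
  "asym K u \<longleftrightarrow> (\<forall>z. \<bar>psi u z\<bar> \<le> K * u^3) \<and>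
     \<bar>G u - u\<^sup>2 / 2 * v2 - u^3 * (v3 / 6 + (real s - 1) / 2 * hh)\<bar> \<le> K * u^4 \<and>
     \<bar>(\<integral>z. (hq (qd u) z)\<^sup>2 * qd u z \<partial>D) - (tq (qd u))\<^sup>2 - v2\<bar> \<le> K * u \<and>
     \<bar>tq (qd u) / s - u * v2\<bar> \<le> K * u\<^sup>2"

lemma asym_eventually: "\<exists>K\<ge>0. \<forall>\<^sub>F u in at_right 0. asym K u"
proof -
  obtain C1 where C1: "0 \<le> C1" "\<forall>\<^sub>F u in at_right 0. 0 < u \<and> u < 1 \<and> (\<forall>z. \<bar>psi u z\<bar> \<le> C1 * u ^ 3)"
    using uO_dest[OF psi_uO] .
  obtain C2 where C2: "0 \<le> C2" "\<forall>\<^sub>F u in at_right 0. 0 < u \<and> u < 1 \<and> (\<forall>z::real. \<bar>G u - u\<^sup>2 / 2 * v2 - u^3 * (v3 / 6 + (real s - 1) / 2 * hh)\<bar> \<le> C2 * u ^ 4)"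
    using uO_dest[OF exponent_expand[folded G_def]] .
  obtain C3 where C3: "0 \<le> C3" "\<forall>\<^sub>F u in at_right 0. 0 < u \<and> u < 1 \<and> (\<forall>z::real. \<bar>(\<integral>z. (hq (qd u) z)\<^sup>2 * qd u z \<partial>D) - (tq (qd u))\<^sup>2 - v2\<bar> \<le> C3 * u ^ 1)"
    using uO_dest[OF variance_expand] .
  obtain C4 where C4: "0 \<le> C4" "\<forall>\<^sub>F u in at_right 0. 0 < u \<and> u < 1 \<and> (\<forall>z::real. \<bar>tq (qd u) / s - u * v2\<bar> \<le> C4 * u ^ 2)"
    using uO_dest[OF tq_linear] .
  let ?K = "C1 + C2 + C3 + C4"
  have "\<forall>\<^sub>F u in at_right 0. asym ?K u"
    using C1(2) C2(2) C3(2) C4(2)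
  proof eventually_elim
    case (elim u)
    then have u: "0 < u" by simp
    have "C1 * u^3 \<le> ?K * u^3" "C2 * u^4 \<le> ?K * u^4" "C3 * u \<le> ?K * u" "C4 * u\<^sup>2 \<le> ?K * u\<^sup>2"
      using u C1(1) C2(1) C3(1) C4(1) by (auto intro!: mult_right_mono)
    with elim show ?case unfolding asym_def power_one_right by (meson order_trans)
  qed
  then show ?thesis using C1(1) C2(1) C3(1) C4(1) by (intro exI[of _ ?K]) auto
qed

end

context normed
begin

lemma qd_density: "bm D (qd u)" "0 \<le> qd u z" "(\<integral>z. qd u z \<partial>D) = 1"
  using qd_pos[of u z] by (auto simp: integral_qd)

lemma Q_ustat: "ustat (density D (qd u)) s h B m \<sigma> \<kappa>"
proof -
  interpret Q: ustat_kernel "density D (qd u)" s h B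
    by (rule kernel_density(1)) (auto simp: integral_qd less_imp_le[OF qd_pos])
  show ?thesis by unfold_locales (use sm sigma_pos kappa_pos sigma_ge in auto)
qed

abbreviation "PQ u \<equiv> PiM {1..m} (\<lambda>_. density D (qd u))"
abbreviation "RQ u \<equiv> ustat.R (density D (qd u)) s h m \<sigma>"

definition Y :: "real \<Rightarrow> real \<Rightarrow> (nat \<Rightarrow> real) \<Rightarrow> real" where
  "Y x u p = x * RQ u p - (\<Sum>i\<in>{1..m}. psi u (p i))"

lemma Q_mu: "ustat.mu (density D (qd u)) s h m \<sigma> = c0 * tq (qd u)"
  unfolding ustat.mu_def[OF Q_ustat]
  by (subst kernel_density(2)) (auto simp: integral_qd less_imp_le[OF qd_pos])

lemma Q_xi: "ustat.xi (density D (qd u)) s h m \<sigma> z = c1 * (hq (qd u) z - tq (qd u))"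
  unfolding ustat.xi_def[OF Q_ustat]
  by (subst kernel_density(2), simp_all add: integral_qd less_imp_le[OF qd_pos] bm_qd,
      subst kernel_density(3), auto simp: integral_qd less_imp_le[OF qd_pos])

text \<open>By the definition of \<open>psi\<close>, \<open>ph u\<close> is \<open>psi u\<close>
  plus a constant plus \<open>x\<close> times the projection of \<open>W\<close> under the tilted
  law. Summing the projections gives \<open>W\<close> minus its tilted mean and its tilted
  remainder.\<close>

lemma log_density_sum:
  assumes u: "u = x * c1"
  shows "(\<Sum>i\<in>{1..m}. ph u (p i) - kap u) = x * (W p - x) - Y x u p - (m * G u - x\<^sup>2)"
proof -
  define E where "E = (\<integral>w. ph u w * qd u w \<partial>D)"
  have ph: "ph u z = psi u z + E + x * ustat.xi (density D (qd u)) s h m \<sigma> z" for z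
    unfolding psi_def Q_xi u E_def by simp
  have sp: "real s \<noteq> 0" using s2 by simp
  have c0': "c0 = m * c1 / s" using c0_eq sp by (simp add: field_simps)
  have "(\<Sum>i\<in>{1..m}. ph u (p i) - kap u) = (\<Sum>i\<in>{1..m}. psi u (p i)) + m * E
      + x * (\<Sum>i\<in>{1..m}. ustat.xi (density D (qd u)) s h m \<sigma> (p i)) - m * kap u"
    unfolding ph by (simp add: sum.distrib sum_subtractf sum_distrib_left)
  also have "(\<Sum>i\<in>{1..m}. ustat.xi (density D (qd u)) s h m \<sigma> (p i)) = W p - c0 * tq (qd u) - RQ u p"
    unfolding ustat.R_def[OF Q_ustat] Q_mu by simp
  finally show ?thesis
    using sp unfolding Y_def G_def c0' E_def[symmetric] by (simp add: u field_simps power2_eq_square)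
qed

lemma tail_representation:
  assumes u: "u = x * c1"
  shows "measure P {p \<in> space P. x < W p} = exp (m * G u - x\<^sup>2) * (\<integral>p. lap x (W p - x) * exp (Y x u p) \<partial>PQ u)"
proof -
  have [measurable]: "W \<in> borel_measurable P" by (rule bm_measurable[OF bm_W])
  let ?S = "{p \<in> space P. x < W p}"
  \<comment> \<open>The indicator times the inverse likelihood ratio, so that integration under the
    tilted law returns the original probability.\<close>
  define F where "F p = indicator ?S p * exp (- (\<Sum>i\<in>{1..m}. ph u (p i) - kap u))" for p
  have S: "?S \<in> sets P" by measurable
  have bF: "bm P F" unfolding F_def[abs_def]
    by (intro bm_mult bm_indicator S bm_exp bm_minus bm_sum bm_diff bm_const M.bm_coord bm_ph)
  have q: "qd u z = exp (ph u z - kap u)" for z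
    using Z_pos[OF bm_ph, of u] by (simp add: qd_def dens_def kap_def exp_diff)
  have "measure P ?S = (\<integral>p. indicator ?S p \<partial>P)" by simp
  also have "\<dots> = (\<integral>p. F p * (\<Prod>i\<in>{1..m}. qd u (p i)) \<partial>P)"
    unfolding F_def q by (simp add: exp_sum[symmetric] mult.assoc exp_add[symmetric])
  also have "\<dots> = (\<integral>p. F p \<partial>PQ u)"
    by (rule M.integral_PiM_density[OF qd_density bF, symmetric])
  also have "\<dots> = (\<integral>p. exp (m * G u - x\<^sup>2) * (lap x (W p - x) * exp (Y x u p)) \<partial>PQ u)"
  proof (rule Bochner_Integration.integral_cong[OF refl])
    fix p assume "p \<in> space (PQ u)"
    then have p: "p \<in> space P" by (simp add: space_PiM)
    show "F p = exp (m * G u - x\<^sup>2) * (lap x (W p - x) * exp (Y x u p))"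
      using p unfolding F_def log_density_sum[OF u] lap_def by (auto simp: exp_add[symmetric] indicator_def)
  qed
  finally show ?thesis by simp
qed

definition gam where "gam = (\<integral>p. (W p)^3 \<partial>P)"

text \<open>\<open>CB\<close> is the constant of \<open>clt_bound\<close>; \<open>C1\<close>,
  \<open>C2\<close> and \<open>CA\<close> are those of \<open>laplace_bound\<close>,
  \<open>remainder_bound\<close> and \<open>exponent_bound\<close>. None of them involves
  \<open>m\<close> or \<open>\<sigma>\<close>, which makes the final constant uniform.\<close>

definition CB where "CB = 2000 * B\<^sup>2 * \<kappa>\<^sup>2 * s + 2000 * B * \<kappa> * s"

definition C1 where "C1 K = 5 * (4 * HH\<^sup>2 + K * \<kappa>^3) + 2 * CB"

definition C2 where
  "C2 K c = ((8 * HH\<^sup>2 + 8 * K\<^sup>2 * \<kappa>^6 * c\<^sup>2) + 4 * (1 + exp (64 * K\<^sup>2 * \<kappa>^6 * c^3))) / 2"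

definition CA where "CA K c = (K * \<kappa>^4 + 2 * HH\<^sup>2 + CG) * c"

text \<open>One pair of \<open>m\<close> and \<open>x\<close> in the moderate range. The condition
  \<open>4 * x \<le> L0\<close> leaves room for doubling the exponent twice: once for the square in
  \<open>remainder_bound\<close>, once for separating \<open>R\<close> from the residual sum in
  \<open>Y_mgf\<close>.\<close>

context
  fixes x K c u y :: real
  assumes u: "u = x * c1" and x1: "1 \<le> x" and xc: "x\<^sup>2 \<le> c * y" and y: "y = sqrt m"
    and K0: "0 \<le> K" and c_nonneg: "0 \<le> c" and asy: "asym K u" and xL: "4 * x \<le> L0"
begin

interpretation Q: ustat "density D (qd u)" s h B m \<sigma> \<kappa> by (rule Q_ustat)

lemma y_pos: "1 \<le> y" "real m = y\<^sup>2" using m_pos by (simp_all add: y)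

lemma u_bounds: "0 < u" "u \<le> \<kappa> * x / y"
  using x1 c1_pos c1_le mult_left_mono[of c1 "\<kappa> / sqrt m" x] by (simp_all add: u y mult.commute)

lemma u_pow: "u ^ k \<le> (\<kappa> * x / y) ^ k"
  using u_bounds by (intro power_mono) auto

lemma x_pow: "x \<le> x\<^sup>2" "x\<^sup>2 \<le> x^4" "x^3 \<le> x^4"
  using x1 power_increasing[of 1 2 x] power_increasing[of 2 4 x] power_increasing[of 3 4 x] by auto

lemma x4: "x^4 / y\<^sup>2 \<le> c * (x\<^sup>2 / y)"
proof -
  have "x\<^sup>2 * x\<^sup>2 \<le> x\<^sup>2 * (c * y)" using xc by (intro mult_left_mono) auto
  then have "x^4 / y\<^sup>2 \<le> x\<^sup>2 * (c * y) / y\<^sup>2" by (intro divide_right_mono) (auto simp: power4_eq_xxxx power2_eq_square mult_ac)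
  also have "\<dots> = c * (x\<^sup>2 / y)" using y_pos by (simp add: power2_eq_square field_simps)
  finally show ?thesis .
qed

text \<open>Inserting \<open>u = x * c1\<close> into the expansion of \<open>G\<close> gives
  \<open>x^2 / 2\<close> up to \<open>var_defect\<close> and \<open>gam * x^3 / 6\<close> up to
  \<open>gamma_bound\<close>, with a remainder \<open>m * u^4\<close>. All three errors are at most
  of order \<open>x^4 / m\<close>, as \<open>x \<ge> 1\<close>.\<close>

lemma exponent_bound:
  "\<bar>(m * G u - x\<^sup>2) + x\<^sup>2 / 2 - gam * x^3 / 6\<bar> \<le> (K * \<kappa>^4 + 2 * HH\<^sup>2 + CG) * c * (x\<^sup>2 / y)"
proof -
  define g where "g = G u - u\<^sup>2 / 2 * v2 - u^3 * (v3 / 6 + (real s - 1) / 2 * hh)"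
  have g: "\<bar>g\<bar> \<le> K * u^4" using asy by (simp add: asym_def g_def)
  define a where "a = m * c1\<^sup>2 * v2 - 1"
  define b where "b = m * c1^3 * (v3 + 3 * (real s - 1) * hh) - gam"
  have CG0: "0 \<le> CG" by (simp add: CG_def)
  have ab: "\<bar>a\<bar> \<le> 4 * HH\<^sup>2 / m" "\<bar>b\<bar> \<le> CG / m"
    using var_defect gamma_bound by (auto simp: a_def b_def gam_def abs_minus_commute)
  have eq: "(m * G u - x\<^sup>2) + x\<^sup>2 / 2 - gam * x^3 / 6 = m * g + x\<^sup>2 / 2 * a + x^3 / 6 * b"
    unfolding g_def a_def b_def u by (simp add: field_simps power2_eq_square power3_eq_cube)
  have 1: "\<bar>m * g\<bar> \<le> K * \<kappa>^4 * (x^4 / y\<^sup>2)"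
  proof -
    have "\<bar>m * g\<bar> \<le> m * (K * u^4)" using g by (simp add: abs_mult mult_left_mono)
    also have "\<dots> \<le> m * (K * (\<kappa> * x / y)^4)" using u_pow[of 4] K0 by (intro mult_left_mono) auto
    also have "\<dots> = K * \<kappa>^4 * (x^4 / y\<^sup>2)"
      using y_pos by (simp add: power_divide power_mult_distrib) (simp add: field_simps power2_eq_square power4_eq_xxxx)
    finally show ?thesis .
  qed
  have 2: "\<bar>x\<^sup>2 / 2 * a\<bar> \<le> 2 * HH\<^sup>2 * (x^4 / y\<^sup>2)"
  proof -
    have "\<bar>x\<^sup>2 / 2 * a\<bar> \<le> x\<^sup>2 / 2 * (4 * HH\<^sup>2 / m)" unfolding abs_mult using ab by (intro mult_mono) auto
    also have "\<dots> = (2 * HH\<^sup>2 / y\<^sup>2) * x\<^sup>2" by (simp add: y_pos)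
    also have "\<dots> \<le> (2 * HH\<^sup>2 / y\<^sup>2) * x^4" using x_pow by (intro mult_left_mono) auto
    finally show ?thesis by simp
  qed
  have 3: "\<bar>x^3 / 6 * b\<bar> \<le> CG * (x^4 / y\<^sup>2)"
  proof -
    have "\<bar>x^3 / 6 * b\<bar> \<le> x^3 * (CG / m)" unfolding abs_mult using ab x1 by (intro mult_mono) auto
    also have "\<dots> = (CG / y\<^sup>2) * x^3" by (simp add: y_pos)
    also have "\<dots> \<le> (CG / y\<^sup>2) * x^4" using x_pow CG0 by (intro mult_left_mono) auto
    finally show ?thesis by simp
  qed
  have "\<bar>(m * G u - x\<^sup>2) + x\<^sup>2 / 2 - gam * x^3 / 6\<bar> \<le> (K * \<kappa>^4 + 2 * HH\<^sup>2 + CG) * (x^4 / y\<^sup>2)"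
    unfolding eq distrib_right using 1 2 3 by linarith
  also have "\<dots> \<le> (K * \<kappa>^4 + 2 * HH\<^sup>2 + CG) * (c * (x\<^sup>2 / y))"
    using x4 K0 CG0 by (intro mult_left_mono) auto
  finally show ?thesis by (simp add: mult.assoc)
qed

lemma inv_m_le: "1 / m \<le> x / y"
proof -
  have "1 / y\<^sup>2 \<le> 1 / y" using y_pos by (intro divide_left_mono) (auto simp: power2_eq_square)
  also have "\<dots> \<le> x / y" using x1 y_pos by (intro divide_right_mono) auto
  finally show ?thesis by (simp add: y_pos)
qed

lemma var_defect_le: "\<bar>1 - m * c1\<^sup>2 * v2\<bar> \<le> 4 * HH\<^sup>2 * (x / y)"
proof -
  have "4 * HH\<^sup>2 * (1 / m) \<le> 4 * HH\<^sup>2 * (x / y)" by (intro mult_left_mono inv_m_le) auto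
  then show ?thesis using var_defect by simp
qed

lemma Q_variance_defect:
  "\<bar>1 - m * (\<integral>z. (Q.xi z)\<^sup>2 \<partial>density D (qd u))\<bar> \<le> (4 * HH\<^sup>2 + K * \<kappa>^3) * (x / y)"
proof -
  define V where "V = (\<integral>z. (hq (qd u) z)\<^sup>2 * qd u z \<partial>D) - (tq (qd u))\<^sup>2"
  have V: "\<bar>V - v2\<bar> \<le> K * u" using asy by (simp add: asym_def V_def)
  have [measurable]: "qd u \<in> borel_measurable D" "hq (qd u) \<in> borel_measurable D"
    by (auto intro: bm_measurable)
  have "(\<integral>z. (Q.xi z)\<^sup>2 \<partial>density D (qd u)) = (\<integral>z. qd u z * (c1 * (hq (qd u) z - tq (qd u)))\<^sup>2 \<partial>D)"
    unfolding Q_xi by (subst integral_density) (auto simp: less_imp_le[OF qd_pos])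
  also have "\<dots> = (\<integral>z. c1\<^sup>2 * ((hq (qd u) z)\<^sup>2 * qd u z - 2 * tq (qd u) * (hq (qd u) z * qd u z) + (tq (qd u))\<^sup>2 * qd u z) \<partial>D)"
    by (rule Bochner_Integration.integral_cong) (auto simp: algebra_simps power2_eq_square)
  also have "\<dots> = c1\<^sup>2 * V"
  proof -
    have "integrable D (\<lambda>z. (hq (qd u) z)\<^sup>2 * qd u z)" "integrable D (\<lambda>z. hq (qd u) z * qd u z)" "integrable D (qd u)"
      by (intro D.bm_integrable bm_mult bm_power bm_hq bm_qd)+
    then have "(\<integral>z. (hq (qd u) z)\<^sup>2 * qd u z - 2 * tq (qd u) * (hq (qd u) z * qd u z) + (tq (qd u))\<^sup>2 * qd u z \<partial>D)
        = (\<integral>z. (hq (qd u) z)\<^sup>2 * qd u z \<partial>D) - 2 * tq (qd u) * tq (qd u) + (tq (qd u))\<^sup>2"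
      by (simp add: integral_hq[OF bm_qd integral_qd] integral_qd)
    also have "\<dots> = V" by (simp add: V_def power2_eq_square)
    finally show ?thesis by simp
  qed
  finally have eq: "(\<integral>z. (Q.xi z)\<^sup>2 \<partial>density D (qd u)) = c1\<^sup>2 * V" .
  have "\<bar>1 - m * (c1\<^sup>2 * V)\<bar> \<le> \<bar>1 - m * c1\<^sup>2 * v2\<bar> + \<bar>m * c1\<^sup>2 * (V - v2)\<bar>" by (simp add: algebra_simps)
  also have "\<bar>1 - m * c1\<^sup>2 * v2\<bar> \<le> 4 * HH\<^sup>2 * (x / y)"
    by (rule var_defect_le)
  also have "\<bar>m * c1\<^sup>2 * (V - v2)\<bar> \<le> K * \<kappa>^3 * (x / y)"
  proof -
    have "m * c1\<^sup>2 \<le> m * (\<kappa> / sqrt m)\<^sup>2" using c1_le c1_pos by (intro mult_left_mono power_mono) auto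
    also have "\<dots> = \<kappa>\<^sup>2" using m_pos by (simp add: power_divide)
    finally have mc: "m * c1\<^sup>2 \<le> \<kappa>\<^sup>2" .
    have "\<bar>m * c1\<^sup>2 * (V - v2)\<bar> = (m * c1\<^sup>2) * \<bar>V - v2\<bar>" by (simp add: abs_mult)
    also have "\<dots> \<le> \<kappa>\<^sup>2 * (K * (\<kappa> * x / y))"
      using mc V order_trans[OF V mult_left_mono[OF u_bounds(2) K0]] by (intro mult_mono) auto
    also have "\<dots> = K * \<kappa>^3 * (x / y)" by (simp add: power2_eq_square power3_eq_cube)
    finally show ?thesis .
  qed
  finally show ?thesis unfolding eq by (simp add: algebra_simps)
qed

text \<open>The tilt \<open>u = x * c1\<close> is tuned so that \<open>m * c1 * u * v2\<close> is
  \<open>x\<close> up to the variance defect: the rare event becomes typical under the tilted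
  law.\<close>

lemma Q_mean_shift: "\<bar>Q.mu - x\<bar> \<le> (4 * HH\<^sup>2 + K * \<kappa>^3) * (x\<^sup>2 / y)"
proof -
  have sp: "real s \<noteq> 0" using s2 by simp
  have c0': "c0 = m * c1 / s" using c0_eq sp by (simp add: field_simps)
  define e where "e = tq (qd u) / s - u * v2"
  have e: "\<bar>e\<bar> \<le> K * u\<^sup>2" using asy by (simp add: asym_def e_def)
  have "Q.mu = m * c1 * (tq (qd u) / s)" unfolding Q_mu c0' by simp
  also have "\<dots> = m * c1 * (u * v2 + e)" by (simp add: e_def)
  finally have "Q.mu - x = x * (m * c1\<^sup>2 * v2 - 1) + m * c1 * e"
    by (simp add: u algebra_simps power2_eq_square)
  also have "\<bar>\<dots>\<bar> \<le> \<bar>x * (m * c1\<^sup>2 * v2 - 1)\<bar> + \<bar>m * c1 * e\<bar>" by (rule abs_triangle_ineq)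
  also have "\<bar>x * (m * c1\<^sup>2 * v2 - 1)\<bar> \<le> 4 * HH\<^sup>2 * (x\<^sup>2 / y)"
  proof -
    have "\<bar>x * (m * c1\<^sup>2 * v2 - 1)\<bar> = x * \<bar>1 - m * c1\<^sup>2 * v2\<bar>" using x1 by (simp add: abs_mult abs_minus_commute)
    also have "\<dots> \<le> x * (4 * HH\<^sup>2 * (x / y))"
      using x1 by (intro mult_left_mono var_defect_le) auto
    finally show ?thesis by (simp add: power2_eq_square mult_ac)
  qed
  also have "\<bar>m * c1 * e\<bar> \<le> K * \<kappa>^3 * (x\<^sup>2 / y)"
  proof -
    have "\<bar>m * c1 * e\<bar> = m * c1 * \<bar>e\<bar>" using c1_pos by (simp add: abs_mult)
    also have "\<dots> \<le> m * (\<kappa> / y) * (K * (\<kappa> * x / y)\<^sup>2)"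
    proof (rule mult_mono[OF mult_left_mono])
      show "c1 \<le> \<kappa> / y" using c1_le by (simp only: y)
      show "\<bar>e\<bar> \<le> K * (\<kappa> * x / y)\<^sup>2" by (rule order_trans[OF e mult_left_mono[OF u_pow[of 2] K0]])
      show "0 \<le> m * (\<kappa> / y)" using kappa_pos y_pos(1) by simp
    qed simp_all
    also have "\<dots> = K * \<kappa>^3 * (x\<^sup>2 / y)"
      using y_pos by (simp add: power_divide power_mult_distrib) (simp add: field_simps power2_eq_square power3_eq_cube)
    finally show ?thesis .
  qed
  finally show ?thesis by (simp add: distrib_right add_divide_distrib)
qed

text \<open>The factor 5 is twice the 2 of \<open>clt_bound\<close>, doubled by
  \<open>lap_compare\<close>, plus one for the mean shift, which costs only \<open>1 / x\<close> of
  its size.\<close>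

lemma laplace_bound:
  "\<bar>(\<integral>p. lap x (W p - x) \<partial>Q.P) - mills x\<bar> \<le> (5 * (4 * HH\<^sup>2 + K * \<kappa>^3) + 2 * CB) * (x / y)"
proof -
  define e where "e = 2 * ((4 * HH\<^sup>2 + K * \<kappa>^3) * (x / y)) + CB * (x / y)"
  have le: "\<bar>measure Q.P {p \<in> space Q.P. (W p - x) - (Q.mu - x) \<le> t} - Phi t\<bar> \<le> e" for t
  proof -
    have "CB / sqrt m \<le> CB * (x / y)"
    proof -
      have "0 \<le> CB" using B_pos kappa_pos by (simp add: CB_def)
      then have "CB * (1 / y) \<le> CB * (x / y)" using x1 y_pos by (intro mult_left_mono divide_right_mono) auto
      then show ?thesis by (simp add: y)
    qed
    then show ?thesis using Q.clt_bound[of t] Q_variance_defect by (simp add: CB_def e_def)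
  qed
  have "\<bar>(\<integral>p. lap x (W p - x) \<partial>Q.P) - mills x\<bar> \<le> 2 * e + \<bar>Q.mu - x\<bar> / x"
  proof (rule laplace_normal_approx[OF Q.M.P.prob_space_axioms _ _ le])
    show "(\<lambda>p. W p - x) \<in> borel_measurable Q.P" using bm_measurable[OF Q.bm_W] by simp
  qed (use x1 in auto)
  also have "\<bar>Q.mu - x\<bar> / x \<le> (4 * HH\<^sup>2 + K * \<kappa>^3) * (x\<^sup>2 / y) / x"
    using Q_mean_shift x1 by (intro divide_right_mono) auto
  also have "\<dots> = (4 * HH\<^sup>2 + K * \<kappa>^3) * (x / y)" using x1 by (simp add: power2_eq_square)
  finally show ?thesis by (simp add: e_def algebra_simps)
qed

section \<open>Second and exponential moments of the error term in the likelihood ratio\<close>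

definition SM :: "(nat \<Rightarrow> real) \<Rightarrow> real" where "SM p = (\<Sum>i\<in>{1..m}. psi u (p i))"

lemma bm_psi: "bm D (psi u)"
  unfolding psi_def[abs_def] by (intro bm_diff bm_mult bm_ph bm_hq bm_qd bm_const)

lemma bm_density: "bm D f \<Longrightarrow> bm (density D (qd u)) f"
  by (simp add: bm_def)

lemma bm_SM: "bm Q.P SM"
  unfolding SM_def[abs_def] by (intro bm_sum Q.M.bm_coord bm_density bm_psi)

lemma osc_SM: "Q.M.osc {1..m} (2 * (K * u^3)) SM"
  unfolding Q.M.osc_def
proof (intro ballI)
  fix k p z assume k: "k \<in> {1..m}"
  have "(\<Sum>i\<in>{1..m} - {k}. psi u ((p(k := z)) i)) = (\<Sum>i\<in>{1..m} - {k}. psi u (p i))" by (rule sum.cong) auto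
  then have "SM p - SM (p(k := z)) = psi u (p k) - psi u z"
    unfolding SM_def using sum.remove[OF _ k, of "\<lambda>i. psi u (p i)"] sum.remove[OF _ k, of "\<lambda>i. psi u ((p(k := z)) i)"] by simp
  moreover have "\<bar>psi u (p k)\<bar> \<le> K * u^3" "\<bar>psi u z\<bar> \<le> K * u^3" using asy by (auto simp: asym_def)
  ultimately show "\<bar>SM p - SM (p(k := z))\<bar> \<le> 2 * (K * u^3)" by linarith
qed

lemma integral_SM: "(\<integral>p. SM p \<partial>Q.P) = 0"
proof -
  have [measurable]: "qd u \<in> borel_measurable D" "psi u \<in> borel_measurable D"
    using bm_psi by (auto intro: bm_measurable)
  have "(\<integral>p. SM p \<partial>Q.P) = (\<Sum>i\<in>{1..m}. \<integral>p. psi u (p i) \<partial>Q.P)"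
    unfolding SM_def by (intro Bochner_Integration.integral_sum Q.M.P.bm_integrable Q.M.bm_coord bm_density bm_psi)
  also have "\<dots> = (\<Sum>i\<in>{1..m}. \<integral>z. psi u z \<partial>density D (qd u))"
    by (intro sum.cong refl Q.M.integral_coord bm_density bm_psi)
  also have "(\<integral>z. psi u z \<partial>density D (qd u)) = (\<integral>z. qd u z * psi u z \<partial>D)"
    by (subst integral_density) (auto simp: less_imp_le[OF qd_pos])
  also have "\<dots> = 0" using integral_psi[of u] by (simp add: mult.commute)
  finally show ?thesis by simp
qed

lemma mu6: "m * (u^3)\<^sup>2 \<le> \<kappa>^6 * (x^6 / y^4)"
proof -
  have "m * (u^3)\<^sup>2 = m * u^6" by simp
  also have "\<dots> \<le> m * (\<kappa> * x / y)^6" using u_pow[of 6] by (intro mult_left_mono) auto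
  also have "\<dots> = \<kappa>^6 * (x^6 / y^4)"
  proof -
    have "y^6 = y\<^sup>2 * y^4" by (simp flip: power_add)
    then have "m * (\<kappa> * x / y)^6 = y\<^sup>2 * (\<kappa>^6 * x^6) / (y\<^sup>2 * y^4)"
      by (simp only: y_pos(2) power_divide power_mult_distrib times_divide_eq_right)
    also have "\<dots> = \<kappa>^6 * x^6 / y^4" by (rule mult_divide_mult_cancel_left) (use y_pos(1) in simp)
    finally show ?thesis by simp
  qed
  finally show ?thesis .
qed

text \<open>Two uses of the range of \<open>x\<close>: the first form gives a second moment of order
  \<open>x^2 / m\<close>, the second a uniform bound on exponential moments.\<close>

lemma power6_bounds: "x^6 / y^4 \<le> c\<^sup>2 * (x\<^sup>2 / y\<^sup>2)" "x^6 / y^4 \<le> c^3"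
proof -
  have x2: "0 \<le> x\<^sup>2" by simp
  have "(x\<^sup>2)\<^sup>2 \<le> (c * y)\<^sup>2" using xc by (intro power_mono) auto
  then have "x\<^sup>2 * (x\<^sup>2)\<^sup>2 \<le> x\<^sup>2 * (c * y)\<^sup>2" by (intro mult_left_mono) auto
  moreover have "x^6 = x\<^sup>2 * (x\<^sup>2)\<^sup>2" by (simp flip: power_mult power_add)
  ultimately have le: "x^6 \<le> x\<^sup>2 * (c * y)\<^sup>2" by (simp only:)
  have "x^6 / y^4 \<le> x\<^sup>2 * (c * y)\<^sup>2 / y^4" by (rule divide_right_mono[OF le]) simp
  also have "\<dots> = c\<^sup>2 * (x\<^sup>2 / y\<^sup>2)"
  proof -
    have "y^4 = y\<^sup>2 * y\<^sup>2" by (simp flip: power_add)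
    then have "x\<^sup>2 * (c * y)\<^sup>2 / y^4 = y\<^sup>2 * (c\<^sup>2 * x\<^sup>2) / (y\<^sup>2 * y\<^sup>2)"
      by (simp only: power_mult_distrib mult_ac)
    also have "\<dots> = c\<^sup>2 * x\<^sup>2 / y\<^sup>2" by (rule mult_divide_mult_cancel_left) (use y_pos(1) in simp)
    finally show ?thesis by simp
  qed
  finally show "x^6 / y^4 \<le> c\<^sup>2 * (x\<^sup>2 / y\<^sup>2)" .
  have "(x\<^sup>2)^3 \<le> (c * y)^3" using xc by (intro power_mono) auto
  moreover have "x^6 = (x\<^sup>2)^3" by (simp flip: power_mult)
  ultimately have le: "x^6 \<le> (c * y)^3" by (simp only:)
  have "x^6 / y^4 \<le> (c * y)^3 / y^4" by (rule divide_right_mono[OF le]) simp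
  also have "\<dots> = c^3 / y"
  proof -
    have "y^4 = y^3 * y" by (simp flip: power_Suc2)
    then have "(c * y)^3 / y^4 = y^3 * c^3 / (y^3 * y)" by (simp only: power_mult_distrib mult_ac)
    also have "\<dots> = c^3 / y" by (rule mult_divide_mult_cancel_left) (use y_pos(1) in simp)
    finally show ?thesis .
  qed
  also have "\<dots> \<le> c^3 / 1" using y_pos c_nonneg by (intro divide_left_mono) auto
  finally show "x^6 / y^4 \<le> c^3" by simp
qed

lemma SM_second: "(\<integral>p. (SM p)\<^sup>2 \<partial>Q.P) \<le> 4 * K\<^sup>2 * \<kappa>^6 * c\<^sup>2 * (x\<^sup>2 / y\<^sup>2)"
proof -
  have "(\<integral>p. (SM p)\<^sup>2 \<partial>Q.P) \<le> (\<integral>p. SM p \<partial>Q.P)\<^sup>2 + card {1..m} * (2 * (K * u^3))\<^sup>2"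
    by (rule Q.M.bounded_differences_variance[OF _ subset_refl bm_SM _ osc_SM]) auto
  also have "\<dots> = 4 * K\<^sup>2 * (m * (u^3)\<^sup>2)" by (simp add: integral_SM power_mult_distrib mult_ac)
  also have "\<dots> \<le> 4 * K\<^sup>2 * (\<kappa>^6 * (c\<^sup>2 * (x\<^sup>2 / y\<^sup>2)))"
    using order_trans[OF mu6 mult_left_mono[OF power6_bounds(1), of "\<kappa>^6"]] by (intro mult_left_mono) auto
  finally show ?thesis by (simp add: mult_ac)
qed

lemma SM_mgf: assumes r: "\<bar>r\<bar> \<le> 4" shows "(\<integral>p. exp (r * SM p) \<partial>Q.P) \<le> exp (64 * K\<^sup>2 * \<kappa>^6 * c^3)"
proof -
  have b: "bm Q.P (\<lambda>p. r * SM p)" by (intro bm_mult bm_const bm_SM)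
  have o: "Q.M.osc {1..m} (\<bar>r\<bar> * (2 * (K * u^3))) (\<lambda>p. r * SM p)"
    using osc_SM unfolding Q.M.osc_def by (auto simp: abs_mult mult_left_mono simp flip: right_diff_distrib)
  have "(\<integral>p. exp (r * SM p) \<partial>Q.P) \<le> exp ((\<integral>p. r * SM p \<partial>Q.P) + card {1..m} * (\<bar>r\<bar> * (2 * (K * u^3)))\<^sup>2)"
    by (rule Q.M.bounded_differences_mgf[OF _ subset_refl b _ o]) auto
  also have "\<dots> = exp (r\<^sup>2 * (4 * K\<^sup>2 * (m * (u^3)\<^sup>2)))" by (simp add: integral_SM power_mult_distrib mult_ac)
  also have "\<dots> \<le> exp (16 * (4 * K\<^sup>2 * (\<kappa>^6 * c^3)))"
  proof (subst exp_le_cancel_iff, rule mult_mono)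
    show "r\<^sup>2 \<le> 16" using r abs_le_square_iff[of r 4] by simp
    show "4 * K\<^sup>2 * (m * (u^3)\<^sup>2) \<le> 4 * K\<^sup>2 * (\<kappa>^6 * c^3)"
      using order_trans[OF mu6 mult_left_mono[OF power6_bounds(2), of "\<kappa>^6"]] by (intro mult_left_mono) auto
  qed auto
  finally show ?thesis by (simp add: mult_ac)
qed

lemma Y_eq: "Y x u p = x * Q.R p - SM p" by (simp add: Y_def SM_def)

lemma bm_Y: "bm Q.P (Y x u)" unfolding Y_eq[abs_def] by (intro bm_diff bm_mult bm_const Q.bm_R bm_SM)

lemma Y_second: "(\<integral>p. (Y x u p)\<^sup>2 \<partial>Q.P) \<le> (8 * HH\<^sup>2 + 8 * K\<^sup>2 * \<kappa>^6 * c\<^sup>2) * (x / y)\<^sup>2"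
proof -
  have i: "integrable Q.P (\<lambda>p. (Q.R p)\<^sup>2)" "integrable Q.P (\<lambda>p. (SM p)\<^sup>2)" "integrable Q.P (\<lambda>p. (Y x u p)\<^sup>2)"
    by (intro Q.M.P.bm_integrable bm_power Q.bm_R bm_SM bm_Y)+
  have "(\<integral>p. (Y x u p)\<^sup>2 \<partial>Q.P) \<le> (\<integral>p. 2 * x\<^sup>2 * (Q.R p)\<^sup>2 + 2 * (SM p)\<^sup>2 \<partial>Q.P)"
  proof (rule integral_mono)
    fix p
    have "0 \<le> (x * Q.R p + SM p)\<^sup>2" by simp
    then show "(Y x u p)\<^sup>2 \<le> 2 * x\<^sup>2 * (Q.R p)\<^sup>2 + 2 * (SM p)\<^sup>2"
      by (simp add: Y_eq power2_eq_square algebra_simps)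
  qed (use i in auto)
  also have "\<dots> = 2 * x\<^sup>2 * (\<integral>p. (Q.R p)\<^sup>2 \<partial>Q.P) + 2 * (\<integral>p. (SM p)\<^sup>2 \<partial>Q.P)" using i by simp
  also have "\<dots> \<le> 2 * x\<^sup>2 * (4 * HH\<^sup>2 / m) + 2 * (4 * K\<^sup>2 * \<kappa>^6 * c\<^sup>2 * (x\<^sup>2 / y\<^sup>2))"
    using Q.R_second SM_second by (intro add_mono mult_left_mono) (auto simp: Q.HH_def HH_def)
  also have "\<dots> = (8 * HH\<^sup>2 + 8 * K\<^sup>2 * \<kappa>^6 * c\<^sup>2) * (x / y)\<^sup>2"
    using y_pos by (simp add: field_simps power_divide)
  finally show ?thesis .
qed

lemma Y_mgf: assumes r: "\<bar>r\<bar> \<le> 2" shows "(\<integral>p. exp (r * Y x u p) \<partial>Q.P) \<le> 1 + exp (64 * K\<^sup>2 * \<kappa>^6 * c^3)"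
proof -
  have i: "integrable Q.P (\<lambda>p. exp ((2 * r * x) * Q.R p))" "integrable Q.P (\<lambda>p. exp ((- 2 * r) * SM p))"
    "integrable Q.P (\<lambda>p. exp (r * Y x u p))"
    by (intro Q.M.P.bm_integrable bm_exp bm_mult bm_const Q.bm_R bm_SM bm_Y)+
  have "(\<integral>p. exp (r * Y x u p) \<partial>Q.P) \<le> (\<integral>p. exp ((2 * r * x) * Q.R p) / 2 + exp ((- 2 * r) * SM p) / 2 \<partial>Q.P)"
  proof (rule integral_mono)
    fix p
    have "2 * exp (r * x * Q.R p) * exp (- r * SM p) \<le> (exp (r * x * Q.R p))\<^sup>2 + (exp (- r * SM p))\<^sup>2"
      by (rule sum_squares_bound)
    then show "exp (r * Y x u p) \<le> exp ((2 * r * x) * Q.R p) / 2 + exp ((- 2 * r) * SM p) / 2"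
      by (simp add: Y_eq exp_add[symmetric] power2_eq_square algebra_simps)
  qed (use i in auto)
  also have "\<dots> = (\<integral>p. exp ((2 * r * x) * Q.R p) \<partial>Q.P) / 2 + (\<integral>p. exp ((- 2 * r) * SM p) \<partial>Q.P) / 2" using i by simp
  also have "\<dots> \<le> 2 / 2 + exp (64 * K\<^sup>2 * \<kappa>^6 * c^3) / 1"
  proof (intro add_mono frac_le)
    have "\<bar>2 * r * x\<bar> \<le> 2 * 2 * x" using r x1 unfolding abs_mult by (intro mult_mono) auto
    then have "\<bar>2 * r * x\<bar> \<le> Q.L0" using xL by (simp add: L0_def Q.L0_def)
    then show "(\<integral>p. exp ((2 * r * x) * Q.R p) \<partial>Q.P) \<le> 2" by (rule Q.R_mgf)
    show "(\<integral>p. exp ((- 2 * r) * SM p) \<partial>Q.P) \<le> exp (64 * K\<^sup>2 * \<kappa>^6 * c^3)" using r by (intro SM_mgf) auto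
  qed auto
  finally show ?thesis by simp
qed

lemma remainder_bound:
  "\<bar>(\<integral>p. lap x (W p - x) * exp (Y x u p) \<partial>Q.P) - (\<integral>p. lap x (W p - x) \<partial>Q.P)\<bar> \<le> C2 K c * (x / y)"
proof -
  have bl: "bm Q.P (\<lambda>p. lap x (W p - x))"
  proof (rule bmI[where K=1])
    have [measurable]: "W \<in> borel_measurable Q.P" by (rule bm_measurable[OF Q.bm_W])
    show "(\<lambda>p. lap x (W p - x)) \<in> borel_measurable Q.P" by measurable
    show "\<bar>lap x (W p - x)\<bar> \<le> 1" for p using lap_bounds[of x "W p - x"] x1 by simp
  qed
  \<comment> \<open>The weight \<open>t\<close> balances the two sides of the arithmetic-geometric
    inequality: the second moment of \<open>Y\<close> is \<open>O(t^2)\<close>, so both terms below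
    are \<open>O(t)\<close>.\<close>
  define t where "t = x / y"
  have t: "t > 0" using x1 y_pos by (simp add: t_def)
  have i: "integrable Q.P (\<lambda>p. lap x (W p - x) * exp (Y x u p))" "integrable Q.P (\<lambda>p. lap x (W p - x))"
    "integrable Q.P (\<lambda>p. (Y x u p)\<^sup>2)" "integrable Q.P (\<lambda>p. exp (2 * Y x u p))" "integrable Q.P (\<lambda>p. exp (- 2 * Y x u p))"
    by (intro Q.M.P.bm_integrable bl bm_mult bm_exp bm_power bm_const bm_Y)+
  have eq: "(\<integral>p. lap x (W p - x) * exp (Y x u p) \<partial>Q.P) - (\<integral>p. lap x (W p - x) \<partial>Q.P)
     = (\<integral>p. lap x (W p - x) * exp (Y x u p) - lap x (W p - x) \<partial>Q.P)" using i by simp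
  have "\<bar>\<integral>p. lap x (W p - x) * exp (Y x u p) - lap x (W p - x) \<partial>Q.P\<bar> \<le> (\<integral>p. ((Y x u p)\<^sup>2 / t + t * (2 * exp (2 * Y x u p) + 2 * exp (- 2 * Y x u p))) / 2 \<partial>Q.P)"
  proof (rule order_trans[OF integral_abs_bound integral_mono])
    show "integrable Q.P (\<lambda>p. \<bar>lap x (W p - x) * exp (Y x u p) - lap x (W p - x)\<bar>)" using i by simp
    show "integrable Q.P (\<lambda>p. ((Y x u p)\<^sup>2 / t + t * (2 * exp (2 * Y x u p) + 2 * exp (- 2 * Y x u p))) / 2)" using i by simp
    fix p
    define w where "w = Y x u p"
    have "\<bar>lap x (W p - x) * exp w - lap x (W p - x)\<bar> = \<bar>lap x (W p - x)\<bar> * \<bar>exp w - 1\<bar>"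
      by (simp add: abs_mult[symmetric] algebra_simps)
    also have "\<dots> \<le> 1 * (\<bar>w\<bar> * exp \<bar>w\<bar>)"
      using lap_bounds[of x "W p - x"] x1 abs_exp_minus_one_le[of w] by (intro mult_mono) auto
    also have "\<dots> \<le> \<bar>w\<bar> * (exp w + exp (- w))" by (auto intro!: mult_left_mono simp: abs_if)
    also have "\<dots> \<le> (w\<^sup>2 / t + t * (exp w + exp (- w))\<^sup>2) / 2"
    proof -
      define r where "r = sqrt t"
      have r: "r > 0" "t = r * r" using t by (auto simp: r_def)
      have "2 * (\<bar>w\<bar> / r) * (r * (exp w + exp (- w))) \<le> (\<bar>w\<bar> / r)\<^sup>2 + (r * (exp w + exp (- w)))\<^sup>2" by (rule sum_squares_bound)
      moreover have "2 * (\<bar>w\<bar> / r) * (r * (exp w + exp (- w))) = 2 * (\<bar>w\<bar> * (exp w + exp (- w)))" using r by simp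
      moreover have "(\<bar>w\<bar> / r)\<^sup>2 = w\<^sup>2 / t" "(r * (exp w + exp (- w)))\<^sup>2 = t * (exp w + exp (- w))\<^sup>2"
        using r by (simp_all add: power_divide power_mult_distrib power2_eq_square)
      ultimately show ?thesis by simp
    qed
    also have "\<dots> \<le> (w\<^sup>2 / t + t * (2 * exp (2 * w) + 2 * exp (- 2 * w))) / 2"
    proof -
      have "0 \<le> (exp w - exp (- w))\<^sup>2" by simp
      then have "(exp w + exp (- w))\<^sup>2 \<le> 2 * (exp w)\<^sup>2 + 2 * (exp (- w))\<^sup>2" by (simp add: power2_eq_square algebra_simps)
      also have "\<dots> = 2 * exp (2 * w) + 2 * exp (- 2 * w)" by (simp add: power2_eq_square exp_add[symmetric])
      finally show ?thesis using t by (intro divide_right_mono add_left_mono mult_left_mono) auto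
    qed
    finally show "\<bar>lap x (W p - x) * exp (Y x u p) - lap x (W p - x)\<bar> \<le> ((Y x u p)\<^sup>2 / t + t * (2 * exp (2 * Y x u p) + 2 * exp (- 2 * Y x u p))) / 2"
      by (simp add: w_def)
  qed
  also have "\<dots> = ((\<integral>p. (Y x u p)\<^sup>2 \<partial>Q.P) / t + t * (2 * (\<integral>p. exp (2 * Y x u p) \<partial>Q.P) + 2 * (\<integral>p. exp (- 2 * Y x u p) \<partial>Q.P))) / 2"
    using i by simp
  also have "\<dots> \<le> ((8 * HH\<^sup>2 + 8 * K\<^sup>2 * \<kappa>^6 * c\<^sup>2) * t\<^sup>2 / t + t * (2 * (1 + exp (64 * K\<^sup>2 * \<kappa>^6 * c^3)) + 2 * (1 + exp (64 * K\<^sup>2 * \<kappa>^6 * c^3)))) / 2"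
    using Y_second Y_mgf[of 2] Y_mgf[of "-2"] t by (intro divide_right_mono add_mono mult_left_mono) (auto simp: t_def)
  also have "\<dots> = C2 K c * t" using t by (simp add: C2_def power2_eq_square field_simps)
  finally show ?thesis unfolding eq by (simp add: t_def)
qed

lemma tail_ratio:
  "\<bar>measure P {p \<in> space P. x < W p} / ((1 - Phi x) * exp (gam * x^3 / 6)) - 1\<bar>
     \<le> exp (CA K c * c) * (CA K c + 6 * (C1 K + C2 K c)) * (x\<^sup>2 / y)"
proof -
  define I where "I = (\<integral>p. lap x (W p - x) * exp (Y x u p) \<partial>Q.P)"
  define w where "w = (m * G u - x\<^sup>2) + x\<^sup>2 / 2 - gam * x^3 / 6"
  define b where "b = I / mills x - 1"
  have "0 < 1 / (6 * x)" using x1 by simp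
  then have mp: "0 < mills x" using mills_ge[OF x1] by linarith
  have "\<bar>I - mills x\<bar> \<le> (C1 K + C2 K c) * (x / y)"
    using remainder_bound laplace_bound[folded C1_def] unfolding I_def distrib_right[of "C1 K" "C2 K c"] by linarith
  then have "\<bar>I - mills x\<bar> / mills x \<le> (C1 K + C2 K c) * (x / y) / mills x"
    using mp by (intro divide_right_mono) auto
  moreover have "b = (I - mills x) / mills x" using mp by (simp add: b_def diff_divide_distrib)
  ultimately have "\<bar>b\<bar> \<le> (C1 K + C2 K c) * (x / y) / mills x" using mp by (simp only: abs_divide abs_of_pos)
  \<comment> \<open>Dividing by the Gaussian transform, of order \<open>1 / x\<close>, brings in the
    factor \<open>6 * x\<close>.\<close>
  also have "\<dots> \<le> (C1 K + C2 K c) * (x / y) / (1 / (6 * x))"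
  proof (rule divide_left_mono[OF mills_ge[OF x1]])
    have "0 \<le> C1 K + C2 K c" using K0 kappa_pos B_pos c_nonneg by (simp add: C1_def C2_def CB_def)
    then show "0 \<le> (C1 K + C2 K c) * (x / y)" using x1 y_pos by simp
    show "0 < mills x * (1 / (6 * x))" using mp x1 by simp
  qed
  also have "\<dots> = 6 * (C1 K + C2 K c) * (x\<^sup>2 / y)" using x1 by (simp add: power2_eq_square)
  finally have b: "\<bar>b\<bar> \<le> 6 * (C1 K + C2 K c) * (x\<^sup>2 / y)" .
  have w: "\<bar>w\<bar> \<le> CA K c * (x\<^sup>2 / y)" using exponent_bound by (simp add: w_def CA_def)
  have CA0: "0 \<le> CA K c" using K0 kappa_pos c_nonneg by (simp add: CA_def CG_def)
  have C120: "0 \<le> C1 K + C2 K c" using K0 kappa_pos B_pos c_nonneg by (simp add: C1_def C2_def CB_def)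
  have xy: "x\<^sup>2 / y \<le> c" using xc y_pos by (simp add: divide_le_eq)
  have "measure P {p \<in> space P. x < W p} = exp (m * G u - x\<^sup>2) * I"
    using tail_representation[OF u] by (simp add: I_def)
  moreover have "1 - Phi x = exp (- (x\<^sup>2 / 2)) * mills x" by (simp add: mills_def exp_minus)
  ultimately have "measure P {p \<in> space P. x < W p} / ((1 - Phi x) * exp (gam * x^3 / 6))
      = (exp (m * G u - x\<^sup>2) / (exp (- (x\<^sup>2 / 2)) * exp (gam * x^3 / 6))) * (I / mills x)" by (simp add: mult_ac)
  also have "exp (m * G u - x\<^sup>2) / (exp (- (x\<^sup>2 / 2)) * exp (gam * x^3 / 6)) = exp w"
    unfolding w_def exp_add[symmetric] exp_diff[symmetric] by simp
  also have "I / mills x = 1 + b" by (simp add: b_def)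
  finally have "measure P {p \<in> space P. x < W p} / ((1 - Phi x) * exp (gam * x^3 / 6)) = exp w * (1 + b)" .
  then show ?thesis
    using exp_ratio_bound[OF w b _ mult_left_mono[OF xy CA0] CA0] C120 y_pos by simp
qed

end

section \<open>Bounded arguments and bounded sample sizes\<close>

definition Cg where "Cg = \<kappa>^3 * (B^3 + 3 * (real s - 1) * B^3) + CG"

lemma Cg_nonneg: "0 \<le> Cg"
proof -
  have "0 \<le> real s - 1" using s2 by simp
  then have "0 \<le> \<kappa>^3 * (B^3 + 3 * (real s - 1) * B^3)"
    using kappa_pos B_pos by (intro mult_nonneg_nonneg add_nonneg_nonneg) auto
  moreover have "0 \<le> CG" by (simp add: CG_def)
  ultimately show ?thesis unfolding Cg_def by linarith
qed

lemma inv_m_sqrt: "1 / real m \<le> 1 / sqrt m"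
proof -
  have "sqrt m \<le> m" using m_pos real_sqrt_le_mono[of "real m" "(real m)\<^sup>2"] by (simp add: power2_eq_square)
  then show ?thesis using m_pos by (intro divide_left_mono) auto
qed

lemma gam_abs_le: "\<bar>gam\<bar> \<le> Cg * (1 / sqrt m)"
proof -
  have s1: "0 \<le> real s - 1" using s2 by simp
  have v3: "\<bar>v3\<bar> \<le> B^3" unfolding v3_def
    by (rule D.abs_integral_le_const) (use h1_bound B_pos in \<open>auto simp: power_abs intro!: power_mono\<close>)
  have hh: "\<bar>hh\<bar> \<le> B^3" unfolding hh_def
  proof (rule K.P.abs_integral_le_const)
    fix y
    have "\<bar>h y\<bar> * (\<bar>h1 (y 1)\<bar> * \<bar>h1 (y 2)\<bar>) \<le> B * (B * B)"
      using h_bound h1_bound B_pos by (intro mult_mono) auto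
    then show "\<bar>h y * (h1 (y 1) * h1 (y 2))\<bar> \<le> B^3" by (simp add: abs_mult power3_eq_cube)
  qed (use B_pos in simp)
  have "\<bar>(real s - 1) * hh\<bar> \<le> (real s - 1) * B^3" using hh s1 by (simp add: abs_mult mult_left_mono)
  then have v: "\<bar>v3 + 3 * (real s - 1) * hh\<bar> \<le> B^3 + 3 * (real s - 1) * B^3" using v3 by linarith
  have "m * c1^3 \<le> m * (\<kappa> / sqrt m)^3" using c1_le c1_pos by (intro mult_left_mono power_mono) auto
  also have "\<dots> = \<kappa>^3 * (1 / sqrt m)"
  proof -
    define q where "q = sqrt m"
    have q: "q > 0" "real m = q * q" using m_pos by (auto simp: q_def)
    show ?thesis unfolding q_def[symmetric] q(2) using q(1) by (simp add: power_divide power3_eq_cube)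
  qed
  finally have mc: "m * c1^3 \<le> \<kappa>^3 * (1 / sqrt m)" .
  have "\<bar>m * c1^3 * (v3 + 3 * (real s - 1) * hh)\<bar> = (m * c1^3) * \<bar>v3 + 3 * (real s - 1) * hh\<bar>"
    using c1_pos by (simp add: abs_mult)
  also have "\<dots> \<le> (\<kappa>^3 * (1 / sqrt m)) * (B^3 + 3 * (real s - 1) * B^3)"
    by (rule mult_mono[OF mc v]) (use kappa_pos in auto)
  finally have 1: "\<bar>m * c1^3 * (v3 + 3 * (real s - 1) * hh)\<bar> \<le> (\<kappa>^3 * (B^3 + 3 * (real s - 1) * B^3)) * (1 / sqrt m)" by (simp add: mult_ac)
  have "CG * (1 / m) \<le> CG * (1 / sqrt m)" by (intro mult_left_mono inv_m_sqrt) (simp add: CG_def)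
  then have "CG / m \<le> CG * (1 / sqrt m)" by simp
  then have "\<bar>gam\<bar> \<le> (\<kappa>^3 * (B^3 + 3 * (real s - 1) * B^3)) * (1 / sqrt m) + CG * (1 / sqrt m)"
    using 1 gamma_bound unfolding gam_def by linarith
  then show ?thesis unfolding Cg_def distrib_right .
qed

lemma tail_prob_compl: "measure P {p \<in> space P. x < W p} = 1 - measure P {p \<in> space P. W p \<le> x}"
proof -
  have [measurable]: "W \<in> borel_measurable P" by (rule bm_measurable[OF bm_W])
  have "{p \<in> space P. x < W p} = space P - {p \<in> space P. W p \<le> x}" by auto
  then show ?thesis by (simp add: M.P.prob_compl)
qed

definition CS where "CS = exp Cg * (Cg + (8 * HH\<^sup>2 + CB) / (1 - Phi 1))"

lemma Phi_lt_1: "Phi x < 1"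
proof -
  define y where "y = max 1 x"
  have "0 < 1 / (6 * y)" by (simp add: y_def)
  also have "\<dots> \<le> mills y" by (rule mills_ge) (simp add: y_def)
  finally have "0 < 1 - Phi y" by (simp add: mills_def zero_less_mult_iff)
  then show ?thesis using Phi_mono[of x y] by (simp add: y_def)
qed

text \<open>On this range the Gaussian tail is at least \<open>1 - Phi 1\<close>, and
  \<open>gam\<close> is \<open>O(1 / sqrt m)\<close>, so an absolute normal approximation error is
  already a relative one.\<close>

lemma tail_ratio_small:
  assumes x: "0 \<le> x" "x \<le> 1"
  shows "\<bar>measure P {p \<in> space P. x < W p} / ((1 - Phi x) * exp (gam * x^3 / 6)) - 1\<bar> \<le> CS * (1 / sqrt m)"
proof -
  define d where "d = 1 / sqrt m"
  have d: "0 \<le> d" "d \<le> 1" using m_pos by (simp_all add: d_def)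
  have CB0: "0 \<le> CB" using B_pos kappa_pos by (simp add: CB_def)
  have "4 * HH\<^sup>2 * (1 / m) \<le> 4 * HH\<^sup>2 * d" unfolding d_def by (intro mult_left_mono inv_m_sqrt) auto
  then have v: "\<bar>1 - m * c1\<^sup>2 * v2\<bar> \<le> 4 * HH\<^sup>2 * d" using var_defect by simp
  have "\<bar>measure P {p \<in> space P. W p - mu \<le> x} - Phi x\<bar> \<le> 2 * \<bar>1 - m * (\<integral>z. (xi z)\<^sup>2 \<partial>D)\<bar> + CB * d"
    using clt_bound[of x] by (simp add: CB_def d_def)
  then have "\<bar>measure P {p \<in> space P. W p \<le> x} - Phi x\<bar> \<le> (8 * HH\<^sup>2 + CB) * d"
    using v by (simp add: mu0 integral_xi_power distrib_right mult.assoc)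
  then have t: "\<bar>measure P {p \<in> space P. x < W p} - (1 - Phi x)\<bar> \<le> (8 * HH\<^sup>2 + CB) * d"
    unfolding tail_prob_compl by linarith
  define b where "b = measure P {p \<in> space P. x < W p} / (1 - Phi x) - 1"
  have px: "0 < 1 - Phi x" "0 < 1 - Phi 1" "1 - Phi 1 \<le> 1 - Phi x" using Phi_lt_1 Phi_mono[OF x(2)] by auto
  have "b = (measure P {p \<in> space P. x < W p} - (1 - Phi x)) / (1 - Phi x)" using px by (simp add: b_def diff_divide_distrib)
  then have "\<bar>b\<bar> = \<bar>measure P {p \<in> space P. x < W p} - (1 - Phi x)\<bar> / (1 - Phi x)" using px by (simp add: abs_divide)
  also have "\<dots> \<le> ((8 * HH\<^sup>2 + CB) * d) / (1 - Phi 1)" using t px CB0 d by (intro frac_le) auto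
  finally have b: "\<bar>b\<bar> \<le> ((8 * HH\<^sup>2 + CB) / (1 - Phi 1)) * d" by simp
  define w where "w = - (gam * x^3 / 6)"
  have "\<bar>w\<bar> \<le> \<bar>gam\<bar>"
  proof -
    have "x^3 \<le> 1" using x by (simp add: power_le_one)
    then have "\<bar>gam\<bar> * x^3 \<le> \<bar>gam\<bar> * 1" by (intro mult_left_mono) auto
    then show ?thesis using x by (simp add: w_def abs_mult)
  qed
  then have w: "\<bar>w\<bar> \<le> Cg * d" using gam_abs_le by (simp add: d_def)
  have "measure P {p \<in> space P. x < W p} / ((1 - Phi x) * exp (gam * x^3 / 6)) = exp w * (1 + b)"
  proof -
    have "exp w = 1 / exp (gam * x^3 / 6)" unfolding w_def exp_minus by (rule inverse_eq_divide)
    moreover have "1 + b = measure P {p \<in> space P. x < W p} / (1 - Phi x)" by (simp add: b_def)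
    ultimately show ?thesis by (simp only: times_divide_times_eq mult_1_left mult.commute)
  qed
  moreover have "0 \<le> (8 * HH\<^sup>2 + CB) / (1 - Phi 1)" using CB0 px by simp
  ultimately show ?thesis
    using exp_ratio_bound[OF w b d(1) _ Cg_nonneg] mult_left_mono[OF d(2) Cg_nonneg] by (simp add: CS_def d_def)
qed

text \<open>The probability is bounded by 1. The result is meant for sample sizes below a fixed
  threshold, where the range of \<open>x\<close> is bounded and no decay in \<open>m\<close> is at
  stake.\<close>

lemma tail_ratio_crude:
  assumes x: "0 \<le> x" "x \<le> X0"
  shows "\<bar>measure P {p \<in> space P. x < W p} / ((1 - Phi x) * exp (gam * x^3 / 6)) - 1\<bar> \<le> 1 + exp (Cg * X0^3) / (1 - Phi X0)"
proof -
  have px: "0 < 1 - Phi x" "0 < 1 - Phi X0" "1 - Phi X0 \<le> 1 - Phi x" using Phi_lt_1 Phi_mono[OF x(2)] by auto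
  have "Cg * (1 / sqrt m) \<le> Cg * 1" using m_pos by (intro mult_left_mono Cg_nonneg) auto
  then have g: "\<bar>gam\<bar> \<le> Cg" using gam_abs_le by linarith
  have "\<bar>gam * x^3 / 6\<bar> \<le> Cg * X0^3"
  proof -
    have "\<bar>gam\<bar> * x^3 \<le> Cg * X0^3" using g x Cg_nonneg by (intro mult_mono power_mono) auto
    moreover have "0 \<le> \<bar>gam\<bar> * x^3" using x by simp
    moreover have "\<bar>gam * x^3 / 6\<bar> = \<bar>gam\<bar> * x^3 / 6" using x by (simp add: abs_mult)
    ultimately show ?thesis by linarith
  qed
  then have e: "exp (- (gam * x^3 / 6)) \<le> exp (Cg * X0^3)" by (simp only: exp_le_cancel_iff)
  define r where "r = measure P {p \<in> space P. x < W p} / ((1 - Phi x) * exp (gam * x^3 / 6))"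
  have "r = measure P {p \<in> space P. x < W p} * exp (- (gam * x^3 / 6)) / (1 - Phi x)"
    unfolding r_def exp_minus by (simp only: divide_inverse inverse_mult_distrib mult_ac)
  also have "\<dots> \<le> (1 * exp (Cg * X0^3)) / (1 - Phi X0)"
    using e px by (intro frac_le mult_mono) auto
  finally have "r \<le> exp (Cg * X0^3) / (1 - Phi X0)" by simp
  moreover have "0 \<le> r" using px by (simp add: r_def)
  moreover have "0 \<le> exp (Cg * X0^3) / (1 - Phi X0)" using px by simp
  ultimately show ?thesis unfolding r_def[symmetric] by linarith
qed

end

section \<open>Normalisation and the choice of the constant for a fixed kernel and law\<close>

context tilt
begin

definition sig :: "nat \<Rightarrow> real" where
  "sig m = sqrt (\<integral>p. (U_sum s h (\<lambda>i p. p i) m p)\<^sup>2 \<partial>PiM {1..m} (\<lambda>_. D))"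

lemma normed_sig:
  assumes v2: "0 < v2" and m: "s \<le> m"
  shows "0 < sig m" "normed D s h B m (sig m) (1 / sqrt v2)"
proof -
  define c where "c = real ((m - 1) choose (s - 1))"
  have m0: "0 < m" using s2 m by simp
  have c: "0 < c" using m s2 by (simp add: c_def)
  \<comment> \<open>With scale 1 and a tautological \<open>\<kappa>\<close> the locale serves only
    to decompose the variance of the raw sum. The linear part then bounds \<open>sig m\<close> from
    below and yields the uniform value \<open>1 / sqrt v2\<close>.\<close>
  interpret V: ustat D s h B m 1 "c * sqrt m"
    by unfold_locales (use m c m0 in \<open>auto simp: c_def\<close>)
  have W: "V.W p = U_sum s h (\<lambda>i p. p i) m p" for p by (simp add: V.W_def)
  have "(\<integral>z. (V.xi z)\<^sup>2 \<partial>D) = c\<^sup>2 * v2"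
    by (simp add: V.xi_def theta0 V.c1_def c_def power_mult_distrib v2_def)
  moreover have "(sig m)\<^sup>2 = (\<integral>p. (U_sum s h (\<lambda>i p. p i) m p)\<^sup>2 \<partial>V.P)"
    unfolding sig_def by (rule real_sqrt_pow2) simp
  ultimately have sq: "(sig m)\<^sup>2 = m * (c\<^sup>2 * v2) + (\<integral>p. (V.R p)\<^sup>2 \<partial>V.P)"
    using V.variance_decomp by (simp add: V.mu_def theta0 W)
  moreover have "0 \<le> (\<integral>p. (V.R p)\<^sup>2 \<partial>V.P)" by simp
  ultimately have ge: "m * (c\<^sup>2 * v2) \<le> (sig m)\<^sup>2" by linarith
  have "sqrt (m * (c\<^sup>2 * v2)) \<le> sqrt ((sig m)\<^sup>2)" using ge by (rule real_sqrt_le_mono)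
  also have "sqrt ((sig m)\<^sup>2) = sig m" by (simp add: sig_def)
  finally have ge': "sqrt m * (c * sqrt v2) \<le> sig m" using c by (simp add: real_sqrt_mult)
  moreover have "0 < sqrt m * (c * sqrt v2)" using c v2 m0 by simp
  ultimately show pos: "0 < sig m" by linarith
  have "c / sig m \<le> c / (sqrt m * (c * sqrt v2))" using ge' c v2 m0 pos by (intro divide_left_mono mult_pos_pos) auto
  also have "\<dots> = 1 / sqrt v2 / sqrt m" using c by simp
  finally have cs: "c / sig m \<le> 1 / sqrt v2 / sqrt m" .
  interpret U: ustat D s h B m "sig m" "1 / sqrt v2"
    by unfold_locales (use m pos v2 cs in \<open>auto simp: c_def\<close>)
  have "(\<integral>p. (U.W p)\<^sup>2 \<partial>U.P) = (\<integral>p. (U_sum s h (\<lambda>i p. p i) m p)\<^sup>2 / (sig m)\<^sup>2 \<partial>U.P)"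
    by (simp add: U.W_def power_divide)
  also have "\<dots> = (sig m)\<^sup>2 / (sig m)\<^sup>2" by (simp add: sig_def)
  finally have "(\<integral>p. (U.W p)\<^sup>2 \<partial>U.P) = 1" using pos by simp
  then show "normed D s h B m (sig m) (1 / sqrt v2)" by unfold_locales
qed

lemma moderate_deviation:
  assumes v2: "0 < v2" and C0: "0 < C0"
  shows "\<exists>C>0. \<forall>m\<ge>s. \<forall>x. 0 \<le> x \<and> x \<le> C0 * real m powr (1/4) \<longrightarrow>
    \<bar>measure (PiM {1..m} (\<lambda>_. D)) {p \<in> space (PiM {1..m} (\<lambda>_. D)). x < U_sum s h (\<lambda>i p. p i) m p / sig m}
      / ((1 - Phi x) * exp ((\<integral>p. (U_sum s h (\<lambda>i p. p i) m p / sig m)^3 \<partial>PiM {1..m} (\<lambda>_. D)) * x^3 / 6)) - 1\<bar>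
      \<le> C / sqrt m * (1 + x\<^sup>2)"
proof -
  define \<kappa> where "\<kappa> = 1 / sqrt v2"
  have kp: "0 < \<kappa>" using v2 by (simp add: \<kappa>_def)
  obtain K where K: "0 \<le> K" "\<forall>\<^sub>F u in at_right 0. asym K u" using asym_eventually by blast
  then obtain e where e: "0 < e" "\<And>u. 0 < u \<Longrightarrow> u < e \<Longrightarrow> asym K u"
    unfolding eventually_at_right_field by blast
  define H where "H = ustat.HH s B \<kappa>"
  \<comment> \<open>The defining equation of \<open>HH\<close> is available only from an instance of
    the locale; \<open>m = s\<close> supplies one.\<close>
  have H0: "0 \<le> H" using B_pos kp by (simp add: H_def ustat.HH_def[OF normed.axioms(2)[OF normed_sig(2)[OF v2 order_refl, folded \<kappa>_def]]])
  define c where "c = C0\<^sup>2"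
  define T where "T = exp (normed.CA s B \<kappa> K c * c) * (normed.CA s B \<kappa> K c + 6 * (normed.C1 s B \<kappa> K + normed.C2 s B \<kappa> K c))"
  \<comment> \<open>A threshold for \<open>r = m powr (1/4)\<close>. Above it
    \<open>u \<le> C0 * \<kappa> / r < e\<close>, so the expansions apply, and
    \<open>4 * x \<le> 4 * C0 * r \<le> r^2 / H\<close>, which is \<open>L0\<close>.\<close>
  define r0 where "r0 = C0 * \<kappa> / e + 4 * C0 * H + 1"
  have r0: "C0 * \<kappa> / e < r0" "4 * C0 * H \<le> r0" "0 < r0"
  proof -
    have "0 \<le> C0 * \<kappa> / e" "0 \<le> 4 * C0 * H" using C0 kp e H0 by auto
    then show "C0 * \<kappa> / e < r0" "4 * C0 * H \<le> r0" "0 < r0" by (auto simp: r0_def)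
  qed
  define KT where "KT = 1 + exp (normed.Cg s B \<kappa> * (C0 * r0)^3) / (1 - Phi (C0 * r0))"
  define C where "C = \<bar>T\<bar> + \<bar>normed.CS s B \<kappa>\<bar> + \<bar>KT\<bar> * r0\<^sup>2 + 1"
  have C: "\<bar>T\<bar> \<le> C" "\<bar>normed.CS s B \<kappa>\<bar> \<le> C" "\<bar>KT\<bar> * r0\<^sup>2 \<le> C" "0 < C" by (auto simp: C_def add_nonneg_pos)
  show ?thesis
  proof (intro exI[of _ C] conjI allI impI C(4))
    fix m x assume m: "s \<le> m" and x: "0 \<le> x \<and> x \<le> C0 * real m powr (1/4)"
    interpret N: normed D s h B m "sig m" \<kappa> unfolding \<kappa>_def by (rule normed_sig(2)[OF v2 m])
    define r where "r = real m powr (1/4)"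
    have r: "0 < r" "r\<^sup>2 = sqrt m"
      using N.m_pos by (simp_all add: r_def powr_half_sqrt[symmetric] power2_eq_square powr_add[symmetric])
    have xr: "x \<le> C0 * r" using x by (simp add: r_def)
    have Wd: "N.W p = U_sum s h (\<lambda>i p. p i) m p / sig m" for p by (simp add: N.W_def)
    let ?R = "\<bar>measure N.P {p \<in> space N.P. x < N.W p} / ((1 - Phi x) * exp (N.gam * x^3 / 6)) - 1\<bar>"
    have "?R \<le> C / sqrt m * (1 + x\<^sup>2)"
    proof -
      consider "x \<le> 1" | "1 \<le> x" "r0 \<le> r" | "1 \<le> x" "r < r0" by linarith
      then show ?thesis
      proof cases
        case 1
        have "?R \<le> normed.CS s B \<kappa> * (1 / sqrt m)" using N.tail_ratio_small[of x] x 1 by simp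
        also have "\<dots> \<le> C * (1 / sqrt m)" using C(2) by (intro mult_right_mono) auto
        also have "\<dots> = C / sqrt m * 1" by simp
        also have "\<dots> \<le> C / sqrt m * (1 + x\<^sup>2)" using C(4) by (intro mult_left_mono) auto
        finally show ?thesis .
      next
        case 2
        define u where "u = x * N.c1"
        have u0: "0 < u" using 2 N.c1_pos by (simp add: u_def)
        have "u \<le> (C0 * r) * (\<kappa> / sqrt m)"
          unfolding u_def using xr N.c1_le N.c1_pos C0 r by (intro mult_mono) auto
        also have "\<dots> = C0 * \<kappa> / r" using r(1) by (simp add: r(2)[symmetric] power2_eq_square)
        also have "\<dots> < e"
        proof -
          have "C0 * \<kappa> < r0 * e" using r0(1) e(1) by (simp add: divide_less_eq)
          also have "\<dots> \<le> r * e" using 2 e(1) by (intro mult_right_mono) auto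
          finally show ?thesis using r(1) by (simp add: divide_less_eq mult.commute)
        qed
        finally have asy: "asym K u" using u0 e(2) by blast
        have "x\<^sup>2 \<le> (C0 * r)\<^sup>2" using xr x by (intro power_mono) auto
        then have xc: "x\<^sup>2 \<le> c * sqrt m" by (simp add: c_def power_mult_distrib r(2))
        have "4 * x \<le> N.L0"
        proof -
          have "4 * x * H \<le> 4 * (C0 * r) * H" using xr H0 by (intro mult_right_mono) auto
          also have "\<dots> = (4 * C0 * H) * r" by simp
          also have "\<dots> \<le> r * r" using r0(2) 2 r(1) by (intro mult_right_mono) auto
          finally have "4 * x * H \<le> sqrt m" by (simp add: r(2)[symmetric] power2_eq_square)
          then show ?thesis using N.HH_pos by (simp add: N.L0_def H_def N.HH_def pos_le_divide_eq)
        qed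
        from N.tail_ratio[OF u_def 2(1) xc refl K(1) _ asy this]
        have "?R \<le> T * (x\<^sup>2 / sqrt m)" by (simp add: c_def T_def)
        also have "\<dots> \<le> C * (x\<^sup>2 / sqrt m)" using C(1) by (intro mult_right_mono) auto
        also have "\<dots> = C / sqrt m * x\<^sup>2" by simp
        also have "\<dots> \<le> C / sqrt m * (1 + x\<^sup>2)" using C(4) by (intro mult_left_mono) auto
        finally show ?thesis .
      next
        case 3
        have "C0 * r \<le> C0 * r0" using C0 3 by (intro mult_left_mono) auto
        then have "x \<le> C0 * r0" using xr by linarith
        then have "?R \<le> KT" using N.tail_ratio_crude[of x "C0 * r0"] x by (simp add: KT_def)
        also have "\<dots> \<le> \<bar>KT\<bar> * 1" by simp
        \<comment> \<open>Here \<open>sqrt m = r^2 < r0^2\<close>, so the factor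
          \<open>r0^2 / sqrt m\<close> is at least 1 and supplies the required form in
          \<open>m\<close>.\<close>
        also have "\<dots> \<le> \<bar>KT\<bar> * (r0\<^sup>2 / sqrt m)"
        proof (rule mult_left_mono)
          have "r\<^sup>2 \<le> r0\<^sup>2" using 3 r(1) by (intro power_mono) auto
          then show "1 \<le> r0\<^sup>2 / sqrt m" using N.m_pos r(2) by (simp add: le_divide_eq)
        qed simp
        also have "\<dots> = (\<bar>KT\<bar> * r0\<^sup>2) / sqrt m * 1" by simp
        also have "\<dots> \<le> C / sqrt m * (1 + x\<^sup>2)" using C by (intro mult_mono divide_right_mono) auto
        finally show ?thesis .
      qed
    qed
    then show "\<bar>measure (PiM {1..m} (\<lambda>_. D)) {p \<in> space (PiM {1..m} (\<lambda>_. D)). x < U_sum s h (\<lambda>i p. p i) m p / sig m}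
      / ((1 - Phi x) * exp ((\<integral>p. (U_sum s h (\<lambda>i p. p i) m p / sig m)^3 \<partial>PiM {1..m} (\<lambda>_. D)) * x^3 / 6)) - 1\<bar>
      \<le> C / sqrt m * (1 + x\<^sup>2)"
      by (simp add: N.gam_def Wd)
  qed
qed

end

section \<open>Transfer from product coordinates to an arbitrary i.i.d. sequence\<close>

lemma iid_sequence_facts:
  assumes "iid_sequence M X D"
  shows "prob_space M" "prob_space D" "sets D = sets borel"
    and "i \<ge> 1 \<Longrightarrow> X i \<in> borel_measurable M"
    and "1 \<le> n \<Longrightarrow> (\<lambda>\<omega>. \<lambda>i\<in>{1..n}. X i \<omega>) \<in> measurable M (PiM {1..n} (\<lambda>_. D))"
    and "1 \<le> n \<Longrightarrow> distr M (PiM {1..n} (\<lambda>_. D)) (\<lambda>\<omega>. \<lambda>i\<in>{1..n}. X i \<omega>) = PiM {1..n} (\<lambda>_. D)"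
proof -
  show M: "prob_space M" using assms by (simp add: iid_sequence_def)
  interpret prob_space M by (rule M)
  have ind: "indep_vars (\<lambda>_. borel) X {1..}" and D: "\<And>i. 1 \<le> i \<Longrightarrow> distr M borel (X i) = D"
    using assms by (auto simp: iid_sequence_def)
  have X: "random_variable borel (X i)" if "1 \<le> i" for i using ind that by (auto simp: indep_vars_def)
  then show "i \<ge> 1 \<Longrightarrow> X i \<in> borel_measurable M" .
  show sD: "sets D = sets borel" using D[of 1] by auto
  show "prob_space D" using prob_space_distr[OF X[of 1]] D[of 1] by simp
  have sP: "sets (PiM {1..n} (\<lambda>_. D)) = sets (PiM {1..n} (\<lambda>_. borel))" for n :: nat
    by (rule sets_PiM_cong) (auto simp: sD)
  assume n: "1 \<le> n"
  show "(\<lambda>\<omega>. \<lambda>i\<in>{1..n}. X i \<omega>) \<in> measurable M (PiM {1..n} (\<lambda>_. D))"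
    unfolding measurable_cong_sets[OF refl sP] by (rule measurable_restrict) (use X in auto)
  have "indep_vars (\<lambda>_. borel) X {1..n}" by (rule indep_vars_subset[OF ind]) auto
  then have "distr M (PiM {1..n} (\<lambda>_. borel)) (\<lambda>\<omega>. \<lambda>i\<in>{1..n}. X i \<omega>) = PiM {1..n} (\<lambda>i. distr M borel (X i))"
    using n X by (subst (asm) indep_vars_iff_distr_eq_PiM') auto
  also have "\<dots> = PiM {1..n} (\<lambda>_. D)" using D by (intro PiM_cong) auto
  finally show "distr M (PiM {1..n} (\<lambda>_. D)) (\<lambda>\<omega>. \<lambda>i\<in>{1..n}. X i \<omega>) = PiM {1..n} (\<lambda>_. D)"
    using distr_cong[OF refl sP refl, of M] by simp
qed

lemma U_sum_coordinates:
  "U_sum s h X m \<omega> = U_sum s h (\<lambda>i p. p i) m (\<lambda>i\<in>{1..m}. X i \<omega>)"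
  unfolding U_sum_def
proof (rule sum.cong[OF refl])
  fix t assume "t \<in> increasing_tuples s m"
  then have "t j \<in> {1..m}" if "j \<in> {1..s}" for j
    using increasing_tuples_strict_mono(3)[of t s m] that by (blast dest: PiE_mem)
  then show "h (\<lambda>j\<in>{1..s}. X (t j) \<omega>) = h (\<lambda>j\<in>{1..s}. (\<lambda>i\<in>{1..m}. X i \<omega>) (t j))"
    by (intro arg_cong[where f=h]) (auto simp: fun_eq_iff)
qed

text \<open>Makes an almost surely bounded kernel bounded everywhere. Truncating by value keeps
  symmetry and measurability, and the clipped kernel agrees almost surely with the original one when
  \<open>b\<close> is an almost sure bound.\<close>

definition clip :: "real \<Rightarrow> ((nat \<Rightarrow> real) \<Rightarrow> real) \<Rightarrow> (nat \<Rightarrow> real) \<Rightarrow> real" where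
  "clip b h y = (if \<bar>h y\<bar> \<le> b then h y else 0)"

lemma clip_kernel:
  assumes "s \<ge> 2" "h \<in> borel_measurable (PiM {1..s} (\<lambda>_. borel))" "symmetric_kernel s h" "iid_sequence M X D" "0 < b"
  shows "ustat_kernel D s (clip b h) b"
proof -
  interpret D: prob_space D by (rule iid_sequence_facts(2)[OF assms(4)])
  show ?thesis
  proof unfold_locales
    note assms(2) [measurable]
    show "clip b h \<in> borel_measurable (PiM {1..s} (\<lambda>_. borel))" unfolding clip_def[abs_def] by measurable
    show "symmetric_kernel s (clip b h)" using assms(3) unfolding symmetric_kernel_def clip_def by simp
  qed (use assms iid_sequence_facts(3)[OF assms(4)] in \<open>auto simp: clip_def\<close>)
qed

lemma AE_distr_transfer:
  assumes "AE y in N. Q y" "f \<in> measurable M N" "distr M N f = N"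
  shows "AE x in M. Q (f x)"
  using AE_distrD[OF assms(2)] assms(1,3) by metis

lemma integral_distr_transfer:
  assumes "F \<in> borel_measurable N" "f \<in> measurable M N" "distr M N f = N"
  shows "(\<integral>x. F (f x) \<partial>M) = (\<integral>y. F y \<partial>N :: real)"
  using integral_distr[OF assms(2,1)] assms(3) by simp

context ustat_kernel
begin

text \<open>Every set of the generated sigma-algebra is a preimage of a Borel set \<open>S\<close>
  under \<open>X 1\<close>, and both defining integrals reduce to that of \<open>h1\<close> over
  \<open>S\<close> under \<open>D\<close>. This identifies any admissible \<open>g\<close> with
  \<open>h1\<close> along \<open>X 1\<close>.\<close>

lemma cond_exp_first_coordinate:
  assumes iid: "iid_sequence M X D" and Y: "Y \<in> borel_measurable M" "AE \<omega> in M. Y \<omega> = h (\<lambda>j\<in>{1..s}. X j \<omega>)"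
  shows "AE \<omega> in M. real_cond_exp M (vimage_algebra (space M) (X 1) borel) Y \<omega> = h1 (X 1 \<omega>)"
proof -
  interpret M: prob_space M by (rule iid_sequence_facts(1)[OF iid])
  have X1 [measurable]: "X 1 \<in> borel_measurable M" by (rule iid_sequence_facts(4)[OF iid]) simp
  have s1: "1 \<le> s" using s2 by simp
  note T = iid_sequence_facts(5,6)[OF iid s1]
  let ?F = "vimage_algebra (space M) (X 1) borel" and ?T = "\<lambda>\<omega>. \<lambda>j\<in>{1..s}. X j \<omega>"
  have T1: "?T \<omega> 1 = X 1 \<omega>" for \<omega> using s1 by simp
  have bh1: "h1 \<in> borel_measurable borel"
    using bm_measurable[OF bm_h1] by (simp add: measurable_cong_sets[OF setsD refl])
  have X1F: "X 1 \<in> borel_measurable ?F" by (rule measurable_vimage_algebra1) simp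
  have hT: "(\<lambda>\<omega>. h (?T \<omega>)) \<in> borel_measurable M" using measurable_compose[OF T(1) bm_measurable[OF bm_h]] .
  have "sets ?F \<subseteq> sets M"
    by (rule sets_image_in_sets) simp_all
  then interpret S: finite_measure_subalgebra M ?F
    by unfold_locales (simp add: subalgebra_def)
  have iY: "integrable M Y"
  proof (rule M.integrable_const_bound[where B=B, OF _ Y(1)])
    show "AE \<omega> in M. norm (Y \<omega>) \<le> B" using Y(2) by eventually_elim (simp add: h_bound)
  qed
  show ?thesis
  proof (rule S.real_cond_exp_charact[OF _ iY])
    show "integrable M (\<lambda>\<omega>. h1 (X 1 \<omega>))"
      using bh1 by (intro M.integrable_const_bound[where B=B]) (auto simp: h1_bound)
    show "(\<lambda>\<omega>. h1 (X 1 \<omega>)) \<in> borel_measurable ?F" by (rule measurable_compose[OF X1F bh1])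
    fix A assume "A \<in> sets ?F"
    then obtain S where S: "S \<in> sets borel" "A = X 1 -` S \<inter> space M" by (auto simp: sets_vimage_algebra2)
    have bS: "bm D (indicat_real S)"
      using S(1) by (intro bmI[where K=1]) (auto simp: measurable_cong_sets[OF setsD refl] indicator_def)
    have Am: "A \<in> sets M" using S by simp
    have "(\<integral>\<omega>\<in>A. Y \<omega> \<partial>M) = (\<integral>\<omega>. indicator A \<omega> * h (?T \<omega>) \<partial>M)"
      unfolding set_lebesgue_integral_def
      by (rule integral_cong_AE) (use Y hT Am in auto)
    also have "\<dots> = (\<integral>\<omega>. indicator S (?T \<omega> 1) * h (?T \<omega>) \<partial>M)"
      unfolding T1 by (rule Bochner_Integration.integral_cong) (auto simp: S(2) indicator_def)
    also have "\<dots> = (\<integral>y. indicator S (y 1) * h y \<partial>K.P)"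
      by (rule integral_distr_transfer[OF _ T]) (use bm_mult[OF K.bm_coord[OF bS one_s(1)] bm_h] in \<open>rule bm_measurable\<close>)
    also have "\<dots> = (\<integral>z. indicator S z * h1 z \<partial>D)"
      using integral_h_coord[OF bS one_s(1)] by (simp add: mult.commute)
    also have "\<dots> = (\<integral>\<omega>. indicator S (X 1 \<omega>) * h1 (X 1 \<omega>) \<partial>M)"
    proof -
      have "distr M borel (X 1) = D" using iid by (simp add: iid_sequence_def)
      then show ?thesis using integral_distr[OF X1, of "\<lambda>z. indicator S z * h1 z"] bh1 S(1) by simp
    qed
    also have "\<dots> = (\<integral>\<omega>\<in>A. h1 (X 1 \<omega>) \<partial>M)"
      unfolding set_lebesgue_integral_def by (rule Bochner_Integration.integral_cong) (auto simp: S(2) indicator_def)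
    finally show "(\<integral>\<omega>\<in>A. Y \<omega> \<partial>M) = (\<integral>\<omega>\<in>A. h1 (X 1 \<omega>) \<partial>M)" .
  qed
qed

text \<open>There are finitely many tuples, and each selects coordinates with the joint law of the
  kernel's arguments, so the exceptional null set pulls back to a null set for the whole
  sum.\<close>

lemma U_sum_coordinates_AE:
  assumes iid: "iid_sequence M X D" and f: "AE y in K.P. f y = h y" and m: "1 \<le> m"
  shows "AE \<omega> in M. U_sum s f X m \<omega> = U_sum s h (\<lambda>i p. p i) m (\<lambda>i\<in>{1..m}. X i \<omega>)"
proof (rule AE_mp[OF AE_distr_transfer[OF _ iid_sequence_facts(5,6)[OF iid m]]])
  show "AE p in PiM {1..m} (\<lambda>_. D). \<forall>t\<in>increasing_tuples s m. f (\<lambda>j\<in>{1..s}. p (t j)) = h (\<lambda>j\<in>{1..s}. p (t j))"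
  proof (rule AE_finite_allI[OF finite_increasing_tuples])
    fix t assume t: "t \<in> increasing_tuples s m"
    have t': "inj_on t {1..s}" "t \<in> {1..s} \<rightarrow> {1..m}"
      using increasing_tuples_strict_mono[OF t] by (auto dest: PiE_mem)
    show "AE p in PiM {1..m} (\<lambda>_. D). f (\<lambda>j\<in>{1..s}. p (t j)) = h (\<lambda>j\<in>{1..s}. p (t j))"
      by (rule AE_distr_transfer[OF f measurable_reindex[OF t'(2)] distr_reindex[OF t']])
  qed
  show "AE \<omega> in M. (\<forall>t\<in>increasing_tuples s m. f (\<lambda>j\<in>{1..s}. (\<lambda>i\<in>{1..m}. X i \<omega>) (t j)) = h (\<lambda>j\<in>{1..s}. (\<lambda>i\<in>{1..m}. X i \<omega>) (t j)))
      \<longrightarrow> U_sum s f X m \<omega> = U_sum s h (\<lambda>i p. p i) m (\<lambda>i\<in>{1..m}. X i \<omega>)"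
    unfolding U_sum_coordinates[of s f X m] by (rule AE_I2) (simp add: U_sum_def)
qed

end

lemma (in tilt) U_stat_coordinates:
  assumes iid: "iid_sequence M X D" and f: "AE y in K.P. f y = h y" "f \<in> borel_measurable (PiM {1..s} (\<lambda>_. borel))"
    and v2: "0 < v2" and m: "s \<le> m"
  shows "U_gamma M s f X m = (\<integral>p. (U_sum s h (\<lambda>i p. p i) m p / sig m)^3 \<partial>PiM {1..m} (\<lambda>_. D))"
    and "measure M {\<omega> \<in> space M. x < U_stat M s f X m \<omega>} =
      measure (PiM {1..m} (\<lambda>_. D)) {p \<in> space (PiM {1..m} (\<lambda>_. D)). x < U_sum s h (\<lambda>i p. p i) m p / sig m}"
proof -
  interpret M: prob_space M by (rule iid_sequence_facts(1)[OF iid])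
  interpret N: normed D s h B m "sig m" "1 / sqrt v2" by (rule normed_sig(2)[OF v2 m])
  have s1: "1 \<le> s" and m1: "1 \<le> m" using s2 m by auto
  let ?T = "\<lambda>\<omega>. \<lambda>i\<in>{1..m}. X i \<omega>" and ?U = "U_sum s h (\<lambda>i p. p i) m"
  note T = iid_sequence_facts(5,6)[OF iid m1]
  have pos: "0 < sig m" by (rule normed_sig(1)[OF v2 m])
  have UW: "?U p = sig m * N.W p" for p using pos by (simp add: N.W_def)
  have U [measurable]: "?U \<in> borel_measurable N.P" unfolding UW using N.bm_W by measurable
  have TU [measurable]: "(\<lambda>\<omega>. ?U (?T \<omega>)) \<in> borel_measurable M" by (rule measurable_compose[OF T(1) U])
  have fU [measurable]: "U_sum s f X m \<in> borel_measurable M"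
    unfolding U_sum_def
  proof (rule borel_measurable_sum)
    fix t assume t: "t \<in> increasing_tuples s m"
    have "(\<lambda>\<omega>. \<lambda>j\<in>{1..s}. X (t j) \<omega>) \<in> measurable M (PiM {1..s} (\<lambda>_. borel))"
    proof (rule measurable_restrict)
      fix j assume "j \<in> {1..s}"
      then have "t j \<in> {1..m}" using increasing_tuples_strict_mono(3)[OF t] by (blast dest: PiE_mem)
      then show "X (t j) \<in> borel_measurable M" using iid_sequence_facts(4)[OF iid] by simp
    qed
    then show "(\<lambda>\<omega>. f (\<lambda>j\<in>{1..s}. X (t j) \<omega>)) \<in> borel_measurable M" by (rule measurable_compose[OF _ f(2)])
  qed
  note ae = U_sum_coordinates_AE[OF iid f(1) m1]
  \<comment> \<open>Standard deviation, third moment and tail are all integrals of functions of the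
    sum, so this one transfer covers them.\<close>
  have trans: "(\<integral>\<omega>. F (U_sum s f X m \<omega>) \<partial>M) = (\<integral>p. F (?U p) \<partial>N.P)"
    if [measurable]: "F \<in> borel_measurable borel" for F :: "real \<Rightarrow> real"
  proof -
    have "(\<integral>\<omega>. F (U_sum s f X m \<omega>) \<partial>M) = (\<integral>\<omega>. F (?U (?T \<omega>)) \<partial>M)"
      by (rule integral_cong_AE) (use ae in auto)
    also have "\<dots> = (\<integral>p. F (?U p) \<partial>N.P)" by (rule integral_distr_transfer[OF _ T]) measurable
    finally show ?thesis .
  qed
  have "M.expectation (U_sum s f X m) = 0"
    using trans[of "\<lambda>y. y"] N.integral_W N.mu0 by (simp add: UW)
  then have sg: "U_sigma M s f X m = sig m"
    using trans[of "\<lambda>y. y\<^sup>2"] by (simp add: U_sigma_def sig_def)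
  show "U_gamma M s f X m = (\<integral>p. (?U p / sig m)^3 \<partial>N.P)"
    unfolding U_gamma_def U_stat_def sg by (rule trans) measurable
  have "measure M {\<omega> \<in> space M. x < U_stat M s f X m \<omega>} = (\<integral>\<omega>. indicator {x<..} (U_sum s f X m \<omega> / sig m) \<partial>M)"
  proof -
    have "(\<integral>\<omega>. indicator {x<..} (U_sum s f X m \<omega> / sig m) \<partial>M) = (\<integral>\<omega>. indicator {\<omega> \<in> space M. x < U_stat M s f X m \<omega>} \<omega> \<partial>M)"
      by (rule Bochner_Integration.integral_cong) (auto simp: U_stat_def sg indicator_def)
    also have "\<dots> = measure M ({\<omega> \<in> space M. x < U_stat M s f X m \<omega>} \<inter> space M)" by simp
    also have "{\<omega> \<in> space M. x < U_stat M s f X m \<omega>} \<inter> space M = {\<omega> \<in> space M. x < U_stat M s f X m \<omega>}" by blast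
    finally show ?thesis by simp
  qed
  also have "\<dots> = (\<integral>p. indicator {x<..} (?U p / sig m) \<partial>N.P)" by (rule trans) measurable
  also have "\<dots> = measure N.P {p \<in> space N.P. x < ?U p / sig m}"
  proof -
    have "(\<integral>p. indicator {x<..} (?U p / sig m) \<partial>N.P) = (\<integral>p. indicator {p \<in> space N.P. x < ?U p / sig m} p \<partial>N.P)"
      by (rule Bochner_Integration.integral_cong) (auto simp: indicator_def)
    also have "\<dots> = measure N.P ({p \<in> space N.P. x < ?U p / sig m} \<inter> space N.P)" by simp
    also have "{p \<in> space N.P. x < ?U p / sig m} \<inter> space N.P = {p \<in> space N.P. x < ?U p / sig m}" by blast
    finally show ?thesis by simp
  qed
  finally show "measure M {\<omega> \<in> space M. x < U_stat M s f X m \<omega>} = measure N.P {p \<in> space N.P. x < ?U p / sig m}" .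
qed

theorem proposition2p2:
  fixes D :: "real measure" and s :: nat and h :: "(nat \<Rightarrow> real) \<Rightarrow> real" and C0 :: real
  assumes "s \<ge> 2"
    and "h \<in> borel_measurable (PiM {1..s} (\<lambda>_. borel))"
    and "symmetric_kernel s h"
    and "C0 > 0"
  shows "\<exists>C>0. \<forall>(M :: 'a measure) (X :: nat \<Rightarrow> 'a \<Rightarrow> real) (g :: real \<Rightarrow> real) (C1 :: real).
           iid_sequence M X D \<longrightarrow>
           prob_space.expectation M (\<lambda>\<omega>. h (\<lambda>j\<in>{1..s}. X j \<omega>)) = 0 \<longrightarrow>
           (AE \<omega> in M. \<bar>h (\<lambda>j\<in>{1..s}. X j \<omega>)\<bar> \<le> C1) \<longrightarrow>
           is_cond_exp_given M (\<lambda>\<omega>. h (\<lambda>j\<in>{1..s}. X j \<omega>)) (X 1) g \<longrightarrow>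
           prob_space.expectation M (\<lambda>\<omega>. (g (X 1 \<omega>))\<^sup>2) > 0 \<longrightarrow>
           (\<forall>m\<ge>s. \<forall>x. 0 \<le> x \<and> x \<le> C0 * real m powr (1/4) \<longrightarrow>
              \<bar>\<P>(\<omega> in M. U_stat M s h X m \<omega> > x)
                 / ((1 - Phi x) * exp (U_gamma M s h X m * x ^ 3 / 6)) - 1\<bar>
              \<le> C / sqrt (real m) * (1 + x\<^sup>2))"
proof -
  \<comment> \<open>The constant has to be chosen before \<open>M\<close>, \<open>X\<close>,
    \<open>g\<close> and \<open>C1\<close>; packaging the hypotheses allows a case split on whether
    any instance exists.\<close>
  define hyp where "hyp M X g C1 \<longleftrightarrow> iid_sequence M X D \<and>
      prob_space.expectation M (\<lambda>\<omega>. h (\<lambda>j\<in>{1..s}. X j \<omega>)) = 0 \<and>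
      (AE \<omega> in M. \<bar>h (\<lambda>j\<in>{1..s}. X j \<omega>)\<bar> \<le> C1) \<and>
      is_cond_exp_given M (\<lambda>\<omega>. h (\<lambda>j\<in>{1..s}. X j \<omega>)) (X 1) g \<and>
      prob_space.expectation M (\<lambda>\<omega>. (g (X 1 \<omega>))\<^sup>2) > 0"
    for M :: "'a measure" and X :: "nat \<Rightarrow> 'a \<Rightarrow> real" and g :: "real \<Rightarrow> real" and C1 :: real
  have "\<exists>C>0. \<forall>(M :: 'a measure) X g C1. hyp M X g C1 \<longrightarrow>
           (\<forall>m\<ge>s. \<forall>x. 0 \<le> x \<and> x \<le> C0 * real m powr (1/4) \<longrightarrow>
              \<bar>\<P>(\<omega> in M. U_stat M s h X m \<omega> > x)
                 / ((1 - Phi x) * exp (U_gamma M s h X m * x ^ 3 / 6)) - 1\<bar>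
              \<le> C / sqrt (real m) * (1 + x\<^sup>2))"
  proof (cases "\<exists>(M :: 'a measure) X g C1. hyp M X g C1")
    case False
    then show ?thesis by (intro exI[of _ 1]) auto
  next
    \<comment> \<open>One admissible instance supplies a bound, a vanishing mean and a positive
      variance of the projection. These are facts about \<open>D\<close> and \<open>h\<close>, so
      the constant obtained from them serves every other sequence with law \<open>D\<close>.\<close>
    case True
    then obtain M :: "'a measure" and X g b where iid: "iid_sequence M X D"
      and mean: "(\<integral>\<omega>. h (\<lambda>j\<in>{1..s}. X j \<omega>) \<partial>M) = 0"
      and bound: "AE \<omega> in M. \<bar>h (\<lambda>j\<in>{1..s}. X j \<omega>)\<bar> \<le> b"
      and g: "is_cond_exp_given M (\<lambda>\<omega>. h (\<lambda>j\<in>{1..s}. X j \<omega>)) (X 1) g"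
      and var: "(\<integral>\<omega>. (g (X 1 \<omega>))\<^sup>2 \<partial>M) > 0"
      unfolding hyp_def by blast
    \<comment> \<open>The bound \<open>b\<close> may fail to be positive;
      \<open>\<bar>b\<bar> + 1\<close> always is, and clipping there changes \<open>h\<close> only
      on a null set.\<close>
    define h' where "h' = clip (\<bar>b\<bar> + 1) h"
    interpret ustat_kernel D s h' "\<bar>b\<bar> + 1"
      unfolding h'_def by (rule clip_kernel[OF assms(1-3) iid]) simp
    have s1: "1 \<le> s" using assms(1) by simp
    note T = iid_sequence_facts(5,6)[OF iid s1]
    have hK [measurable]: "h \<in> borel_measurable K.P"
      using assms(2) by (simp add: measurable_cong_sets[OF sets_PiM_D refl])
    have hT [measurable]: "(\<lambda>\<omega>. h (\<lambda>j\<in>{1..s}. X j \<omega>)) \<in> borel_measurable M" by (rule measurable_compose[OF T(1) hK])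
    have "AE y in K.P. \<bar>h y\<bar> \<le> b"
    proof -
      have "{y \<in> space K.P. \<bar>h y\<bar> \<le> b} \<in> sets K.P" by measurable
      then show ?thesis using AE_distr_iff[OF T(1), of "\<lambda>y. \<bar>h y\<bar> \<le> b"] bound unfolding T(2) by blast
    qed
    then have hh': "AE y in K.P. h y = h' y"
      by eventually_elim (auto simp: h'_def clip_def)
    have "theta = 0"
    proof -
      have "theta = (\<integral>y. h y \<partial>K.P)"
        unfolding theta_def by (rule integral_cong_AE) (use hh' bm_measurable[OF bm_h] in auto)
      also have "\<dots> = (\<integral>\<omega>. h (\<lambda>j\<in>{1..s}. X j \<omega>) \<partial>M)" by (rule integral_distr_transfer[OF hK T, symmetric])
      finally show ?thesis using mean by simp
    qed
    then interpret tilt D s h' "\<bar>b\<bar> + 1" by unfold_locales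
    have "AE \<omega> in M. g (X 1 \<omega>) = h1 (X 1 \<omega>)"
      using cond_exp_first_coordinate[OF iid hT AE_distr_transfer[OF hh' T]] g
      unfolding is_cond_exp_given_def by auto
    moreover have X1: "X 1 \<in> borel_measurable M" by (rule iid_sequence_facts(4)[OF iid]) simp
    moreover have bh1: "h1 \<in> borel_measurable borel"
      using bm_measurable[OF bm_h1] by (simp add: measurable_cong_sets[OF setsD refl])
    ultimately have "(\<integral>\<omega>. (g (X 1 \<omega>))\<^sup>2 \<partial>M) = (\<integral>\<omega>. (h1 (X 1 \<omega>))\<^sup>2 \<partial>M)"
      using g by (intro integral_cong_AE) (auto simp: is_cond_exp_given_def intro!: borel_measurable_power elim: measurable_compose)
    also have "\<dots> = v2"
    proof -
      have "distr M borel (X 1) = D" using iid by (simp add: iid_sequence_def)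
      then show ?thesis using integral_distr[OF X1, of "\<lambda>z. (h1 z)\<^sup>2"] bh1 by (simp add: v2_def)
    qed
    finally have v2: "0 < v2" using var by simp
    obtain C where C: "0 < C" "\<And>m x. s \<le> m \<Longrightarrow> 0 \<le> x \<and> x \<le> C0 * real m powr (1/4) \<Longrightarrow>
      \<bar>measure (PiM {1..m} (\<lambda>_. D)) {p \<in> space (PiM {1..m} (\<lambda>_. D)). x < U_sum s h' (\<lambda>i p. p i) m p / sig m}
      / ((1 - Phi x) * exp ((\<integral>p. (U_sum s h' (\<lambda>i p. p i) m p / sig m)^3 \<partial>PiM {1..m} (\<lambda>_. D)) * x^3 / 6)) - 1\<bar>
      \<le> C / sqrt m * (1 + x\<^sup>2)"
      using moderate_deviation[OF v2 assms(4)] by blast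
    show ?thesis
    proof (intro exI[of _ C] conjI allI impI C(1))
      fix M' :: "'a measure" and X' g' C1' m x
      assume H: "hyp M' X' g' C1'" and m: "s \<le> m" and x: "0 \<le> x \<and> x \<le> C0 * real m powr (1/4)"
      have iid': "iid_sequence M' X' D" using H by (simp add: hyp_def)
      show "\<bar>\<P>(\<omega> in M'. U_stat M' s h X' m \<omega> > x)
                 / ((1 - Phi x) * exp (U_gamma M' s h X' m * x ^ 3 / 6)) - 1\<bar>
              \<le> C / sqrt (real m) * (1 + x\<^sup>2)"
        unfolding U_stat_coordinates[OF iid' hh' assms(2) v2 m] by (rule C(2)[OF m x])
    qed
  qed
  then show ?thesis unfolding hyp_def by blast
qed

end
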